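(* Let $\psi:P\to P'$ be a morphism of connected dg-operads over a commutative ring $\mathbb{K}$. Let $L=\bar{L}\circ P$ be a quasi-free right $P$-module and $L'=\bar{L}'\circ P'$ a quasi-free right $P'$-module, regarded also as a right $P$-module by restriction of structure along $\psi$. Let $\phi:L\to L'$ be a morphism of (dg) right $P$-modules. If $\mathbb{K}$ is not a field, assume that $P$, $P'$, $\bar{L}$ and $\bar{L}'$ are projective as $\mathbb{K}$-modules. Identify $\bar{L}$ (respectively $\bar{L}'$) with the indecomposable quotient of $L$ (respectively $L'$) and let $\bar\phi:\bar{L}\to\bar{L}'$ be the morphism of dg-$\Sigma_*$-modules induced by $\phi$. (a) If $\psi:P\to P'$ and $\bar\phi:\bar{L}\to\bar{L}'$ are quasi-isomorphisms, then so is $\phi:L\to L'$. (b) If $\psi:P\to P'$ and $\phi:L\to L'$ are quasi-isomorphisms, then so is $\bar\phi:\bar{L}\to\bar{L}'$. (c) Assume in addition $\bar{L}(0)=\bar{L}'(0)=0$ and $\bar{L}(1)=\bar{L}'(1)=\mathbb{K}$. If $\phi:L\to L'$ and $\bar\phi:\bar{L}\to\bar{L}'$ are quasi-isomorphisms, then so is $\psi:P\to P'$.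
   Context: Dg-modules are $\mathbb{N}$-graded $\mathbb{K}$-modules with a differential $\delta$ of degree $-1$, with the usual tensor product and Koszul sign rule. A dg-$\Sigma_*$-module $M$ is a sequence $M(r)$, $r\in\mathbb{N}$, of dg-$\mathbb{K}[\Sigma_r]$-modules, extended to finite sets and bijections $J\mapsto M(J)$ with $M(\{1,\dots,r\})=M(r)$; quasi-isomorphisms are aritywise. $(M\otimes N)(n)=\bigoplus_{J\amalg J'=\{1,\dots,n\}}M(J)\otimes N(J')$ and $(M\circ N)(n)=\bigoplus_r(M(r)\otimes N^{\otimes r}(n))_{\Sigma_r}$, with unit $I$ ($I(1)=\mathbb{K}$, $I(r)=0$ for $r\ne1$); $x(y_1,\dots,y_r)$ denotes the class of $x\otimes y_1\otimes\dots\otimes y_r$. A dg-operad is a monoid for $\circ$; a right $P$-module is a dg-$\Sigma_*$-module $L$ with an associative unital action $L\circ P\to L$. An operad is connected if $P(0)=0$ and $P(1)=\mathbb{K}1$; it then has a unique augmentation $P\to I$. Projective as a $\mathbb{K}$-module means that the $M(r)$ consist of projective $\mathbb{K}$-modules. A quasi-free right $P$-module is a dg right $P$-module which, forgetting the differential, is a free right $P$-module $M\circ P$ with $M$ a dg-$\Sigma_*$-module, and whose differential is $\delta+d_\theta$, where $\delta$ is the canonical differential of $M\circ P$ and $d_\theta$ is homogeneous of degree $-1$ with $d_\theta(x(q_1,\dots,q_r))=d_\theta(x)(q_1,\dots,q_r)$; it is always assumed that the composite of $d_\theta:M\circ P\to M\circ P$ with the projection $M\circ P\to M$ (induced by the augmentation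 $P\to I$) vanishes. Then $M$, as a dg-$\Sigma_*$-module, is identified with the indecomposable quotient $L\circ_PI$, where $L\circ_PR$ denotes the coequalizer of the two maps $L\circ P\circ R\rightrightarrows L\circ R$. *)

theory Defs
  imports "HOL-Algebra.Module" "HOL-Algebra.AbelCoset" "HOL-Combinatorics.Permutations"
begin

section \<open>Linear algebra over a commutative ring\<close>

definition lin_map ::
  "('k, 'c) ring_scheme \<Rightarrow> ('k, 'a) module \<Rightarrow> ('k, 'b) module \<Rightarrow> ('a \<Rightarrow> 'b) \<Rightarrow> bool" where
  "lin_map K A B f \<longleftrightarrow>
     f \<in> carrier A \<rightarrow> carrier B \<and>
     (\<forall>x\<in>carrier A. \<forall>y\<in>carrier A. f (x \<oplus>\<^bsub>A\<^esub> y) = f x \<oplus>\<^bsub>B\<^esub> f y) \<and>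
     (\<forall>c\<in>carrier K. \<forall>x\<in>carrier A. f (c \<odot>\<^bsub>A\<^esub> x) = c \<odot>\<^bsub>B\<^esub> f x)"

definition zero_module :: "('k, 'a) module \<Rightarrow> bool" where
  "zero_module A \<longleftrightarrow> carrier A = {\<zero>\<^bsub>A\<^esub>}"

text \<open>The ring fields \<open>mult\<close> and \<open>one\<close> of the record type of modules play no role
  and are left undefined.\<close>

definition free_module :: "('k, 'c) ring_scheme \<Rightarrow> 's set \<Rightarrow> ('k, 's \<Rightarrow> 'k) module" where
  "free_module K S =
     \<lparr>carrier = {f. (\<forall>s. f s \<in> carrier K) \<and> {s. f s \<noteq> \<zero>\<^bsub>K\<^esub>} \<subseteq> S \<and> finite {s. f s \<noteq> \<zero>\<^bsub>K\<^esub>}},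
      monoid.mult = undefined, one = undefined,
      zero = (\<lambda>s. \<zero>\<^bsub>K\<^esub>), add = (\<lambda>f g s. f s \<oplus>\<^bsub>K\<^esub> g s), smult = (\<lambda>c f s. c \<otimes>\<^bsub>K\<^esub> f s)\<rparr>"

definition basis_vec :: "('k, 'c) ring_scheme \<Rightarrow> 's \<Rightarrow> 's \<Rightarrow> 'k" where
  "basis_vec K s = (\<lambda>t. if t = s then \<one>\<^bsub>K\<^esub> else \<zero>\<^bsub>K\<^esub>)"

definition lin_ext ::
  "('k, 'c) ring_scheme \<Rightarrow> ('k, 'a) module \<Rightarrow> ('s \<Rightarrow> 'a) \<Rightarrow> ('s \<Rightarrow> 'k) \<Rightarrow> 'a" where
  "lin_ext K A g f = (\<Oplus>\<^bsub>A\<^esub>s\<in>{s. f s \<noteq> \<zero>\<^bsub>K\<^esub>}. f s \<odot>\<^bsub>A\<^esub> g s)"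

definition mspan :: "('k, 'c) ring_scheme \<Rightarrow> ('k, 'a) module \<Rightarrow> 'a set \<Rightarrow> 'a set" where
  "mspan K A S = \<Inter>{H. submodule H K A \<and> S \<subseteq> H}"

definition quot_module :: "('k, 'a) module \<Rightarrow> 'a set \<Rightarrow> ('k, 'a set) module" where
  "quot_module A H =
     \<lparr>carrier = a_rcosets\<^bsub>A\<^esub> H, monoid.mult = undefined, one = undefined,
      zero = H, add = (\<lambda>X Y. X <+>\<^bsub>A\<^esub> Y), smult = (\<lambda>c X. \<Union>x\<in>X. H +>\<^bsub>A\<^esub> (c \<odot>\<^bsub>A\<^esub> x))\<rparr>"

text \<open>The map into \<open>quot_module B H\<close> induced on cosets by a map \<open>f\<close> into \<open>B\<close>.\<close>

definition quot_map :: "('k, 'b) module \<Rightarrow> 'b set \<Rightarrow> ('a \<Rightarrow> 'b) \<Rightarrow> 'a set \<Rightarrow> 'b set" where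
  "quot_map B H f X = (\<Union>x\<in>X. H +>\<^bsub>B\<^esub> f x)"

text \<open>Projective means direct summand of a free module. A module is a quotient of the free
  module on its own elements, so bases taken from the element type suffice.\<close>

definition projective_module :: "('k, 'c) ring_scheme \<Rightarrow> ('k, 'a) module \<Rightarrow> bool" where
  "projective_module K A \<longleftrightarrow>
     (\<exists>(S :: 'a set) i p. lin_map K A (free_module K S) i \<and> lin_map K (free_module K S) A p \<and>
        (\<forall>x\<in>carrier A. p (i x) = x))"

definition ksign :: "('k, 'c) ring_scheme \<Rightarrow> int \<Rightarrow> 'k" where
  "ksign K e = (if even e then \<one>\<^bsub>K\<^esub> else \<ominus>\<^bsub>K\<^esub> \<one>\<^bsub>K\<^esub>)"


section \<open>Dg-\<open>\<Sigma>\<^sub>*\<close>-modules\<close>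

text \<open>\<open>dg_mod M r d\<close> is the homogeneous component of degree \<open>d\<close> of \<open>M(r)\<close>. Degrees are
  integers so that the differential always goes from degree \<open>d\<close> to degree \<open>d - 1\<close>;
  the grading by natural numbers is the requirement that negative degrees vanish.
  The standard set with \<open>r\<close> elements is \<open>{..<r}\<close>, in agreement with list positions, and
  \<open>dg_act M r d s\<close> is the left action of a permutation \<open>s\<close> of this set.\<close>

record ('k, 'm) dg_seq =
  dg_mod :: "nat \<Rightarrow> int \<Rightarrow> ('k, 'm) module"
  dg_diff :: "nat \<Rightarrow> int \<Rightarrow> 'm \<Rightarrow> 'm"
  dg_act :: "nat \<Rightarrow> int \<Rightarrow> (nat \<Rightarrow> nat) \<Rightarrow> 'm \<Rightarrow> 'm"

definition dg_sigma_module :: "('k, 'c) ring_scheme \<Rightarrow> ('k, 'm, 'x) dg_seq_scheme \<Rightarrow> bool" where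
  "dg_sigma_module K M \<longleftrightarrow>
     (\<forall>r d. module K (dg_mod M r d)) \<and>
     (\<forall>r d. d < 0 \<longrightarrow> zero_module (dg_mod M r d)) \<and>
     (\<forall>r d. lin_map K (dg_mod M r d) (dg_mod M r (d - 1)) (dg_diff M r d)) \<and>
     (\<forall>r d. \<forall>x\<in>carrier (dg_mod M r d).
        dg_diff M r (d - 1) (dg_diff M r d x) = \<zero>\<^bsub>dg_mod M r (d - 2)\<^esub>) \<and>
     (\<forall>r d s. s permutes {..<r} \<longrightarrow>
        lin_map K (dg_mod M r d) (dg_mod M r d) (dg_act M r d s)) \<and>
     (\<forall>r d. \<forall>x\<in>carrier (dg_mod M r d). dg_act M r d id x = x) \<and>
     (\<forall>r d s t. s permutes {..<r} \<longrightarrow> t permutes {..<r} \<longrightarrow>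
        (\<forall>x\<in>carrier (dg_mod M r d). dg_act M r d (s \<circ> t) x = dg_act M r d s (dg_act M r d t x))) \<and>
     (\<forall>r d s. s permutes {..<r} \<longrightarrow>
        (\<forall>x\<in>carrier (dg_mod M r d).
           dg_diff M r d (dg_act M r d s x) = dg_act M r (d - 1) s (dg_diff M r d x)))"

definition dg_morphism :: "('k, 'c) ring_scheme \<Rightarrow> ('k, 'm, 'x) dg_seq_scheme \<Rightarrow>
    ('k, 'n, 'y) dg_seq_scheme \<Rightarrow> (nat \<Rightarrow> int \<Rightarrow> 'm \<Rightarrow> 'n) \<Rightarrow> bool" where
  "dg_morphism K M N f \<longleftrightarrow>
     (\<forall>r d. lin_map K (dg_mod M r d) (dg_mod N r d) (f r d)) \<and>
     (\<forall>r d. \<forall>x\<in>carrier (dg_mod M r d).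
        f r (d - 1) (dg_diff M r d x) = dg_diff N r d (f r d x)) \<and>
     (\<forall>r d s. s permutes {..<r} \<longrightarrow>
        (\<forall>x\<in>carrier (dg_mod M r d). f r d (dg_act M r d s x) = dg_act N r d s (f r d x)))"

definition cycles :: "('k, 'm, 'x) dg_seq_scheme \<Rightarrow> nat \<Rightarrow> int \<Rightarrow> 'm set" where
  "cycles M r d =
     {x \<in> carrier (dg_mod M r d). dg_diff M r d x = \<zero>\<^bsub>dg_mod M r (d - 1)\<^esub>}"

definition boundaries :: "('k, 'm, 'x) dg_seq_scheme \<Rightarrow> nat \<Rightarrow> int \<Rightarrow> 'm set" where
  "boundaries M r d = dg_diff M r (d + 1) ` carrier (dg_mod M r (d + 1))"

definition homology :: "('k, 'm, 'x) dg_seq_scheme \<Rightarrow> nat \<Rightarrow> int \<Rightarrow> ('k, 'm set) module" where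
  "homology M r d = quot_module ((dg_mod M r d)\<lparr>carrier := cycles M r d\<rparr>) (boundaries M r d)"

definition quasi_iso :: "('k, 'c) ring_scheme \<Rightarrow> ('k, 'm, 'x) dg_seq_scheme \<Rightarrow>
    ('k, 'n, 'y) dg_seq_scheme \<Rightarrow> (nat \<Rightarrow> int \<Rightarrow> 'm \<Rightarrow> 'n) \<Rightarrow> bool" where
  "quasi_iso K M N f \<longleftrightarrow>
     dg_morphism K M N f \<and>
     (\<forall>r d. bij_betw (quot_map (dg_mod N r d) (boundaries N r d) (f r d))
              (carrier (homology M r d)) (carrier (homology N r d)))"

definition projective_seq :: "('k, 'c) ring_scheme \<Rightarrow> ('k, 'm, 'x) dg_seq_scheme \<Rightarrow> bool" where
  "projective_seq K M \<longleftrightarrow> (\<forall>r d. projective_module K (dg_mod M r d))"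

text \<open>The component \<open>M(1)\<close> is the ground ring, concentrated in degree \<open>0\<close> and generated by \<open>e\<close>.\<close>

definition ground_ring_in_arity_one ::
  "('k, 'c) ring_scheme \<Rightarrow> ('k, 'm, 'x) dg_seq_scheme \<Rightarrow> 'm \<Rightarrow> bool" where
  "ground_ring_in_arity_one K M e \<longleftrightarrow>
     e \<in> carrier (dg_mod M 1 0) \<and>
     bij_betw (\<lambda>k. k \<odot>\<^bsub>dg_mod M 1 0\<^esub> e) (carrier K) (carrier (dg_mod M 1 0)) \<and>
     (\<forall>d. d \<noteq> 0 \<longrightarrow> zero_module (dg_mod M 1 d))"

definition zero_in_arity_zero :: "('k, 'm, 'x) dg_seq_scheme \<Rightarrow> bool" where
  "zero_in_arity_zero M \<longleftrightarrow> (\<forall>d. zero_module (dg_mod M 0 d))"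

text \<open>The extension of \<open>M\<close> to finite sets \<open>J\<close> of natural numbers: the increasing bijection from
  \<open>{..<card J}\<close> to \<open>J\<close> is used to identify \<open>M(J)\<close> with \<open>M(card J)\<close>, so elements of \<open>M(J)\<close> are
  represented by elements of \<open>M(card J)\<close>, and \<open>transport M J d f\<close> is the map
  \<open>M(J) \<rightarrow> M(f ` J)\<close> in degree \<open>d\<close> given by a bijection \<open>f\<close>.\<close>

definition rank :: "nat set \<Rightarrow> nat \<Rightarrow> nat" where
  "rank J j = card {i \<in> J. i < j}"

definition transport :: "('k, 'm, 'x) dg_seq_scheme \<Rightarrow> nat set \<Rightarrow> int \<Rightarrow> (nat \<Rightarrow> nat) \<Rightarrow> 'm \<Rightarrow> 'm" where
  "transport M J d f =
     dg_act M (card J) d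
       (\<lambda>i. if i < card J then rank (f ` J) (f (sorted_list_of_set J ! i)) else i)"


section \<open>The composition product\<close>

text \<open>A generator \<open>(a, x, ys)\<close> with \<open>ys = [(J\<^sub>1, b\<^sub>1, y\<^sub>1), \<dots>, (J\<^sub>r, b\<^sub>r, y\<^sub>r)]\<close> stands for the tensor
  \<open>x \<otimes> y\<^sub>1 \<otimes> \<dots> \<otimes> y\<^sub>r\<close> with \<open>x\<close> in \<open>M(r)\<close> of degree \<open>a\<close> and \<open>y\<^sub>i\<close> in \<open>N(J\<^sub>i)\<close> of degree \<open>b\<^sub>i\<close>.\<close>

type_synonym 'n inputs = "(nat set \<times> int \<times> 'n) list"
type_synonym ('m, 'n) gen = "int \<times> 'm \<times> 'n inputs"
type_synonym ('k, 'm, 'n) comp_el = "(('m, 'n) gen \<Rightarrow> 'k) set"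

definition in_block :: "'n inputs \<Rightarrow> nat \<Rightarrow> nat set" where
  "in_block ys i = fst (ys ! i)"

definition in_deg :: "'n inputs \<Rightarrow> nat \<Rightarrow> int" where
  "in_deg ys i = fst (snd (ys ! i))"

definition tot_deg :: "'n inputs \<Rightarrow> int" where
  "tot_deg ys = (\<Sum>i<length ys. in_deg ys i)"

text \<open>The blocks form an ordered partition of \<open>{..<n}\<close>; empty blocks are allowed.\<close>

definition valid_inputs :: "('k, 'n, 'y) dg_seq_scheme \<Rightarrow> nat \<Rightarrow> 'n inputs \<Rightarrow> bool" where
  "valid_inputs N n ys \<longleftrightarrow>
     (\<forall>i<length ys. \<forall>j<length ys. i \<noteq> j \<longrightarrow> in_block ys i \<inter> in_block ys j = {}) \<and>
     (\<Union>i<length ys. in_block ys i) = {..<n} \<and>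
     (\<forall>(J, b, y)\<in>set ys. y \<in> carrier (dg_mod N (card J) b))"

definition gens :: "('k, 'm, 'x) dg_seq_scheme \<Rightarrow> ('k, 'n, 'y) dg_seq_scheme \<Rightarrow>
    nat \<Rightarrow> int \<Rightarrow> ('m, 'n) gen set" where
  "gens M N n d =
     {(a, x, ys). x \<in> carrier (dg_mod M (length ys) a) \<and> valid_inputs N n ys \<and> a + tot_deg ys = d}"

text \<open>Koszul sign of the rearrangement \<open>y\<^sub>0 \<otimes> y\<^sub>1 \<otimes> \<dots> \<mapsto> y\<^bsub>s 0\<^esub> \<otimes> y\<^bsub>s 1\<^esub> \<otimes> \<dots>\<close>.\<close>

definition perm_sign :: "('k, 'c) ring_scheme \<Rightarrow> (nat \<Rightarrow> nat) \<Rightarrow> 'n inputs \<Rightarrow> 'k" where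
  "perm_sign K s ys = ksign K
     (\<Sum>(i, j) \<in> {(i, j). i < j \<and> j < length ys \<and> s j < s i}. in_deg ys (s i) * in_deg ys (s j))"

abbreviation free_gens :: "('k, 'c) ring_scheme \<Rightarrow> ('k, 'm, 'x) dg_seq_scheme \<Rightarrow>
    ('k, 'n, 'y) dg_seq_scheme \<Rightarrow> nat \<Rightarrow> int \<Rightarrow> ('k, ('m, 'n) gen \<Rightarrow> 'k) module" where
  "free_gens K M N n d \<equiv> free_module K (gens M N n d)"

text \<open>Relations presenting the direct sum over \<open>r\<close> of the \<open>\<Sigma>\<^sub>r\<close>-coinvariants of
  \<open>M(r) \<otimes> N\<^sup>\<otimes>\<^sup>r(n)\<close>, where \<open>N\<^sup>\<otimes>\<^sup>r(n)\<close> is the direct sum of the \<open>N(J\<^sub>1) \<otimes> \<dots> \<otimes> N(J\<^sub>r)\<close> over the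
  ordered partitions of \<open>{..<n}\<close>: multilinearity, and identification of the orbits of the
  diagonal action.\<close>

inductive comp_rel :: "('k, 'c) ring_scheme \<Rightarrow> ('k, 'm, 'x) dg_seq_scheme \<Rightarrow>
    ('k, 'n, 'y) dg_seq_scheme \<Rightarrow> nat \<Rightarrow> int \<Rightarrow> (('m, 'n) gen \<Rightarrow> 'k) \<Rightarrow> (('m, 'n) gen \<Rightarrow> 'k) \<Rightarrow> bool"
  for K M N n d where
  add_root: "(a, x, ys) \<in> gens M N n d \<Longrightarrow> (a, x', ys) \<in> gens M N n d \<Longrightarrow>
    comp_rel K M N n d (basis_vec K (a, x \<oplus>\<^bsub>dg_mod M (length ys) a\<^esub> x', ys))
      (basis_vec K (a, x, ys) \<oplus>\<^bsub>free_gens K M N n d\<^esub> basis_vec K (a, x', ys))"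
| smult_root: "(a, x, ys) \<in> gens M N n d \<Longrightarrow> k \<in> carrier K \<Longrightarrow>
    comp_rel K M N n d (basis_vec K (a, k \<odot>\<^bsub>dg_mod M (length ys) a\<^esub> x, ys))
      (k \<odot>\<^bsub>free_gens K M N n d\<^esub> basis_vec K (a, x, ys))"
| add_input: "(a, x, ys @ (J, b, y) # zs) \<in> gens M N n d \<Longrightarrow>
    (a, x, ys @ (J, b, y') # zs) \<in> gens M N n d \<Longrightarrow>
    comp_rel K M N n d (basis_vec K (a, x, ys @ (J, b, y \<oplus>\<^bsub>dg_mod N (card J) b\<^esub> y') # zs))
      (basis_vec K (a, x, ys @ (J, b, y) # zs)
         \<oplus>\<^bsub>free_gens K M N n d\<^esub> basis_vec K (a, x, ys @ (J, b, y') # zs))"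
| smult_input: "(a, x, ys @ (J, b, y) # zs) \<in> gens M N n d \<Longrightarrow> k \<in> carrier K \<Longrightarrow>
    comp_rel K M N n d (basis_vec K (a, x, ys @ (J, b, k \<odot>\<^bsub>dg_mod N (card J) b\<^esub> y) # zs))
      (k \<odot>\<^bsub>free_gens K M N n d\<^esub> basis_vec K (a, x, ys @ (J, b, y) # zs))"
| coinvariant: "(a, x, ys) \<in> gens M N n d \<Longrightarrow> s permutes {..<length ys} \<Longrightarrow>
    comp_rel K M N n d (basis_vec K (a, dg_act M (length ys) a s x, ys))
      (perm_sign K s ys \<odot>\<^bsub>free_gens K M N n d\<^esub> basis_vec K (a, x, permute_list s ys))"

definition comp_rels :: "('k, 'c) ring_scheme \<Rightarrow> ('k, 'm, 'x) dg_seq_scheme \<Rightarrow>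
    ('k, 'n, 'y) dg_seq_scheme \<Rightarrow> nat \<Rightarrow> int \<Rightarrow> (('m, 'n) gen \<Rightarrow> 'k) set" where
  "comp_rels K M N n d =
     mspan K (free_gens K M N n d) {f \<ominus>\<^bsub>free_gens K M N n d\<^esub> g |f g. comp_rel K M N n d f g}"

definition gen_diff :: "('k, 'c) ring_scheme \<Rightarrow> ('k, 'm, 'x) dg_seq_scheme \<Rightarrow>
    ('k, 'n, 'y) dg_seq_scheme \<Rightarrow> nat \<Rightarrow> int \<Rightarrow> ('m, 'n) gen \<Rightarrow> (('m, 'n) gen \<Rightarrow> 'k)" where
  "gen_diff K M N n d = (\<lambda>(a, x, ys).
     let F = free_gens K M N n (d - 1) in
     basis_vec K (a - 1, dg_diff M (length ys) a x, ys) \<oplus>\<^bsub>F\<^esub>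
     (\<Oplus>\<^bsub>F\<^esub>i\<in>{..<length ys}.
        ksign K (a + (\<Sum>j<i. in_deg ys j)) \<odot>\<^bsub>F\<^esub>
        basis_vec K (a, x, ys[i := (case ys ! i of (J, b, y) \<Rightarrow> (J, b - 1, dg_diff N (card J) b y))])))"

definition gen_act :: "('k, 'n, 'y) dg_seq_scheme \<Rightarrow> (nat \<Rightarrow> nat) \<Rightarrow> ('m, 'n) gen \<Rightarrow> ('m, 'n) gen" where
  "gen_act N s = (\<lambda>(a, x, ys). (a, x, map (\<lambda>(J, b, y). (s ` J, b, transport N J b s y)) ys))"

definition comp_prod :: "('k, 'c) ring_scheme \<Rightarrow> ('k, 'm, 'x) dg_seq_scheme \<Rightarrow>
    ('k, 'n, 'y) dg_seq_scheme \<Rightarrow> ('k, ('k, 'm, 'n) comp_el) dg_seq" where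
  "comp_prod K M N =
     \<lparr>dg_mod = (\<lambda>n d. quot_module (free_gens K M N n d) (comp_rels K M N n d)),
      dg_diff = (\<lambda>n d. quot_map (free_gens K M N n (d - 1)) (comp_rels K M N n (d - 1))
         (lin_ext K (free_gens K M N n (d - 1)) (gen_diff K M N n d))),
      dg_act = (\<lambda>n d s. quot_map (free_gens K M N n d) (comp_rels K M N n d)
         (lin_ext K (free_gens K M N n d) (\<lambda>g. basis_vec K (gen_act N s g))))\<rparr>"

text \<open>The class \<open>x(y\<^sub>1, \<dots>, y\<^sub>r)\<close> of a generator.\<close>

definition cls :: "('k, 'c) ring_scheme \<Rightarrow> ('k, 'm, 'x) dg_seq_scheme \<Rightarrow>
    ('k, 'n, 'y) dg_seq_scheme \<Rightarrow> nat \<Rightarrow> int \<Rightarrow> ('m, 'n) gen \<Rightarrow> ('k, 'm, 'n) comp_el" where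
  "cls K M N n d g = comp_rels K M N n d +>\<^bsub>free_gens K M N n d\<^esub> basis_vec K g"

text \<open>The morphism \<open>f \<circ> g\<close> into \<open>M' \<circ> N'\<close>.\<close>

definition comp_map :: "('k, 'c) ring_scheme \<Rightarrow> ('k, 'm1, 'x) dg_seq_scheme \<Rightarrow>
    ('k, 'n1, 'y) dg_seq_scheme \<Rightarrow> (nat \<Rightarrow> int \<Rightarrow> 'm \<Rightarrow> 'm1) \<Rightarrow> (nat \<Rightarrow> int \<Rightarrow> 'n \<Rightarrow> 'n1) \<Rightarrow>
    nat \<Rightarrow> int \<Rightarrow> ('k, 'm, 'n) comp_el \<Rightarrow> ('k, 'm1, 'n1) comp_el" where
  "comp_map K M' N' f g n d =
     quot_map (free_gens K M' N' n d) (comp_rels K M' N' n d)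
       (lin_ext K (free_gens K M' N' n d) (\<lambda>(a, x, ys).
          basis_vec K (a, f (length ys) a x, map (\<lambda>(J, b, y). (J, b, g (card J) b y)) ys)))"

text \<open>The linear map \<open>M \<circ> N \<rightarrow> A\<close> (in a fixed arity and degree) determined by its values on
  generators.\<close>

definition comp_lift :: "('k, 'c) ring_scheme \<Rightarrow> ('k, 'a) module \<Rightarrow> (('m, 'n) gen \<Rightarrow> 'a) \<Rightarrow>
    ('k, 'm, 'n) comp_el \<Rightarrow> 'a" where
  "comp_lift K A f X = the_elem (lin_ext K A f ` X)"


section \<open>The unit sequence\<close>

definition unit_seq :: "('k, 'c) ring_scheme \<Rightarrow> ('k, 'k) dg_seq" where
  "unit_seq K =
     \<lparr>dg_mod = (\<lambda>r d.
        \<lparr>carrier = (if r = 1 \<and> d = 0 then carrier K else {\<zero>\<^bsub>K\<^esub>}), monoid.mult = undefined, one = undefined,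
         zero = \<zero>\<^bsub>K\<^esub>, add = (\<oplus>\<^bsub>K\<^esub>), smult = (\<otimes>\<^bsub>K\<^esub>)\<rparr>),
      dg_diff = (\<lambda>r d x. \<zero>\<^bsub>K\<^esub>),
      dg_act = (\<lambda>r d s x. x)\<rparr>"

text \<open>The inputs \<open>(u, \<dots>, u)\<close> where \<open>u\<close> has arity one and degree zero.\<close>

definition unit_inputs :: "nat \<Rightarrow> 'n \<Rightarrow> 'n inputs" where
  "unit_inputs n u = map (\<lambda>i. ({i}, 0, u)) [0..<n]"

text \<open>The isomorphism \<open>M \<circ> I \<cong> M\<close>. A generator with blocks \<open>{t 0}, \<dots>, {t (r - 1)}\<close> has its
  \<open>i\<close>-th entry relabelled by \<open>t i\<close>.\<close>

definition right_unitor :: "('k, 'c) ring_scheme \<Rightarrow> ('k, 'm, 'x) dg_seq_scheme \<Rightarrow>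
    nat \<Rightarrow> int \<Rightarrow> ('k, 'm, 'k) comp_el \<Rightarrow> 'm" where
  "right_unitor K M n d = comp_lift K (dg_mod M n d) (\<lambda>(a, x, ys).
     if \<forall>(J, b, k)\<in>set ys. card J = 1 \<and> b = 0
     then foldr (\<lambda>(J, b, k) c. k \<otimes>\<^bsub>K\<^esub> c) ys \<one>\<^bsub>K\<^esub> \<odot>\<^bsub>dg_mod M n d\<^esub>
       dg_act M n d (\<lambda>i. if i < length ys then the_elem (in_block ys i) else i) x
     else \<zero>\<^bsub>dg_mod M n d\<^esub>)"


section \<open>Operads and right modules\<close>

record ('k, 'p) dg_operad = "('k, 'p) dg_seq" +
  op_comp :: "nat \<Rightarrow> int \<Rightarrow> ('k, 'p, 'p) comp_el \<Rightarrow> 'p"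
  op_unit :: 'p

record ('k, 'p, 'l) dg_rmod = "('k, 'l) dg_seq" +
  rm_act :: "nat \<Rightarrow> int \<Rightarrow> ('k, 'l, 'p) comp_el \<Rightarrow> 'l"

text \<open>The associativity isomorphism sends \<open>(x(y\<^sub>0, \<dots>, y\<^bsub>r-1\<^esub>))(z\<^sub>0, \<dots>, z\<^bsub>n-1\<^esub>)\<close>, with \<open>y\<^sub>i\<close> in \<open>P(J\<^sub>i)\<close>, to
  \<open>\<plusminus> x(y\<^sub>0(z\<^sub>k : k \<in> J\<^sub>0), \<dots>, y\<^bsub>r-1\<^esub>(z\<^sub>k : k \<in> J\<^bsub>r-1\<^esub>))\<close>. The sign is the Koszul sign of the
  rearrangement: \<open>y\<^sub>j\<close> is moved across \<open>z\<^sub>k\<close> for \<open>k \<in> J\<^sub>i\<close> and \<open>i < j\<close>, and \<open>z\<^sub>l\<close> across \<open>z\<^sub>k\<close>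
  for \<open>l < k\<close>, \<open>k \<in> J\<^sub>i\<close>, \<open>l \<in> J\<^sub>j\<close> and \<open>i < j\<close>.\<close>

definition assoc_sign :: "('k, 'c) ring_scheme \<Rightarrow> 'n inputs \<Rightarrow> 'z inputs \<Rightarrow> 'k" where
  "assoc_sign K ys zs = ksign K
     (\<Sum>(i, j) \<in> {(i, j). i < j \<and> j < length ys}.
        (\<Sum>k\<in>in_block ys i. in_deg ys j * in_deg zs k) +
        (\<Sum>(k, l) \<in> {(k, l). k \<in> in_block ys i \<and> l \<in> in_block ys j \<and> l < k}. in_deg zs k * in_deg zs l))"

text \<open>The inputs \<open>y\<^sub>i(z\<^sub>k : k \<in> J\<^sub>i)\<close>, each evaluated by a map \<open>lam\<close> from \<open>P \<circ> R\<close> to \<open>R\<close>. The blocks of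
  the \<open>z\<^sub>k\<close>, which partition some set \<open>T\<close>, are moved to \<open>{..<card T}\<close> by the increasing bijection.\<close>

definition regroup :: "('k, 'c) ring_scheme \<Rightarrow> ('k, 'p, 'x) dg_seq_scheme \<Rightarrow>
    ('k, 'z, 'y) dg_seq_scheme \<Rightarrow> (nat \<Rightarrow> int \<Rightarrow> ('k, 'p, 'z) comp_el \<Rightarrow> 'z) \<Rightarrow>
    'p inputs \<Rightarrow> 'z inputs \<Rightarrow> 'z inputs" where
  "regroup K P R lam ys zs = map (\<lambda>(J, b, y).
     let T = (\<Union>k\<in>J. in_block zs k);
         ws = map (\<lambda>k. case zs ! k of (B, c, z) \<Rightarrow> (rank T ` B, c, z)) (sorted_list_of_set J);
         e = b + tot_deg ws
     in (T, e, lam (card T) e (cls K P R (card T) e (b, y, ws)))) ys"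

text \<open>A map \<open>rho : L \<circ> P \<rightarrow> L\<close> is an associative and unital action of \<open>P\<close>. The composition
  product of an operad is itself such an action, hence the common formulation.\<close>

definition right_action :: "('k, 'c) ring_scheme \<Rightarrow> ('k, 'p, 'x) dg_operad_scheme \<Rightarrow>
    ('k, 'l, 'y) dg_seq_scheme \<Rightarrow> (nat \<Rightarrow> int \<Rightarrow> ('k, 'l, 'p) comp_el \<Rightarrow> 'l) \<Rightarrow> bool" where
  "right_action K P L rho \<longleftrightarrow>
     dg_morphism K (comp_prod K L P) L rho \<and>
     (\<forall>n d a x ys m zs.
        (a, x, ys) \<in> gens L P n d \<longrightarrow> valid_inputs P m zs \<longrightarrow> length zs = n \<longrightarrow>
        rho m (d + tot_deg zs)
            (cls K L P m (d + tot_deg zs) (d, rho n d (cls K L P n d (a, x, ys)), zs)) =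
        assoc_sign K ys zs \<odot>\<^bsub>dg_mod L m (d + tot_deg zs)\<^esub>
          rho m (d + tot_deg zs)
            (cls K L P m (d + tot_deg zs) (a, x, regroup K P P (op_comp P) ys zs))) \<and>
     (\<forall>n d. \<forall>x\<in>carrier (dg_mod L n d).
        rho n d (cls K L P n d (d, x, unit_inputs n (op_unit P))) = x)"

text \<open>The differential of the unit vanishes automatically, because it has degree \<open>-1\<close>.\<close>

definition operad :: "('k, 'c) ring_scheme \<Rightarrow> ('k, 'p, 'x) dg_operad_scheme \<Rightarrow> bool" where
  "operad K P \<longleftrightarrow>
     dg_sigma_module K P \<and>
     op_unit P \<in> carrier (dg_mod P 1 0) \<and>
     right_action K P P (op_comp P) \<and>
     (\<forall>n d. \<forall>p\<in>carrier (dg_mod P n d).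
        op_comp P n d (cls K P P n d (0, op_unit P, [({..<n}, d, p)])) = p)"

definition connected_operad :: "('k, 'c) ring_scheme \<Rightarrow> ('k, 'p, 'x) dg_operad_scheme \<Rightarrow> bool" where
  "connected_operad K P \<longleftrightarrow>
     operad K P \<and> zero_in_arity_zero P \<and> ground_ring_in_arity_one K P (op_unit P)"

definition operad_morphism :: "('k, 'c) ring_scheme \<Rightarrow> ('k, 'p, 'x) dg_operad_scheme \<Rightarrow>
    ('k, 'q, 'y) dg_operad_scheme \<Rightarrow> (nat \<Rightarrow> int \<Rightarrow> 'p \<Rightarrow> 'q) \<Rightarrow> bool" where
  "operad_morphism K P Q psi \<longleftrightarrow>
     dg_morphism K P Q psi \<and>
     psi 1 0 (op_unit P) = op_unit Q \<and>
     (\<forall>n d. \<forall>X\<in>carrier (dg_mod (comp_prod K P P) n d).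
        psi n d (op_comp P n d X) = op_comp Q n d (comp_map K Q Q psi psi n d X))"

definition right_module :: "('k, 'c) ring_scheme \<Rightarrow> ('k, 'p, 'x) dg_operad_scheme \<Rightarrow>
    ('k, 'p, 'l, 'y) dg_rmod_scheme \<Rightarrow> bool" where
  "right_module K P L \<longleftrightarrow> dg_sigma_module K L \<and> right_action K P L (rm_act L)"

definition right_module_morphism :: "('k, 'c) ring_scheme \<Rightarrow> ('k, 'p, 'x) dg_operad_scheme \<Rightarrow>
    ('k, 'p, 'l, 'y) dg_rmod_scheme \<Rightarrow> ('k, 'p, 'n, 'z) dg_rmod_scheme \<Rightarrow>
    (nat \<Rightarrow> int \<Rightarrow> 'l \<Rightarrow> 'n) \<Rightarrow> bool" where
  "right_module_morphism K P L N phi \<longleftrightarrow>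
     dg_morphism K L N phi \<and>
     (\<forall>n d. \<forall>X\<in>carrier (dg_mod (comp_prod K L P) n d).
        phi n d (rm_act L n d X) = rm_act N n d (comp_map K N P phi (\<lambda>_ _ p. p) n d X))"

definition restrict_rmod :: "('k, 'c) ring_scheme \<Rightarrow> ('k, 'q, 'x) dg_operad_scheme \<Rightarrow>
    (nat \<Rightarrow> int \<Rightarrow> 'p \<Rightarrow> 'q) \<Rightarrow> ('k, 'q, 'l) dg_rmod \<Rightarrow> ('k, 'p, 'l) dg_rmod" where
  "restrict_rmod K Q psi L =
     \<lparr>dg_mod = dg_mod L, dg_diff = dg_diff L, dg_act = dg_act L,
      rm_act = (\<lambda>n d X. rm_act L n d (comp_map K L Q (\<lambda>_ _ x. x) psi n d X))\<rparr>"


section \<open>Augmentation and indecomposable quotient\<close>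

text \<open>The augmentation of a connected operad.\<close>

definition augmentation :: "('k, 'c) ring_scheme \<Rightarrow> ('k, 'p, 'x) dg_operad_scheme \<Rightarrow>
    nat \<Rightarrow> int \<Rightarrow> 'p \<Rightarrow> 'k" where
  "augmentation K P r d p =
     (if r = 1 \<and> d = 0 then THE k. k \<in> carrier K \<and> p = k \<odot>\<^bsub>dg_mod P 1 0\<^esub> op_unit P else \<zero>\<^bsub>K\<^esub>)"

text \<open>The left action \<open>P \<circ> I \<rightarrow> I \<circ> I \<cong> I\<close> on the unit sequence induced by the augmentation.\<close>

definition unit_left_action :: "('k, 'c) ring_scheme \<Rightarrow> ('k, 'p, 'x) dg_operad_scheme \<Rightarrow>
    nat \<Rightarrow> int \<Rightarrow> ('k, 'p, 'k) comp_el \<Rightarrow> 'k" where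
  "unit_left_action K P n d X =
     right_unitor K (unit_seq K) n d
       (comp_map K (unit_seq K) (unit_seq K) (augmentation K P) (\<lambda>_ _ k. k) n d X)"

text \<open>The relative composition product \<open>L \<circ>\<^sub>P R\<close> for a left action \<open>lam : P \<circ> R \<rightarrow> R\<close>. The
  coequalizer is the quotient of \<open>L \<circ> R\<close> by the image of the difference of the two maps from
  \<open>L \<circ> P \<circ> R\<close>, which is spanned by its values on the elements \<open>(x(y\<^sub>1, \<dots>, y\<^sub>r))(z\<^sub>1, \<dots>, z\<^sub>n)\<close>.\<close>

definition rel_comp_rels :: "('k, 'c) ring_scheme \<Rightarrow> ('k, 'p, 'x) dg_operad_scheme \<Rightarrow>
    ('k, 'p, 'l, 'y) dg_rmod_scheme \<Rightarrow> ('k, 'r, 'z) dg_seq_scheme \<Rightarrow>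
    (nat \<Rightarrow> int \<Rightarrow> ('k, 'p, 'r) comp_el \<Rightarrow> 'r) \<Rightarrow> nat \<Rightarrow> int \<Rightarrow> ('k, 'l, 'r) comp_el set" where
  "rel_comp_rels K P L R lam m d =
     (let A = dg_mod (comp_prod K L R) m d in
      mspan K A
        {cls K L R m d (e, rm_act L n e (cls K L P n e (a, x, ys)), zs) \<ominus>\<^bsub>A\<^esub>
         assoc_sign K ys zs \<odot>\<^bsub>A\<^esub> cls K L R m d (a, x, regroup K P R lam ys zs)
         |n e a x ys zs. (a, x, ys) \<in> gens L P n e \<and> valid_inputs R m zs \<and> length zs = n \<and>
           e + tot_deg zs = d})"

definition rel_comp :: "('k, 'c) ring_scheme \<Rightarrow> ('k, 'p, 'x) dg_operad_scheme \<Rightarrow>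
    ('k, 'p, 'l, 'y) dg_rmod_scheme \<Rightarrow> ('k, 'r, 'z) dg_seq_scheme \<Rightarrow>
    (nat \<Rightarrow> int \<Rightarrow> ('k, 'p, 'r) comp_el \<Rightarrow> 'r) \<Rightarrow> ('k, ('k, 'l, 'r) comp_el set) dg_seq" where
  "rel_comp K P L R lam =
     \<lparr>dg_mod = (\<lambda>n d. quot_module (dg_mod (comp_prod K L R) n d) (rel_comp_rels K P L R lam n d)),
      dg_diff = (\<lambda>n d. quot_map (dg_mod (comp_prod K L R) n (d - 1)) (rel_comp_rels K P L R lam n (d - 1))
         (dg_diff (comp_prod K L R) n d)),
      dg_act = (\<lambda>n d s. quot_map (dg_mod (comp_prod K L R) n d) (rel_comp_rels K P L R lam n d)
         (dg_act (comp_prod K L R) n d s))\<rparr>"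

text \<open>The indecomposable quotient \<open>L \<circ>\<^sub>P I\<close>, the class in it of an element of \<open>L \<cong> L \<circ> I\<close>, and the
  map \<open>L \<circ>\<^sub>P I \<rightarrow> L' \<circ>\<^bsub>P'\<^esub> I\<close> induced by a morphism \<open>phi : L \<rightarrow> L'\<close>.\<close>

definition indec :: "('k, 'c) ring_scheme \<Rightarrow> ('k, 'p, 'x) dg_operad_scheme \<Rightarrow>
    ('k, 'p, 'l, 'y) dg_rmod_scheme \<Rightarrow> ('k, ('k, 'l, 'k) comp_el set) dg_seq" where
  "indec K P L = rel_comp K P L (unit_seq K) (unit_left_action K P)"

definition indec_class :: "('k, 'c) ring_scheme \<Rightarrow> ('k, 'p, 'x) dg_operad_scheme \<Rightarrow>
    ('k, 'p, 'l, 'y) dg_rmod_scheme \<Rightarrow> nat \<Rightarrow> int \<Rightarrow> 'l \<Rightarrow> ('k, 'l, 'k) comp_el set" where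
  "indec_class K P L n d x =
     rel_comp_rels K P L (unit_seq K) (unit_left_action K P) n d
       +>\<^bsub>dg_mod (comp_prod K L (unit_seq K)) n d\<^esub>
     cls K L (unit_seq K) n d (d, x, unit_inputs n \<one>\<^bsub>K\<^esub>)"

definition indec_map :: "('k, 'c) ring_scheme \<Rightarrow> ('k, 'q, 'x) dg_operad_scheme \<Rightarrow>
    ('k, 'q, 'n, 'y) dg_rmod_scheme \<Rightarrow> (nat \<Rightarrow> int \<Rightarrow> 'l \<Rightarrow> 'n) \<Rightarrow>
    nat \<Rightarrow> int \<Rightarrow> ('k, 'l, 'k) comp_el set \<Rightarrow> ('k, 'n, 'k) comp_el set" where
  "indec_map K P' L' phi n d =
     quot_map (dg_mod (comp_prod K L' (unit_seq K)) n d)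
       (rel_comp_rels K P' L' (unit_seq K) (unit_left_action K P') n d)
       (comp_map K L' (unit_seq K) phi (\<lambda>_ _ k. k) n d)"


section \<open>Quasi-free right modules\<close>

text \<open>The inclusion \<open>M \<rightarrow> M \<circ> P\<close> sending \<open>x\<close> to \<open>x(1, \<dots>, 1)\<close>, and the projection
  \<open>M \<circ> P \<rightarrow> M \<circ> I \<cong> M\<close> induced by the augmentation.\<close>

definition free_incl :: "('k, 'c) ring_scheme \<Rightarrow> ('k, 'p, 'x) dg_operad_scheme \<Rightarrow>
    ('k, 'm, 'y) dg_seq_scheme \<Rightarrow> nat \<Rightarrow> int \<Rightarrow> 'm \<Rightarrow> ('k, 'm, 'p) comp_el" where
  "free_incl K P M n d x = cls K M P n d (d, x, unit_inputs n (op_unit P))"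

definition free_proj :: "('k, 'c) ring_scheme \<Rightarrow> ('k, 'p, 'x) dg_operad_scheme \<Rightarrow>
    ('k, 'm, 'y) dg_seq_scheme \<Rightarrow> nat \<Rightarrow> int \<Rightarrow> ('k, 'm, 'p) comp_el \<Rightarrow> 'm" where
  "free_proj K P M n d X =
     right_unitor K M n d (comp_map K M (unit_seq K) (\<lambda>_ _ x. x) (augmentation K P) n d X)"

text \<open>\<open>L\<close> is the quasi-free right \<open>P\<close>-module \<open>M \<circ> P\<close> with differential \<open>\<delta> + d\<^sub>\<theta>\<close>. The clause on
  \<open>rm_act L\<close> is the action of the free module, \<open>(M \<circ> P) \<circ> P \<cong> M \<circ> (P \<circ> P) \<rightarrow> M \<circ> P\<close>.\<close>

definition quasi_free :: "('k, 'c) ring_scheme \<Rightarrow> ('k, 'p, 'x) dg_operad_scheme \<Rightarrow>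
    ('k, 'm, 'y) dg_seq_scheme \<Rightarrow> ('k, 'p, ('k, 'm, 'p) comp_el, 'z) dg_rmod_scheme \<Rightarrow> bool" where
  "quasi_free K P M L \<longleftrightarrow>
     dg_sigma_module K M \<and>
     right_module K P L \<and>
     dg_mod L = dg_mod (comp_prod K M P) \<and>
     (\<forall>n d s. s permutes {..<n} \<longrightarrow>
        (\<forall>X\<in>carrier (dg_mod L n d). dg_act L n d s X = dg_act (comp_prod K M P) n d s X)) \<and>
     (\<forall>n d a x ys m zs.
        (a, x, ys) \<in> gens M P n d \<longrightarrow> valid_inputs P m zs \<longrightarrow> length zs = n \<longrightarrow>
        rm_act L m (d + tot_deg zs)
            (cls K L P m (d + tot_deg zs) (d, cls K M P n d (a, x, ys), zs)) =
        assoc_sign K ys zs \<odot>\<^bsub>dg_mod L m (d + tot_deg zs)\<^esub>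
          cls K M P m (d + tot_deg zs) (a, x, regroup K P P (op_comp P) ys zs)) \<and>
     (\<exists>dth.
        (\<forall>n d. lin_map K (dg_mod L n d) (dg_mod L n (d - 1)) (dth n d)) \<and>
        (\<forall>n d. \<forall>X\<in>carrier (dg_mod L n d).
           dg_diff L n d X = dg_diff (comp_prod K M P) n d X \<oplus>\<^bsub>dg_mod L n (d - 1)\<^esub> dth n d X) \<and>
        (\<forall>n d a x ys. (a, x, ys) \<in> gens M P n d \<longrightarrow>
           dth n d (cls K M P n d (a, x, ys)) =
           rm_act L n (d - 1) (cls K L P n (d - 1)
             (a - 1, dth (length ys) a (free_incl K P M (length ys) a x), ys))) \<and>
        (\<forall>n d. \<forall>X\<in>carrier (dg_mod L n d).
           free_proj K P M n (d - 1) (dth n d X) = \<zero>\<^bsub>dg_mod M n (d - 1)\<^esub>))"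

text \<open>The generators \<open>M\<close> of a quasi-free module \<open>L\<close> are identified with \<open>L \<circ>\<^sub>P I\<close> by sending \<open>x\<close> to the
  class of \<open>x(1, \<dots>, 1)\<close>; \<open>gen_map\<close> is the map \<open>L \<circ>\<^sub>P I \<rightarrow> L' \<circ>\<^bsub>P'\<^esub> I\<close> under this identification.\<close>

definition gen_class :: "('k, 'c) ring_scheme \<Rightarrow> ('k, 'p, 'x) dg_operad_scheme \<Rightarrow>
    ('k, 'm, 'y) dg_seq_scheme \<Rightarrow> ('k, 'p, ('k, 'm, 'p) comp_el, 'z) dg_rmod_scheme \<Rightarrow>
    nat \<Rightarrow> int \<Rightarrow> 'm \<Rightarrow> ('k, ('k, 'm, 'p) comp_el, 'k) comp_el set" where
  "gen_class K P M L n d x = indec_class K P L n d (free_incl K P M n d x)"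

definition gen_map :: "('k, 'c) ring_scheme \<Rightarrow>
    ('k, 'p, 'x) dg_operad_scheme \<Rightarrow> ('k, 'm, 'y) dg_seq_scheme \<Rightarrow>
    ('k, 'p, ('k, 'm, 'p) comp_el, 'z) dg_rmod_scheme \<Rightarrow>
    ('k, 'p1, 'x1) dg_operad_scheme \<Rightarrow> ('k, 'm1, 'y1) dg_seq_scheme \<Rightarrow>
    ('k, 'p1, ('k, 'm1, 'p1) comp_el, 'z1) dg_rmod_scheme \<Rightarrow>
    (nat \<Rightarrow> int \<Rightarrow> ('k, 'm, 'p) comp_el \<Rightarrow> ('k, 'm1, 'p1) comp_el) \<Rightarrow>
    nat \<Rightarrow> int \<Rightarrow> 'm \<Rightarrow> 'm1" where
  "gen_map K P M L P' M' L' phi n d x =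
     (THE y. y \<in> carrier (dg_mod M' n d) \<and>
        gen_class K P' M' L' n d y = indec_map K P' L' phi n d (gen_class K P M L n d x))"

end

theory Submission
  imports Defs
begin

text \<open>The composition product \<open>L = M \<circ> P\<close> is filtered by the number of nonempty inputs. Since \<open>P(0) = 0\<close>,
  coinvariants disappear once the blocks are sorted by their minima, so on the part with \<open>r\<close>
  inputs maps can be defined entry by entry, without equivariance. As the augmentation kills \<open>d\<^sub>\<theta>\<close>, the
  perturbation lowers the filtration, and the graded piece of \<open>\<phi>\<close> with \<open>r\<close> inputs is \<open>\<phi>\<close>bar applied to the root
  and \<open>\<psi>\<close> to each input, whose arities are at most \<open>n + 1 - r\<close>. Over a field, or for
  projective modules, quasi-isomorphisms of nonnegative complexes have homotopy inverses, so such
  an entrywise map is a quasi-isomorphism as soon as its entries are.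

  Going up the filtration gives (a). For (b), induct on the arity \<open>n\<close>: all of \<open>L(n)\<close> but its top piece
  \<open>M(n)\<close> is controlled by \<open>\<phi>\<close>bar in arities below \<open>n\<close>. For (c), induct on \<open>n\<close> as well: the piece of
  \<open>L(n)\<close> with one input is \<open>P(n)\<close>, and the pieces with at least two inputs involve \<open>\<psi>\<close> only in
  arities below \<open>n\<close>.\<close>

text \<open>Quasi-isomorphic entries do not by themselves control tensor products; a homotopy
  equivalence does pass to them, one entry at a time, which is why homotopy inverses come before any
  comparison of graded pieces. Quasi-isomorphisms are recast as acyclic mapping cones, a statement
  about pairs of elements in which injectivity and surjectivity in homology are handled at once. The
  piece with exactly \<open>r\<close> inputs is the image of an idempotent of
  \<open>M \<circ> P\<close>, and congruence modulo fewer inputs stands in for the quotient. A pair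
  is corrected by cone boundaries while its filtration level drops from \<open>s\<close> to
  \<open>s0\<close>. In arity \<open>n\<close> the three parts differ in these bounds: from
  \<open>n + 1\<close> to \<open>0\<close> for (a), from \<open>n\<close> to \<open>0\<close> for
  (b), from \<open>n + 1\<close> to \<open>2\<close> for (c); the bound \<open>2\<close> leaves the
  elements with at most one input, a copy of \<open>P(n)\<close>. Two definitions have to be
  unlocked before: the canonical differential is a union over a coset, and is recovered as the
  differential of \<open>L\<close> minus \<open>d\<^sub>\<theta>\<close>; and \<open>phibar\<close>
  is defined through \<open>L \<circ>\<^sub>P I\<close>, whose relations turn out to be the kernel
  of the projection to \<open>M\<close>.\<close>

abbreviation (input) add_in ("_ \<oplus>[_] _" [65, 0, 66] 65) where "x \<oplus>[A] y \<equiv> x \<oplus>\<^bsub>A\<^esub> y"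
abbreviation (input) minus_in ("_ \<ominus>[_] _" [65, 0, 66] 65) where "x \<ominus>[A] y \<equiv> x \<ominus>\<^bsub>A\<^esub> y"
abbreviation (input) neg_in ("\<ominus>[_] _" [0, 81] 80) where "\<ominus>[A] x \<equiv> \<ominus>\<^bsub>A\<^esub> x"
abbreviation (input) smult_in ("_ \<odot>[_] _" [70, 0, 71] 70) where "c \<odot>[A] x \<equiv> c \<odot>\<^bsub>A\<^esub> x"
abbreviation (input) mult_in ("_ \<otimes>[_] _" [70, 0, 71] 70) where "x \<otimes>[K] y \<equiv> x \<otimes>\<^bsub>K\<^esub> y"
abbreviation (input) zero_in ("\<zero>[_]") where "\<zero>[A] \<equiv> \<zero>\<^bsub>A\<^esub>"
abbreviation (input) one_in ("\<one>[_]") where "\<one>[K] \<equiv> \<one>\<^bsub>K\<^esub>"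
abbreviation (input) coset_in ("_ +>[_] _" [60, 0, 61] 60) where "H +>[A] x \<equiv> H +>\<^bsub>A\<^esub> x"
abbreviation (input) elts where "elts M r d \<equiv> carrier (dg_mod M r d)"

section \<open>Linear maps, spans and quotients\<close>

text \<open>Cancellation between non-adjacent summands, for terms in the normal form of \<open>a_ac\<close>.\<close>

lemma (in abelian_group) cancel0:
  "{x} \<subseteq> carrier G \<Longrightarrow>
    x \<oplus> (\<ominus> x) = \<zero>"
  "{x, z} \<subseteq> carrier G \<Longrightarrow>
    x \<oplus> (\<ominus> x \<oplus> z) = z"
  "{x} \<subseteq> carrier G \<Longrightarrow>
    \<ominus> x \<oplus> (x) = \<zero>"
  "{x, z} \<subseteq> carrier G \<Longrightarrow>
    \<ominus> x \<oplus> (x \<oplus> z) = z"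
  by (simp_all add: r_neg l_neg r_neg1 r_neg2)

lemma (in abelian_group) cancel1:
  "{x, a} \<subseteq> carrier G \<Longrightarrow>
    x \<oplus> (a \<oplus> (\<ominus> x)) = a"
  "{x, a, z} \<subseteq> carrier G \<Longrightarrow>
    x \<oplus> (a \<oplus> (\<ominus> x \<oplus> z)) = a \<oplus> (z)"
  "{x, a} \<subseteq> carrier G \<Longrightarrow>
    \<ominus> x \<oplus> (a \<oplus> x) = a"
  "{x, a, z} \<subseteq> carrier G \<Longrightarrow>
    \<ominus> x \<oplus> (a \<oplus> (x \<oplus> z)) = a \<oplus> (z)"
  by (subst a_lcomm; simp add: cancel0)+

lemma (in abelian_group) cancel2:
  "{x, a, b} \<subseteq> carrier G \<Longrightarrow>
    x \<oplus> (a \<oplus> (b \<oplus> (\<ominus> x))) = a \<oplus> (b)"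
  "{x, a, b, z} \<subseteq> carrier G \<Longrightarrow>
    x \<oplus> (a \<oplus> (b \<oplus> (\<ominus> x \<oplus> z))) = a \<oplus> (b \<oplus> z)"
  "{x, a, b} \<subseteq> carrier G \<Longrightarrow>
    \<ominus> x \<oplus> (a \<oplus> (b \<oplus> x)) = a \<oplus> (b)"
  "{x, a, b, z} \<subseteq> carrier G \<Longrightarrow>
    \<ominus> x \<oplus> (a \<oplus> (b \<oplus> (x \<oplus> z))) = a \<oplus> (b \<oplus> z)"
  by (subst a_lcomm; simp add: cancel1)+

lemma (in abelian_group) cancel3:
  "{x, a, b, c} \<subseteq> carrier G \<Longrightarrow>
    x \<oplus> (a \<oplus> (b \<oplus> (c \<oplus> (\<ominus> x)))) = a \<oplus> (b \<oplus> c)"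
  "{x, a, b, c, z} \<subseteq> carrier G \<Longrightarrow>
    x \<oplus> (a \<oplus> (b \<oplus> (c \<oplus> (\<ominus> x \<oplus> z)))) = a \<oplus> (b \<oplus> (c \<oplus> z))"
  "{x, a, b, c} \<subseteq> carrier G \<Longrightarrow>
    \<ominus> x \<oplus> (a \<oplus> (b \<oplus> (c \<oplus> x))) = a \<oplus> (b \<oplus> c)"
  "{x, a, b, c, z} \<subseteq> carrier G \<Longrightarrow>
    \<ominus> x \<oplus> (a \<oplus> (b \<oplus> (c \<oplus> (x \<oplus> z)))) = a \<oplus> (b \<oplus> (c \<oplus> z))"
  by (subst a_lcomm; simp add: cancel2)+

lemma (in abelian_group) cancel4:
  "{x, a, b, c, d} \<subseteq> carrier G \<Longrightarrow>
    x \<oplus> (a \<oplus> (b \<oplus> (c \<oplus> (d \<oplus> (\<ominus> x))))) = a \<oplus> (b \<oplus> (c \<oplus> d))"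
  "{x, a, b, c, d, z} \<subseteq> carrier G \<Longrightarrow>
    x \<oplus> (a \<oplus> (b \<oplus> (c \<oplus> (d \<oplus> (\<ominus> x \<oplus> z))))) = a \<oplus> (b \<oplus> (c \<oplus> (d \<oplus> z)))"
  "{x, a, b, c, d} \<subseteq> carrier G \<Longrightarrow>
    \<ominus> x \<oplus> (a \<oplus> (b \<oplus> (c \<oplus> (d \<oplus> x)))) = a \<oplus> (b \<oplus> (c \<oplus> d))"
  "{x, a, b, c, d, z} \<subseteq> carrier G \<Longrightarrow>
    \<ominus> x \<oplus> (a \<oplus> (b \<oplus> (c \<oplus> (d \<oplus> (x \<oplus> z))))) = a \<oplus> (b \<oplus> (c \<oplus> (d \<oplus> z)))"
  by (subst a_lcomm; simp add: cancel3)+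

lemma (in abelian_group) cancel5:
  "{x, a, b, c, d, e} \<subseteq> carrier G \<Longrightarrow>
    x \<oplus> (a \<oplus> (b \<oplus> (c \<oplus> (d \<oplus> (e \<oplus> (\<ominus> x)))))) = a \<oplus> (b \<oplus> (c \<oplus> (d \<oplus> e)))"
  "{x, a, b, c, d, e, z} \<subseteq> carrier G \<Longrightarrow>
    x \<oplus> (a \<oplus> (b \<oplus> (c \<oplus> (d \<oplus> (e \<oplus> (\<ominus> x \<oplus> z)))))) = a \<oplus> (b \<oplus> (c \<oplus> (d \<oplus> (e \<oplus> z))))"
  "{x, a, b, c, d, e} \<subseteq> carrier G \<Longrightarrow>
    \<ominus> x \<oplus> (a \<oplus> (b \<oplus> (c \<oplus> (d \<oplus> (e \<oplus> x))))) = a \<oplus> (b \<oplus> (c \<oplus> (d \<oplus> e)))"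
  "{x, a, b, c, d, e, z} \<subseteq> carrier G \<Longrightarrow>
    \<ominus> x \<oplus> (a \<oplus> (b \<oplus> (c \<oplus> (d \<oplus> (e \<oplus> (x \<oplus> z)))))) = a \<oplus> (b \<oplus> (c \<oplus> (d \<oplus> (e \<oplus> z))))"
  by (subst a_lcomm; simp add: cancel4)+

lemmas (in abelian_group) cancels = cancel0 cancel1 cancel2 cancel3 cancel4 cancel5

lemma lin_closed: "lin_map K A B f \<Longrightarrow> x \<in> carrier A \<Longrightarrow> f x \<in> carrier B"
  by (auto simp: lin_map_def)

lemma lin_add: "lin_map K A B f \<Longrightarrow> x \<in> carrier A \<Longrightarrow> y \<in> carrier A \<Longrightarrow>
    f (x \<oplus>[A] y) = f x \<oplus>[B] f y"
  by (auto simp: lin_map_def)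

lemma lin_smult: "lin_map K A B f \<Longrightarrow> c \<in> carrier K \<Longrightarrow> x \<in> carrier A \<Longrightarrow>
    f (c \<odot>[A] x) = c \<odot>[B] f x"
  by (auto simp: lin_map_def)

lemma lin_mapI:
  assumes "\<And>x. x \<in> carrier A \<Longrightarrow> f x \<in> carrier B"
    and "\<And>x y. x \<in> carrier A \<Longrightarrow> y \<in> carrier A \<Longrightarrow> f (x \<oplus>[A] y) = f x \<oplus>[B] f y"
    and "\<And>c x. c \<in> carrier K \<Longrightarrow> x \<in> carrier A \<Longrightarrow> f (c \<odot>[A] x) = c \<odot>[B] f x"
  shows "lin_map K A B f"
  using assms by (auto simp: lin_map_def)

lemma lin_zero:
  assumes "module K A" "module K B" "lin_map K A B f"
  shows "f \<zero>[A] = \<zero>[B]"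
proof -
  interpret A: module K A by fact
  interpret B: module K B by fact
  have "f (\<zero>[K] \<odot>[A] \<zero>[A]) = \<zero>[K] \<odot>[B] f \<zero>[A]"
    by (rule lin_smult[OF assms(3)]) auto
  then show ?thesis using lin_closed[OF assms(3) A.zero_closed] by simp
qed

lemma lin_neg:
  assumes "module K A" "module K B" "lin_map K A B f" "x \<in> carrier A"
  shows "f (\<ominus>[A] x) = \<ominus>[B] f x"
proof -
  interpret A: module K A by fact
  interpret B: module K B by fact
  have "f (\<ominus>[A] x) \<oplus>[B] f x = f (\<ominus>[A] x \<oplus>[A] x)"
    using assms(4) by (simp add: lin_add[OF assms(3)])
  also have "\<dots> = \<zero>[B]" using assms(4) lin_zero[OF assms(1,2,3)] by (simp add: A.l_neg)
  finally show ?thesis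
    using assms(4) B.minus_equality lin_closed[OF assms(3)] by (metis A.a_inv_closed)
qed

lemma lin_minus:
  assumes "module K A" "module K B" "lin_map K A B f" "x \<in> carrier A" "y \<in> carrier A"
  shows "f (x \<ominus>[A] y) = f x \<ominus>[B] f y"
proof -
  interpret A: module K A by fact
  interpret B: module K B by fact
  show ?thesis using assms(4,5)
    by (simp add: a_minus_def lin_add[OF assms(3)] lin_neg[OF assms(1,2,3)])
qed

lemma lin_finsum:
  assumes "module K A" "module K B" "lin_map K A B f" "finite I" "g \<in> I \<rightarrow> carrier A"
  shows "f (\<Oplus>\<^bsub>A\<^esub>i\<in>I. g i) = (\<Oplus>\<^bsub>B\<^esub>i\<in>I. f (g i))"
proof -
  interpret A: module K A by fact
  interpret B: module K B by fact
  show ?thesis using assms(4,5)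
  proof (induction I)
    case empty
    then show ?case using lin_zero[OF assms(1,2,3)] by simp
  next
    case (insert i I)
    have 1: "g \<in> I \<rightarrow> carrier A" "g i \<in> carrier A" using insert.prems by auto
    have 2: "(\<lambda>i. f (g i)) \<in> I \<rightarrow> carrier B" "f (g i) \<in> carrier B"
      using 1 lin_closed[OF assms(3)] by auto
    show ?case using insert 1 2
      by (simp add: lin_add[OF assms(3)] A.finsum_closed)
  qed
qed

lemma lin_id: "lin_map K A A (\<lambda>x. x)"
  by (auto simp: lin_map_def)

lemma lin_comp: "lin_map K A B f \<Longrightarrow> lin_map K B C g \<Longrightarrow> lin_map K A C (\<lambda>x. g (f x))"
  by (auto simp: lin_map_def Pi_def)

lemma lin_const_zero: "module K B \<Longrightarrow> lin_map K A B (\<lambda>x. \<zero>[B])"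
proof -
  assume "module K B"
  then interpret B: module K B .
  show ?thesis by (auto simp: lin_map_def)
qed

lemma lin_plus:
  assumes "module K A" "module K B" "lin_map K A B f" "lin_map K A B g"
  shows "lin_map K A B (\<lambda>x. f x \<oplus>[B] g x)"
proof -
  interpret A: module K A by fact
  interpret B: module K B by fact
  note [simp] = lin_closed[OF assms(3)] lin_closed[OF assms(4)]
  show ?thesis
    by (rule lin_mapI) (simp_all add: lin_add[OF assms(3)] lin_add[OF assms(4)]
      lin_smult[OF assms(3)] lin_smult[OF assms(4)] B.a_ac B.smult_r_distr)
qed

lemma lin_scale:
  assumes "module K A" "module K B" "lin_map K A B f" "c \<in> carrier K"
  shows "lin_map K A B (\<lambda>x. c \<odot>[B] f x)"
proof -
  interpret A: module K A by fact
  interpret B: module K B by fact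
  note [simp] = lin_closed[OF assms(3)] assms(4)
  have "c \<odot>[B] (c' \<odot>[B] f x) = c' \<odot>[B] (c \<odot>[B] f x)"
    if "c' \<in> carrier K" "x \<in> carrier A" for c' x
    using that by (simp flip: B.smult_assoc1 add: A.R.m_comm)
  then show ?thesis
    by (intro lin_mapI) (simp_all add: lin_add[OF assms(3)] lin_smult[OF assms(3)]
      B.smult_r_distr)
qed

lemma lin_uminus:
  assumes "module K A" "module K B" "lin_map K A B f"
  shows "lin_map K A B (\<lambda>x. \<ominus>[B] f x)"
proof -
  interpret A: module K A by fact
  interpret B: module K B by fact
  note [simp] = lin_closed[OF assms(3)]
  show ?thesis
    by (rule lin_mapI) (simp_all add: lin_add[OF assms(3)] lin_smult[OF assms(3)]
      B.minus_add B.smult_r_minus)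
qed

lemma lin_diff:
  assumes "module K A" "module K B" "lin_map K A B f" "lin_map K A B g"
  shows "lin_map K A B (\<lambda>x. f x \<ominus>[B] g x)"
  unfolding a_minus_def by (intro lin_plus lin_uminus assms)

lemma lin_cong:
  assumes "module K A" "lin_map K A B f" "\<And>x. x \<in> carrier A \<Longrightarrow> g x = f x"
  shows "lin_map K A B g"
proof -
  interpret A: module K A by fact
  show ?thesis using assms(2,3) by (auto simp: lin_map_def Pi_def)
qed

lemma zero_module_D: "zero_module A \<Longrightarrow> x \<in> carrier A \<Longrightarrow> x = \<zero>[A]"
  by (simp add: zero_module_def)

section \<open>Submodules and spans\<close>

lemma submodule_Inter:
  assumes "module K A" "S \<noteq> {}" "\<And>H. H \<in> S \<Longrightarrow> submodule H K A"
  shows "submodule (\<Inter>S) K A"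
proof -
  interpret A: module K A by fact
  note E = A.submoduleE[OF assms(3)]
  have z: "\<zero>[A] \<in> H" if "H \<in> S" for H
    using subgroup.one_closed[OF submodule.axioms(1)[OF assms(3)[OF that]]] by simp
  show ?thesis
  proof (rule A.submoduleI)
    show "\<Inter>S \<subseteq> carrier A" using assms(2) E(1) by blast
    show "\<ominus>[A] a \<in> \<Inter>S" if "a \<in> \<Inter>S" for a using that E(3) by blast
    show "a \<oplus>[A] b \<in> \<Inter>S" if "a \<in> \<Inter>S" "b \<in> \<Inter>S" for a b using that E(5) by blast
    show "c \<odot>[A] b \<in> \<Inter>S" if "c \<in> carrier K" "b \<in> \<Inter>S" for c b using that E(4) by blast
  qed (use z in blast)
qed

lemma
  assumes "module K A" "S \<subseteq> carrier A"
  shows submodule_mspan: "submodule (mspan K A S) K A"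
    and mspan_superset: "S \<subseteq> mspan K A S"
proof -
  interpret A: module K A by fact
  have "{H. submodule H K A \<and> S \<subseteq> H} \<noteq> {}"
    using A.carrier_is_submodule assms(2) by blast
  then show "submodule (mspan K A S) K A"
    unfolding mspan_def by (rule submodule_Inter[OF assms(1)]) simp
  show "S \<subseteq> mspan K A S" by (auto simp: mspan_def)
qed

lemma mspan_least: "submodule H K A \<Longrightarrow> S \<subseteq> H \<Longrightarrow> mspan K A S \<subseteq> H"
  by (auto simp: mspan_def)

lemma mspan_induct [consumes 3, case_names base zero add smult]:
  assumes "module K A" "S \<subseteq> carrier A" "x \<in> mspan K A S"
    and base: "\<And>x. x \<in> S \<Longrightarrow> Q x"
    and zero: "Q \<zero>[A]"
    and add: "\<And>x y. x \<in> mspan K A S \<Longrightarrow> y \<in> mspan K A S \<Longrightarrow> x \<in> carrier A \<Longrightarrow> y \<in> carrier A \<Longrightarrow>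
      Q x \<Longrightarrow> Q y \<Longrightarrow> Q (x \<oplus>[A] y)"
    and smult: "\<And>c x. c \<in> carrier K \<Longrightarrow> x \<in> mspan K A S \<Longrightarrow> x \<in> carrier A \<Longrightarrow> Q x \<Longrightarrow> Q (c \<odot>[A] x)"
  shows "Q x"
proof -
  interpret A: module K A by fact
  have sm: "submodule (mspan K A S) K A" using submodule_mspan[OF assms(1,2)] .
  note E = A.submoduleE[OF sm]
  have c: "x \<in> mspan K A S \<Longrightarrow> x \<in> carrier A" for x using E(1) by auto
  have z: "\<zero>[A] \<in> mspan K A S"
    using subgroup.one_closed[OF submodule.axioms(1)[OF sm]] by simp
  have "submodule {x \<in> mspan K A S. Q x} K A"
  proof (rule A.submoduleI)
    fix a assume a: "a \<in> {x \<in> mspan K A S. Q x}"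
    \<comment> \<open>Negation is multiplication by the scalar -1, so the induction rule gets by
      with the cases of zero, sums and multiples.\<close>
    have "\<ominus>[A] a = (\<ominus>[K] \<one>[K]) \<odot>[A] a" using a c by (simp add: A.smult_l_minus)
    then show "\<ominus>[A] a \<in> {x \<in> mspan K A S. Q x}" using a c E(4) smult by auto
  qed (use c z zero add smult E in auto)
  then have "mspan K A S \<subseteq> {x \<in> mspan K A S. Q x}"
    by (rule mspan_least) (use base mspan_superset[OF assms(1,2)] in auto)
  then show ?thesis using assms(3) by auto
qed

lemma submodule_zero: "submodule H K A \<Longrightarrow> \<zero>[A] \<in> H"
  using subgroup.one_closed[OF submodule.axioms(1)[of H K A]] by simp

lemma submodule_abelian_subgroup:
  assumes "module K A" "submodule H K A" shows "abelian_subgroup H A"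
proof -
  interpret A: module K A by fact
  show ?thesis
    by (rule abelian_subgroupI3)
      (auto intro: additive_subgroup.intro submodule.axioms(1)[OF assms(2)] A.abelian_group_axioms)
qed

section \<open>Quotient modules and the maps induced on them\<close>

lemma quot_module_simps:
  "carrier (quot_module A H) = a_rcosets\<^bsub>A\<^esub> H" "\<zero>[quot_module A H] = H"
  "X \<oplus>[quot_module A H] Y = X <+>\<^bsub>A\<^esub> Y"
  "c \<odot>[quot_module A H] X = (\<Union>x\<in>X. H +>[A] (c \<odot>[A] x))"
  by (simp_all add: quot_module_def)

lemma coset_eq_iff:
  assumes "module K A" "submodule H K A" "x \<in> carrier A" "y \<in> carrier A"
  shows "H +>[A] x = H +>[A] y \<longleftrightarrow> x \<ominus>[A] y \<in> H"
proof -
  interpret A: module K A by fact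
  interpret H: abelian_subgroup H A using submodule_abelian_subgroup[OF assms(1,2)] .
  show ?thesis
    using H.a_rcos_module[OF assms(4,3)] H.a_repr_independence' H.a_repr_independenceD assms(3,4)
    by (metis A.minus_eq)
qed

lemma mem_coset_iff:
  assumes "module K A" "submodule H K A" "x \<in> carrier A"
  shows "y \<in> H +>[A] x \<longleftrightarrow> y \<in> carrier A \<and> H +>[A] y = H +>[A] x"
proof -
  interpret A: module K A by fact
  interpret H: abelian_subgroup H A using submodule_abelian_subgroup[OF assms(1,2)] .
  show ?thesis
    using H.a_repr_independence' H.a_repr_independenceD H.a_elemrcos_carrier assms(3) by metis
qed

lemma coset_self:
  assumes "module K A" "submodule H K A" "x \<in> carrier A"
  shows "x \<in> H +>[A] x"
  using mem_coset_iff[OF assms] assms(3) by blast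

lemma rcosetsE:
  assumes "X \<in> a_rcosets\<^bsub>A\<^esub> H"
  obtains x where "x \<in> carrier A" "X = H +>[A] x"
  using assms by (auto simp: A_RCOSETS_def')

lemma coset_closed: "x \<in> carrier A \<Longrightarrow> H +>[A] x \<in> a_rcosets\<^bsub>A\<^esub> H"
  by (auto simp: A_RCOSETS_def')

lemma coset_add:
  assumes "module K A" "submodule H K A" "x \<in> carrier A" "y \<in> carrier A"
  shows "(H +>[A] x) <+>\<^bsub>A\<^esub> (H +>[A] y) = H +>[A] (x \<oplus>[A] y)"
proof -
  interpret H: abelian_subgroup H A using submodule_abelian_subgroup[OF assms(1,2)] .
  show ?thesis using H.a_rcos_sum assms(3,4) by simp
qed

text \<open>Two representatives of a coset differ by an element of \<open>G\<close>, which
  \<open>f\<close> sends into \<open>H\<close>; hence the union in \<open>quot_map\<close> is over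
  copies of one and the same coset.\<close>

lemma quot_map_coset:
  assumes "module K A" "submodule G K A" "module K B" "submodule H K B"
    and "lin_map K A B f" "\<And>x. x \<in> G \<Longrightarrow> f x \<in> H" "x \<in> carrier A"
  shows "quot_map B H f (G +>[A] x) = H +>[B] f x"
proof -
  have "H +>[B] f y = H +>[B] f x" if "y \<in> G +>[A] x" for y
  proof -
    have y: "y \<in> carrier A" "y \<ominus>[A] x \<in> G"
      using mem_coset_iff[OF assms(1,2,7)] coset_eq_iff[OF assms(1,2) _ assms(7)] that by auto
    then have "f y \<ominus>[B] f x \<in> H"
      using assms(6)[OF y(2)] lin_minus[OF assms(1,3,5) y(1) assms(7)] by simp
    then show ?thesis
      using coset_eq_iff[OF assms(3,4)] lin_closed[OF assms(5)] y(1) assms(7) by simp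
  qed
  then show ?thesis using coset_self[OF assms(1,2,7)] unfolding quot_map_def by blast
qed

lemma coset_smult:
  assumes "module K A" "submodule H K A" "x \<in> carrier A" "c \<in> carrier K"
  shows "c \<odot>[quot_module A H] (H +>[A] x) = H +>[A] (c \<odot>[A] x)"
proof -
  interpret A: module K A by fact
  \<comment> \<open>The scalar multiplication of \<open>quot_module\<close> has the shape of
    \<open>quot_map\<close> for the linear map that multiplies by \<open>c\<close>.\<close>
  show ?thesis
    using quot_map_coset[OF assms(1,2,1,2) lin_scale[OF assms(1,1) lin_id assms(4)] _ assms(3)]
      A.submoduleE(4)[OF assms(2) assms(4)]
    by (simp add: quot_module_simps quot_map_def)
qed

lemma quot_module_module:
  assumes "module K A" "submodule H K A"
  shows "module K (quot_module A H)"
proof -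
  interpret A: module K A by fact
  let ?Q = "quot_module A H"
  note ca = coset_add[OF assms] and cs = coset_smult[OF assms] and ss = A.submoduleE[OF assms(2)]
  have z: "H = H +>[A] \<zero>[A]" using A.a_coset_add_zero[OF ss(1)] by simp
  show ?thesis
  proof (rule moduleI)
    show "abelian_group ?Q"
    proof (rule abelian_groupI)
      show "\<zero>[?Q] \<in> carrier ?Q" using z by (metis A.zero_closed coset_closed quot_module_simps(1,2))
      fix X assume X: "X \<in> carrier ?Q"
      then obtain x where x: "x \<in> carrier A" "X = H +>[A] x"
        by (auto simp: quot_module_simps elim: rcosetsE)
      show "\<zero>[?Q] \<oplus>[?Q] X = X" using ca[OF A.zero_closed x(1)] x z by (simp add: quot_module_simps)
      show "\<exists>Y\<in>carrier ?Q. Y \<oplus>[?Q] X = \<zero>[?Q]"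
        using ca[OF A.a_inv_closed[OF x(1)] x(1)] x z coset_closed[OF A.a_inv_closed[OF x(1)]]
        by (auto simp: quot_module_simps A.l_neg)
      fix Y assume "Y \<in> carrier ?Q"
      then obtain y where y: "y \<in> carrier A" "Y = H +>[A] y"
        by (auto simp: quot_module_simps elim: rcosetsE)
      show "X \<oplus>[?Q] Y \<in> carrier ?Q"
        using ca[OF x(1) y(1)] x y by (simp add: quot_module_simps coset_closed)
      show "X \<oplus>[?Q] Y = Y \<oplus>[?Q] X"
        using ca[OF x(1) y(1)] ca[OF y(1) x(1)] x y by (simp add: quot_module_simps A.a_comm)
      fix Z assume "Z \<in> carrier ?Q"
      then obtain w where w: "w \<in> carrier A" "Z = H +>[A] w"
        by (auto simp: quot_module_simps elim: rcosetsE)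
      show "(X \<oplus>[?Q] Y) \<oplus>[?Q] Z = X \<oplus>[?Q] (Y \<oplus>[?Q] Z)"
        using x y w by (simp add: quot_module_simps ca A.a_assoc)
    qed
  next
    fix c X assume c: "c \<in> carrier K" and X: "X \<in> carrier ?Q"
    then obtain x where x: "x \<in> carrier A" "X = H +>[A] x"
      by (auto simp: quot_module_simps elim: rcosetsE)
    show "c \<odot>[?Q] X \<in> carrier ?Q"
      using cs[OF x(1) c] x(2) coset_closed[OF A.smult_closed[OF c x(1)]] by (simp add: quot_module_simps(1))
    fix c' assume c': "c' \<in> carrier K"
    show "(c \<oplus>[K] c') \<odot>[?Q] X = c \<odot>[?Q] X \<oplus>[?Q] c' \<odot>[?Q] X"
      using c c' x by (simp add: cs quot_module_simps(3) ca A.smult_l_distr)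
    show "(c \<otimes>[K] c') \<odot>[?Q] X = c \<odot>[?Q] (c' \<odot>[?Q] X)"
      using c c' x by (simp add: cs A.smult_assoc1)
  next
    fix c X Y assume c: "c \<in> carrier K" and X: "X \<in> carrier ?Q" "Y \<in> carrier ?Q"
    then obtain x y where x: "x \<in> carrier A" "X = H +>[A] x" "y \<in> carrier A" "Y = H +>[A] y"
      by (auto simp: quot_module_simps elim!: rcosetsE)
    show "c \<odot>[?Q] (X \<oplus>[?Q] Y) = c \<odot>[?Q] X \<oplus>[?Q] c \<odot>[?Q] Y"
      using c x by (simp add: cs quot_module_simps(3) ca A.smult_r_distr)
  next
    fix X assume "X \<in> carrier ?Q"
    then obtain x where x: "x \<in> carrier A" "X = H +>[A] x"
      by (auto simp: quot_module_simps elim: rcosetsE)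
    then show "\<one>[K] \<odot>[?Q] X = X" by (simp add: cs)
  qed (rule A.is_cring)
qed

lemma coset_lin_map:
  assumes "module K A" "submodule H K A"
  shows "lin_map K A (quot_module A H) (\<lambda>x. H +>[A] x)"
  by (rule lin_mapI)
    (simp_all add: quot_module_simps(1,3) coset_closed coset_add[OF assms] coset_smult[OF assms])

lemma quot_map_lin_map:
  assumes "module K A" "submodule G K A" "module K B" "submodule H K B"
    and "lin_map K A B f" "\<And>x. x \<in> G \<Longrightarrow> f x \<in> H"
  shows "lin_map K (quot_module A G) (quot_module B H) (quot_map B H f)"
proof -
  interpret A: module K A by fact
  note q = quot_map_coset[OF assms]
  note fc = lin_closed[OF assms(5)]
  show ?thesis
  proof (rule lin_mapI)
    fix X Y assume "X \<in> carrier (quot_module A G)" "Y \<in> carrier (quot_module A G)"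
    then obtain x y where x: "x \<in> carrier A" "X = G +>[A] x" "y \<in> carrier A" "Y = G +>[A] y"
      by (auto simp: quot_module_simps elim!: rcosetsE)
    then show "quot_map B H f (X \<oplus>[quot_module A G] Y) =
        quot_map B H f X \<oplus>[quot_module B H] quot_map B H f Y"
      by (simp add: quot_module_simps(3) coset_add[OF assms(1,2)] coset_add[OF assms(3,4)] q fc
        lin_add[OF assms(5)])
  next
    fix X assume "X \<in> carrier (quot_module A G)"
    then obtain x where x: "x \<in> carrier A" "X = G +>[A] x"
      by (auto simp: quot_module_simps elim!: rcosetsE)
    then show "quot_map B H f X \<in> carrier (quot_module B H)"
      by (simp add: q quot_module_simps(1) coset_closed fc)
    fix c assume c: "c \<in> carrier K"
    then show "quot_map B H f (c \<odot>[quot_module A G] X) = c \<odot>[quot_module B H] quot_map B H f X"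
      using x by (simp add: coset_smult[OF assms(1,2)] coset_smult[OF assms(3,4)] q fc
        lin_smult[OF assms(5)])
  qed
qed

text \<open>If the union over a coset happens to be a coset, its value can be read off at any
  representative, without knowing that the map respects the subgroups.\<close>

lemma quot_map_rep:
  assumes "module K B" "submodule H K B" "x \<in> X" "f x \<in> carrier B"
    and "quot_map B H f X \<in> a_rcosets\<^bsub>B\<^esub> H"
  shows "quot_map B H f X = H +>[B] f x"
proof -
  obtain y where y: "y \<in> carrier B" "quot_map B H f X = H +>[B] y" using assms(5) by (rule rcosetsE)
  have "f x \<in> quot_map B H f X"
    using coset_self[OF assms(1,2,4)] assms(3) by (auto simp: quot_map_def)
  then show ?thesis using mem_coset_iff[OF assms(1,2) y(1)] y by auto
qed

text \<open>Here only the sum of the union with a further coset \<open>Y\<close> is known to be a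
  coset. All elements \<open>f u + y\<close> then lie in one coset, so the \<open>f u\<close> are
  congruent to each other. This is the position of the canonical differential of a quasi-free
  module: the full differential and the twisting part have cosets as values, and it is what
  remains.\<close>

lemma quot_map_rep_add:
  assumes "module K B" "submodule H K B" "x \<in> X" "\<And>x. x \<in> X \<Longrightarrow> f x \<in> carrier B"
    and "Y \<in> a_rcosets\<^bsub>B\<^esub> H" "quot_map B H f X <+>\<^bsub>B\<^esub> Y \<in> a_rcosets\<^bsub>B\<^esub> H"
  shows "quot_map B H f X = H +>[B] f x"
proof -
  interpret B: module K B by fact
  obtain y where y: "y \<in> carrier B" "Y = H +>[B] y" using assms(5) by (rule rcosetsE)
  obtain z where z: "z \<in> carrier B" "quot_map B H f X <+>\<^bsub>B\<^esub> Y = H +>[B] z"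
    using assms(6) by (rule rcosetsE)
  have *: "H +>[B] (f u \<oplus>[B] y) = H +>[B] z" if u: "u \<in> X" for u
  proof -
    have "f u \<in> quot_map B H f X"
      using coset_self[OF assms(1,2) assms(4)[OF u]] u by (auto simp: quot_map_def)
    moreover have "y \<in> Y" using coset_self[OF assms(1,2) y(1)] y by simp
    ultimately have "f u \<oplus>[B] y \<in> H +>[B] z" unfolding z(2)[symmetric] set_add_def' by blast
    then show ?thesis using mem_coset_iff[OF assms(1,2) z(1)] by auto
  qed
  have "H +>[B] f u = H +>[B] f x" if u: "u \<in> X" for u
  proof -
    have c: "f u \<in> carrier B" "f x \<in> carrier B" using u assms(3,4) by auto
    have "(f u \<oplus>[B] y) \<ominus>[B] (f x \<oplus>[B] y) = f u \<ominus>[B] f x"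
      using c y(1) by (simp add: a_minus_def B.minus_add B.a_ac B.cancels)
    then show ?thesis
      using coset_eq_iff[OF assms(1,2)] *[OF u] *[OF assms(3)] c y(1) by (metis B.a_closed)
  qed
  then have "quot_map B H f X = (\<Union>u\<in>X. H +>[B] f x)" unfolding quot_map_def by (rule SUP_cong[OF refl])
  then show ?thesis using assms(3) by auto
qed

section \<open>Free modules\<close>

lemma free_module_simps:
  "carrier (free_module K S) = {f. (\<forall>s. f s \<in> carrier K) \<and> {s. f s \<noteq> \<zero>[K]} \<subseteq> S \<and> finite {s. f s \<noteq> \<zero>[K]}}"
  "\<zero>[free_module K S] = (\<lambda>s. \<zero>[K])" "f \<oplus>[free_module K S] g = (\<lambda>s. f s \<oplus>[K] g s)"
  "c \<odot>[free_module K S] f = (\<lambda>s. c \<otimes>[K] f s)"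
  by (simp_all add: free_module_def)

lemma free_module_module:
  assumes "cring K" shows "module K (free_module K S)"
proof -
  interpret K: cring K by fact
  let ?F = "free_module K S"
  have add: "(\<lambda>s. f s \<oplus>[K] g s) \<in> carrier ?F" if "f \<in> carrier ?F" "g \<in> carrier ?F" for f g
  proof -
    have "{s. f s \<oplus>[K] g s \<noteq> \<zero>[K]} \<subseteq> {s. f s \<noteq> \<zero>[K]} \<union> {s. g s \<noteq> \<zero>[K]}" using that by (auto simp: free_module_simps)
    from finite_subset[OF this] this show ?thesis using that unfolding free_module_simps by auto
  qed
  have scale: "(\<lambda>s. c \<otimes>[K] f s) \<in> carrier ?F" if "f \<in> carrier ?F" "c \<in> carrier K" for f c
  proof -
    have "{s. c \<otimes>[K] f s \<noteq> \<zero>[K]} \<subseteq> {s. f s \<noteq> \<zero>[K]}" using that by (auto simp: free_module_simps)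
    from finite_subset[OF this] show ?thesis using that by (auto simp: free_module_simps)
  qed
  have c: "f s \<in> carrier K" if "f \<in> carrier ?F" for f s using that by (auto simp: free_module_simps)
  show ?thesis
  proof (rule moduleI)
    show "abelian_group ?F"
    proof (rule abelian_groupI)
      fix f assume f: "f \<in> carrier ?F"
      show "\<exists>g\<in>carrier ?F. g \<oplus>[?F] f = \<zero>[?F]"
        using scale[OF f, of "\<ominus>[K] \<one>[K]"] c[OF f]
        by (intro bexI[of _ "\<lambda>s. (\<ominus>[K] \<one>[K]) \<otimes>[K] f s"])
          (auto simp: free_module_simps(2,3) K.l_minus K.l_neg)
      fix g assume g: "g \<in> carrier ?F"
      show "f \<oplus>[?F] g \<in> carrier ?F" using add[OF f g] by (simp add: free_module_simps(3))
      show "f \<oplus>[?F] g = g \<oplus>[?F] f" using c[OF f] c[OF g] by (simp add: free_module_simps(3) K.a_comm)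
      fix h assume h: "h \<in> carrier ?F"
      show "(f \<oplus>[?F] g) \<oplus>[?F] h = f \<oplus>[?F] (g \<oplus>[?F] h)"
        using c[OF f] c[OF g] c[OF h] by (simp add: free_module_simps(3) K.a_assoc)
    next
      show "\<zero>[?F] \<in> carrier ?F" by (simp add: free_module_simps)
      show "\<zero>[?F] \<oplus>[?F] f = f" if "f \<in> carrier ?F" for f
        using c[OF that] by (simp add: free_module_simps(2,3))
    qed
  next
    fix a b f g assume a: "a \<in> carrier K" and b: "b \<in> carrier K" and f: "f \<in> carrier ?F" and g: "g \<in> carrier ?F"
    show "a \<odot>[?F] f \<in> carrier ?F" using scale[OF f a] by (simp add: free_module_simps(4))
    show "(a \<oplus>[K] b) \<odot>[?F] f = a \<odot>[?F] f \<oplus>[?F] b \<odot>[?F] f"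
      using a b c[OF f] by (simp add: free_module_simps(3,4) K.l_distr)
    show "a \<odot>[?F] (f \<oplus>[?F] g) = a \<odot>[?F] f \<oplus>[?F] a \<odot>[?F] g"
      using a c[OF f] c[OF g] by (simp add: free_module_simps(3,4) K.r_distr)
    show "(a \<otimes>[K] b) \<odot>[?F] f = a \<odot>[?F] (b \<odot>[?F] f)"
      using a b c[OF f] by (simp add: free_module_simps(4) K.m_assoc)
  next
    show "\<one>[K] \<odot>[?F] f = f" if "f \<in> carrier ?F" for f
      using c[OF that] by (simp add: free_module_simps(4))
  qed (rule assms)
qed

lemma basis_vec_closed:
  assumes "cring K" "s \<in> S" shows "basis_vec K s \<in> carrier (free_module K S)"
proof -
  interpret K: cring K by fact
  have "{t. basis_vec K s t \<noteq> \<zero>[K]} \<subseteq> {s}" by (auto simp: basis_vec_def)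
  from finite_subset[OF this] show ?thesis using assms(2) by (auto simp: free_module_simps basis_vec_def)
qed

text \<open>Induction on a finite set containing the support, splitting off one coordinate at a
  time.\<close>

lemma free_module_spanned:
  assumes "cring K" "f \<in> carrier (free_module K S)"
  shows "f \<in> mspan K (free_module K S) (basis_vec K ` S)"
proof -
  interpret K: cring K by fact
  let ?F = "free_module K S"
  interpret F: module K ?F using free_module_module[OF assms(1)] .
  have sub: "basis_vec K ` S \<subseteq> carrier ?F" using basis_vec_closed[OF assms(1)] by auto
  note sm = submodule_mspan[OF F.module_axioms sub]
  have "f \<in> mspan K ?F (basis_vec K ` S)" if "finite T" "f \<in> carrier ?F" "{s. f s \<noteq> \<zero>[K]} \<subseteq> T" for f T
    using that
  proof (induction T arbitrary: f)
    case empty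
    then have "f = \<zero>[?F]" by (auto simp: free_module_simps)
    then show ?case using submodule_zero[OF sm] by simp
  next
    case (insert t T)
    show ?case
    proof (cases "t \<in> S")
      case True
      let ?g = "f(t := \<zero>[K])"
      have g: "?g \<in> carrier ?F" using insert.prems(1)
        by (auto simp: free_module_simps elim: rev_finite_subset)
      have fc: "f s \<in> carrier K" for s using insert.prems(1) by (auto simp: free_module_simps)
      have "f = ?g \<oplus>[?F] f t \<odot>[?F] basis_vec K t"
        using fc by (auto simp: free_module_simps basis_vec_def)
      moreover have "?g \<in> mspan K ?F (basis_vec K ` S)" using insert.prems(2) by (intro insert.IH g) auto
      moreover have "f t \<odot>[?F] basis_vec K t \<in> mspan K ?F (basis_vec K ` S)"
        using F.submoduleE(4)[OF sm fc] mspan_superset[OF F.module_axioms sub] True by blast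
      ultimately show ?thesis using F.submoduleE(5)[OF sm] by metis
    next
      case False
      then have "f t = \<zero>[K]" using insert.prems(1) by (auto simp: free_module_simps)
      then show ?thesis using insert.prems by (intro insert.IH) auto
    qed
  qed
  then show ?thesis using assms(2) by (auto simp: free_module_simps)
qed

lemma
  assumes "module K A" "g \<in> S \<rightarrow> carrier A"
  shows lin_ext_lin_map: "lin_map K (free_module K S) A (lin_ext K A g)"
    and lin_ext_basis_vec: "s \<in> S \<Longrightarrow> lin_ext K A g (basis_vec K s) = g s"
proof -
  interpret A: module K A by fact
  let ?F = "free_module K S"
  \<comment> \<open>The sum may run over any finite set between the support and \<open>S\<close>;
    two elements can then be summed over a common index set.\<close>
  have ext: "lin_ext K A g f = (\<Oplus>\<^bsub>A\<^esub>s\<in>T. f s \<odot>[A] g s)"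
    if "f \<in> carrier ?F" "finite T" "{s. f s \<noteq> \<zero>[K]} \<subseteq> T" "T \<subseteq> S" for f T
    unfolding lin_ext_def
    by (rule A.add.finprod_mono_neutral_cong_left) (use that assms(2) in \<open>auto simp: free_module_simps Pi_def\<close>)
  have fin: "finite {s. f s \<noteq> \<zero>[K]}" "{s. f s \<noteq> \<zero>[K]} \<subseteq> S" "f s \<in> carrier K" if "f \<in> carrier ?F" for f s
    using that by (auto simp: free_module_simps)
  interpret F: module K ?F using free_module_module[OF A.is_cring] .
  show "lin_map K ?F A (lin_ext K A g)"
  proof (rule lin_mapI)
    fix f assume f: "f \<in> carrier ?F"
    show "lin_ext K A g f \<in> carrier A" unfolding lin_ext_def
      by (rule A.finsum_closed) (use fin(2,3)[OF f] assms(2) in auto)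
    fix c assume c: "c \<in> carrier K"
    let ?T = "{s. f s \<noteq> \<zero>[K]}"
    have "lin_ext K A g (c \<odot>[?F] f) = (\<Oplus>\<^bsub>A\<^esub>s\<in>?T. (c \<otimes>[K] f s) \<odot>[A] g s)"
      using ext[of "c \<odot>[?F] f" ?T] fin[OF f] c F.smult_closed[OF c f]
      by (force simp: free_module_simps(2-))
    also have "\<dots> = (\<Oplus>\<^bsub>A\<^esub>s\<in>?T. c \<odot>[A] (f s \<odot>[A] g s))"
      by (rule A.finsum_cong') (use fin(2,3)[OF f] assms(2) c in \<open>auto simp: A.smult_assoc1 Pi_def\<close>)
    also have "\<dots> = c \<odot>[A] lin_ext K A g f" unfolding lin_ext_def
      by (rule A.finsum_smult_ldistr[symmetric]) (use fin[OF f] assms(2) c in auto)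
    finally show "lin_ext K A g (c \<odot>[?F] f) = c \<odot>[A] lin_ext K A g f" .
  next
    fix f h assume f: "f \<in> carrier ?F" and h: "h \<in> carrier ?F"
    let ?T = "{s. f s \<noteq> \<zero>[K]} \<union> {s. h s \<noteq> \<zero>[K]}"
    have T: "finite ?T" "?T \<subseteq> S" using fin[OF f] fin[OF h] by auto
    have "lin_ext K A g (f \<oplus>[?F] h) = (\<Oplus>\<^bsub>A\<^esub>s\<in>?T. (f s \<oplus>[K] h s) \<odot>[A] g s)"
    proof -
      have "{s. (f \<oplus>[?F] h) s \<noteq> \<zero>[K]} \<subseteq> ?T" using fin(3)[OF f] fin(3)[OF h] by (auto simp: free_module_simps(3))
      from ext[OF F.a_closed[OF f h] T(1) this T(2)] show ?thesis by (simp add: free_module_simps(3))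
    qed
    also have "\<dots> = (\<Oplus>\<^bsub>A\<^esub>s\<in>?T. f s \<odot>[A] g s \<oplus>[A] h s \<odot>[A] g s)"
      by (rule A.finsum_cong') (use fin(2,3)[OF f] fin(2,3)[OF h] assms(2) in \<open>auto simp: A.smult_l_distr Pi_def\<close>)
    also have "\<dots> = (\<Oplus>\<^bsub>A\<^esub>s\<in>?T. f s \<odot>[A] g s) \<oplus>[A] (\<Oplus>\<^bsub>A\<^esub>s\<in>?T. h s \<odot>[A] g s)"
      by (rule A.finsum_addf; intro Pi_I A.smult_closed) (use fin(2,3)[OF f] fin(2,3)[OF h] assms(2) in auto)
    also have "\<dots> = lin_ext K A g f \<oplus>[A] lin_ext K A g h"
      using ext[OF f T(1) _ T(2)] ext[OF h T(1) _ T(2)] by simp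
    finally show "lin_ext K A g (f \<oplus>[?F] h) = lin_ext K A g f \<oplus>[A] lin_ext K A g h" .
  qed
  show "lin_ext K A g (basis_vec K s) = g s" if s: "s \<in> S"
  proof -
    have gs: "g s \<in> carrier A" using s assms(2) by auto
    have "lin_ext K A g (basis_vec K s) = (\<Oplus>\<^bsub>A\<^esub>t\<in>{s}. basis_vec K s t \<odot>[A] g t)"
      by (rule ext) (use s basis_vec_closed[OF A.is_cring s] in \<open>auto simp: basis_vec_def\<close>)
    also have "\<dots> = g s" using gs by (simp add: basis_vec_def)
    finally show ?thesis .
  qed
qed

lemma lin_eq_on_mspan:
  assumes "module K A" "module K B" "lin_map K A B f" "lin_map K A B g" "S \<subseteq> carrier A"
    and "\<And>s. s \<in> S \<Longrightarrow> f s = g s" "x \<in> mspan K A S"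
  shows "f x = g x"
  using assms(1,5,7)
  by (induction rule: mspan_induct)
    (simp_all add: assms(6) lin_zero[OF assms(1,2)] assms(3,4) lin_add[OF assms(3)]
      lin_add[OF assms(4)] lin_smult[OF assms(3)] lin_smult[OF assms(4)])

lemma lin_eq_on_free:
  assumes "module K B" "lin_map K (free_module K S) B f" "lin_map K (free_module K S) B g"
    and "\<And>s. s \<in> S \<Longrightarrow> f (basis_vec K s) = g (basis_vec K s)" "x \<in> carrier (free_module K S)"
  shows "f x = g x"
proof -
  interpret B: module K B by fact
  show ?thesis
    by (rule lin_eq_on_mspan[OF free_module_module[OF B.is_cring] assms(1,2,3) _ _
        free_module_spanned[OF B.is_cring assms(5)]])
      (auto simp: assms(4) intro: basis_vec_closed[OF B.is_cring])
qed

text \<open>The universal property of the quotient in the form in which \<open>comp_lift\<close>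
  computes it: once \<open>f\<close> vanishes on \<open>H\<close>, the image of a coset under
  \<open>f\<close> is a singleton.\<close>

lemma
  assumes "module K A" "submodule H K A" "module K B" "lin_map K A B f" "\<And>h. h \<in> H \<Longrightarrow> f h = \<zero>[B]"
  shows the_elem_coset: "x \<in> carrier A \<Longrightarrow> the_elem (f ` (H +>[A] x)) = f x"
    and the_elem_lin_map: "lin_map K (quot_module A H) B (\<lambda>X. the_elem (f ` X))"
proof -
  interpret A: module K A by fact
  interpret B: module K B by fact
  have *: "the_elem (f ` (H +>[A] x)) = f x" if x: "x \<in> carrier A" for x
  proof -
    have "f y = f x" if "y \<in> H +>[A] x" for y
    proof -
      have y: "y \<in> carrier A" "y \<ominus>[A] x \<in> H"
        using mem_coset_iff[OF assms(1,2) x] coset_eq_iff[OF assms(1,2) _ x] that by auto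
      have "f y \<ominus>[B] f x = \<zero>[B]" using lin_minus[OF assms(1,3,4) y(1) x] assms(5)[OF y(2)] by simp
      then show ?thesis using lin_closed[OF assms(4)] x y(1)
        by (metis B.minus_eq B.a_inv_closed B.minus_equality B.minus_minus)
    qed
    then have "f ` (H +>[A] x) = {f x}" using coset_self[OF assms(1,2) x] by blast
    then show ?thesis by simp
  qed
  then show "x \<in> carrier A \<Longrightarrow> the_elem (f ` (H +>[A] x)) = f x" .
  note fc = lin_closed[OF assms(4)]
  show "lin_map K (quot_module A H) B (\<lambda>X. the_elem (f ` X))"
  proof (rule lin_mapI)
    fix X Y assume "X \<in> carrier (quot_module A H)" "Y \<in> carrier (quot_module A H)"
    then obtain x y where x: "x \<in> carrier A" "X = H +>[A] x" "y \<in> carrier A" "Y = H +>[A] y"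
      by (auto simp: quot_module_simps elim!: rcosetsE)
    then show "the_elem (f ` (X \<oplus>[quot_module A H] Y)) = the_elem (f ` X) \<oplus>[B] the_elem (f ` Y)"
      by (simp add: quot_module_simps(3) coset_add[OF assms(1,2)] * lin_add[OF assms(4)])
  next
    fix X assume "X \<in> carrier (quot_module A H)"
    then obtain x where x: "x \<in> carrier A" "X = H +>[A] x"
      by (auto simp: quot_module_simps elim!: rcosetsE)
    then show "the_elem (f ` X) \<in> carrier B" by (simp add: * fc)
    fix c assume c: "c \<in> carrier K"
    then show "the_elem (f ` (c \<odot>[quot_module A H] X)) = c \<odot>[B] the_elem (f ` X)"
      using x by (simp add: coset_smult[OF assms(1,2)] * lin_smult[OF assms(4)])
  qed
qed

lemma submodule_kernel:
  assumes "module K A" "module K B" "lin_map K A B f"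
  shows "submodule {x \<in> carrier A. f x = \<zero>[B]} K A"
proof -
  interpret A: module K A by fact
  interpret B: module K B by fact
  show ?thesis
    by (rule A.submoduleI) (auto simp: lin_zero[OF assms] lin_neg[OF assms] lin_add[OF assms(3)]
      lin_smult[OF assms(3)])
qed

lemma submodule_vimage:
  assumes "module K A" "module K B" "lin_map K A B f" "submodule H K B"
  shows "submodule {x \<in> carrier A. f x \<in> H} K A"
proof -
  interpret A: module K A by fact
  interpret B: module K B by fact
  show ?thesis
    by (rule A.submoduleI) (auto simp: lin_zero[OF assms(1-3)] lin_neg[OF assms(1-3)]
      lin_add[OF assms(3)] lin_smult[OF assms(3)] submodule_zero[OF assms(4)]
      B.submoduleE(3-5)[OF assms(4)])
qed

lemma submodule_image:
  assumes "module K A" "module K B" "lin_map K A B f"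
  shows "submodule (f ` carrier A) K B"
proof -
  interpret A: module K A by fact
  interpret B: module K B by fact
  note l = lin_zero[OF assms] lin_neg[OF assms] lin_add[OF assms(3)] lin_smult[OF assms(3)]
  show ?thesis
  proof (rule B.submoduleI)
    show "f ` carrier A \<subseteq> carrier B" using lin_closed[OF assms(3)] by (rule image_subsetI)
    show "\<zero>[B] \<in> f ` carrier A" using l(1) A.zero_closed by (metis imageI)
  qed (auto simp flip: l)
qed

section \<open>The composition product\<close>

definition in_val :: "'n inputs \<Rightarrow> nat \<Rightarrow> 'n" where
  "in_val ys i = snd (snd (ys ! i))"

definition set_val :: "'n inputs \<Rightarrow> nat \<Rightarrow> 'n \<Rightarrow> 'n inputs" where
  "set_val ys i v = ys[i := (in_block ys i, in_deg ys i, v)]"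

lemma length_set_val [simp]: "length (set_val ys i v) = length ys"
  by (simp add: set_val_def)

lemma in_block_set_val [simp]: "in_block (set_val ys i v) j = in_block ys j"
  by (cases "i < length ys") (auto simp: set_val_def in_block_def nth_list_update not_less list_update_beyond)

lemma in_deg_set_val [simp]: "in_deg (set_val ys i v) j = in_deg ys j"
  by (cases "i < length ys") (auto simp: set_val_def in_deg_def nth_list_update not_less list_update_beyond)

lemma in_val_set_val: "i < length ys \<Longrightarrow> in_val (set_val ys i v) j = (if j = i then v else in_val ys j)"
  by (auto simp: set_val_def in_val_def nth_list_update)

lemma tot_deg_set_val [simp]: "tot_deg (set_val ys i v) = tot_deg ys"
  by (simp add: tot_deg_def)

lemma inputs_eqI:
  assumes "length xs = length ys" "\<And>i. i < length ys \<Longrightarrow> in_block xs i = in_block ys i"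
    "\<And>i. i < length ys \<Longrightarrow> in_deg xs i = in_deg ys i" "\<And>i. i < length ys \<Longrightarrow> in_val xs i = in_val ys i"
  shows "xs = ys"
  using assms by (intro nth_equalityI) (auto simp: in_block_def in_deg_def in_val_def prod_eq_iff)

lemma set_val_same: "set_val ys i (in_val ys i) = ys"
  by (cases "i < length ys") (auto simp: set_val_def in_val_def in_block_def in_deg_def not_less list_update_beyond)

lemma set_val_set_val [simp]: "set_val (set_val ys i v) i w = set_val ys i w"
  by (cases "i < length ys") (auto simp: set_val_def in_block_def in_deg_def not_less list_update_beyond)

lemma nth_inputs: "ys ! i = (in_block ys i, in_deg ys i, in_val ys i)"
  by (simp add: in_block_def in_deg_def in_val_def)

lemma valid_inputs_iff:
  "valid_inputs N n ys \<longleftrightarrow>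
     (\<forall>i<length ys. \<forall>j<length ys. i \<noteq> j \<longrightarrow> in_block ys i \<inter> in_block ys j = {}) \<and>
     (\<Union>i<length ys. in_block ys i) = {..<n} \<and>
     (\<forall>i<length ys. in_val ys i \<in> elts N (card (in_block ys i)) (in_deg ys i))"
proof -
  have "(\<forall>(J, b, y)\<in>set ys. y \<in> elts N (card J) b) \<longleftrightarrow>
     (\<forall>i<length ys. in_val ys i \<in> elts N (card (in_block ys i)) (in_deg ys i))"
    by (auto simp: set_conv_nth nth_inputs)
  then show ?thesis by (simp add: valid_inputs_def)
qed

lemma valid_inputs_set_val:
  "valid_inputs N n ys \<Longrightarrow> i < length ys \<Longrightarrow> v \<in> elts N (card (in_block ys i)) (in_deg ys i) \<Longrightarrow>
    valid_inputs N n (set_val ys i v)"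
  by (simp add: valid_inputs_iff in_val_set_val)

lemma
  assumes "s permutes {..<length ys}" "i < length ys"
  shows in_block_permute: "in_block (permute_list s ys) i = in_block ys (s i)"
    and in_deg_permute: "in_deg (permute_list s ys) i = in_deg ys (s i)"
    and in_val_permute: "in_val (permute_list s ys) i = in_val ys (s i)"
  using assms by (simp_all add: in_block_def in_deg_def in_val_def permute_list_nth)

lemma permutes_lessThan: "s permutes {..<n::nat} \<Longrightarrow> s i < n \<longleftrightarrow> i < n"
  using permutes_in_image[of s "{..<n}" i] by simp

lemma tot_deg_permute: "s permutes {..<length ys} \<Longrightarrow> tot_deg (permute_list s ys) = tot_deg ys"
  using sum.permute[of s "{..<length ys}" "in_deg ys"] by (simp add: tot_deg_def in_deg_permute o_def)

lemma valid_inputs_permute: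
  assumes "valid_inputs N n ys" "s permutes {..<length ys}"
  shows "valid_inputs N n (permute_list s ys)"
proof -
  have inj: "s i \<noteq> s j" if "i \<noteq> j" for i j using that permutes_inj[OF assms(2)] by (auto dest: injD)
  have "(\<Union>i<length ys. in_block ys (s i)) = (\<Union>i\<in>s ` {..<length ys}. in_block ys i)" by auto
  also have "s ` {..<length ys} = {..<length ys}" by (rule permutes_image[OF assms(2)])
  finally show ?thesis using assms inj
    by (auto simp: valid_inputs_iff in_block_permute in_deg_permute in_val_permute permutes_lessThan)
qed

lemma in_split [simp]:
  "in_val (us @ (J, b, y) # zs) (length us) = y" "in_block (us @ (J, b, y) # zs) (length us) = J"
  "in_deg (us @ (J, b, y) # zs) (length us) = b"
  by (simp_all add: in_val_def in_block_def in_deg_def)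

lemma set_val_split [simp]: "set_val (us @ (J, b, y) # zs) (length us) v = us @ (J, b, v) # zs"
  by (simp add: set_val_def)

text \<open>Multilinearity is stated at a single generator because it will be required either at all
  generators or only at those whose blocks are sorted.\<close>

definition multilinear_at where
  "multilinear_at K M N B F a x ys \<longleftrightarrow>
     F (a, x, ys) \<in> carrier B \<and>
     (\<forall>x'\<in>elts M (length ys) a.
        F (a, x \<oplus>[dg_mod M (length ys) a] x', ys) = F (a, x, ys) \<oplus>[B] F (a, x', ys)) \<and>
     (\<forall>k\<in>carrier K. F (a, k \<odot>[dg_mod M (length ys) a] x, ys) = k \<odot>[B] F (a, x, ys)) \<and>
     (\<forall>i<length ys. \<forall>y\<in>elts N (card (in_block ys i)) (in_deg ys i).
        F (a, x, set_val ys i (in_val ys i \<oplus>[dg_mod N (card (in_block ys i)) (in_deg ys i)] y)) =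
        F (a, x, ys) \<oplus>[B] F (a, x, set_val ys i y)) \<and>
     (\<forall>i<length ys. \<forall>k\<in>carrier K.
        F (a, x, set_val ys i (k \<odot>[dg_mod N (card (in_block ys i)) (in_deg ys i)] in_val ys i)) =
        k \<odot>[B] F (a, x, ys))"

lemma multilinear_atD:
  assumes "multilinear_at K M N B F a x ys"
  shows "F (a, x, ys) \<in> carrier B"
    and "x' \<in> elts M (length ys) a \<Longrightarrow>
        F (a, x \<oplus>[dg_mod M (length ys) a] x', ys) = F (a, x, ys) \<oplus>[B] F (a, x', ys)"
    and "k \<in> carrier K \<Longrightarrow> F (a, k \<odot>[dg_mod M (length ys) a] x, ys) = k \<odot>[B] F (a, x, ys)"
    and "i < length ys \<Longrightarrow> y \<in> elts N (card (in_block ys i)) (in_deg ys i) \<Longrightarrow>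
        F (a, x, set_val ys i (in_val ys i \<oplus>[dg_mod N (card (in_block ys i)) (in_deg ys i)] y)) =
        F (a, x, ys) \<oplus>[B] F (a, x, set_val ys i y)"
    and "i < length ys \<Longrightarrow> k \<in> carrier K \<Longrightarrow>
        F (a, x, set_val ys i (k \<odot>[dg_mod N (card (in_block ys i)) (in_deg ys i)] in_val ys i)) =
        k \<odot>[B] F (a, x, ys)"
  using assms by (simp_all add: multilinear_at_def)

text \<open>Families of values on generators that factor through the composition product.\<close>

definition balanced where
  "balanced K M N n d B F \<longleftrightarrow> (\<forall>a x ys. (a, x, ys) \<in> gens M N n d \<longrightarrow> multilinear_at K M N B F a x ys \<and>
     (\<forall>s. s permutes {..<length ys} \<longrightarrow>
        F (a, dg_act M (length ys) a s x, ys) = perm_sign K s ys \<odot>[B] F (a, x, permute_list s ys)))"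

lemma
  assumes "balanced K M N n d B F" "(a, x, ys) \<in> gens M N n d"
  shows balanced_multilinear: "multilinear_at K M N B F a x ys"
    and balanced_perm: "s permutes {..<length ys} \<Longrightarrow>
        F (a, dg_act M (length ys) a s x, ys) = perm_sign K s ys \<odot>[B] F (a, x, permute_list s ys)"
  using assms by (simp_all add: balanced_def)

lemmas balancedD = multilinear_atD[OF balanced_multilinear] balanced_perm

lemma ksign_closed: "cring K \<Longrightarrow> ksign K e \<in> carrier K"
proof -
  assume "cring K" then interpret K: cring K .
  show ?thesis by (simp add: ksign_def)
qed

lemma perm_sign_cong:
  assumes "length xs = length ys" "\<And>i. i < length ys \<Longrightarrow> in_deg xs i = in_deg ys i" "s permutes {..<length ys}"
  shows "perm_sign K s xs = perm_sign K s ys"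
proof -
  have "in_deg xs (s k) = in_deg ys (s k)" if "k < length ys" for k
    using assms(2)[of "s k"] permutes_lessThan[OF assms(3), of k] that by simp
  then show ?thesis unfolding perm_sign_def
    by (intro arg_cong[where f = "ksign K"] sum.cong) (simp_all add: assms(1) split: prod.splits)
qed

lemma
  fixes g :: "nat \<Rightarrow> int \<Rightarrow> 'n \<Rightarrow> 'n1"
  defines "m \<equiv> map (\<lambda>(J, b, y). (J, b, g (card J) b y))"
  assumes "i < length ys"
  shows in_block_map: "in_block (m ys) i = in_block ys i" and in_deg_map: "in_deg (m ys) i = in_deg ys i"
    and in_val_map: "in_val (m ys) i = g (card (in_block ys i)) (in_deg ys i) (in_val ys i)"
  using assms by (simp_all add: in_block_def in_deg_def in_val_def case_prod_unfold)

locale comp_product =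
  fixes K :: "('k, 'c) ring_scheme" and M :: "('k, 'm, 'x) dg_seq_scheme" and N :: "('k, 'n, 'y) dg_seq_scheme"
  assumes K: "cring K" and M: "dg_sigma_module K M" and N: "dg_sigma_module K N"
begin

sublocale K: cring K by (rule K)

abbreviation "A n d \<equiv> dg_mod (comp_prod K M N) n d"
abbreviation (input) "cA n d \<equiv> carrier (dg_mod (comp_prod K M N) n d)"
abbreviation "C n d g \<equiv> cls K M N n d g"
abbreviation "Fr n d \<equiv> free_gens K M N n d"

lemma A_def: "A n d = quot_module (Fr n d) (comp_rels K M N n d)"
  by (simp add: comp_prod_def)

lemma module_M: "module K (dg_mod M r d)" and module_N: "module K (dg_mod N r d)"
  using M N by (auto simp: dg_sigma_module_def)

sublocale M: module K "dg_mod M r d" for r d by (rule module_M)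
sublocale N: module K "dg_mod N r d" for r d by (rule module_N)

lemma act_M: "s permutes {..<r} \<Longrightarrow> lin_map K (dg_mod M r d) (dg_mod M r d) (dg_act M r d s)"
  using M by (auto simp: dg_sigma_module_def)

lemma gensD:
  assumes "(a, x, ys) \<in> gens M N n d"
  shows "x \<in> elts M (length ys) a" "valid_inputs N n ys" "a + tot_deg ys = d"
    and "i < length ys \<Longrightarrow> in_val ys i \<in> elts N (card (in_block ys i)) (in_deg ys i)"
  using assms by (auto simp: gens_def valid_inputs_iff)

lemma gens_root: "(a, x, ys) \<in> gens M N n d \<Longrightarrow> x' \<in> elts M (length ys) a \<Longrightarrow>
    (a, x', ys) \<in> gens M N n d"
  by (auto simp: gens_def)

lemma gens_add_root: "(a, x, ys) \<in> gens M N n d \<Longrightarrow> (a, x', ys) \<in> gens M N n d \<Longrightarrow>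
    (a, x \<oplus>[dg_mod M (length ys) a] x', ys) \<in> gens M N n d"
  using gens_root M.a_closed gensD(1) by metis

lemma gens_smult_root: "(a, x, ys) \<in> gens M N n d \<Longrightarrow> k \<in> carrier K \<Longrightarrow>
    (a, k \<odot>[dg_mod M (length ys) a] x, ys) \<in> gens M N n d"
  using gens_root M.smult_closed gensD(1) by metis

lemma gens_act_root: "(a, x, ys) \<in> gens M N n d \<Longrightarrow> s permutes {..<length ys} \<Longrightarrow>
    (a, dg_act M (length ys) a s x, ys) \<in> gens M N n d"
  using gens_root lin_closed[OF act_M] gensD(1) by metis

lemma gens_set_val: "(a, x, ys) \<in> gens M N n d \<Longrightarrow> i < length ys \<Longrightarrow>
    v \<in> elts N (card (in_block ys i)) (in_deg ys i) \<Longrightarrow> (a, x, set_val ys i v) \<in> gens M N n d"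
  by (auto simp: gens_def valid_inputs_set_val)

lemma gens_permute: "(a, x, ys) \<in> gens M N n d \<Longrightarrow> s permutes {..<length ys} \<Longrightarrow>
    (a, x, permute_list s ys) \<in> gens M N n d"
  by (auto simp: gens_def valid_inputs_permute tot_deg_permute)

lemma basis_in: "g \<in> gens M N n d \<Longrightarrow> basis_vec K g \<in> carrier (Fr n d)"
  by (rule basis_vec_closed[OF K])

sublocale F: module K "Fr n d" for n d by (rule free_module_module[OF K])

lemma comp_rel_closed:
  assumes "comp_rel K M N n d f g"
  shows "f \<in> carrier (Fr n d) \<and> g \<in> carrier (Fr n d)"
  using assms
proof cases
  case (add_root a x ys x')
  show ?thesis unfolding add_root(1,2)
    using basis_in[OF gens_add_root[OF add_root(3,4)]] basis_in[OF add_root(3)] basis_in[OF add_root(4)] by simp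
next
  case (smult_root a x ys k)
  show ?thesis unfolding smult_root(1,2)
    using basis_in[OF gens_smult_root[OF smult_root(3,4)]] basis_in[OF smult_root(3)] smult_root(4) by simp
next
  case (add_input a x ys J b y zs y')
  have "y \<in> elts N (card J) b" "y' \<in> elts N (card J) b"
    using gensD(4)[OF add_input(3), of "length ys"] gensD(4)[OF add_input(4), of "length ys"]
    by simp_all
  then have "(a, x, ys @ (J, b, y \<oplus>[dg_mod N (card J) b] y') # zs) \<in> gens M N n d"
    using gens_set_val[OF add_input(3), of "length ys"] by simp
  from basis_in[OF this] show ?thesis unfolding add_input(1,2)
    using basis_in[OF add_input(3)] basis_in[OF add_input(4)] by simp
next
  case (smult_input a x ys J b y zs k)
  have "y \<in> elts N (card J) b"
    using gensD(4)[OF smult_input(3), of "length ys"] by simp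
  then have "(a, x, ys @ (J, b, k \<odot>[dg_mod N (card J) b] y) # zs) \<in> gens M N n d"
    using gens_set_val[OF smult_input(3), of "length ys"] smult_input(4) by simp
  from basis_in[OF this] show ?thesis unfolding smult_input(1,2)
    using basis_in[OF smult_input(3)] smult_input(4) by simp
next
  case (coinvariant a x ys s)
  show ?thesis unfolding coinvariant(1,2)
    using basis_in[OF gens_act_root[OF coinvariant(3,4)]] basis_in[OF gens_permute[OF coinvariant(3,4)]]
    by (simp add: perm_sign_def ksign_closed[OF K])
qed

lemma rels_subset: "{f \<ominus>[Fr n d] g |f g. comp_rel K M N n d f g} \<subseteq> carrier (Fr n d)"
  by (rule subsetI, elim CollectE exE conjE) (use comp_rel_closed in simp)

lemma submodule_rels: "submodule (comp_rels K M N n d) K (Fr n d)"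
  unfolding comp_rels_def by (rule submodule_mspan[OF F.module_axioms rels_subset])

lemma module_A: "module K (A n d)"
  unfolding A_def by (rule quot_module_module[OF F.module_axioms submodule_rels])

sublocale A: module K "A n d" for n d by (rule module_A)

lemma rel_in: "comp_rel K M N n d f g \<Longrightarrow> f \<ominus>[Fr n d] g \<in> comp_rels K M N n d"
  unfolding comp_rels_def by (rule subsetD[OF mspan_superset[OF F.module_axioms rels_subset]]) blast

lemma coset_rel: "comp_rel K M N n d f g \<Longrightarrow>
    comp_rels K M N n d +>[Fr n d] f = comp_rels K M N n d +>[Fr n d] g"
  by (rule iffD2[OF coset_eq_iff[OF F.module_axioms submodule_rels] rel_in])
    (use comp_rel_closed[of n d f g] in simp_all)

lemma coset_lin: "lin_map K (Fr n d) (A n d) (\<lambda>f. comp_rels K M N n d +>[Fr n d] f)"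
  unfolding A_def by (rule coset_lin_map[OF F.module_axioms submodule_rels])

lemma cls_closed [simp]: "g \<in> gens M N n d \<Longrightarrow> C n d g \<in> cA n d"
  unfolding cls_def by (rule lin_closed[OF coset_lin basis_in])

lemma balanced_cls: "balanced K M N n d (A n d) (C n d)"
  unfolding balanced_def multilinear_at_def
proof (intro allI impI conjI ballI)
  fix a x ys assume g: "(a, x, ys) \<in> gens M N n d"
  show "C n d (a, x, ys) \<in> cA n d" using g by simp
  show "C n d (a, x \<oplus>[dg_mod M (length ys) a] x', ys) = C n d (a, x, ys) \<oplus>[A n d] C n d (a, x', ys)"
    if x': "x' \<in> elts M (length ys) a" for x'
    using coset_rel[OF comp_rel.add_root[OF g gens_root[OF g x']]]
      lin_add[OF coset_lin basis_in[OF g] basis_in[OF gens_root[OF g x']]]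
    unfolding cls_def by simp
  show "C n d (a, k \<odot>[dg_mod M (length ys) a] x, ys) = k \<odot>[A n d] C n d (a, x, ys)" if k: "k \<in> carrier K" for k
    using coset_rel[OF comp_rel.smult_root[OF g k]] lin_smult[OF coset_lin k basis_in[OF g]]
    unfolding cls_def by simp
  show "C n d (a, dg_act M (length ys) a s x, ys) = perm_sign K s ys \<odot>[A n d] C n d (a, x, permute_list s ys)"
    if s: "s permutes {..<length ys}" for s
    using coset_rel[OF comp_rel.coinvariant[OF g s]]
      lin_smult[OF coset_lin ksign_closed[OF K] basis_in[OF gens_permute[OF g s]]]
    unfolding cls_def perm_sign_def by simp
  fix i assume i: "i < length ys"
  let ?B = "dg_mod N (card (in_block ys i)) (in_deg ys i)"
  \<comment> \<open>The relations change an entry at a split of the list,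
    \<open>multilinear_at\<close> an entry at a position.\<close>
  obtain us J b y zs where ys: "ys = us @ (J, b, y) # zs" "i = length us"
    using id_take_nth_drop[OF i] i that[of "take i ys" _ _ _ "drop (Suc i) ys"]
    by (cases "ys ! i") (simp add: min_def)
  have B: "?B = dg_mod N (card J) b" "in_val ys i = y" using ys by simp_all
  have sv: "set_val ys i v = us @ (J, b, v) # zs" for v by (simp add: ys)
  show "C n d (a, x, set_val ys i (in_val ys i \<oplus>[?B] y')) = C n d (a, x, ys) \<oplus>[A n d] C n d (a, x, set_val ys i y')"
    if y': "y' \<in> carrier ?B" for y'
  proof -
    have g': "(a, x, us @ (J, b, y') # zs) \<in> gens M N n d" using gens_set_val[OF g i y'] by (simp add: sv)
    show ?thesis
      using coset_rel[OF comp_rel.add_input[OF g[unfolded ys] g']]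
        lin_add[OF coset_lin basis_in[OF g[unfolded ys]] basis_in[OF g']]
      unfolding cls_def sv B by (simp add: ys)
  qed
  show "C n d (a, x, set_val ys i (k \<odot>[?B] in_val ys i)) = k \<odot>[A n d] C n d (a, x, ys)" if k: "k \<in> carrier K" for k
    using coset_rel[OF comp_rel.smult_input[OF g[unfolded ys] k]]
      lin_smult[OF coset_lin k basis_in[OF g[unfolded ys]]]
    unfolding cls_def sv B by (simp add: ys)
qed

lemmas cls_add_root = balancedD(2)[OF balanced_cls]
lemmas cls_smult_root = balancedD(3)[OF balanced_cls]
lemmas cls_add_input = balancedD(4)[OF balanced_cls]
lemmas cls_smult_input = balancedD(5)[OF balanced_cls]
lemmas cls_coinvariant = balancedD(6)[OF balanced_cls]

lemma balanced_kills_rels: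
  assumes "module K B" "balanced K M N n d B F" "f \<in> comp_rels K M N n d"
  shows "lin_ext K B F f = \<zero>[B]"
proof -
  interpret B: module K B by fact
  note bD = balancedD[OF assms(2)]
  have F: "F \<in> gens M N n d \<rightarrow> carrier B" using bD(1) by auto
  note T = lin_ext_lin_map[OF assms(1) F] and Tb = lin_ext_basis_vec[OF assms(1) F]
  have eq: "lin_ext K B F f = lin_ext K B F g" if "comp_rel K M N n d f g" for f g
    using that
  proof cases
    case (add_root a x ys x')
    have "(a, x \<oplus>[dg_mod M (length ys) a] x', ys) \<in> gens M N n d"
      by (rule gens_add_root[OF add_root(3,4)])
    then show ?thesis using add_root
      by (simp add: Tb lin_add[OF T basis_in basis_in] bD(2)[OF add_root(3) gensD(1)[OF add_root(4)]])
  next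
    case (smult_root a x ys k)
    have "(a, k \<odot>[dg_mod M (length ys) a] x, ys) \<in> gens M N n d"
      by (rule gens_smult_root[OF smult_root(3,4)])
    then show ?thesis using smult_root
      by (simp add: Tb lin_smult[OF T _ basis_in] bD(3)[OF smult_root(3)])
  next
    case (add_input a x ys J b y zs y')
    have y': "y' \<in> elts N (card J) b" "y \<in> elts N (card J) b"
      using gensD(4)[OF add_input(4), of "length ys"] gensD(4)[OF add_input(3), of "length ys"]
      by simp_all
    have g: "(a, x, ys @ (J, b, y \<oplus>[dg_mod N (card J) b] y') # zs) \<in> gens M N n d"
      using gens_set_val[OF add_input(3), of "length ys"] y' by simp
    have "F (a, x, ys @ (J, b, y \<oplus>[dg_mod N (card J) b] y') # zs) =
      F (a, x, ys @ (J, b, y) # zs) \<oplus>[B] F (a, x, ys @ (J, b, y') # zs)"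
      using bD(4)[OF add_input(3), of "length ys" y'] y' by simp
    then show ?thesis using add_input g by (simp add: Tb lin_add[OF T basis_in basis_in])
  next
    case (smult_input a x ys J b y zs k)
    have y': "y \<in> elts N (card J) b"
      using gensD(4)[OF smult_input(3), of "length ys"] by simp_all
    have g: "(a, x, ys @ (J, b, k \<odot>[dg_mod N (card J) b] y) # zs) \<in> gens M N n d"
      using gens_set_val[OF smult_input(3), of "length ys"] y' smult_input(4) by simp
    have "F (a, x, ys @ (J, b, k \<odot>[dg_mod N (card J) b] y) # zs) = k \<odot>[B] F (a, x, ys @ (J, b, y) # zs)"
      using bD(5)[OF smult_input(3), of "length ys" k] smult_input(4) by simp
    then show ?thesis using smult_input g by (simp add: Tb lin_smult[OF T _ basis_in])
  next
    case (coinvariant a x ys s)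
    have "(a, dg_act M (length ys) a s x, ys) \<in> gens M N n d"
      by (rule gens_act_root[OF coinvariant(3,4)])
    moreover have "perm_sign K s ys \<in> carrier K" by (simp add: perm_sign_def ksign_closed[OF K])
    ultimately show ?thesis using coinvariant gens_permute[OF coinvariant(3,4)]
      by (simp add: Tb lin_smult[OF T _ basis_in] bD(6)[OF coinvariant(3)])
  qed
  have "comp_rels K M N n d \<subseteq> {f \<in> carrier (Fr n d). lin_ext K B F f = \<zero>[B]}"
    unfolding comp_rels_def
  proof (rule mspan_least[OF submodule_kernel[OF F.module_axioms assms(1) T]], safe)
    fix f g assume fg: "comp_rel K M N n d f g"
    note c = comp_rel_closed[OF fg]
    then show "f \<ominus>[Fr n d] g \<in> carrier (Fr n d)" by simp
    have "lin_ext K B F f \<in> carrier B" using lin_closed[OF T] c by auto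
    then show "lin_ext K B F (f \<ominus>[Fr n d] g) = \<zero>[B]"
      using lin_minus[OF F.module_axioms assms(1) T] c eq[OF fg] by (simp add: B.minus_eq B.r_neg)
  qed
  then show ?thesis using assms(3) by auto
qed

text \<open>The universal property of \<open>M \<circ> N\<close>. The right unitor uses it directly;
  all maps defined entry by entry use it through \<open>sorted_lift\<close>.\<close>

lemma
  assumes "module K B" "balanced K M N n d B F"
  shows comp_lift_lin_map: "lin_map K (A n d) B (comp_lift K B F)"
    and comp_lift_cls: "g \<in> gens M N n d \<Longrightarrow> comp_lift K B F (C n d g) = F g"
proof -
  have F: "F \<in> gens M N n d \<rightarrow> carrier B" using balancedD(1)[OF assms(2)] by auto
  note T = lin_ext_lin_map[OF assms(1) F] and Tb = lin_ext_basis_vec[OF assms(1) F]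
  show "lin_map K (A n d) B (comp_lift K B F)"
    unfolding A_def comp_lift_def[abs_def]
    by (rule the_elem_lin_map[OF F.module_axioms submodule_rels assms(1) T balanced_kills_rels[OF assms]])
  show "comp_lift K B F (C n d g) = F g" if "g \<in> gens M N n d"
    unfolding comp_lift_def cls_def
    using the_elem_coset[OF F.module_axioms submodule_rels assms(1) T balanced_kills_rels[OF assms] basis_in[OF that]]
      Tb[OF that] by simp
qed

lemma A_spanned: "X \<in> cA n d \<Longrightarrow> X \<in> mspan K (A n d) (C n d ` gens M N n d)"
proof -
  assume "X \<in> cA n d"
  then obtain f where f: "f \<in> carrier (Fr n d)" "X = comp_rels K M N n d +>[Fr n d] f"
    unfolding A_def by (auto simp: quot_module_simps elim: rcosetsE)
  have c: "C n d ` gens M N n d \<subseteq> cA n d" by auto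
  note sm = submodule_vimage[OF F.module_axioms module_A coset_lin submodule_mspan[OF module_A c]]
  have "f \<in> {f \<in> carrier (Fr n d). comp_rels K M N n d +>[Fr n d] f \<in> mspan K (A n d) (C n d ` gens M N n d)}"
    using mspan_least[OF sm, of "basis_vec K ` gens M N n d"] free_module_spanned[OF K f(1)]
      mspan_superset[OF module_A c] basis_in by (force simp: cls_def)
  then show ?thesis using f by simp
qed

lemma cls_zero_input:
  assumes "(a, x, ys) \<in> gens M N n d" "i < length ys"
    and "in_val ys i = \<zero>[dg_mod N (card (in_block ys i)) (in_deg ys i)]"
  shows "C n d (a, x, ys) = \<zero>[A n d]"
proof -
  have "set_val ys i (\<zero>[K] \<odot>[dg_mod N (card (in_block ys i)) (in_deg ys i)] in_val ys i) = ys"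
    using set_val_same[of ys i] assms by simp
  then show ?thesis using cls_smult_input[OF assms(1,2) K.zero_closed] assms(1) by simp
qed

lemma cls_zero_root:
  assumes "(a, \<zero>[dg_mod M (length ys) a], ys) \<in> gens M N n d"
  shows "C n d (a, \<zero>[dg_mod M (length ys) a], ys) = \<zero>[A n d]"
  using cls_smult_root[OF assms K.zero_closed] assms by simp

lemma basis_vec_in_cls: "g \<in> gens M N n d \<Longrightarrow> basis_vec K g \<in> C n d g"
  unfolding cls_def by (rule coset_self[OF F.module_axioms submodule_rels basis_in])

end

text \<open>\<open>comp_map\<close> is defined on cosets, so it has to be shown that relations go to
  relations. The family of classes of the image generators is balanced, hence its linear extension
  kills the relations; modulo the relations of the target it agrees with the extension by basis
  vectors that \<open>comp_map\<close> uses.\<close>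

lemma comp_map_props:
  assumes "comp_product K M N" "comp_product K M' N'"
    and f: "\<And>r d. lin_map K (dg_mod M r d) (dg_mod M' r d) (f r d)"
    and equiv: "\<And>r d s x. s permutes {..<r} \<Longrightarrow> x \<in> elts M r d \<Longrightarrow>
      f r d (dg_act M r d s x) = dg_act M' r d s (f r d x)"
    and g: "\<And>r d. lin_map K (dg_mod N r d) (dg_mod N' r d) (g r d)"
  shows "lin_map K (dg_mod (comp_prod K M N) n d) (dg_mod (comp_prod K M' N') n d) (comp_map K M' N' f g n d)"
    and "(a, x, ys) \<in> gens M N n d \<Longrightarrow> comp_map K M' N' f g n d (cls K M N n d (a, x, ys)) =
      cls K M' N' n d (a, f (length ys) a x, map (\<lambda>(J, b, y). (J, b, g (card J) b y)) ys)"
    and "(a, x, ys) \<in> gens M N n d \<Longrightarrow>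
      (a, f (length ys) a x, map (\<lambda>(J, b, y). (J, b, g (card J) b y)) ys) \<in> gens M' N' n d"
proof -
  interpret S: comp_product K M N by fact
  interpret T: comp_product K M' N' by fact
  let ?m = "map (\<lambda>(J, b, y). (J, b, g (card J) b y))"
  let ?G = "\<lambda>(a, x, ys). (a, f (length ys) a x, ?m ys)"
  note m = in_block_map[where g = g] in_deg_map[where g = g] in_val_map[where g = g]
  have td: "tot_deg (?m ys) = tot_deg ys" for ys by (simp add: tot_deg_def m)
  have ps: "perm_sign K s (?m ys) = perm_sign K s ys" if "s permutes {..<length ys}" for s ys
    by (rule perm_sign_cong) (simp_all add: m that)
  have G: "?G h \<in> gens M' N' n d" if "h \<in> gens M N n d" for h
  proof -
    obtain a x ys where h: "h = (a, x, ys)" by (cases h)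
    note gD = S.gensD[OF that[unfolded h]]
    have "valid_inputs N' n (?m ys)" using gD(2) by (simp add: valid_inputs_iff m lin_closed[OF g])
    then show ?thesis using gD by (simp add: h gens_def td lin_closed[OF f])
  qed
  show "(a, x, ys) \<in> gens M N n d \<Longrightarrow> (a, f (length ys) a x, ?m ys) \<in> gens M' N' n d"
    using G[of "(a, x, ys)"] by simp
  have sv: "?m (set_val ys i v) = set_val (?m ys) i (g (card (in_block ys i)) (in_deg ys i) v)"
    if "i < length ys" for ys i v
    using that by (intro inputs_eqI) (simp_all add: m in_val_set_val)
  let ?F = "\<lambda>h. cls K M' N' n d (?G h)"
  have bal: "balanced K M N n d (T.A n d) ?F"
    unfolding balanced_def multilinear_at_def
  proof (intro allI impI conjI ballI)
    fix a x ys assume h: "(a, x, ys) \<in> gens M N n d"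
    note gD = S.gensD[OF h]
    have h': "(a, f (length ys) a x, ?m ys) \<in> gens M' N' n d" using G[OF h] by simp
    show "?F (a, x, ys) \<in> T.cA n d" using T.cls_closed[OF h'] by simp
    show "?F (a, x \<oplus>[dg_mod M (length ys) a] x', ys) = ?F (a, x, ys) \<oplus>[T.A n d] ?F (a, x', ys)"
      if "x' \<in> elts M (length ys) a" for x'
      using T.cls_add_root[OF h'] lin_closed[OF f that] by (simp add: lin_add[OF f gD(1) that])
    show "?F (a, k \<odot>[dg_mod M (length ys) a] x, ys) = k \<odot>[T.A n d] ?F (a, x, ys)" if "k \<in> carrier K" for k
      using T.cls_smult_root[OF h' that] by (simp add: lin_smult[OF f that gD(1)])
    show "?F (a, dg_act M (length ys) a s x, ys) = perm_sign K s ys \<odot>[T.A n d] ?F (a, x, permute_list s ys)"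
      if s: "s permutes {..<length ys}" for s
      using T.cls_coinvariant[OF h'] s by (simp add: equiv[OF s gD(1)] ps permute_list_map)
    fix i assume i: "i < length ys"
    note gl = g[of "card (in_block ys i)" "in_deg ys i"]
    show "?F (a, x, set_val ys i (in_val ys i \<oplus>[dg_mod N (card (in_block ys i)) (in_deg ys i)] y)) =
        ?F (a, x, ys) \<oplus>[T.A n d] ?F (a, x, set_val ys i y)"
      if "y \<in> elts N (card (in_block ys i)) (in_deg ys i)" for y
      using T.cls_add_input[OF h', of i] i lin_closed[OF gl that]
      by (simp add: sv[OF i] lin_add[OF gl gD(4)[OF i] that] m[OF i])
    show "?F (a, x, set_val ys i (k \<odot>[dg_mod N (card (in_block ys i)) (in_deg ys i)] in_val ys i)) =
        k \<odot>[T.A n d] ?F (a, x, ys)" if "k \<in> carrier K" for k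
      using T.cls_smult_input[OF h', of i k] i that
      by (simp add: sv[OF i] lin_smult[OF gl that gD(4)[OF i]] m[OF i])
  qed
  let ?B = "\<lambda>h. basis_vec K (?G h)"
  have Bc: "?B \<in> gens M N n d \<rightarrow> carrier (T.Fr n d)" by (rule Pi_I) (rule T.basis_in[OF G])
  have Fc: "?F \<in> gens M N n d \<rightarrow> T.cA n d" by (rule Pi_I) (rule T.cls_closed[OF G])
  note L = lin_ext_lin_map[OF T.F.module_axioms Bc] and Lb = lin_ext_basis_vec[OF T.F.module_axioms Bc]
  have Leq: "comp_rels K M' N' n d +>[T.Fr n d] lin_ext K (T.Fr n d) ?B x = lin_ext K (T.A n d) ?F x"
    if "x \<in> carrier (S.Fr n d)" for x
    by (rule lin_eq_on_free[OF T.module_A lin_comp[OF L T.coset_lin] lin_ext_lin_map[OF T.module_A Fc] _ that])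
      (use Lb lin_ext_basis_vec[OF T.module_A Fc] in \<open>auto simp: cls_def\<close>)
  have kill: "lin_ext K (T.Fr n d) ?B x \<in> comp_rels K M' N' n d" if x: "x \<in> comp_rels K M N n d" for x
  proof -
    have xc: "x \<in> carrier (S.Fr n d)" by (rule subsetD[OF S.F.submoduleE(1)[OF S.submodule_rels] x])
    have "comp_rels K M' N' n d +>[T.Fr n d] lin_ext K (T.Fr n d) ?B x = comp_rels K M' N' n d"
      using Leq[OF xc] S.balanced_kills_rels[OF T.module_A bal x] by (simp add: T.A_def quot_module_simps)
    then show ?thesis using coset_self[OF T.F.module_axioms T.submodule_rels lin_closed[OF L xc]] by simp
  qed
  have cm: "comp_map K M' N' f g n d = quot_map (T.Fr n d) (comp_rels K M' N' n d) (lin_ext K (T.Fr n d) ?B)"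
    by (simp add: comp_map_def case_prod_unfold)
  show "lin_map K (S.A n d) (T.A n d) (comp_map K M' N' f g n d)"
    unfolding cm S.A_def T.A_def
    by (rule quot_map_lin_map[OF S.F.module_axioms S.submodule_rels T.F.module_axioms T.submodule_rels L kill])
  show "comp_map K M' N' f g n d (cls K M N n d (a, x, ys)) = cls K M' N' n d (a, f (length ys) a x, ?m ys)"
    if "(a, x, ys) \<in> gens M N n d"
    unfolding cm
    using quot_map_coset[OF S.F.module_axioms S.submodule_rels T.F.module_axioms T.submodule_rels L kill
        S.basis_in[OF that]] Lb[OF that] by (simp add: cls_def)
qed

section \<open>Sorting the blocks\<close>

lemma ksign_add:
  assumes "cring K" shows "ksign K (a + b) = ksign K a \<otimes>[K] ksign K b"
proof -
  interpret K: cring K by fact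
  show ?thesis by (simp add: ksign_def K.l_minus K.r_minus)
qed

lemma ksign_cong: "even (a - b) \<Longrightarrow> ksign K a = ksign K b"
  by (simp add: ksign_def)

text \<open>An unordered pair of positions is inverted by \<open>t \<circ> s\<close> iff it is
  inverted by exactly one of \<open>s\<close> and, after moving it by \<open>s\<close>,
  \<open>t\<close>. Reindexing the sum of \<open>t\<close> along the bijection of pairs induced by
  \<open>s\<close> makes all three sums run over the same pairs, and each pair contributes an even
  number.\<close>

lemma inversions_compose:
  fixes c :: "nat \<Rightarrow> int"
  assumes t: "t permutes {..<r}" and s: "s permutes {..<r}"
  defines "e \<equiv> \<lambda>t c. \<Sum>(i, j)\<in>{(i, j). i < j \<and> j < r \<and> t j < t i}. c (t i) * c (t j) :: int"
  shows "even (e t c + e s (c \<circ> t) - e (t \<circ> s) c)"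
proof -
  let ?P = "{(i, j). i < j \<and> j < r}"
  have fin: "finite ?P" by (rule finite_subset[of _ "{..<r} \<times> {..<r}"]) auto
  have e: "e u w = (\<Sum>(i, j)\<in>?P. if u j < u i then w (u i) * w (u j) else 0)" for u w
    unfolding e_def by (rule sum.mono_neutral_cong_left[OF fin]) (auto split: if_splits)
  define g where "g = (\<lambda>(i, j). if t j < t i then c (t i) * c (t j) else 0)"
  define \<sigma> where "\<sigma> = (\<lambda>(i, j). if s i < s j then (s i, s j) else (s j, s i))"
  have si: "s i = s j \<longleftrightarrow> i = j" for i j using permutes_inj[OF s] by (auto dest: injD)
  have ti: "t i = t j \<longleftrightarrow> i = j" for i j using permutes_inj[OF t] by (auto dest: injD)
  have "\<sigma> ` ?P \<subseteq> ?P"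
  proof
    fix p assume "p \<in> \<sigma> ` ?P"
    then obtain i j where ij: "i < j" "j < r" "p = \<sigma> (i, j)" by auto
    then have "s i \<noteq> s j" "s i < r" "s j < r" using si permutes_lessThan[OF s] by auto
    then show "p \<in> ?P" using ij(3) by (auto simp: \<sigma>_def)
  qed
  moreover have inj: "inj_on \<sigma> ?P"
    by (rule inj_onI) (auto simp: \<sigma>_def si split: if_splits)
  ultimately have "bij_betw \<sigma> ?P ?P" using endo_inj_surj[OF fin] by (auto simp: bij_betw_def)
  then have "e t c = (\<Sum>p\<in>?P. g (\<sigma> p))"
    using sum.reindex_bij_betw[of \<sigma> ?P ?P g] by (simp add: e g_def)
  then have "e t c + e s (c \<circ> t) - e (t \<circ> s) c =
     (\<Sum>p\<in>?P. g (\<sigma> p) + (case p of (i, j) \<Rightarrow> if s j < s i then c (t (s i)) * c (t (s j)) else 0)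
        - (case p of (i, j) \<Rightarrow> if t (s j) < t (s i) then c (t (s i)) * c (t (s j)) else 0))"
    by (simp add: e sum.distrib sum_subtractf case_prod_unfold o_def)
  also have "even \<dots>"
  proof (rule dvd_sum, clarify)
    fix i j :: nat assume ij: "i < j" "j < r"
    then have "s i \<noteq> s j" "t (s i) \<noteq> t (s j)" by (simp_all add: si ti)
    then show "even (g (\<sigma> (i, j)) + (if s j < s i then c (t (s i)) * c (t (s j)) else 0)
        - (if t (s j) < t (s i) then c (t (s i)) * c (t (s j)) else 0))"
      by (auto simp: g_def \<sigma>_def mult.commute)
  qed
  finally show ?thesis .
qed

lemma perm_sign_compose:
  assumes "cring K" "t permutes {..<length ys}" "s permutes {..<length ys}"
  shows "perm_sign K (t \<circ> s) ys = perm_sign K t ys \<otimes>[K] perm_sign K s (permute_list t ys)"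
proof -
  let ?I = "\<lambda>u. {(i, j). i < j \<and> j < length ys \<and> u j < (u i :: nat)}"
  have "perm_sign K s (permute_list t ys) =
      ksign K (\<Sum>(i, j)\<in>?I s. (in_deg ys \<circ> t) (s i) * (in_deg ys \<circ> t) (s j))"
    unfolding perm_sign_def length_permute_list
    by (intro arg_cong[where f = "ksign K"] sum.cong refl)
      (auto simp: in_deg_permute[OF assms(2)] permutes_lessThan[OF assms(3)])
  then have "perm_sign K t ys \<otimes>[K] perm_sign K s (permute_list t ys) =
     ksign K ((\<Sum>(i, j)\<in>?I t. in_deg ys (t i) * in_deg ys (t j)) +
       (\<Sum>(i, j)\<in>?I s. (in_deg ys \<circ> t) (s i) * (in_deg ys \<circ> t) (s j)))"
    by (simp add: perm_sign_def ksign_add[OF assms(1)])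
  also have "\<dots> = perm_sign K (t \<circ> s) ys"
    unfolding perm_sign_def by (rule ksign_cong) (rule inversions_compose[OF assms(2,3)])
  finally show ?thesis by simp
qed

lemma perm_sign_id: "perm_sign K id ys = \<one>[K]"
proof -
  have "{(i, j). i < j \<and> j < length ys \<and> id j < (id i :: nat)} = {}" by auto
  then show ?thesis unfolding perm_sign_def by (simp only: sum.empty) (simp add: ksign_def)
qed

lemma sorting_perm_exists:
  fixes m :: "nat \<Rightarrow> nat"
  assumes "inj_on m {..<r}"
  shows "\<exists>s. s permutes {..<r} \<and> (\<forall>i j. i < j \<and> j < r \<longrightarrow> m (s i) < m (s j))"
proof -
  define zs where "zs = sort_key m [0..<r]"
  have "mset zs = mset [0..<r]" by (simp add: zs_def)
  then obtain s where s: "s permutes {..<length [0..<r]}" "permute_list s [0..<r] = zs"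
    by (rule mset_eq_permutation)
  have s': "s permutes {..<r}" using s(1) by simp
  have z: "zs ! i = s i" if "i < r" for i
    using permute_list_nth[OF s(1), of i] s(2) that permutes_lessThan[OF s', of i] by simp
  have lz: "length zs = r" by (simp add: zs_def)
  have "m (s i) < m (s j)" if "i < j" "j < r" for i j
  proof -
    have "sorted (map m zs)" by (simp add: zs_def)
    then have "m (zs ! i) \<le> m (zs ! j)" using that lz by (auto simp: sorted_iff_nth_mono_less)
    moreover have "s i \<noteq> s j" using that permutes_inj[OF s'] by (auto dest: injD)
    then have "m (s i) \<noteq> m (s j)"
      using inj_onD[OF assms, of "s i" "s j"] that permutes_lessThan[OF s'] by (metis lessThan_iff less_trans)
    ultimately show ?thesis using z that by simp
  qed
  then show ?thesis using s' by blast
qed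

text \<open>Both \<open>m \<circ> s\<close> and \<open>m \<circ> t\<close> list the set of values of
  \<open>m\<close> in increasing order, and \<open>m\<close> is injective.\<close>

lemma sorting_perm_unique:
  fixes m :: "nat \<Rightarrow> nat"
  assumes "s permutes {..<r}" "t permutes {..<r}"
    and "\<And>i j. i < j \<Longrightarrow> j < r \<Longrightarrow> m (s i) < m (s j)" "\<And>i j. i < j \<Longrightarrow> j < r \<Longrightarrow> m (t i) < m (t j)"
  shows "s = t"
proof -
  have *: "sorted (map (\<lambda>i. m (u i)) [0..<r]) \<and> distinct (map (\<lambda>i. m (u i)) [0..<r]) \<and>
      set (map (\<lambda>i. m (u i)) [0..<r]) = m ` {..<r}"
    if u: "u permutes {..<r}" "\<And>i j. i < j \<Longrightarrow> j < r \<Longrightarrow> m (u i) < m (u j)" for u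
  proof -
    have "inj_on (\<lambda>i. m (u i)) {..<r}"
      by (rule inj_onI) (metis lessThan_iff nat_neq_iff u(2))
    moreover have "(\<lambda>i. m (u i)) ` {..<r} = m ` {..<r}"
      using permutes_image[OF u(1)] by (metis image_image)
    ultimately show ?thesis
      using u(2) by (auto simp: sorted_iff_nth_mono_less distinct_map atLeast0LessThan intro!: less_imp_le)
  qed
  have eq: "map (\<lambda>i. m (s i)) [0..<r] = map (\<lambda>i. m (t i)) [0..<r]"
    by (rule sorted_distinct_set_unique) (use *[OF assms(1,3)] *[OF assms(2,4)] in auto)
  have inj: "inj_on m {..<r}"
  proof (rule inj_onI)
    fix x y assume xy: "x \<in> {..<r}" "y \<in> {..<r}" "m x = m y"
    obtain i j where "x = s i" "y = s j" "i < r" "j < r"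
      using xy permutes_image[OF assms(1)] by (metis imageE lessThan_iff)
    then show "x = y" using assms(3) xy(3) by (metis nat_neq_iff)
  qed
  show ?thesis
  proof
    fix i show "s i = t i"
    proof (cases "i < r")
      case True
      then have "m (s i) = m (t i)" using arg_cong[OF eq, of "\<lambda>l. l ! i"] by simp
      then show ?thesis
        using inj_onD[OF inj, of "s i" "t i"] True permutes_lessThan[OF assms(1)] permutes_lessThan[OF assms(2)] by simp
    next
      case False
      then show ?thesis using assms(1,2) by (simp add: permutes_def)
    qed
  qed
qed

definition blocks_nonempty :: "'n inputs \<Rightarrow> bool" where
  "blocks_nonempty ys \<longleftrightarrow> (\<forall>i<length ys. in_block ys i \<noteq> {})"

text \<open>The symmetric group acts freely on lists of disjoint nonempty blocks; ordering the
  blocks by their minima selects one list from each orbit.\<close>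

definition sorted_inputs :: "'n inputs \<Rightarrow> bool" where
  "sorted_inputs ys \<longleftrightarrow> blocks_nonempty ys \<and>
     (\<forall>i j. i < j \<and> j < length ys \<longrightarrow> Min (in_block ys i) < Min (in_block ys j))"

definition sgens :: "('k, 'm, 'x) dg_seq_scheme \<Rightarrow> ('k, 'n, 'y) dg_seq_scheme \<Rightarrow>
    nat \<Rightarrow> int \<Rightarrow> ('m, 'n) gen set" where
  "sgens M N n d = {(a, x, ys) \<in> gens M N n d. sorted_inputs ys}"

definition sort_perm :: "'n inputs \<Rightarrow> nat \<Rightarrow> nat" where
  "sort_perm ys = (SOME s. s permutes {..<length ys} \<and>
     (\<forall>i j. i < j \<and> j < length ys \<longrightarrow> Min (in_block ys (s i)) < Min (in_block ys (s j))))"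

lemma blocks_nonempty_set_val [simp]: "blocks_nonempty (set_val ys i v) = blocks_nonempty ys"
  by (simp add: blocks_nonempty_def)

lemma sorted_inputs_set_val [simp]: "sorted_inputs (set_val ys i v) = sorted_inputs ys"
  by (simp add: sorted_inputs_def)

lemma sort_perm_set_val [simp]: "sort_perm (set_val ys i v) = sort_perm ys"
  by (simp add: sort_perm_def)

lemma valid_inputs_finite_block: "valid_inputs N n ys \<Longrightarrow> i < length ys \<Longrightarrow> finite (in_block ys i)"
  by (rule finite_subset[of _ "{..<n}"]) (auto simp: valid_inputs_iff)

lemma sort_perm:
  assumes "valid_inputs N n ys" "blocks_nonempty ys"
  shows "sort_perm ys permutes {..<length ys}"
    and "i < j \<Longrightarrow> j < length ys \<Longrightarrow> Min (in_block ys (sort_perm ys i)) < Min (in_block ys (sort_perm ys j))"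
proof -
  have "inj_on (\<lambda>i. Min (in_block ys i)) {..<length ys}"
  proof (rule inj_onI, rule ccontr)
    fix i j assume ij: "i \<in> {..<length ys}" "j \<in> {..<length ys}" "Min (in_block ys i) = Min (in_block ys j)" "i \<noteq> j"
    have "Min (in_block ys k) \<in> in_block ys k" if "k < length ys" for k
      using that assms(2) valid_inputs_finite_block[OF assms(1) that] by (simp add: blocks_nonempty_def)
    then have "in_block ys i \<inter> in_block ys j \<noteq> {}" using ij by (metis IntI empty_iff lessThan_iff)
    then show False using ij assms(1) by (auto simp: valid_inputs_iff)
  qed
  from someI_ex[OF sorting_perm_exists[OF this]]
  show "sort_perm ys permutes {..<length ys}"
    "i < j \<Longrightarrow> j < length ys \<Longrightarrow> Min (in_block ys (sort_perm ys i)) < Min (in_block ys (sort_perm ys j))"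
    by (auto simp: sort_perm_def)
qed

lemma blocks_nonempty_permute:
  "s permutes {..<length ys} \<Longrightarrow> blocks_nonempty (permute_list s ys) = blocks_nonempty ys"
proof -
  assume s: "s permutes {..<length ys}"
  have "(\<forall>i<length ys. in_block ys (s i) \<noteq> {}) \<longleftrightarrow> (\<forall>i<length ys. in_block ys i \<noteq> {})"
    by (metis permutes_lessThan[OF s] permutes_lessThan[OF permutes_inv[OF s]] permutes_inverses(1)[OF s])
  then show ?thesis by (simp add: blocks_nonempty_def in_block_permute[OF s])
qed

lemma sorted_permute_sort_perm:
  assumes "valid_inputs N n ys" "blocks_nonempty ys"
  shows "sorted_inputs (permute_list (sort_perm ys) ys)"
  using sort_perm[OF assms] assms(2)
  by (simp add: sorted_inputs_def blocks_nonempty_permute in_block_permute)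

lemma sort_perm_sorted:
  assumes "valid_inputs N n ys" "sorted_inputs ys" shows "sort_perm ys = id"
proof (rule sorting_perm_unique)
  have "blocks_nonempty ys" using assms(2) by (simp add: sorted_inputs_def)
  note sp = sort_perm[OF assms(1) this]
  show "sort_perm ys permutes {..<length ys}"
    "\<And>i j. i < j \<Longrightarrow> j < length ys \<Longrightarrow> Min (in_block ys (sort_perm ys i)) < Min (in_block ys (sort_perm ys j))"
    by (fact sp)+
  show "\<And>i j. i < j \<Longrightarrow> j < length ys \<Longrightarrow> Min (in_block ys (id i)) < Min (in_block ys (id j))"
    using assms(2) by (simp add: sorted_inputs_def)
qed (rule permutes_id)

text \<open>Both sides sort the blocks of \<open>ys\<close>, and the sorting permutation is unique.
  This compatibility is what makes the extension in \<open>sorted_lift\<close> respect the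
  coinvariance relation.\<close>

lemma sort_perm_permute:
  assumes "valid_inputs N n ys" "blocks_nonempty ys" "t permutes {..<length ys}"
  shows "t \<circ> sort_perm (permute_list t ys) = sort_perm ys"
proof (rule sorting_perm_unique)
  have v: "valid_inputs N n (permute_list t ys)" "blocks_nonempty (permute_list t ys)"
    using valid_inputs_permute[OF assms(1,3)] blocks_nonempty_permute[OF assms(3)] assms(2) by auto
  note sp = sort_perm[OF v, unfolded length_permute_list] and sp0 = sort_perm[OF assms(1,2)]
  show "t \<circ> sort_perm (permute_list t ys) permutes {..<length ys}"
    by (rule permutes_compose[OF sp(1) assms(3)])
  show "sort_perm ys permutes {..<length ys}" by (fact sp0)
  show "Min (in_block ys ((t \<circ> sort_perm (permute_list t ys)) i)) < Min (in_block ys ((t \<circ> sort_perm (permute_list t ys)) j))"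
    if "i < j" "j < length ys" for i j
    using sp(2)[OF that] that permutes_lessThan[OF sp(1)] by (simp add: in_block_permute[OF assms(3)])
  show "Min (in_block ys (sort_perm ys i)) < Min (in_block ys (sort_perm ys j))"
    if "i < j" "j < length ys" for i j by (rule sp0(2)[OF that])
qed

lemma permute_list_set_val:
  assumes "s permutes {..<length ys}" "i < length ys"
  shows "permute_list s (set_val ys i v) = set_val (permute_list s ys) (inv_into UNIV s i) v"
proof (rule inputs_eqI)
  have inv: "inv_into UNIV s i < length ys" using permutes_lessThan[OF permutes_inv[OF assms(1)]] assms(2) by simp
  have sj: "s j < length ys \<longleftrightarrow> j < length ys" for j using permutes_lessThan[OF assms(1)] .
  fix j assume "j < length (set_val (permute_list s ys) (inv_into UNIV s i) v)"
  then have j: "j < length ys" by simp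
  have "s j = i \<longleftrightarrow> j = inv_into UNIV s i" using permutes_inverses[OF assms(1)] by metis
  then show "in_val (permute_list s (set_val ys i v)) j = in_val (set_val (permute_list s ys) (inv_into UNIV s i) v) j"
    using assms j inv by (simp add: in_val_permute in_val_set_val)
qed (use assms in \<open>simp_all add: in_block_permute in_deg_permute\<close>)

text \<open>There is no clause for permutations, since a nontrivial permutation destroys
  sortedness.\<close>

definition sorted_balanced :: "('k, 'c) ring_scheme \<Rightarrow> ('k, 'm, 'x) dg_seq_scheme \<Rightarrow> ('k, 'n, 'y) dg_seq_scheme \<Rightarrow>
    nat \<Rightarrow> int \<Rightarrow> ('k, 'b) module \<Rightarrow> (('m, 'n) gen \<Rightarrow> 'b) \<Rightarrow> bool" where
  "sorted_balanced K M N n d B F \<longleftrightarrow> (\<forall>a x ys. (a, x, ys) \<in> sgens M N n d \<longrightarrow> multilinear_at K M N B F a x ys)"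

lemma sorted_balanced_multilinear: "sorted_balanced K M N n d B F \<Longrightarrow> (a, x, ys) \<in> sgens M N n d \<Longrightarrow> multilinear_at K M N B F a x ys"
  by (simp add: sorted_balanced_def)

lemmas sorted_balancedD = multilinear_atD[OF sorted_balanced_multilinear]

lemma sgensD: "(a, x, ys) \<in> sgens M N n d \<Longrightarrow> (a, x, ys) \<in> gens M N n d"
  "(a, x, ys) \<in> sgens M N n d \<Longrightarrow> sorted_inputs ys"
  by (simp_all add: sgens_def)

lemma sgensI: "(a, x, ys) \<in> gens M N n d \<Longrightarrow> sorted_inputs ys \<Longrightarrow> (a, x, ys) \<in> sgens M N n d"
  by (simp add: sgens_def)

context comp_product
begin

lemma act_M_comp: "s permutes {..<r} \<Longrightarrow> t permutes {..<r} \<Longrightarrow> x \<in> elts M r d \<Longrightarrow>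
    dg_act M r d s (dg_act M r d t x) = dg_act M r d (s \<circ> t) x"
  using M by (simp add: dg_sigma_module_def)

lemma act_M_id: "x \<in> elts M r d \<Longrightarrow> dg_act M r d id x = x"
  using M by (simp add: dg_sigma_module_def)

lemma perm_sign_closed: "perm_sign K s ys \<in> carrier K"
  by (simp add: perm_sign_def ksign_closed[OF K])

text \<open>Coinvariants of a free action are computed on one representative per orbit. The
  extension \<open>G\<close> sorts the inputs, lets the inverse of the sorting permutation act on
  the root and multiplies by the Koszul sign; a generator with an empty block goes to zero. It is
  balanced because \<open>sort_perm\<close> is compatible with permutations of the list and
  \<open>perm_sign\<close> is multiplicative along composition.\<close>

lemma sorted_lift:
  assumes B: "module K B" and F: "sorted_balanced K M N n d B F"
  shows "\<exists>T. lin_map K (A n d) B T \<and> (\<forall>g\<in>sgens M N n d. T (C n d g) = F g)"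
proof -
  interpret B: module K B by (rule B)
  let ?inv = "inv_into (UNIV :: nat set)"
  define G where "G = (\<lambda>(a, x, ys). if blocks_nonempty ys then perm_sign K (sort_perm ys) ys \<odot>[B]
     F (a, dg_act M (length ys) a (?inv (sort_perm ys)) x, permute_list (sort_perm ys) ys) else \<zero>[B])"
  have G0: "G (a, x, ys) = \<zero>[B]" if "\<not> blocks_nonempty ys" for a x ys using that by (simp add: G_def)
  have G1: "G (a, x, ys) = perm_sign K (sort_perm ys) ys \<odot>[B]
     F (a, dg_act M (length ys) a (?inv (sort_perm ys)) x, permute_list (sort_perm ys) ys)"
    if "blocks_nonempty ys" for a x ys using that by (simp add: G_def)
  have "balanced K M N n d B G"
    unfolding balanced_def
  proof (intro allI impI)
    fix a x ys assume g: "(a, x, ys) \<in> gens M N n d"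
    note gD = gensD[OF g]
    show "multilinear_at K M N B G a x ys \<and> (\<forall>s. s permutes {..<length ys} \<longrightarrow>
        G (a, dg_act M (length ys) a s x, ys) = perm_sign K s ys \<odot>[B] G (a, x, permute_list s ys))"
    proof (cases "blocks_nonempty ys")
      case False
      then show ?thesis by (simp add: multilinear_at_def G0 blocks_nonempty_permute perm_sign_closed)
    next
      case True
      let ?s = "sort_perm ys" let ?e = "perm_sign K ?s ys" let ?zs = "permute_list ?s ys"
      have s: "?s permutes {..<length ys}" by (rule sort_perm(1)[OF gD(2) True])
      have si: "?inv ?s permutes {..<length ys}" by (rule permutes_inv[OF s])
      let ?x = "\<lambda>x. dg_act M (length ys) a (?inv ?s) x"
      note xl = act_M[OF si, of a]
      have sg: "(a, ?x x', ?zs) \<in> sgens M N n d" if "x' \<in> elts M (length ys) a" for x'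
        by (intro sgensI gens_root[OF gens_permute[OF g s]] sorted_permute_sort_perm[OF gD(2) True])
          (simp add: lin_closed[OF xl that])
      note sD = sorted_balancedD[OF F sg] and e = perm_sign_closed[of ?s ys]
      have comm: "?e \<odot>[B] (k \<odot>[B] z) = k \<odot>[B] (?e \<odot>[B] z)" if "k \<in> carrier K" "z \<in> carrier B" for k z
        using that e by (simp flip: B.smult_assoc1 add: K.m_comm)
      show ?thesis unfolding multilinear_at_def
      proof (intro conjI ballI allI impI)
        show "G (a, x, ys) \<in> carrier B" using sD(1)[OF gD(1)] e by (simp add: G1[OF True])
        show "G (a, x \<oplus>[dg_mod M (length ys) a] x', ys) = G (a, x, ys) \<oplus>[B] G (a, x', ys)"
          if x': "x' \<in> elts M (length ys) a" for x'
          using sD(2)[OF gD(1), of "?x x'"] lin_closed[OF xl x'] sD(1)[OF gD(1)] sD(1)[OF x'] e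
          by (simp add: G1[OF True] lin_add[OF xl gD(1) x'] B.smult_r_distr)
        show "G (a, k \<odot>[dg_mod M (length ys) a] x, ys) = k \<odot>[B] G (a, x, ys)" if k: "k \<in> carrier K" for k
          using sD(3)[OF gD(1) k] comm[OF k sD(1)[OF gD(1)]]
          by (simp add: G1[OF True] lin_smult[OF xl k gD(1)])
        show "G (a, dg_act M (length ys) a t x, ys) = perm_sign K t ys \<odot>[B] G (a, x, permute_list t ys)"
          if t: "t permutes {..<length ys}" for t
        proof -
          let ?u = "sort_perm (permute_list t ys)"
          have tu: "t \<circ> ?u = ?s" by (rule sort_perm_permute[OF gD(2) True t])
          have u: "?u permutes {..<length ys}"
            using sort_perm(1)[OF valid_inputs_permute[OF gD(2) t]] blocks_nonempty_permute[OF t] True by simp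
          have "?inv ?s \<circ> t = ?inv ?u"
            unfolding tu[symmetric] o_inv_distrib[OF permutes_bij[OF t] permutes_bij[OF u]]
            using permutes_inv_o(2)[OF t] by (simp add: o_assoc[symmetric])
          then have 1: "?x (dg_act M (length ys) a t x) = dg_act M (length ys) a (?inv ?u) x"
            using act_M_comp[OF si t gD(1)] by simp
          have 2: "?zs = permute_list ?u (permute_list t ys)"
            using permute_list_compose[of ?u ys t] u tu by simp
          have 3: "?e = perm_sign K t ys \<otimes>[K] perm_sign K ?u (permute_list t ys)"
            using perm_sign_compose[OF K t u] tu by simp
          have "G (a, dg_act M (length ys) a t x, ys) = ?e \<odot>[B] F (a, dg_act M (length ys) a (?inv ?u) x, ?zs)"
            by (simp add: G1[OF True] 1)
          also have "\<dots> = perm_sign K t ys \<odot>[B] (perm_sign K ?u (permute_list t ys) \<odot>[B]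
              F (a, dg_act M (length ys) a (?inv ?u) x, ?zs))"
            using sD(1)[OF lin_closed[OF act_M[OF t] gD(1)]] unfolding 3 1
            by (intro B.smult_assoc1 perm_sign_closed)
          finally show ?thesis using True by (simp add: G1 blocks_nonempty_permute[OF t] 2)
        qed
        fix i assume i: "i < length ys"
        let ?j = "?inv ?s i"
        have j: "?j < length ?zs" "?s ?j = i" "?j < length ys"
          using permutes_lessThan[OF si, of i] i permutes_inverses(1)[OF s] by simp_all
        have z: "in_block ?zs ?j = in_block ys i" "in_deg ?zs ?j = in_deg ys i" "in_val ?zs ?j = in_val ys i"
          using j s by (simp_all add: in_block_permute in_deg_permute in_val_permute)
        have sv: "G (a, x, set_val ys i v) = ?e \<odot>[B] F (a, ?x x, set_val ?zs ?j v)" for v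
        proof -
          have "perm_sign K ?s (set_val ys i v) = ?e" by (rule perm_sign_cong) (simp_all add: s)
          then show ?thesis using True by (simp add: G1 permute_list_set_val[OF s i])
        qed
        show "G (a, x, set_val ys i (in_val ys i \<oplus>[dg_mod N (card (in_block ys i)) (in_deg ys i)] y)) =
            G (a, x, ys) \<oplus>[B] G (a, x, set_val ys i y)"
          if y: "y \<in> elts N (card (in_block ys i)) (in_deg ys i)" for y
        proof -
          have "(a, ?x x, set_val ?zs ?j y) \<in> sgens M N n d"
            using sgensD[OF sg[OF gD(1)]] gens_set_val[OF sgensD(1)[OF sg[OF gD(1)]] j(1), of y] y z
            by (intro sgensI) simp_all
          then have "F (a, ?x x, set_val ?zs ?j y) \<in> carrier B" by (rule sorted_balancedD(1)[OF F])
          then show ?thesis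
            using sD(4)[OF gD(1) j(1), of y] y sD(1)[OF gD(1)] e
            by (simp add: sv z G1[OF True] B.smult_r_distr)
        qed
        show "G (a, x, set_val ys i (k \<odot>[dg_mod N (card (in_block ys i)) (in_deg ys i)] in_val ys i)) =
            k \<odot>[B] G (a, x, ys)" if k: "k \<in> carrier K" for k
          using sD(5)[OF gD(1) j(1) k] comm[OF k sD(1)[OF gD(1)]]
          by (simp add: sv z G1[OF True])
      qed
    qed
  qed
  note T = comp_lift_lin_map[OF B this] comp_lift_cls[OF B this]
  have "comp_lift K B G (C n d g) = F g" if "g \<in> sgens M N n d" for g
  proof -
    obtain a x ys where g: "g = (a, x, ys)" by (cases g)
    note gs = sgensD[OF that[unfolded g]]
    note gD = gensD[OF gs(1)]
    have sp: "sort_perm ys = id" by (rule sort_perm_sorted[OF gD(2) gs(2)])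
    have "blocks_nonempty ys" using gs(2) by (simp add: sorted_inputs_def)
    then show ?thesis
      using T(2)[OF gs(1)] sorted_balancedD(1)[OF F that[unfolded g]]
      by (simp add: g G1 sp perm_sign_id act_M_id[OF gD(1)])
  qed
  then show ?thesis using T(1) by (intro exI[of _ "comp_lift K B G"]) simp
qed

end

section \<open>The filtration by the number of inputs\<close>

locale reduced_product = comp_product K M N
  for K :: "('k, 'c) ring_scheme" and M :: "('k, 'm, 'x) dg_seq_scheme" and N :: "('k, 'n, 'y) dg_seq_scheme" +
  assumes N0: "zero_in_arity_zero N"
begin

definition low_gens :: "nat \<Rightarrow> nat \<Rightarrow> int \<Rightarrow> ('m, 'n) gen set" where
  "low_gens s n d = {(a, x, ys) \<in> sgens M N n d. length ys < s}"

text \<open>The inequality is strict: \<open>filt s\<close> is spanned by the classes with fewer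
  than \<open>s\<close> inputs. So \<open>filt 0\<close> is zero, and the piece with exactly
  \<open>r\<close> inputs is \<open>filt (Suc r)\<close> modulo \<open>filt r\<close>.\<close>

definition filt :: "nat \<Rightarrow> nat \<Rightarrow> int \<Rightarrow> ('k, 'm, 'n) comp_el set" where
  "filt s n d = mspan K (A n d) (C n d ` low_gens s n d)"

lemma low_gens_closed: "C n d ` low_gens s n d \<subseteq> cA n d"
  by (rule subsetI) (auto simp only: low_gens_def sgens_def intro!: cls_closed)

lemma submodule_filt: "submodule (filt s n d) K (A n d)"
  unfolding filt_def by (rule submodule_mspan[OF module_A low_gens_closed])

lemma filt_carrier: "X \<in> filt s n d \<Longrightarrow> X \<in> cA n d"
  by (rule subsetD[OF A.submoduleE(1)[OF submodule_filt]])

lemma filt_zero: "\<zero>[A n d] \<in> filt s n d"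
  by (rule submodule_zero[OF submodule_filt])

lemma filt_add: "X \<in> filt s n d \<Longrightarrow> Y \<in> filt s n d \<Longrightarrow> X \<oplus>[A n d] Y \<in> filt s n d"
  by (rule A.submoduleE(5)[OF submodule_filt])

lemma filt_neg: "X \<in> filt s n d \<Longrightarrow> \<ominus>[A n d] X \<in> filt s n d"
  by (rule A.submoduleE(3)[OF submodule_filt])

lemma filt_smult: "k \<in> carrier K \<Longrightarrow> X \<in> filt s n d \<Longrightarrow> k \<odot>[A n d] X \<in> filt s n d"
  by (rule A.submoduleE(4)[OF submodule_filt])

lemma cls_sorted_filt: "(a, x, ys) \<in> sgens M N n d \<Longrightarrow> length ys < s \<Longrightarrow> C n d (a, x, ys) \<in> filt s n d"
  unfolding filt_def
  by (rule subsetD[OF mspan_superset[OF module_A low_gens_closed]]) (simp add: low_gens_def)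

lemma cls_empty_block:
  assumes "(a, x, ys) \<in> gens M N n d" "\<not> blocks_nonempty ys"
  shows "C n d (a, x, ys) = \<zero>[A n d]"
proof -
  obtain i where i: "i < length ys" "in_block ys i = {}" using assms(2) by (auto simp: blocks_nonempty_def)
  have "in_val ys i = \<zero>[dg_mod N (card (in_block ys i)) (in_deg ys i)]"
    using gensD(4)[OF assms(1) i(1)] N0 i(2) by (simp add: zero_in_arity_zero_def zero_module_def)
  then show ?thesis by (rule cls_zero_input[OF assms(1) i(1)])
qed

text \<open>Write \<open>x\<close> as the sorting permutation acting on some \<open>x'\<close>; the
  coinvariance relation moves the permutation from the root to the inputs, at the cost of a
  sign.\<close>

lemma cls_sort:
  assumes g: "(a, x, ys) \<in> gens M N n d" and ne: "blocks_nonempty ys"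
  obtains x' zs k where "(a, x', zs) \<in> sgens M N n d" "length zs = length ys" "k \<in> carrier K"
    "C n d (a, x, ys) = k \<odot>[A n d] C n d (a, x', zs)"
proof -
  let ?inv = "inv_into (UNIV :: nat set)" let ?s = "sort_perm ys"
  note gD = gensD[OF g]
  have s: "?s permutes {..<length ys}" by (rule sort_perm(1)[OF gD(2) ne])
  have si: "?inv ?s permutes {..<length ys}" by (rule permutes_inv[OF s])
  let ?x = "dg_act M (length ys) a (?inv ?s) x"
  have xc: "?x \<in> elts M (length ys) a" by (rule lin_closed[OF act_M[OF si] gD(1)])
  have x: "dg_act M (length ys) a ?s ?x = x"
    by (simp add: act_M_comp[OF s si gD(1)] permutes_inv_o(1)[OF s] act_M_id[OF gD(1)])
  show ?thesis
  proof (rule that)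
    show "(a, ?x, permute_list ?s ys) \<in> sgens M N n d"
      by (intro sgensI gens_root[OF gens_permute[OF g s]] sorted_permute_sort_perm[OF gD(2) ne]) (simp add: xc)
    show "C n d (a, x, ys) = perm_sign K ?s ys \<odot>[A n d] C n d (a, ?x, permute_list ?s ys)"
      using cls_coinvariant[OF gens_root[OF g xc] s] x by simp
  qed (simp_all add: perm_sign_closed)
qed

text \<open>Sorting keeps the number of inputs, and a generator with an empty block has class zero
  because \<open>N(0) = 0\<close>. The filtration, defined by sorted generators, can therefore be
  tested on arbitrary ones.\<close>

lemma cls_filt:
  assumes "(a, x, ys) \<in> gens M N n d" "length ys < s" shows "C n d (a, x, ys) \<in> filt s n d"
proof (cases "blocks_nonempty ys")
  case True
  obtain x' zs k where z: "(a, x', zs) \<in> sgens M N n d" "length zs = length ys" "k \<in> carrier K"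
    "C n d (a, x, ys) = k \<odot>[A n d] C n d (a, x', zs)"
    by (rule cls_sort[OF assms(1) True])
  show ?thesis unfolding z(4) using z(2) assms(2) by (intro filt_smult z(3) cls_sorted_filt[OF z(1)]) simp
next
  case False
  then show ?thesis using cls_empty_block[OF assms(1)] filt_zero by simp
qed

lemma filt_induct [consumes 1, case_names base zero add smult]:
  assumes "X \<in> filt s n d"
    and "\<And>a x ys. (a, x, ys) \<in> sgens M N n d \<Longrightarrow> length ys < s \<Longrightarrow> Q (C n d (a, x, ys))"
    and "Q \<zero>[A n d]"
    and "\<And>X Y. X \<in> filt s n d \<Longrightarrow> Y \<in> filt s n d \<Longrightarrow> X \<in> cA n d \<Longrightarrow> Y \<in> cA n d \<Longrightarrow>
      Q X \<Longrightarrow> Q Y \<Longrightarrow> Q (X \<oplus>[A n d] Y)"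
    and "\<And>k X. k \<in> carrier K \<Longrightarrow> X \<in> filt s n d \<Longrightarrow> X \<in> cA n d \<Longrightarrow> Q X \<Longrightarrow> Q (k \<odot>[A n d] X)"
  shows "Q X"
  using module_A low_gens_closed assms(1)[unfolded filt_def]
proof (induction rule: mspan_induct)
  case (base X)
  then show ?case using assms(2) by (auto simp only: low_gens_def)
next
  case (add X Y)
  then show ?case using assms(4) unfolding filt_def by simp
next
  case (smult k X)
  then show ?case using assms(5) unfolding filt_def by simp
qed (rule assms(3))

lemma filt_lin:
  assumes "module K B" "lin_map K (A n d) B f" "submodule H K B" "X \<in> filt s n d"
    and "\<And>a x ys. (a, x, ys) \<in> sgens M N n d \<Longrightarrow> length ys < s \<Longrightarrow> f (C n d (a, x, ys)) \<in> H"
  shows "f X \<in> H"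
  using assms(4)
proof (induction rule: filt_induct)
  case (base a x ys)
  then show ?case by (rule assms(5))
qed (simp_all add: lin_zero[OF module_A assms(1,2)] lin_add[OF assms(2)] lin_smult[OF assms(2)]
    submodule_zero[OF assms(3)] module.submoduleE(4,5)[OF assms(1,3)])

lemma filt_mono:
  assumes "X \<in> filt s n d" "s \<le> t" shows "X \<in> filt t n d"
  using assms(1)
proof (induction rule: filt_induct)
  case (base a x ys)
  then show ?case using assms(2) by (intro cls_sorted_filt) simp_all
qed (simp_all add: filt_zero filt_add filt_smult)

text \<open>Disjoint nonempty blocks leave little room: the other blocks need one point each.\<close>

lemma block_card_bound:
  assumes "valid_inputs N n ys" "blocks_nonempty ys" "i < length ys"
  shows "card (in_block ys i) + length ys \<le> n + 1"
proof -
  let ?I = "{..<length ys}"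
  have fin: "finite (in_block ys j)" if "j \<in> ?I" for j using valid_inputs_finite_block[OF assms(1)] that by simp
  have "n = card (\<Union>j\<in>?I. in_block ys j)" using assms(1) by (simp add: valid_inputs_iff)
  also have "\<dots> = (\<Sum>j\<in>?I. card (in_block ys j))"
    by (rule card_UN_disjoint) (use assms(1) fin in \<open>simp_all add: valid_inputs_iff\<close>)
  also have "\<dots> = card (in_block ys i) + (\<Sum>j\<in>?I - {i}. card (in_block ys j))"
    using assms(3) by (simp add: sum.remove)
  finally have 1: "n = card (in_block ys i) + (\<Sum>j\<in>?I - {i}. card (in_block ys j))" .
  have "(\<Sum>j\<in>?I - {i}. 1) \<le> (\<Sum>j\<in>?I - {i}. card (in_block ys j))"
  proof (rule sum_mono)
    fix j assume j: "j \<in> ?I - {i}"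
    then have "in_block ys j \<noteq> {}" using assms(2) by (simp add: blocks_nonempty_def)
    then show "1 \<le> card (in_block ys j)" using fin[of j] j by (simp add: Suc_le_eq card_gt_0_iff)
  qed
  moreover have "(\<Sum>j\<in>?I - {i}. 1) = length ys - 1" using assms(3) by simp
  ultimately show ?thesis using 1 by linarith
qed

lemma block_card_pos:
  assumes "valid_inputs N n ys" "blocks_nonempty ys" "i < length ys"
  shows "0 < card (in_block ys i)"
  using assms valid_inputs_finite_block[OF assms(1,3)] by (simp add: card_gt_0_iff blocks_nonempty_def)

lemma length_le_arity:
  assumes "valid_inputs N n ys" "blocks_nonempty ys" shows "length ys \<le> n"
proof (cases "length ys = 0")
  case False
  then show ?thesis
    using block_card_bound[OF assms, of 0] block_card_pos[OF assms, of 0] by simp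
qed simp

text \<open>A partition of \<open>n\<close> points has at most \<open>n\<close> nonempty blocks, and
  the classes with an empty block vanish.\<close>

lemma filt_all:
  assumes "X \<in> cA n d" "n < s" shows "X \<in> filt s n d"
proof -
  have "C n d ` gens M N n d \<subseteq> filt s n d"
  proof (rule image_subsetI)
    fix g assume g: "g \<in> gens M N n d"
    obtain a x ys where e: "g = (a, x, ys)" by (cases g)
    show "C n d g \<in> filt s n d"
    proof (cases "blocks_nonempty ys")
      case True
      then show ?thesis using length_le_arity[OF gensD(2)[OF g[unfolded e]] True] assms(2) g
        unfolding e by (intro cls_filt) simp_all
    next
      case False
      then show ?thesis using cls_empty_block[OF g[unfolded e]] filt_zero by (simp add: e)
    qed
  qed
  from mspan_least[OF submodule_filt this] show ?thesis by (rule subsetD) (rule A_spanned[OF assms(1)])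
qed

lemma filt_0: "X \<in> filt 0 n d \<Longrightarrow> X = \<zero>[A n d]"
  by (induction rule: filt_induct) simp_all

text \<open>The blocks of a generator without inputs cover nothing, so it can only live in arity
  zero.\<close>

lemma filt_1: "0 < n \<Longrightarrow> X \<in> filt 1 n d \<Longrightarrow> X = \<zero>[A n d]"
proof (rotate_tac, induction rule: filt_induct)
  case (base a x ys)
  have "valid_inputs N n ys" using gensD(2)[OF sgensD(1)[OF base(1)]] .
  then have "{..<n} = {}" using base(2) by (simp add: valid_inputs_iff)
  then have "0 \<notin> {..<n}" by (simp only: empty_iff not_False_eq_True)
  then show ?case using base(3) by simp
qed simp_all

lemma lin_eq_on_sorted:
  assumes "module K B" "lin_map K (A n d) B f" "lin_map K (A n d) B g"
    and "\<And>a x ys. (a, x, ys) \<in> sgens M N n d \<Longrightarrow> f (C n d (a, x, ys)) = g (C n d (a, x, ys))"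
    and "X \<in> cA n d"
  shows "f X = g X"
proof -
  interpret B: module K B by fact
  have "X \<in> filt (Suc n) n d" using filt_all[OF assms(5)] by simp
  then show ?thesis
    by (induction rule: filt_induct)
      (simp_all add: assms(4) lin_zero[OF module_A assms(1)] assms(2,3) lin_add[OF assms(2)]
        lin_add[OF assms(3)] lin_smult[OF assms(2)] lin_smult[OF assms(3)])
qed

end

section \<open>Maps defined entry by entry\<close>

text \<open>The map applied to an entry may depend on its position, and shifts the degree by
  \<open>u i\<close>. This covers chain maps (\<open>u = 0\<close>), the differential of one entry
  (\<open>-1\<close> at that entry) and homotopies (\<open>1\<close> at one entry).\<close>

definition slot :: "(nat \<Rightarrow> int) \<Rightarrow> (nat \<Rightarrow> nat \<Rightarrow> int \<Rightarrow> 'n \<Rightarrow> 'n1) \<Rightarrow> 'n inputs \<Rightarrow> 'n1 inputs" where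
  "slot u g ys = map (\<lambda>i. (in_block ys i, in_deg ys i + u i, g i (card (in_block ys i)) (in_deg ys i) (in_val ys i)))
     [0..<length ys]"

lemma length_slot [simp]: "length (slot u g ys) = length ys"
  by (simp add: slot_def)

lemma in_deg_set_val_fun: "in_deg (set_val ys i v) = in_deg ys"
  by (rule ext) simp

lemma
  assumes "i < length ys"
  shows in_block_slot: "in_block (slot u g ys) i = in_block ys i"
    and in_deg_slot: "in_deg (slot u g ys) i = in_deg ys i + u i"
    and in_val_slot: "in_val (slot u g ys) i = g i (card (in_block ys i)) (in_deg ys i) (in_val ys i)"
  using assms by (simp_all add: slot_def in_block_def in_deg_def in_val_def)

lemmas in_slot = in_block_slot in_deg_slot in_val_slot

lemma slot_set_val:
  "i < length ys \<Longrightarrow> slot u g (set_val ys i v) =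
     set_val (slot u g ys) i (g i (card (in_block ys i)) (in_deg ys i) v)"
  by (rule inputs_eqI) (simp_all add: in_slot in_val_set_val)

lemma sorted_slot [simp]: "sorted_inputs (slot u g ys) = sorted_inputs ys"
  by (simp add: sorted_inputs_def blocks_nonempty_def in_slot)

lemma tot_deg_slot: "tot_deg (slot u g ys) = tot_deg ys + (\<Sum>i<length ys. u i)"
  by (simp add: tot_deg_def in_slot sum.distrib)

lemma valid_slot:
  assumes "valid_inputs N n ys"
    and "\<And>i. i < length ys \<Longrightarrow> g i (card (in_block ys i)) (in_deg ys i) (in_val ys i)
           \<in> elts N' (card (in_block ys i)) (in_deg ys i + u i)"
  shows "valid_inputs N' n (slot u g ys)"
  using assms by (simp add: valid_inputs_iff in_slot)

text \<open>The coefficient \<open>\<sigma>\<close> sees only the degrees of the root and of the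
  inputs, so it does not interfere with multilinearity and can carry a Koszul sign.\<close>

definition is_slot_map where
  "is_slot_map K M N M' N' n r e u f g \<sigma> d d' T \<longleftrightarrow>
     lin_map K (dg_mod (comp_prod K M N) n d) (dg_mod (comp_prod K M' N') n d') T \<and>
     (\<forall>a x ys. (a, x, ys) \<in> sgens M N n d \<longrightarrow> T (cls K M N n d (a, x, ys)) =
        (if length ys = r
         then \<sigma> a (in_deg ys) \<odot>[dg_mod (comp_prod K M' N') n d'] cls K M' N' n d' (a + e, f a x, slot u g ys)
         else \<zero>[dg_mod (comp_prod K M' N') n d']))"

lemma slot_gens:
  assumes "comp_product K M N"
    and f: "lin_map K (dg_mod M (length ys) a) (dg_mod M' (length ys) (a + e)) (f a)"
    and g: "\<And>i j b. lin_map K (dg_mod N j b) (dg_mod N' j (b + u i)) (g i j b)"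
    and "d' = d + e + (\<Sum>i<length ys. u i)"
    and "(a, x, ys) \<in> gens M N n d"
  shows "(a + e, f a x, slot u g ys) \<in> gens M' N' n d'"
proof -
  interpret S: comp_product K M N by fact
  note gD = S.gensD[OF assms(5)]
  have "valid_inputs N' n (slot u g ys)"
    by (rule valid_slot[OF gD(2)]) (rule lin_closed[OF g gD(4)])
  then show ?thesis
    using lin_closed[OF f gD(1)] gD(3) assms(4) by (simp add: gens_def tot_deg_slot)
qed

text \<open>\<open>slot\<close> leaves the blocks alone, so sorted generators stay sorted and
  \<open>sorted_lift\<close> reduces the existence to multilinearity, entry by entry.\<close>

lemma slot_map_exists:
  assumes "comp_product K M N" "comp_product K M' N'"
    and f: "\<And>a. lin_map K (dg_mod M r a) (dg_mod M' r (a + e)) (f a)"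
    and g: "\<And>i j b. lin_map K (dg_mod N j b) (dg_mod N' j (b + u i)) (g i j b)"
    and \<sigma>: "\<And>a b. \<sigma> a b \<in> carrier K"
    and d': "d' = d + e + (\<Sum>i<r. u i)"
  shows "\<exists>T. is_slot_map K M N M' N' n r e u f g \<sigma> d d' T"
proof -
  interpret S: comp_product K M N by fact
  interpret T: comp_product K M' N' by fact
  let ?B = "T.A n d'"
  define F where "F = (\<lambda>(a, x, ys). if length ys = r
     then \<sigma> a (in_deg ys) \<odot>[?B] cls K M' N' n d' (a + e, f a x, slot u g ys) else \<zero>[?B])"
  have "sorted_balanced K M N n d ?B F"
    unfolding sorted_balanced_def
  proof (intro allI impI)
    fix a x ys assume sg: "(a, x, ys) \<in> sgens M N n d"
    note gn = sgensD(1)[OF sg]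
    note gD = S.gensD[OF gn]
    show "multilinear_at K M N ?B F a x ys"
    proof (cases "length ys = r")
      case False
      then show ?thesis by (simp add: multilinear_at_def F_def)
    next
      case True
      let ?s = "\<sigma> a (in_deg ys)"
      have f': "lin_map K (dg_mod M (length ys) a) (dg_mod M' (length ys) (a + e)) (f a)" using f True by simp
      have sl: "(a + e, f a x, slot u g ys) \<in> gens M' N' n d'"
        if "(a, x, ys) \<in> gens M N n d" "length ys = r" for x ys
        by (rule slot_gens[OF assms(1) _ g _ that(1)]) (use f that(2) d' in simp_all)
      note h = sl[OF gn True]
      have F1: "F (a, x', ys) = ?s \<odot>[?B] cls K M' N' n d' (a + e, f a x', slot u g ys)" for x'
        using True by (simp add: F_def)
      have F2: "F (a, x, set_val ys i v) = ?s \<odot>[?B] cls K M' N' n d' (a + e, f a x,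
          set_val (slot u g ys) i (g i (card (in_block ys i)) (in_deg ys i) v))" if "i < length ys" for i v
        using True that by (simp add: F_def slot_set_val in_deg_set_val_fun)
      have comm: "?s \<odot>[?B] (k \<odot>[?B] z) = k \<odot>[?B] (?s \<odot>[?B] z)" if "k \<in> carrier K" "z \<in> carrier ?B" for k z
        using that \<sigma> by (simp flip: T.A.smult_assoc1 add: S.K.m_comm)
      show ?thesis unfolding multilinear_at_def
      proof (intro conjI ballI allI impI)
        show "F (a, x, ys) \<in> carrier ?B" using T.cls_closed[OF h] \<sigma> by (simp add: F1)
        show "F (a, x \<oplus>[dg_mod M (length ys) a] x', ys) = F (a, x, ys) \<oplus>[?B] F (a, x', ys)"
          if x': "x' \<in> elts M (length ys) a" for x'
          using T.cls_add_root[OF h] lin_closed[OF f' x'] T.cls_closed[OF h]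
            T.cls_closed[OF sl[OF S.gens_root[OF gn x'] True]] \<sigma>
          by (simp add: F1 lin_add[OF f' gD(1) x'] T.A.smult_r_distr)
        show "F (a, k \<odot>[dg_mod M (length ys) a] x, ys) = k \<odot>[?B] F (a, x, ys)" if k: "k \<in> carrier K" for k
          using T.cls_smult_root[OF h k] comm[OF k T.cls_closed[OF h]]
          by (simp add: F1 lin_smult[OF f' k gD(1)])
        fix i assume i: "i < length ys"
        let ?N = "dg_mod N (card (in_block ys i)) (in_deg ys i)"
        show "F (a, x, set_val ys i (in_val ys i \<oplus>[?N] y)) = F (a, x, ys) \<oplus>[?B] F (a, x, set_val ys i y)"
          if y: "y \<in> carrier ?N" for y
        proof -
          have h2: "(a + e, f a x, set_val (slot u g ys) i (g i (card (in_block ys i)) (in_deg ys i) y)) \<in> gens M' N' n d'"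
            using sl[OF S.gens_set_val[OF gn i y]] i True by (simp add: slot_set_val)
          show ?thesis
            using T.cls_add_input[OF h, of i] i lin_closed[OF g y, of i] T.cls_closed[OF h] T.cls_closed[OF h2] \<sigma>
            by (simp add: F1 F2 in_slot lin_add[OF g gD(4)[OF i] y] T.A.smult_r_distr)
        qed
        show "F (a, x, set_val ys i (k \<odot>[?N] in_val ys i)) = k \<odot>[?B] F (a, x, ys)" if k: "k \<in> carrier K" for k
          using T.cls_smult_input[OF h, of i k] i k comm[OF k T.cls_closed[OF h]]
          by (simp add: F1 F2 in_slot lin_smult[OF g k gD(4)[OF i]])
      qed
    qed
  qed
  from S.sorted_lift[OF T.module_A this] show ?thesis
    unfolding is_slot_map_def by (simp add: F_def Ball_def)
qed

section \<open>The differential on generators\<close>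

definition dslot :: "('k, 'n, 'y) dg_seq_scheme \<Rightarrow> nat \<Rightarrow> 'n inputs \<Rightarrow> 'n inputs" where
  "dslot N k = slot (\<lambda>i. if i = k then - 1 else 0) (\<lambda>i j b. if i = k then dg_diff N j b else (\<lambda>y. y))"

context comp_product
begin

lemma diff_M: "lin_map K (dg_mod M r d) (dg_mod M r (d - 1)) (dg_diff M r d)"
  using M by (simp add: dg_sigma_module_def)

lemma diff_N: "lin_map K (dg_mod N r d) (dg_mod N r (d - 1)) (dg_diff N r d)"
  using N by (simp add: dg_sigma_module_def)

lemma gens_diff_root: "(a, x, ys) \<in> gens M N n d \<Longrightarrow> (a - 1, dg_diff M (length ys) a x, ys) \<in> gens M N n (d - 1)"
  by (frule gensD(1), drule lin_closed[OF diff_M]) (simp add: gens_def)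

lemma gens_dslot: 
  assumes "(a, x, ys) \<in> gens M N n d" "k < length ys"
  shows "(a, x, dslot N k ys) \<in> gens M N n (d - 1)"
proof -
  have "(a + 0, (\<lambda>x. x) x, dslot N k ys) \<in> gens M N n (d - 1)"
    unfolding dslot_def
    by (rule slot_gens[where f = "\<lambda>a x. x", OF comp_product_axioms _ _ _ assms(1)])
      (simp_all add: lin_id diff_N assms(2))
  then show ?thesis by simp
qed

text \<open>The exponent of the sign in the Leibniz rule: the differential passes the root and all
  inputs before position \<open>k\<close>.\<close>

definition leib :: "int \<Rightarrow> (nat \<Rightarrow> int) \<Rightarrow> nat \<Rightarrow> int" where
  "leib a b k = a + (\<Sum>j<k. b j)"

lemma gen_diff_eq:
  assumes "(a, x, ys) \<in> gens M N n d"
  shows "gen_diff K M N n d (a, x, ys) = basis_vec K (a - 1, dg_diff M (length ys) a x, ys) \<oplus>[Fr n (d - 1)]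
     (\<Oplus>\<^bsub>Fr n (d - 1)\<^esub>k\<in>{..<length ys}. ksign K (leib a (in_deg ys) k) \<odot>[Fr n (d - 1)] basis_vec K (a, x, dslot N k ys))"
proof -
  have "ys[k := (case ys ! k of (J, b, y) \<Rightarrow> (J, b - 1, dg_diff N (card J) b y))] = dslot N k ys"
    if k: "k < length ys" for k
    by (rule inputs_eqI) (simp_all add: dslot_def in_slot, simp_all add: in_block_def in_deg_def in_val_def nth_list_update k
      split: prod.splits)
  then have "(\<Oplus>\<^bsub>Fr n (d - 1)\<^esub>i\<in>{..<length ys}. ksign K (a + (\<Sum>j<i. in_deg ys j)) \<odot>[Fr n (d - 1)]
        basis_vec K (a, x, ys[i := (case ys ! i of (J, b, y) \<Rightarrow> (J, b - 1, dg_diff N (card J) b y))])) =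
     (\<Oplus>\<^bsub>Fr n (d - 1)\<^esub>k\<in>{..<length ys}. ksign K (leib a (in_deg ys) k) \<odot>[Fr n (d - 1)] basis_vec K (a, x, dslot N k ys))"
    by (intro F.finsum_cong') (simp_all add: leib_def Pi_def ksign_closed[OF K] basis_in[OF gens_dslot[OF assms]])
  then show ?thesis by (simp add: gen_diff_def Let_def)
qed

lemma gen_diff_closed: "g \<in> gens M N n d \<Longrightarrow> gen_diff K M N n d g \<in> carrier (Fr n (d - 1))"
proof -
  assume g: "g \<in> gens M N n d"
  obtain a x ys where e: "g = (a, x, ys)" by (cases g)
  show ?thesis unfolding e gen_diff_eq[OF g[unfolded e]]
    by (intro F.a_closed basis_in F.finsum_closed Pi_I F.smult_closed ksign_closed[OF K] gens_diff_root)
      (use g gens_dslot in \<open>simp_all add: e\<close>)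
qed

lemma coset_gen_diff:
  assumes g: "(a, x, ys) \<in> gens M N n d"
  shows "comp_rels K M N n (d - 1) +>[Fr n (d - 1)] gen_diff K M N n d (a, x, ys) =
     C n (d - 1) (a - 1, dg_diff M (length ys) a x, ys) \<oplus>[A n (d - 1)]
     (\<Oplus>\<^bsub>A n (d - 1)\<^esub>k\<in>{..<length ys}. ksign K (leib a (in_deg ys) k) \<odot>[A n (d - 1)] C n (d - 1) (a, x, dslot N k ys))"
proof -
  let ?F = "Fr n (d - 1)" and ?A = "A n (d - 1)"
  let ?t = "\<lambda>k. ksign K (leib a (in_deg ys) k) \<odot>[?F] basis_vec K (a, x, dslot N k ys)"
  let ?q = "\<lambda>f. comp_rels K M N n (d - 1) +>[?F] f"
  have t: "?t \<in> {..<length ys} \<rightarrow> carrier ?F"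
    by (intro Pi_I F.smult_closed ksign_closed[OF K] basis_in gens_dslot[OF g]) simp
  have b: "basis_vec K (a - 1, dg_diff M (length ys) a x, ys) \<in> carrier ?F" by (rule basis_in[OF gens_diff_root[OF g]])
  have "?q (gen_diff K M N n d (a, x, ys)) =
      ?q (basis_vec K (a - 1, dg_diff M (length ys) a x, ys)) \<oplus>[?A] (\<Oplus>\<^bsub>?A\<^esub>k\<in>{..<length ys}. ?q (?t k))"
    unfolding gen_diff_eq[OF g] using lin_add[OF coset_lin b F.finsum_closed[OF t]]
      lin_finsum[OF F.module_axioms module_A coset_lin _ t] by simp
  also have "(\<Oplus>\<^bsub>?A\<^esub>k\<in>{..<length ys}. ?q (?t k)) =
     (\<Oplus>\<^bsub>?A\<^esub>k\<in>{..<length ys}. ksign K (leib a (in_deg ys) k) \<odot>[?A] C n (d - 1) (a, x, dslot N k ys))"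
  proof (rule A.finsum_cong'[OF refl])
    show "(\<lambda>k. ksign K (leib a (in_deg ys) k) \<odot>[?A] C n (d - 1) (a, x, dslot N k ys)) \<in> {..<length ys} \<rightarrow> carrier ?A"
      by (intro Pi_I A.smult_closed ksign_closed[OF K] cls_closed gens_dslot[OF g]) simp
    fix k assume "k \<in> {..<length ys}"
    then have "basis_vec K (a, x, dslot N k ys) \<in> carrier ?F" by (intro basis_in gens_dslot[OF g]) simp
    from lin_smult[OF coset_lin ksign_closed[OF K] this]
    show "?q (?t k) = ksign K (leib a (in_deg ys) k) \<odot>[?A] C n (d - 1) (a, x, dslot N k ys)"
      unfolding cls_def .
  qed
  finally show ?thesis by (simp only: cls_def[of K M N n "d - 1" "(a - 1, dg_diff M (length ys) a x, ys)"])
qed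

lemma diff_rep:
  assumes g: "g \<in> gens M N n d" and c: "dg_diff (comp_prod K M N) n d (C n d g) \<in> cA n (d - 1)"
  shows "dg_diff (comp_prod K M N) n d (C n d g) = comp_rels K M N n (d - 1) +>[Fr n (d - 1)] gen_diff K M N n d g"
proof -
  have G: "gen_diff K M N n d \<in> gens M N n d \<rightarrow> carrier (Fr n (d - 1))" by (rule Pi_I) (rule gen_diff_closed)
  note T = lin_ext_basis_vec[OF F.module_axioms G g]
  have dd: "dg_diff (comp_prod K M N) n d (C n d g) = quot_map (Fr n (d - 1)) (comp_rels K M N n (d - 1))
     (lin_ext K (Fr n (d - 1)) (gen_diff K M N n d)) (C n d g)" by (simp add: comp_prod_def)
  have "quot_map (Fr n (d - 1)) (comp_rels K M N n (d - 1))
     (lin_ext K (Fr n (d - 1)) (gen_diff K M N n d)) (C n d g) =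
     comp_rels K M N n (d - 1) +>[Fr n (d - 1)] lin_ext K (Fr n (d - 1)) (gen_diff K M N n d) (basis_vec K g)"
    by (rule quot_map_rep[OF F.module_axioms submodule_rels basis_vec_in_cls[OF g]])
      (use c gen_diff_closed[OF g] in \<open>simp_all add: T dd A_def quot_module_simps(1)\<close>)
  then show ?thesis by (simp add: dd T)
qed

end

text \<open>Linearity of the canonical differential is a hypothesis of the locale. For quasi-free
  modules it is discharged by writing this differential as the difference of
  \<open>dg_diff L\<close> and \<open>dth\<close>, both of which are linear.\<close>

locale dg_product = reduced_product K M N
  for K :: "('k, 'c) ring_scheme" and M :: "('k, 'm, 'x) dg_seq_scheme" and N :: "('k, 'n, 'y) dg_seq_scheme" +
  assumes diff_lin: "lin_map K (dg_mod (comp_prod K M N) n d) (dg_mod (comp_prod K M N) n (d - 1)) (dg_diff (comp_prod K M N) n d)"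
begin

abbreviation "del n d X \<equiv> dg_diff (comp_prod K M N) n d X"

lemma del_cls:
  assumes g: "(a, x, ys) \<in> gens M N n d"
  shows "del n d (C n d (a, x, ys)) =
     C n (d - 1) (a - 1, dg_diff M (length ys) a x, ys) \<oplus>[A n (d - 1)]
     (\<Oplus>\<^bsub>A n (d - 1)\<^esub>k\<in>{..<length ys}. ksign K (leib a (in_deg ys) k) \<odot>[A n (d - 1)] C n (d - 1) (a, x, dslot N k ys))"
  using diff_rep[OF g lin_closed[OF diff_lin cls_closed[OF g]]] coset_gen_diff[OF g] by simp

end

section \<open>Chain maps and homotopies on composition products\<close>

lemma (in abelian_group) finsum_cancel:
  assumes "finite I" "P \<in> I \<rightarrow> carrier G" "\<And>k. k \<in> I \<Longrightarrow> Q k = \<ominus> P k"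
  shows "(\<Oplus>k\<in>I. P k) \<oplus> (\<Oplus>k\<in>I. Q k) = \<zero>"
proof -
  have PQ: "P k \<in> carrier G" "Q k \<in> carrier G" if "k \<in> I" for k using assms that by auto
  have "(\<Oplus>k\<in>I. P k) \<oplus> (\<Oplus>k\<in>I. Q k) = (\<Oplus>k\<in>I. P k \<oplus> Q k)"
    by (rule finsum_addf[symmetric]) (use PQ in auto)
  also have "\<dots> = (\<Oplus>k\<in>I. \<zero>)"
    by (rule finsum_cong') (use PQ assms(3) in \<open>auto simp: r_neg\<close>)
  finally show ?thesis by simp
qed

text \<open>For two Leibniz sums with opposite signs everywhere except at the entry on which a
  homotopy acts.\<close>

lemma (in abelian_group) finsum_cancel_except:
  assumes "finite I" "i \<in> I" "P \<in> I \<rightarrow> carrier G" "Q \<in> I \<rightarrow> carrier G"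
    and "\<And>k. k \<in> I \<Longrightarrow> k \<noteq> i \<Longrightarrow> Q k = \<ominus> P k"
  shows "(\<Oplus>k\<in>I. P k) \<oplus> (\<Oplus>k\<in>I. Q k) = P i \<oplus> Q i"
proof -
  have I: "I = insert i (I - {i})" using assms(2) by auto
  have s: "(\<Oplus>k\<in>I. R k) = R i \<oplus> (\<Oplus>k\<in>I - {i}. R k)" if "R \<in> I \<rightarrow> carrier G" for R
    by (subst I, rule finsum_insert) (use assms(1,2) that in auto)
  have "(\<Oplus>k\<in>I - {i}. P k) \<oplus> (\<Oplus>k\<in>I - {i}. Q k) = \<zero>"
    by (rule finsum_cancel) (use assms in auto)
  moreover have "(\<Oplus>k\<in>I - {i}. P k) \<in> carrier G" "(\<Oplus>k\<in>I - {i}. Q k) \<in> carrier G"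
    "P i \<in> carrier G" "Q i \<in> carrier G" using assms by (auto intro!: finsum_closed)
  ultimately show ?thesis
    by (simp add: s[OF assms(3)] s[OF assms(4)]) (metis a_assoc a_comm a_lcomm r_zero a_closed)
qed

abbreviation slot0 where "slot0 \<equiv> slot (\<lambda>_. 0)"

context comp_product begin

lemma leib_shift:
  assumes "\<And>j. j < k \<Longrightarrow> b' j = b j + (if j = i then c else 0)"
  shows "leib a b' k = leib a b k + (if i < k then c else 0)"
proof -
  have "(\<Sum>j<k. b' j) = (\<Sum>j<k. b j + (if j = i then c else 0))"
    by (rule sum.cong) (simp_all add: assms)
  then show ?thesis by (simp add: leib_def sum.distrib)
qed

end

lemma in_dslot:
  assumes "i < length ys"
  shows "in_block (dslot N k ys) i = in_block ys i"
    and "in_deg (dslot N k ys) i = in_deg ys i + (if i = k then - 1 else 0)"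
    and "in_val (dslot N k ys) i =
      (if i = k then dg_diff N (card (in_block ys i)) (in_deg ys i) (in_val ys i) else in_val ys i)"
  using assms by (simp_all add: dslot_def in_slot)

lemma length_dslot [simp]: "length (dslot N k ys) = length ys"
  by (simp add: dslot_def)

lemma sorted_dslot [simp]: "sorted_inputs (dslot N k ys) = sorted_inputs ys"
  by (simp add: dslot_def)

definition entrywise where
  "entrywise K M N M' N' n r f g T \<longleftrightarrow>
     (\<forall>d. is_slot_map K M N M' N' n r 0 (\<lambda>_. 0) f g (\<lambda>_ _. \<one>[K]) d d (T d))"

lemma entrywise_lin: "entrywise K M N M' N' n r f g T \<Longrightarrow>
    lin_map K (dg_mod (comp_prod K M N) n d) (dg_mod (comp_prod K M' N') n d) (T d)"
  by (simp add: entrywise_def is_slot_map_def)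

lemma entrywise_exists:
  assumes "comp_product K M N" "comp_product K M' N'"
    and "\<And>a. lin_map K (dg_mod M r a) (dg_mod M' r a) (f a)"
    and "\<And>i j b. lin_map K (dg_mod N j b) (dg_mod N' j b) (g i j b)"
  shows "\<exists>T. entrywise K M N M' N' n r f g T"
proof -
  interpret S: comp_product K M N by fact
  have "\<forall>d. \<exists>T. is_slot_map K M N M' N' n r 0 (\<lambda>_. 0) f g (\<lambda>_ _. \<one>[K]) d d T"
    by (intro allI slot_map_exists[OF assms(1,2)]) (simp_all add: assms(3,4))
  then show ?thesis unfolding entrywise_def by (rule choice)
qed

lemma slot0_gens:
  assumes "comp_product K M N"
    and "lin_map K (dg_mod M (length ys) a) (dg_mod M' (length ys) a) (f a)"
    and "\<And>i j b. lin_map K (dg_mod N j b) (dg_mod N' j b) (g i j b)"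
    and "(a, x, ys) \<in> gens M N n d"
  shows "(a, f a x, slot0 g ys) \<in> gens M' N' n d"
  using slot_gens[OF assms(1), of ys a M' 0 f N' "\<lambda>_. 0" g d d x n] assms(2-) by simp

lemma entrywise_cls:
  assumes "comp_product K M N" "comp_product K M' N'" "entrywise K M N M' N' n r f g T"
    and "\<And>a. lin_map K (dg_mod M r a) (dg_mod M' r a) (f a)"
    and "\<And>i j b. lin_map K (dg_mod N j b) (dg_mod N' j b) (g i j b)"
    and "(a, x, ys) \<in> sgens M N n d"
  shows "T d (cls K M N n d (a, x, ys)) =
     (if length ys = r then cls K M' N' n d (a, f a x, slot0 g ys) else \<zero>[dg_mod (comp_prod K M' N') n d])"
proof -
  interpret T: comp_product K M' N' by fact
  have "T d (cls K M N n d (a, x, ys)) = (if length ys = r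
     then \<one>[K] \<odot>[T.A n d] cls K M' N' n d (a + 0, f a x, slot0 g ys) else \<zero>[T.A n d])"
    using assms(3,6) unfolding entrywise_def is_slot_map_def by blast
  moreover have "cls K M' N' n d (a, f a x, slot0 g ys) \<in> T.cA n d" if "length ys = r"
    by (rule T.cls_closed, rule slot0_gens[OF assms(1) _ assms(5) sgensD(1)[OF assms(6)]]) (simp add: assms(4) that)
  ultimately show ?thesis by simp
qed

lemma entrywise_compose:
  assumes "reduced_product K M N" "comp_product K M' N'" "comp_product K M'' N''"
    and T: "entrywise K M N M' N' n r f g T" and T': "entrywise K M' N' M'' N'' n r f' g' T'"
    and f: "\<And>a. lin_map K (dg_mod M r a) (dg_mod M' r a) (f a)"
    and g: "\<And>i j b. lin_map K (dg_mod N j b) (dg_mod N' j b) (g i j b)"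
    and f': "\<And>a. lin_map K (dg_mod M' r a) (dg_mod M'' r a) (f' a)"
    and g': "\<And>i j b. lin_map K (dg_mod N' j b) (dg_mod N'' j b) (g' i j b)"
  shows "entrywise K M N M'' N'' n r (\<lambda>a x. f' a (f a x)) (\<lambda>i j b y. g' i j b (g i j b y)) (\<lambda>d X. T' d (T d X))"
  unfolding entrywise_def is_slot_map_def
proof (intro allI conjI impI)
  interpret S: reduced_product K M N by fact
  interpret T: comp_product K M' N' by fact
  interpret U: comp_product K M'' N'' by fact
  fix d show "lin_map K (S.A n d) (U.A n d) (\<lambda>X. T' d (T d X))"
    by (rule lin_comp[OF entrywise_lin[OF T] entrywise_lin[OF T']])
  fix a x ys assume h: "(a, x, ys) \<in> sgens M N n d"
  show "T' d (T d (cls K M N n d (a, x, ys))) = (if length ys = r then \<one>[K] \<odot>[U.A n d]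
     cls K M'' N'' n d (a + 0, f' a (f a x), slot0 (\<lambda>i j b y. g' i j b (g i j b y)) ys) else \<zero>[U.A n d])"
  proof (cases "length ys = r")
    case False
    then show ?thesis
      by (simp add: entrywise_cls[OF S.comp_product_axioms T.comp_product_axioms T f g h]
        lin_zero[OF T.module_A U.module_A entrywise_lin[OF T']])
  next
    case True
    have 1: "(a, f a x, slot0 g ys) \<in> sgens M' N' n d"
      by (intro sgensI slot0_gens[OF S.comp_product_axioms _ g sgensD(1)[OF h]])
        (simp_all add: True f sgensD(2)[OF h])
    have 2: "slot0 g' (slot0 g ys) = slot0 (\<lambda>i j b y. g' i j b (g i j b y)) ys"
      by (rule inputs_eqI) (simp_all add: in_slot)
    have "cls K M'' N'' n d (a, f' a (f a x), slot0 g' (slot0 g ys)) \<in> carrier (U.A n d)"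
      by (rule U.cls_closed, rule slot0_gens[OF T.comp_product_axioms _ g' sgensD(1)[OF 1]]) (simp add: True f')
    then show ?thesis using True
      by (simp add: entrywise_cls[OF S.comp_product_axioms T.comp_product_axioms T f g h]
        entrywise_cls[OF T.comp_product_axioms U.comp_product_axioms T' f' g' 1] 2)
  qed
qed

context dg_product
begin

lemma lin_del:
  assumes "module K B" "lin_map K (A n (d - 1)) B H" "(a, x, ys) \<in> gens M N n d"
  shows "H (del n d (C n d (a, x, ys))) = H (C n (d - 1) (a - 1, dg_diff M (length ys) a x, ys)) \<oplus>[B]
     (\<Oplus>\<^bsub>B\<^esub>k\<in>{..<length ys}. ksign K (leib a (in_deg ys) k) \<odot>[B] H (C n (d - 1) (a, x, dslot N k ys)))"
proof -
  interpret B: module K B by fact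
  let ?A = "A n (d - 1)"
  let ?t = "\<lambda>k. ksign K (leib a (in_deg ys) k) \<odot>[?A] C n (d - 1) (a, x, dslot N k ys)"
  have c: "C n (d - 1) (a, x, dslot N k ys) \<in> carrier ?A" if "k < length ys" for k
    by (rule cls_closed[OF gens_dslot[OF assms(3) that]])
  have t: "?t \<in> {..<length ys} \<rightarrow> carrier ?A"
    by (intro Pi_I A.smult_closed ksign_closed[OF K] c) simp
  have "H (\<Oplus>\<^bsub>?A\<^esub>k\<in>{..<length ys}. ?t k) = (\<Oplus>\<^bsub>B\<^esub>k\<in>{..<length ys}. H (?t k))"
    by (rule lin_finsum[OF module_A assms(1,2) _ t]) simp
  also have "\<dots> = (\<Oplus>\<^bsub>B\<^esub>k\<in>{..<length ys}. ksign K (leib a (in_deg ys) k) \<odot>[B] H (C n (d - 1) (a, x, dslot N k ys)))"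
    by (rule B.finsum_cong'[OF refl])
      (simp_all add: Pi_def lin_smult[OF assms(2) ksign_closed[OF K] c] ksign_closed[OF K]
        lin_closed[OF assms(2) c])
  finally show ?thesis
    unfolding del_cls[OF assms(3)]
    using lin_add[OF assms(2) cls_closed[OF gens_diff_root[OF assms(3)]] A.finsum_closed[OF t]] by simp
qed

lemma sgens_diff_root: "(a, x, ys) \<in> sgens M N n d \<Longrightarrow> (a - 1, dg_diff M (length ys) a x, ys) \<in> sgens M N n (d - 1)"
  by (intro sgensI gens_diff_root) (simp_all add: sgens_def)

lemma sgens_dslot: "(a, x, ys) \<in> sgens M N n d \<Longrightarrow> k < length ys \<Longrightarrow> (a, x, dslot N k ys) \<in> sgens M N n (d - 1)"
  by (intro sgensI gens_dslot) (simp_all add: sgens_def)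

lemma slot0_dslot:
  assumes "valid_inputs N n ys" "k < length ys"
    and chain: "\<And>i j b y. y \<in> elts N j b \<Longrightarrow> g i j (b - 1) (dg_diff N j b y) = dg_diff N' j b (g i j b y)"
  shows "slot0 g (dslot N k ys) = dslot N' k (slot0 g ys)"
  by (rule inputs_eqI)
    (use assms(1,2) in \<open>simp_all add: in_slot in_dslot chain valid_inputs_iff\<close>)

lemma lin_del_zero:
  assumes "module K B" "lin_map K (A n (d - 1)) B H" "(a, x, ys) \<in> sgens M N n d"
    and "\<And>a' x' zs. (a', x', zs) \<in> sgens M N n (d - 1) \<Longrightarrow> length zs = length ys \<Longrightarrow>
      H (C n (d - 1) (a', x', zs)) = \<zero>[B]"
  shows "H (del n d (C n d (a, x, ys))) = \<zero>[B]"
proof -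
  interpret B: module K B by fact
  have "(\<Oplus>\<^bsub>B\<^esub>k\<in>{..<length ys}. ksign K (leib a (in_deg ys) k) \<odot>[B] H (C n (d - 1) (a, x, dslot N k ys))) =
      (\<Oplus>\<^bsub>B\<^esub>k\<in>{..<length ys}. \<zero>[B])"
    by (rule B.finsum_cong'[OF refl]) (simp_all add: assms(4)[OF sgens_dslot[OF assms(3)]] ksign_closed[OF K])
  then show ?thesis
    unfolding lin_del[OF assms(1,2) sgensD(1)[OF assms(3)]]
    by (simp add: assms(4)[OF sgens_diff_root[OF assms(3)]])
qed

end

text \<open>The two Leibniz sums agree term by term: an entrywise map keeps all degrees, hence all
  signs, and each entry is a chain map.\<close>

lemma entrywise_chain:
  assumes "dg_product K M N" "dg_product K M' N'" and T: "entrywise K M N M' N' n r f g T"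
    and f: "\<And>a. lin_map K (dg_mod M r a) (dg_mod M' r a) (f a)"
    and fc: "\<And>a x. x \<in> elts M r a \<Longrightarrow> f (a - 1) (dg_diff M r a x) = dg_diff M' r a (f a x)"
    and g: "\<And>i j b. lin_map K (dg_mod N j b) (dg_mod N' j b) (g i j b)"
    and gc: "\<And>i j b y. y \<in> elts N j b \<Longrightarrow> g i j (b - 1) (dg_diff N j b y) = dg_diff N' j b (g i j b y)"
    and X: "X \<in> elts (comp_prod K M N) n d"
  shows "T (d - 1) (dg_diff (comp_prod K M N) n d X) = dg_diff (comp_prod K M' N') n d (T d X)"
proof -
  interpret S: dg_product K M N by fact
  interpret T: dg_product K M' N' by fact
  note Tl = entrywise_lin[OF T]
  note Tc = entrywise_cls[OF S.comp_product_axioms T.comp_product_axioms T f g]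
  show ?thesis
  proof (rule S.lin_eq_on_sorted[OF T.module_A lin_comp[OF S.diff_lin Tl] lin_comp[OF Tl T.diff_lin] _ X])
    fix a x ys assume h: "(a, x, ys) \<in> sgens M N n d"
    note hg = sgensD(1)[OF h]
    note gD = S.gensD[OF hg]
    show "T (d - 1) (S.del n d (cls K M N n d (a, x, ys))) = T.del n d (T d (cls K M N n d (a, x, ys)))"
    proof (cases "length ys = r")
      case False
      have "T (d - 1) (S.del n d (cls K M N n d (a, x, ys))) = \<zero>[T.A n (d - 1)]"
        by (rule S.lin_del_zero[OF T.module_A Tl h]) (simp add: Tc False)
      then show ?thesis using False
        by (simp add: Tc[OF h] lin_zero[OF T.module_A T.module_A T.diff_lin])
    next
      case True
      have g1: "(a, f a x, slot0 g ys) \<in> gens M' N' n d"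
        by (rule slot0_gens[OF S.comp_product_axioms _ g hg]) (simp add: f True)
      have d1: "in_deg (slot0 g ys) j = in_deg ys j" if "j < length ys" for j using that by (simp add: in_slot)
      have ld: "T.leib a (in_deg (slot0 g ys)) k = S.leib a (in_deg ys) k" if "k < length ys" for k
        using that by (simp add: T.leib_def S.leib_def d1)
      have x: "x \<in> elts M r a" using gD(1) True by simp
      have tr: "T (d - 1) (S.C n (d - 1) (a - 1, dg_diff M r a x, ys)) =
          T.C n (d - 1) (a - 1, dg_diff M' r a (f a x), slot0 g ys)"
        using Tc[OF S.sgens_diff_root[OF h]] True by (simp add: fc[OF x])
      have "T (d - 1) (S.del n d (cls K M N n d (a, x, ys))) =
        T.C n (d - 1) (a - 1, dg_diff M' r a (f a x), slot0 g ys) \<oplus>[T.A n (d - 1)]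
        (\<Oplus>\<^bsub>T.A n (d - 1)\<^esub>k\<in>{..<length ys}. ksign K (S.leib a (in_deg ys) k) \<odot>[T.A n (d - 1)]
           T (d - 1) (S.C n (d - 1) (a, x, dslot N k ys)))"
        unfolding S.lin_del[OF T.module_A Tl hg] using True
        by (simp add: tr)
      also have "(\<Oplus>\<^bsub>T.A n (d - 1)\<^esub>k\<in>{..<length ys}. ksign K (S.leib a (in_deg ys) k) \<odot>[T.A n (d - 1)]
           T (d - 1) (S.C n (d - 1) (a, x, dslot N k ys))) =
        (\<Oplus>\<^bsub>T.A n (d - 1)\<^esub>k\<in>{..<length ys}. ksign K (T.leib a (in_deg (slot0 g ys)) k) \<odot>[T.A n (d - 1)]
           T.C n (d - 1) (a, f a x, dslot N' k (slot0 g ys)))"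
      proof (rule T.A.finsum_cong'[OF refl])
        show "(\<lambda>k. ksign K (T.leib a (in_deg (slot0 g ys)) k) \<odot>[T.A n (d - 1)]
           T.C n (d - 1) (a, f a x, dslot N' k (slot0 g ys))) \<in> {..<length ys} \<rightarrow> T.cA n (d - 1)"
          by (intro Pi_I T.A.smult_closed ksign_closed[OF S.K] T.cls_closed T.gens_dslot[OF g1]) simp
        fix k assume "k \<in> {..<length ys}"
        then have k: "k < length ys" by simp
        have sd: "slot0 g (dslot N k ys) = dslot N' k (slot0 g ys)" by (rule S.slot0_dslot[OF gD(2) k gc])
        show "ksign K (S.leib a (in_deg ys) k) \<odot>[T.A n (d - 1)] T (d - 1) (S.C n (d - 1) (a, x, dslot N k ys)) =
           ksign K (T.leib a (in_deg (slot0 g ys)) k) \<odot>[T.A n (d - 1)] T.C n (d - 1) (a, f a x, dslot N' k (slot0 g ys))"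
          using True by (simp add: Tc[OF S.sgens_dslot[OF h k]] ld[OF k] sd)
      qed
      also have "T.C n (d - 1) (a - 1, dg_diff M' r a (f a x), slot0 g ys) \<oplus>[T.A n (d - 1)]
        (\<Oplus>\<^bsub>T.A n (d - 1)\<^esub>k\<in>{..<length ys}. ksign K (T.leib a (in_deg (slot0 g ys)) k) \<odot>[T.A n (d - 1)]
           T.C n (d - 1) (a, f a x, dslot N' k (slot0 g ys))) = T.del n d (T d (cls K M N n d (a, x, ys)))"
        using True by (simp add: Tc[OF h] T.del_cls[OF g1])
      finally show ?thesis .
    qed
  qed
qed

lemma (in abelian_group) cancel_frame:
  assumes "c \<in> carrier G" "p \<in> carrier G" "q \<in> carrier G" "c' = \<ominus> c" "p \<oplus> q = w"
  shows "(c \<oplus> p) \<oplus> (c' \<oplus> q) = w"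
proof -
  have "(c \<oplus> p) \<oplus> (c' \<oplus> q) = p \<oplus> q"
    unfolding assms(4) using assms(1-3) by (simp add: a_ac cancels)
  then show ?thesis using assms(5) by simp
qed

lemma ksign_mult:
  assumes "module K A" "x \<in> carrier A"
  shows "ksign K e \<odot>[A] (ksign K e' \<odot>[A] x) = ksign K (e + e') \<odot>[A] x"
proof -
  interpret A: module K A by fact
  show ?thesis using assms(2) ksign_closed[OF A.is_cring]
    by (simp add: ksign_add[OF A.is_cring] A.smult_assoc1)
qed

lemma ksign_neg:
  assumes "module K A" "x \<in> carrier A" "odd (e - e')"
  shows "ksign K e \<odot>[A] x = \<ominus>[A] (ksign K e' \<odot>[A] x)"
proof -
  interpret A: module K A by fact
  show ?thesis using assms(2,3) by (auto simp: ksign_def A.smult_l_minus)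
qed

section \<open>Homotopies between entrywise maps\<close>

context dg_product
begin

definition homotopic where
  "homotopic n F G \<longleftrightarrow> (\<exists>H. (\<forall>d. lin_map K (A n d) (A n (d + 1)) (H d)) \<and>
     (\<forall>d. \<forall>X\<in>cA n d. F d X = G d X \<oplus>[A n d] (del n (d + 1) (H d X) \<oplus>[A n d] H (d - 1) (del n d X))))"

lemma homotopic_trans:
  assumes "homotopic n F G" "homotopic n G E" "\<And>d X. X \<in> cA n d \<Longrightarrow> E d X \<in> cA n d"
  shows "homotopic n F E"
proof -
  obtain H where H: "\<And>d. lin_map K (A n d) (A n (d + 1)) (H d)" "\<And>d X. X \<in> cA n d \<Longrightarrow>
      F d X = G d X \<oplus>[A n d] (del n (d + 1) (H d X) \<oplus>[A n d] H (d - 1) (del n d X))"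
    using assms(1) unfolding homotopic_def by blast
  obtain H' where H': "\<And>d. lin_map K (A n d) (A n (d + 1)) (H' d)" "\<And>d X. X \<in> cA n d \<Longrightarrow>
      G d X = E d X \<oplus>[A n d] (del n (d + 1) (H' d X) \<oplus>[A n d] H' (d - 1) (del n d X))"
    using assms(2) unfolding homotopic_def by blast
  have *: "F d X = E d X \<oplus>[A n d] (del n (d + 1) (H d X \<oplus>[A n (d + 1)] H' d X) \<oplus>[A n d]
      (H (d - 1) (del n d X) \<oplus>[A n d] H' (d - 1) (del n d X)))" if X: "X \<in> cA n d" for d X
  proof -
    note c = lin_closed[OF H(1) X] lin_closed[OF H'(1) X]
    note dX = lin_closed[OF diff_lin X]
    have c1: "del n (d + 1) (H d X) \<in> cA n d" "del n (d + 1) (H' d X) \<in> cA n d"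
      using lin_closed[OF diff_lin c(1)] lin_closed[OF diff_lin c(2)] by simp_all
    have c2: "H (d - 1) (del n d X) \<in> cA n d" "H' (d - 1) (del n d X) \<in> cA n d"
      using lin_closed[OF H(1) dX] lin_closed[OF H'(1) dX] by simp_all
    have dd: "del n (d + 1) (H d X \<oplus>[A n (d + 1)] H' d X) = del n (d + 1) (H d X) \<oplus>[A n d] del n (d + 1) (H' d X)"
      using lin_add[OF diff_lin c] by simp
    show ?thesis unfolding H(2)[OF X] H'(2)[OF X] dd using c1 c2 assms(3)[OF X] by (simp add: A.a_ac)
  qed
  show ?thesis unfolding homotopic_def
    by (rule exI[of _ "\<lambda>d X. H d X \<oplus>[A n (d + 1)] H' d X"])
      (use * lin_plus[OF module_A module_A H(1) H'(1)] in simp)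
qed

lemma homotopic_refl:
  assumes "\<And>d X. X \<in> cA n d \<Longrightarrow> F d X = G d X" "\<And>d X. X \<in> cA n d \<Longrightarrow> G d X \<in> cA n d"
  shows "homotopic n F G"
  unfolding homotopic_def
proof (intro exI[of _ "\<lambda>d X. \<zero>[A n (d + 1)]"] conjI allI ballI)
  fix d show "lin_map K (A n d) (A n (d + 1)) (\<lambda>X. \<zero>[A n (d + 1)])" by (rule lin_const_zero[OF module_A])
  fix X assume X: "X \<in> cA n d"
  have "del n (d + 1) \<zero>[A n (d + 1)] = \<zero>[A n d]" using lin_zero[OF module_A module_A diff_lin, of n "d + 1"] by simp
  then show "F d X = G d X \<oplus>[A n d] (del n (d + 1) \<zero>[A n (d + 1)] \<oplus>[A n d] \<zero>[A n (d - 1 + 1)])"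
    using assms X by simp
qed

lemma homotopic_on_sorted:
  assumes H: "\<And>d. lin_map K (A n d) (A n (d + 1)) (H d)"
    and F: "\<And>d. lin_map K (A n d) (A n d) (F d)" and G: "\<And>d. lin_map K (A n d) (A n d) (G d)"
    and eq: "\<And>d a x ys. (a, x, ys) \<in> sgens M N n d \<Longrightarrow> F d (C n d (a, x, ys)) = G d (C n d (a, x, ys)) \<oplus>[A n d]
      (del n (d + 1) (H d (C n d (a, x, ys))) \<oplus>[A n d] H (d - 1) (del n d (C n d (a, x, ys))))"
  shows "homotopic n F G"
  unfolding homotopic_def
proof (intro exI[of _ H] conjI allI ballI)
  fix d show "lin_map K (A n d) (A n (d + 1)) (H d)" by (rule H)
  have 1: "lin_map K (A n d) (A n d) (\<lambda>X. del n (d + 1) (H d X))"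
    using lin_comp[OF H[of d] diff_lin] by simp
  have 2: "lin_map K (A n d) (A n d) (\<lambda>X. H (d - 1) (del n d X))"
    using lin_comp[OF diff_lin H[of "d - 1"]] by simp
  fix X assume X: "X \<in> cA n d"
  show "F d X = G d X \<oplus>[A n d] (del n (d + 1) (H d X) \<oplus>[A n d] H (d - 1) (del n d X))"
    by (rule lin_eq_on_sorted[where f = "F d" and
        g = "\<lambda>X. G d X \<oplus>[A n d] (del n (d + 1) (H d X) \<oplus>[A n d] H (d - 1) (del n d X))",
        OF module_A F lin_plus[OF module_A module_A G lin_plus[OF module_A module_A 1 2]] eq X])
qed

text \<open>Off the part with \<open>r\<close> inputs all maps vanish, so the homotopy identity is trivial there.\<close>

lemma homotopy_off:
  assumes H: "\<And>d. is_slot_map K M N M N n r e u f g \<sigma> d (d + 1) (H d)"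
    and F: "entrywise K M N M N n r f1 g1 F" "entrywise K M N M N n r f2 g2 G"
    and h: "(a, x, ys) \<in> sgens M N n d" "length ys \<noteq> r"
  shows "F d (C n d (a, x, ys)) = G d (C n d (a, x, ys)) \<oplus>[A n d]
      (del n (d + 1) (H d (C n d (a, x, ys))) \<oplus>[A n d] H (d - 1) (del n d (C n d (a, x, ys))))"
proof -
  have Hl: "lin_map K (A n d) (A n (d + 1)) (H d)" for d using H[of d] by (simp add: is_slot_map_def)
  have Hz: "H d' (C n d' (a', x', zs)) = \<zero>[A n (d' + 1)]"
    if "(a', x', zs) \<in> sgens M N n d'" "length zs \<noteq> r" for a' x' zs d'
    using H[of d'] that unfolding is_slot_map_def by simp
  have "F d (C n d (a, x, ys)) = \<zero>[A n d]" "G d (C n d (a, x, ys)) = \<zero>[A n d]"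
    using F h unfolding entrywise_def is_slot_map_def by simp_all
  moreover have "H (d - 1) (del n d (C n d (a, x, ys))) = \<zero>[A n d]"
    using lin_del_zero[OF module_A Hl h(1)] Hz h(2) by simp
  moreover have "del n (d + 1) (H d (C n d (a, x, ys))) = \<zero>[A n d]"
    using Hz[OF h] lin_zero[OF module_A module_A diff_lin, of n "d + 1"] by simp
  ultimately show ?thesis by simp
qed

text \<open>The homotopy applies \<open>h\<close> to the root and \<open>g\<close> to the inputs.
  Raising the degree of the root by one flips every Leibniz sign, so the input terms of
  \<open>\<delta>H\<close> and \<open>H\<delta>\<close> cancel and the root terms remain.\<close>

lemma root_homotopy:
  assumes f: "\<And>a. lin_map K (dg_mod M r a) (dg_mod M r a) (f a)"
    and f': "\<And>a. lin_map K (dg_mod M r a) (dg_mod M r a) (f' a)"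
    and h: "\<And>a. lin_map K (dg_mod M r a) (dg_mod M r (a + 1)) (h a)"
    and hom: "\<And>a x. x \<in> elts M r a \<Longrightarrow>
      f a x = f' a x \<oplus>[dg_mod M r a] (dg_diff M r (a + 1) (h a x) \<oplus>[dg_mod M r a] h (a - 1) (dg_diff M r a x))"
    and g: "\<And>i j b. lin_map K (dg_mod N j b) (dg_mod N j b) (g i j b)"
    and gc: "\<And>i j b y. y \<in> elts N j b \<Longrightarrow> g i j (b - 1) (dg_diff N j b y) = dg_diff N j b (g i j b y)"
    and E: "entrywise K M N M N n r f g E" and E': "entrywise K M N M N n r f' g E'"
  shows "homotopic n E E'"
proof -
  have "\<forall>d. \<exists>T. is_slot_map K M N M N n r 1 (\<lambda>_. 0) h g (\<lambda>_ _. \<one>[K]) d (d + 1) T"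
    by (intro allI slot_map_exists[OF comp_product_axioms comp_product_axioms]) (simp_all add: h g)
  then obtain H where H: "\<And>d. is_slot_map K M N M N n r 1 (\<lambda>_. 0) h g (\<lambda>_ _. \<one>[K]) d (d + 1) (H d)" by metis
  have Hl: "lin_map K (A n d) (A n (d + 1)) (H d)" for d using H[of d] by (simp add: is_slot_map_def)
  have hg: "(a + 1, h a x, slot0 g ys) \<in> gens M N n (d + 1)" if "(a, x, ys) \<in> gens M N n d" "length ys = r" for a x ys d
    by (rule slot_gens[OF comp_product_axioms _ _ _ that(1)]) (simp_all add: h g that(2))
  have Hc: "H d (C n d (a, x, ys)) = C n (d + 1) (a + 1, h a x, slot0 g ys)"
    if "(a, x, ys) \<in> sgens M N n d" "length ys = r" for a x ys d
    using H[of d] that hg[OF sgensD(1)[OF that(1)] that(2)] unfolding is_slot_map_def by simp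
  show ?thesis
  proof (rule homotopic_on_sorted[OF Hl entrywise_lin[OF E] entrywise_lin[OF E']])
    fix d a x ys assume s: "(a, x, ys) \<in> sgens M N n d"
    note sg = sgensD(1)[OF s]
    show "E d (C n d (a, x, ys)) = E' d (C n d (a, x, ys)) \<oplus>[A n d]
      (del n (d + 1) (H d (C n d (a, x, ys))) \<oplus>[A n d] H (d - 1) (del n d (C n d (a, x, ys))))"
    proof (cases "length ys = r")
      case False
      then show ?thesis by (rule homotopy_off[OF H E E' s])
    next
      case True
      let ?Z = "slot0 g ys" and ?A = "A n d"
      have x: "x \<in> elts M r a" using gensD(1)[OF sg] True by simp
      have Zg: "(a, z, ?Z) \<in> gens M N n d" if "z \<in> elts M r a" for z
        by (rule gens_root[OF slot0_gens[where f = "\<lambda>_ x. x", OF comp_product_axioms _ g sg]])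
          (simp_all add: lin_id True that)
      have dx: "dg_diff M r a x \<in> elts M r (a - 1)" by (rule lin_closed[OF diff_M x])
      have c1: "dg_diff M r (a + 1) (h a x) \<in> elts M r a"
        using lin_closed[OF diff_M lin_closed[OF h x]] by simp
      have c2: "h (a - 1) (dg_diff M r a x) \<in> elts M r a" using lin_closed[OF h dx] by simp
      define P where "P k = ksign K (leib (a + 1) (in_deg ?Z) k) \<odot>[?A] C n d (a + 1, h a x, dslot N k ?Z)" for k
      define Q where "Q k = ksign K (leib a (in_deg ys) k) \<odot>[?A] C n d (a + 1, h a x, dslot N k ?Z)" for k
      have hZ: "(a + 1, h a x, ?Z) \<in> gens M N n (d + 1)" by (rule hg[OF sg True])
      have cP: "C n d (a + 1, h a x, dslot N k ?Z) \<in> carrier ?A" if "k < r" for k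
        using cls_closed[OF gens_dslot[OF hZ]] that True by simp
      have PQ: "Q k = \<ominus>[?A] P k" if "k \<in> {..<r}" for k
      proof -
        have "leib (a + 1) (in_deg ?Z) k = leib a (in_deg ys) k + 1"
          using that True by (simp add: leib_def in_slot)
        then show ?thesis unfolding P_def Q_def using cP that by (intro ksign_neg[OF module_A]) simp_all
      qed
      have Pc: "P \<in> {..<r} \<rightarrow> carrier ?A" "Q \<in> {..<r} \<rightarrow> carrier ?A"
        using cP by (simp_all add: P_def Q_def Pi_def ksign_closed[OF K])
      have 1: "del n (d + 1) (H d (C n d (a, x, ys))) =
          C n d (a, dg_diff M r (a + 1) (h a x), ?Z) \<oplus>[?A] (\<Oplus>\<^bsub>?A\<^esub>k\<in>{..<r}. P k)"
        using del_cls[OF hZ] True by (simp add: Hc[OF s True] P_def)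
      have tr: "H (d - 1) (C n (d - 1) (a - 1, dg_diff M r a x, ys)) = C n d (a, h (a - 1) (dg_diff M r a x), ?Z)"
        using Hc[OF sgens_diff_root[OF s] True] True by simp
      have "(\<Oplus>\<^bsub>?A\<^esub>k\<in>{..<r}. ksign K (leib a (in_deg ys) k) \<odot>[?A] H (d - 1) (C n (d - 1) (a, x, dslot N k ys))) =
          (\<Oplus>\<^bsub>?A\<^esub>k\<in>{..<r}. Q k)"
      proof (rule A.finsum_cong'[OF refl Pc(2)])
        fix k assume "k \<in> {..<r}"
        then have k: "k < length ys" using True by simp
        show "ksign K (leib a (in_deg ys) k) \<odot>[?A] H (d - 1) (C n (d - 1) (a, x, dslot N k ys)) = Q k"
        proof -
          have "slot0 g (dslot N k ys) = dslot N k ?Z" by (rule slot0_dslot[OF gensD(2)[OF sg] k gc])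
          then show ?thesis using Hc[OF sgens_dslot[OF s k]] True by (simp add: Q_def)
        qed
      qed
      then have 2: "H (d - 1) (del n d (C n d (a, x, ys))) =
          C n d (a, h (a - 1) (dg_diff M r a x), ?Z) \<oplus>[?A] (\<Oplus>\<^bsub>?A\<^esub>k\<in>{..<r}. Q k)"
        using lin_del[OF module_A _ sg, of _ _ "H (d - 1)"] Hl[of "d - 1"] True tr by simp
      have 3: "(\<Oplus>\<^bsub>?A\<^esub>k\<in>{..<r}. P k) \<oplus>[?A] (\<Oplus>\<^bsub>?A\<^esub>k\<in>{..<r}. Q k) = \<zero>[?A]"
        by (rule A.finsum_cancel[OF _ Pc(1) PQ]) simp_all
      note cl = cls_closed[OF Zg[OF c1]] cls_closed[OF Zg[OF c2]] cls_closed[OF Zg[OF lin_closed[OF f' x]]]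
      have 4: "del n (d + 1) (H d (C n d (a, x, ys))) \<oplus>[?A] H (d - 1) (del n d (C n d (a, x, ys))) =
          C n d (a, dg_diff M r (a + 1) (h a x), ?Z) \<oplus>[?A] C n d (a, h (a - 1) (dg_diff M r a x), ?Z)"
      proof -
        have "(p \<oplus>[?A] s) \<oplus>[?A] (q \<oplus>[?A] t) = p \<oplus>[?A] q"
          if "p \<in> carrier ?A" "q \<in> carrier ?A" "s \<in> carrier ?A" "t \<in> carrier ?A" "s \<oplus>[?A] t = \<zero>[?A]" for p q s t
          using that by (metis A.a_assoc A.a_comm A.a_closed A.r_zero)
        then show ?thesis unfolding 1 2 using cl 3 A.finsum_closed[OF Pc(1)] A.finsum_closed[OF Pc(2)] by blast
      qed
      have "E d (C n d (a, x, ys)) = C n d (a, f a x, ?Z)" "E' d (C n d (a, x, ys)) = C n d (a, f' a x, ?Z)"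
        using entrywise_cls[OF comp_product_axioms comp_product_axioms E f g s]
          entrywise_cls[OF comp_product_axioms comp_product_axioms E' f' g s] True by simp_all
      moreover have "C n d (a, f a x, ?Z) = C n d (a, f' a x, ?Z) \<oplus>[?A]
          (C n d (a, dg_diff M r (a + 1) (h a x), ?Z) \<oplus>[?A] C n d (a, h (a - 1) (dg_diff M r a x), ?Z))"
        using cls_add_root[OF Zg[OF lin_closed[OF f' x]], of "dg_diff M r (a + 1) (h a x) \<oplus>[dg_mod M r a] h (a - 1) (dg_diff M r a x)"]
          cls_add_root[OF Zg[OF c1], of "h (a - 1) (dg_diff M r a x)"] True c1 c2 by (simp add: hom[OF x])
      ultimately show ?thesis using 4 by simp
    qed
  qed
qed

text \<open>The homotopy applies \<open>h\<close> to entry \<open>i\<close> with the Koszul sign of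
  a degree one map that passes the root and the earlier inputs. The root terms and the Leibniz terms
  at the other entries cancel in pairs; at entry \<open>i\<close> both signs become squares and the
  two summands of the given homotopy remain. The identity \<open>hom\<close> is asked only for
  \<open>j + r \<le> n + 1\<close>, since the other \<open>r - 1\<close> nonempty blocks occupy at
  least \<open>r - 1\<close> of the \<open>n\<close> points.\<close>

lemma input_homotopy:
  assumes i: "i < r"
    and f: "\<And>a. lin_map K (dg_mod M r a) (dg_mod M r a) (f a)"
    and fc: "\<And>a x. x \<in> elts M r a \<Longrightarrow> f (a - 1) (dg_diff M r a x) = dg_diff M r a (f a x)"
    and g: "\<And>i j b. lin_map K (dg_mod N j b) (dg_mod N j b) (g i j b)"
    and gc: "\<And>i j b y. y \<in> elts N j b \<Longrightarrow> g i j (b - 1) (dg_diff N j b y) = dg_diff N j b (g i j b y)"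
    and g': "\<And>j b. lin_map K (dg_mod N j b) (dg_mod N j b) (g' j b)"
    and h: "\<And>j b. lin_map K (dg_mod N j b) (dg_mod N j (b + 1)) (h j b)"
    and hom: "\<And>j b y. j + r \<le> n + 1 \<Longrightarrow> y \<in> elts N j b \<Longrightarrow>
      g i j b y = g' j b y \<oplus>[dg_mod N j b] (dg_diff N j (b + 1) (h j b y) \<oplus>[dg_mod N j b] h j (b - 1) (dg_diff N j b y))"
    and E: "entrywise K M N M N n r f g E" and E': "entrywise K M N M N n r f (g(i := g')) E'"
  shows "homotopic n E E'"
proof -
  let ?u = "\<lambda>j. if j = i then 1 else 0 :: int" and ?gh = "g(i := h)" and ?s = "\<lambda>a b. ksign K (leib a b i)"
  have gh: "lin_map K (dg_mod N j b) (dg_mod N j (b + ?u k)) (?gh k j b)" for k j b using g h by simp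
  have gi': "lin_map K (dg_mod N j b) (dg_mod N j b) ((g(i := g')) k j b)" for k j b using g g' by simp
  have "\<forall>d. \<exists>T. is_slot_map K M N M N n r 0 ?u f ?gh ?s d (d + 1) T"
    by (intro allI slot_map_exists[OF comp_product_axioms comp_product_axioms])
      (use i f gh in \<open>simp_all add: ksign_closed[OF K]\<close>)
  then obtain H where H: "\<And>d. is_slot_map K M N M N n r 0 ?u f ?gh ?s d (d + 1) (H d)" by metis
  have Hl: "lin_map K (A n d) (A n (d + 1)) (H d)" for d using H[of d] by (simp add: is_slot_map_def)
  have hg: "(a, f a x, slot ?u ?gh ys) \<in> gens M N n (d + 1)" if "(a, x, ys) \<in> gens M N n d" "length ys = r" for a x ys d
    using slot_gens[OF comp_product_axioms, of ys a M 0 f N ?u ?gh "d + 1" d x n] f gh that i by simp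
  have Hc: "H d (C n d (a, x, ys)) = ?s a (in_deg ys) \<odot>[A n (d + 1)] C n (d + 1) (a, f a x, slot ?u ?gh ys)"
    if "(a, x, ys) \<in> sgens M N n d" "length ys = r" for a x ys d
    using H[of d] that unfolding is_slot_map_def by simp
  show ?thesis
  proof (rule homotopic_on_sorted[OF Hl entrywise_lin[OF E] entrywise_lin[OF E']])
    fix d a x ys assume s: "(a, x, ys) \<in> sgens M N n d"
    note sg = sgensD(1)[OF s]
    note gD = gensD[OF sg]
    show "E d (C n d (a, x, ys)) = E' d (C n d (a, x, ys)) \<oplus>[A n d]
      (del n (d + 1) (H d (C n d (a, x, ys))) \<oplus>[A n d] H (d - 1) (del n d (C n d (a, x, ys))))"
    proof (cases "length ys = r")
      case False
      then show ?thesis by (rule homotopy_off[OF H E E' s])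
    next
      case True
      let ?Z = "slot0 g ys" and ?A = "A n d" and ?H = "slot ?u ?gh ys"
      define J b y where "J = card (in_block ys i)" and "b = in_deg ys i" and "y = in_val ys i"
      let ?N = "dg_mod N J b"
      have il: "i < length ys" using i True by simp
      have x: "x \<in> elts M r a" using gD(1) True by simp
      have y: "y \<in> carrier ?N" using gD(4)[OF il] by (simp add: J_def b_def y_def)
      have ne: "blocks_nonempty ys" using sgensD(2)[OF s] by (simp add: sorted_inputs_def)
      have Jr: "J + r \<le> n + 1" using block_card_bound[OF gD(2) ne il] True by (simp add: J_def)
      have Zg: "(a, f a x, ?Z) \<in> gens M N n d"
        by (rule slot0_gens[OF comp_product_axioms _ g sg]) (simp add: f True)
      have Zb: "in_block ?Z i = in_block ys i" "in_deg ?Z i = b" using il by (simp_all add: in_slot b_def)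
      have Zi: "(a, f a x, set_val ?Z i v) \<in> gens M N n d" if "v \<in> carrier ?N" for v
        by (rule gens_set_val[OF Zg]) (use il that in \<open>simp_all add: Zb J_def\<close>)
      define w1 w2 where "w1 = dg_diff N J (b + 1) (h J b y)" and "w2 = h J (b - 1) (dg_diff N J b y)"
      have w: "w1 \<in> carrier ?N" "w2 \<in> carrier ?N"
        using lin_closed[OF diff_N lin_closed[OF h y]] lin_closed[OF h lin_closed[OF diff_N y]]
        by (simp_all add: w1_def w2_def)
      define L where "L = leib a (in_deg ys) i"
      \<comment> \<open>In \<open>P\<close> the sign \<open>L\<close> belongs to the homotopy and
        the other one to the differential taken afterwards. In \<open>Q\<close> the order is
        reversed, so the sign of the homotopy is computed from the degrees after the differential at
        \<open>k\<close>.\<close>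
      define P where "P k = ksign K (L + leib a (in_deg ?H) k) \<odot>[?A] C n d (a, f a x, dslot N k ?H)" for k
      define Q where "Q k = ksign K (leib a (in_deg ys) k + leib a (in_deg (dslot N k ys)) i) \<odot>[?A]
        C n d (a, f a x, slot ?u ?gh (dslot N k ys))" for k
      have Hg: "(a, f a x, ?H) \<in> gens M N n (d + 1)" by (rule hg[OF sg True])
      have cP: "C n d (a, f a x, dslot N k ?H) \<in> carrier ?A" if "k < r" for k
        using cls_closed[OF gens_dslot[OF Hg]] that True by simp
      have cQ: "C n d (a, f a x, slot ?u ?gh (dslot N k ys)) \<in> carrier ?A" if "k < r" for k
        using cls_closed[OF hg[OF gens_dslot[OF sg]]] that True by simp
      have Pc: "P \<in> {..<r} \<rightarrow> carrier ?A" "Q \<in> {..<r} \<rightarrow> carrier ?A"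
        using cP cQ by (simp_all add: P_def Q_def Pi_def ksign_closed[OF K])
      have lH: "leib a (in_deg ?H) k = leib a (in_deg ys) k + (if i < k then 1 else 0)" if "k \<le> r" for k
        by (rule leib_shift) (use that True in \<open>simp add: in_slot\<close>)
      have ld: "leib a (in_deg (dslot N k ys)) i = L + (if k < i then - 1 else 0)" if "k < r" for k
        unfolding L_def by (rule leib_shift) (use il in \<open>simp add: in_dslot\<close>)
      have PQ: "Q k = \<ominus>[?A] P k" if "k \<in> {..<r}" "k \<noteq> i" for k
      proof -
        have k: "k < r" using that by simp
        have eq: "slot ?u ?gh (dslot N k ys) = dslot N k ?H"
          by (rule inputs_eqI) (use that True gD(4)[of k] in \<open>simp_all add: in_slot in_dslot gc\<close>)
        show ?thesis unfolding P_def Q_def eq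
          by (rule ksign_neg[OF module_A cP[OF k]]) (use k that(2) in \<open>simp add: lH ld\<close>)
      qed
      have Pi: "P i = C n d (a, f a x, set_val ?Z i w1)"
      proof -
        have "dslot N i ?H = set_val ?Z i w1"
          by (rule inputs_eqI) (use il in \<open>simp_all add: in_slot in_dslot in_val_set_val w1_def J_def b_def y_def\<close>)
        moreover have "ksign K (L + leib a (in_deg ?H) i) = \<one>[K]" using lH[of i] i by (simp add: ksign_def L_def)
        ultimately show ?thesis using cls_closed[OF Zi[OF w(1)]] by (simp add: P_def)
      qed
      have Qi: "Q i = C n d (a, f a x, set_val ?Z i w2)"
      proof -
        have "slot ?u ?gh (dslot N i ys) = set_val ?Z i w2"
          by (rule inputs_eqI) (use il in \<open>simp_all add: in_slot in_dslot in_val_set_val w2_def J_def b_def y_def\<close>)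
        moreover have "ksign K (leib a (in_deg ys) i + leib a (in_deg (dslot N i ys)) i) = \<one>[K]"
          using ld[of i] i by (simp add: ksign_def L_def)
        ultimately show ?thesis using cls_closed[OF Zi[OF w(2)]] by (simp add: Q_def)
      qed
      let ?c = "C n d (a - 1, dg_diff M r a (f a x), ?H)"
      have cc: "?c \<in> carrier ?A" using cls_closed[OF gens_diff_root[OF Hg]] True by simp
      have 1: "del n (d + 1) (H d (C n d (a, x, ys))) = ksign K L \<odot>[?A] ?c \<oplus>[?A] (\<Oplus>\<^bsub>?A\<^esub>k\<in>{..<r}. P k)"
      proof -
        let ?t = "\<lambda>k. ksign K (leib a (in_deg ?H) k) \<odot>[?A] C n d (a, f a x, dslot N k ?H)"
        have t: "?t \<in> {..<r} \<rightarrow> carrier ?A" using cP by (simp add: Pi_def ksign_closed[OF K])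
        have "del n (d + 1) (H d (C n d (a, x, ys))) = ksign K L \<odot>[?A] del n (d + 1) (C n (d + 1) (a, f a x, ?H))"
          using lin_smult[OF diff_lin ksign_closed[OF K] cls_closed[OF Hg]] by (simp add: Hc[OF s True] L_def)
        also have "\<dots> = ksign K L \<odot>[?A] (?c \<oplus>[?A] (\<Oplus>\<^bsub>?A\<^esub>k\<in>{..<r}. ?t k))"
          using del_cls[OF Hg] True by simp
        also have "\<dots> = ksign K L \<odot>[?A] ?c \<oplus>[?A] (\<Oplus>\<^bsub>?A\<^esub>k\<in>{..<r}. ksign K L \<odot>[?A] ?t k)"
          using A.smult_r_distr[OF ksign_closed[OF K] cc A.finsum_closed[OF t]]
            A.finsum_smult_ldistr[OF _ ksign_closed[OF K] t] by simp
        also have "(\<Oplus>\<^bsub>?A\<^esub>k\<in>{..<r}. ksign K L \<odot>[?A] ?t k) = (\<Oplus>\<^bsub>?A\<^esub>k\<in>{..<r}. P k)"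
          by (rule A.finsum_cong'[OF refl Pc(1)]) (simp add: P_def ksign_mult[OF module_A cP])
        finally show ?thesis .
      qed
      have tr: "H (d - 1) (C n (d - 1) (a - 1, dg_diff M r a x, ys)) = ksign K (leib (a - 1) (in_deg ys) i) \<odot>[?A] ?c"
        using Hc[OF sgens_diff_root[OF s] True] True by (simp add: fc[OF x])
      have "(\<Oplus>\<^bsub>?A\<^esub>k\<in>{..<r}. ksign K (leib a (in_deg ys) k) \<odot>[?A] H (d - 1) (C n (d - 1) (a, x, dslot N k ys))) =
          (\<Oplus>\<^bsub>?A\<^esub>k\<in>{..<r}. Q k)"
      proof (rule A.finsum_cong'[OF refl Pc(2)])
        fix k assume "k \<in> {..<r}"
        then have k: "k < length ys" "k < r" using True by simp_all
        show "ksign K (leib a (in_deg ys) k) \<odot>[?A] H (d - 1) (C n (d - 1) (a, x, dslot N k ys)) = Q k"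
          using Hc[OF sgens_dslot[OF s k(1)]] True by (simp add: Q_def ksign_mult[OF module_A cQ[OF k(2)]])
      qed
      then have 2: "H (d - 1) (del n d (C n d (a, x, ys))) =
          ksign K (leib (a - 1) (in_deg ys) i) \<odot>[?A] ?c \<oplus>[?A] (\<Oplus>\<^bsub>?A\<^esub>k\<in>{..<r}. Q k)"
        using lin_del[OF module_A _ sg, of _ _ "H (d - 1)"] Hl[of "d - 1"] True tr by simp
      have 3: "ksign K (leib (a - 1) (in_deg ys) i) \<odot>[?A] ?c = \<ominus>[?A] (ksign K L \<odot>[?A] ?c)"
        by (rule ksign_neg[OF module_A cc]) (simp add: L_def leib_def)
      have "(\<Oplus>\<^bsub>?A\<^esub>k\<in>{..<r}. P k) \<oplus>[?A] (\<Oplus>\<^bsub>?A\<^esub>k\<in>{..<r}. Q k) = P i \<oplus>[?A] Q i"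
        by (rule A.finsum_cancel_except[OF _ _ Pc PQ]) (use i in simp_all)
      then have 4: "del n (d + 1) (H d (C n d (a, x, ys))) \<oplus>[?A] H (d - 1) (del n d (C n d (a, x, ys))) =
          C n d (a, f a x, set_val ?Z i w1) \<oplus>[?A] C n d (a, f a x, set_val ?Z i w2)"
        unfolding 1 2 using cc ksign_closed[OF K]
        by (intro A.cancel_frame[OF _ _ _ 3] A.finsum_closed[OF Pc(1)] A.finsum_closed[OF Pc(2)]) (simp_all add: Pi Qi)
      have gy: "g i J b y = g' J b y \<oplus>[?N] (w1 \<oplus>[?N] w2)" using hom[OF Jr y] by (simp add: w1_def w2_def)
      have "slot0 (g(i := g')) ys = set_val ?Z i (g' J b y)"
        by (rule inputs_eqI) (use il in \<open>simp_all add: in_slot in_val_set_val J_def b_def y_def\<close>)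
      then have "E' d (C n d (a, x, ys)) = C n d (a, f a x, set_val ?Z i (g' J b y))"
        using entrywise_cls[OF comp_product_axioms comp_product_axioms E' f gi' s] True by simp
      moreover have "E d (C n d (a, x, ys)) = C n d (a, f a x, set_val ?Z i (g i J b y))"
        using entrywise_cls[OF comp_product_axioms comp_product_axioms E f g s] True set_val_same[of ?Z i] il
        by (simp add: in_slot J_def b_def y_def)
      moreover have "C n d (a, f a x, set_val ?Z i (g i J b y)) = C n d (a, f a x, set_val ?Z i (g' J b y)) \<oplus>[?A]
         (C n d (a, f a x, set_val ?Z i w1) \<oplus>[?A] C n d (a, f a x, set_val ?Z i w2))"
        using cls_add_input[OF Zi[OF lin_closed[OF g' y]], of i "w1 \<oplus>[?N] w2"]
          cls_add_input[OF Zi[OF w(1)], of i w2] w il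
        unfolding gy by (simp add: Zb in_val_set_val J_def)
      ultimately show ?thesis using 4 by simp
    qed
  qed
qed

text \<open>The inputs are replaced by identities one at a time: \<open>?G m\<close> applies
  \<open>g\<close> to the first \<open>m\<close> entries only, and neighbouring stages are homotopic
  by \<open>input_homotopy\<close>. The root is replaced last.\<close>

lemma entrywise_homotopic:
  assumes f: "\<And>a. lin_map K (dg_mod M r a) (dg_mod M r a) (f a)"
    and fc: "\<And>a x. x \<in> elts M r a \<Longrightarrow> f (a - 1) (dg_diff M r a x) = dg_diff M r a (f a x)"
    and h0: "\<And>a. lin_map K (dg_mod M r a) (dg_mod M r (a + 1)) (h0 a)"
    and hom0: "\<And>a x. x \<in> elts M r a \<Longrightarrow>
      f a x = x \<oplus>[dg_mod M r a] (dg_diff M r (a + 1) (h0 a x) \<oplus>[dg_mod M r a] h0 (a - 1) (dg_diff M r a x))"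
    and g: "\<And>j b. lin_map K (dg_mod N j b) (dg_mod N j b) (g j b)"
    and gc: "\<And>j b y. y \<in> elts N j b \<Longrightarrow> g j (b - 1) (dg_diff N j b y) = dg_diff N j b (g j b y)"
    and h: "\<And>j b. lin_map K (dg_mod N j b) (dg_mod N j (b + 1)) (h j b)"
    and hom: "\<And>j b y. j + r \<le> n + 1 \<Longrightarrow> y \<in> elts N j b \<Longrightarrow>
      g j b y = y \<oplus>[dg_mod N j b] (dg_diff N j (b + 1) (h j b y) \<oplus>[dg_mod N j b] h j (b - 1) (dg_diff N j b y))"
    and E: "entrywise K M N M N n r f (\<lambda>_. g) E" and E': "entrywise K M N M N n r (\<lambda>_ x. x) (\<lambda>_ _ _ y. y) E'"
  shows "homotopic n E E'"
proof -
  let ?G = "\<lambda>m i. if i < m then g else (\<lambda>_ _ y. y)"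
  have G: "lin_map K (dg_mod N j b) (dg_mod N j b) (?G m i j b)" for m i j b by (simp add: g lin_id)
  have Gc: "?G m i j (b - 1) (dg_diff N j b y) = dg_diff N j b (?G m i j b y)" if "y \<in> elts N j b" for m i j b y
    using gc that by simp
  have "\<forall>m. \<exists>T. entrywise K M N M N n r f (?G m) T"
    by (intro allI entrywise_exists[OF comp_product_axioms comp_product_axioms f G])
  then obtain T where T: "\<And>m. entrywise K M N M N n r f (?G m) (T m)" by metis
  have cl: "T m d X \<in> cA n d" if "X \<in> cA n d" for m d X
    by (rule lin_closed[OF entrywise_lin[OF T] that])
  have step: "homotopic n (T (Suc m)) (T m)" if m: "m < r" for m
  proof (rule input_homotopy[where g' = "\<lambda>_ _ y. y", OF m f fc G Gc lin_id h])
    show "entrywise K M N M N n r f (?G (Suc m)) (T (Suc m))" by (rule T)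
    have "(?G (Suc m))(m := \<lambda>_ _ y. y) = ?G m" by (rule ext) simp
    then show "entrywise K M N M N n r f ((?G (Suc m))(m := \<lambda>_ _ y. y)) (T m)" using T by simp
  qed (use hom in simp_all)
  have "homotopic n (T m) (T 0)" if "m \<le> r" for m
    using that
  proof (induction m)
    case 0
    show ?case by (rule homotopic_refl) (simp_all add: cl)
  next
    case (Suc m)
    then show ?case using homotopic_trans[OF step[of m]] cl by simp
  qed
  from this[of r] have 1: "homotopic n (T r) (T 0)" by simp
  have 2: "homotopic n (T 0) E'"
  proof (rule root_homotopy[where g = "?G 0" and f' = "\<lambda>_ x. x", OF f lin_id h0])
    show "entrywise K M N M N n r (\<lambda>_ x. x) (?G 0) E'" using E' by simp
  qed (use hom0 T[of 0] in \<open>simp_all add: lin_id\<close>)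
  \<comment> \<open>The families differ only at positions from \<open>r\<close> on, which do not
    occur in lists of length \<open>r\<close>.\<close>
  have 3: "homotopic n E (T r)"
  proof (rule homotopic_refl)
    fix d X assume X: "X \<in> cA n d"
    show "T r d X \<in> cA n d" by (rule cl[OF X])
    show "E d X = T r d X"
    proof (rule lin_eq_on_sorted[OF module_A entrywise_lin[OF E] entrywise_lin[OF T] _ X])
      fix a x ys assume s: "(a, x, ys) \<in> sgens M N n d"
      have "slot0 (\<lambda>_. g) ys = slot0 (?G r) ys" if "length ys = r"
        by (rule inputs_eqI) (use that in \<open>simp_all add: in_slot\<close>)
      then show "E d (C n d (a, x, ys)) = T r d (C n d (a, x, ys))"
        using entrywise_cls[OF comp_product_axioms comp_product_axioms E f _ s]
          entrywise_cls[OF comp_product_axioms comp_product_axioms T f G s] g by simp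
    qed
  qed
  have cE: "E' d X \<in> cA n d" if "X \<in> cA n d" for d X
    by (rule lin_closed[OF entrywise_lin[OF E'] that])
  show ?thesis by (rule homotopic_trans[OF 3 homotopic_trans[OF 1 2 cE] cE])
qed

end

lemma (in abelian_group) neg_zero [simp]: "\<ominus> \<zero> = \<zero>"
  by (rule minus_equality) simp_all

section \<open>Lifting through linear relations\<close>

definition linear_relation where
  "linear_relation K A B R \<longleftrightarrow>
     (\<forall>x\<in>carrier A. \<forall>x'\<in>carrier A. \<forall>y\<in>carrier B. \<forall>y'\<in>carrier B.
        R x y \<longrightarrow> R x' y' \<longrightarrow> R (x \<oplus>[A] x') (y \<oplus>[B] y')) \<and>
     (\<forall>c\<in>carrier K. \<forall>x\<in>carrier A. \<forall>y\<in>carrier B. R x y \<longrightarrow> R (c \<odot>[A] x) (c \<odot>[B] y)) \<and>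
     (\<forall>x\<in>carrier A. \<exists>y\<in>carrier B. R x y)"

text \<open>Every total linear relation contains the graph of a linear map. This turns element-wise
  choices into linear ones; phrased with relations it serves projective modules and modules over a
  field alike.\<close>

definition liftable where
  "liftable K A B \<longleftrightarrow>
     (\<forall>R. linear_relation K A B R \<longrightarrow> (\<exists>l. lin_map K A B l \<and> (\<forall>x\<in>carrier A. R x (l x))))"

lemma linear_relationD:
  assumes "linear_relation K A B R"
  shows "\<lbrakk>x \<in> carrier A; x' \<in> carrier A; y \<in> carrier B; y' \<in> carrier B; R x y; R x' y'\<rbrakk> \<Longrightarrow>
      R (x \<oplus>[A] x') (y \<oplus>[B] y')"
    and "\<lbrakk>c \<in> carrier K; x \<in> carrier A; y \<in> carrier B; R x y\<rbrakk> \<Longrightarrow> R (c \<odot>[A] x) (c \<odot>[B] y)"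
    and "x \<in> carrier A \<Longrightarrow> \<exists>y\<in>carrier B. R x y"
  using assms unfolding linear_relation_def by blast+

lemma linear_relation_zero:
  assumes "module K A" "module K B" "linear_relation K A B R"
  shows "R \<zero>[A] \<zero>[B]"
proof -
  interpret A: module K A by fact
  interpret B: module K B by fact
  obtain y where y: "y \<in> carrier B" "R \<zero>[A] y" using linear_relationD(3)[OF assms(3) A.zero_closed] by blast
  from linear_relationD(2)[OF assms(3) A.R.zero_closed A.zero_closed y] show ?thesis using y(1) by simp
qed

text \<open>Choose related elements for the images of a basis, extend linearly, and precompose with
  the section into the free module.\<close>

lemma liftable_projective:
  assumes "module K A" "module K B" "projective_module K A"
  shows "liftable K A B"
  unfolding liftable_def
proof (intro allI impI)
  fix R assume R: "linear_relation K A B R"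
  note RD = linear_relationD[OF R]
  interpret A: module K A by fact
  interpret B: module K B by fact
  obtain S :: "'c set" and i p where i: "lin_map K A (free_module K S) i" and p: "lin_map K (free_module K S) A p"
    and pi: "\<And>x. x \<in> carrier A \<Longrightarrow> p (i x) = x"
    using assms(3) unfolding projective_module_def by auto
  note Fm = free_module_module[OF A.is_cring, of S]
  have bc: "basis_vec K s \<in> carrier (free_module K S)" if "s \<in> S" for s by (rule basis_vec_closed[OF A.is_cring that])
  define y where "y s = (SOME y. y \<in> carrier B \<and> R (p (basis_vec K s)) y)" for s
  have y: "y s \<in> carrier B \<and> R (p (basis_vec K s)) (y s)" if "s \<in> S" for s
    unfolding y_def by (rule someI_ex[OF RD(3)[OF lin_closed[OF p bc[OF that]], unfolded Bex_def]])
  have yc: "y \<in> S \<rightarrow> carrier B" using y by blast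
  note L = lin_ext_lin_map[OF assms(2) yc] and Lb = lin_ext_basis_vec[OF assms(2) yc]
  have *: "R (p f) (lin_ext K B y f)" if "f \<in> mspan K (free_module K S) (basis_vec K ` S)" for f
  proof -
    have sub: "basis_vec K ` S \<subseteq> carrier (free_module K S)" using bc by blast
    show ?thesis using Fm sub that
    proof (induction rule: mspan_induct)
      case (base f) then show ?case by (elim imageE) (simp add: y Lb)
    next
      case zero
      show ?case using linear_relation_zero[OF assms(1,2) R]
        by (simp add: lin_zero[OF Fm assms(1) p] lin_zero[OF Fm assms(2) L])
    next
      case (add f g)
      show ?case unfolding lin_add[OF p add(3,4)] lin_add[OF L add(3,4)]
        by (rule RD(1)) (use add lin_closed[OF p] lin_closed[OF L] in simp_all)
    next
      case (smult c f)
      show ?case unfolding lin_smult[OF p smult(1,3)] lin_smult[OF L smult(1,3)]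
        by (rule RD(2)) (use smult lin_closed[OF p] lin_closed[OF L] in simp_all)
    qed
  qed
  show "\<exists>l. lin_map K A B l \<and> (\<forall>x\<in>carrier A. R x (l x))"
  proof (intro exI conjI ballI)
    show "lin_map K A B (\<lambda>x. lin_ext K B y (i x))" by (rule lin_comp[OF i L])
    fix x assume x: "x \<in> carrier A"
    show "R x (lin_ext K B y (i x))"
      using *[OF free_module_spanned[OF A.is_cring lin_closed[OF i x]]] pi[OF x] by simp
  qed
qed

text \<open>Zorn's lemma for graphs of partial linear maps contained in \<open>R\<close>. If a
  maximal one misses \<open>x\<close>, choose \<open>y\<close> related to \<open>x\<close> and
  adjoin the line through \<open>(x, y)\<close>; the result is again a graph, contradicting
  maximality.\<close>

lemma liftable_field:
  assumes "module K A" "module K B" "field K"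
  shows "liftable K A B"
  unfolding liftable_def
proof (intro allI impI)
  fix R assume R: "linear_relation K A B R"
  note RD = linear_relationD[OF R]
  interpret A: module K A by fact
  interpret B: module K B by fact
  interpret K: field K by fact
  \<comment> \<open>Submodules of the product contained in \<open>R\<close>; the last clause makes
    them single-valued.\<close>
  define good where "good G \<longleftrightarrow> G \<subseteq> {(x, y). x \<in> carrier A \<and> y \<in> carrier B \<and> R x y} \<and> (\<zero>[A], \<zero>[B]) \<in> G \<and>
     (\<forall>x y x' y'. (x, y) \<in> G \<longrightarrow> (x', y') \<in> G \<longrightarrow> (x \<oplus>[A] x', y \<oplus>[B] y') \<in> G) \<and>
     (\<forall>c x y. c \<in> carrier K \<longrightarrow> (x, y) \<in> G \<longrightarrow> (c \<odot>[A] x, c \<odot>[B] y) \<in> G) \<and>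
     (\<forall>y. (\<zero>[A], y) \<in> G \<longrightarrow> y = \<zero>[B])" for G
  have gD: "x \<in> carrier A" "y \<in> carrier B" "R x y" if "good G" "(x, y) \<in> G" for G x y
    using that unfolding good_def by blast+
  have gadd: "(x \<oplus>[A] x', y \<oplus>[B] y') \<in> G" if "good G" "(x, y) \<in> G" "(x', y') \<in> G" for G x y x' y'
    using that unfolding good_def by blast
  have gsm: "(c \<odot>[A] x, c \<odot>[B] y) \<in> G" if "good G" "c \<in> carrier K" "(x, y) \<in> G" for G x y c
    using that unfolding good_def by blast
  have gz: "y = \<zero>[B]" if "good G" "(\<zero>[A], y) \<in> G" for G y using that unfolding good_def by blast
  have g0: "(\<zero>[A], \<zero>[B]) \<in> G" if "good G" for G using that unfolding good_def by blast
  have "good {(\<zero>[A], \<zero>[B])}" unfolding good_def using linear_relation_zero[OF assms(1,2) R] by simp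
  then have ne: "{G. good G} \<noteq> {}" by blast
  have "\<Union>\<C> \<in> {G. good G}" if "\<C> \<noteq> {}" and ch: "subset.chain {G. good G} \<C>" for \<C>
  proof -
    have gC: "good G" if "G \<in> \<C>" for G using ch that by (auto simp: subset.chain_def)
    have dir: "\<exists>H\<in>\<C>. G \<subseteq> H \<and> G' \<subseteq> H" if "G \<in> \<C>" "G' \<in> \<C>" for G G'
      using subset.chain_total[OF ch that] that by blast
    have c3: "(x \<oplus>[A] x', y \<oplus>[B] y') \<in> \<Union>\<C>" if m: "(x, y) \<in> \<Union>\<C>" "(x', y') \<in> \<Union>\<C>" for x y x' y'
    proof -
      obtain G G' where G: "G \<in> \<C>" "G' \<in> \<C>" "(x, y) \<in> G" "(x', y') \<in> G'" using m by blast
      obtain H where H: "H \<in> \<C>" "G \<subseteq> H" "G' \<subseteq> H" using dir[OF G(1,2)] by blast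
      show ?thesis using gadd[OF gC[OF H(1)]] G H by blast
    qed
    have c1: "\<Union>\<C> \<subseteq> {(x, y). x \<in> carrier A \<and> y \<in> carrier B \<and> R x y}"
      using gC unfolding good_def by blast
    have c2: "(\<zero>[A], \<zero>[B]) \<in> \<Union>\<C>" using g0 gC that(1) by blast
    have c4: "(c \<odot>[A] x, c \<odot>[B] y) \<in> \<Union>\<C>" if "c \<in> carrier K" "(x, y) \<in> \<Union>\<C>" for c x y
      using gsm[OF gC] that by blast
    have c5: "y = \<zero>[B]" if "(\<zero>[A], y) \<in> \<Union>\<C>" for y using gz[OF gC] that by blast
    have "good (\<Union>\<C>)" unfolding good_def
      by (intro conjI allI impI) (rule c1, rule c2, erule (1) c3, erule (1) c4, erule c5)
    then show ?thesis by (rule CollectI)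
  qed
  from subset_Zorn_nonempty[OF ne this]
  obtain G where G: "good G" and max: "\<And>X. good X \<Longrightarrow> G \<subseteq> X \<Longrightarrow> X = G" by auto
  note gD = gD[OF G] and gadd = gadd[OF G] and gsm = gsm[OF G] and gz = gz[OF G] and g0 = g0[OF G]
  have total: "\<exists>y. (x, y) \<in> G" if x: "x \<in> carrier A" for x
  proof (rule ccontr)
    assume nx: "\<not> (\<exists>y. (x, y) \<in> G)"
    obtain y where y: "y \<in> carrier B" "R x y" using RD(3)[OF x] by blast
    define X where "X = {(u \<oplus>[A] c \<odot>[A] x, v \<oplus>[B] c \<odot>[B] y) |u v c. (u, v) \<in> G \<and> c \<in> carrier K}"
    have XI: "(u \<oplus>[A] c \<odot>[A] x, v \<oplus>[B] c \<odot>[B] y) \<in> X" if "(u, v) \<in> G" "c \<in> carrier K" for u v c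
      using that unfolding X_def by blast
    have XE: "\<exists>u v c. p = u \<oplus>[A] c \<odot>[A] x \<and> q = v \<oplus>[B] c \<odot>[B] y \<and> (u, v) \<in> G \<and> c \<in> carrier K"
      if "(p, q) \<in> X" for p q using that unfolding X_def by blast
    have GX: "G \<subseteq> X"
    proof
      fix p assume p: "p \<in> G"
      then obtain u v where uv: "p = (u, v)" by (cases p)
      show "p \<in> X" using XI[of u v "\<zero>[K]"] p gD x y uv by simp
    qed
    have "good X" unfolding good_def
    proof (intro conjI allI impI)
      show "X \<subseteq> {(x, y). x \<in> carrier A \<and> y \<in> carrier B \<and> R x y}"
      proof (rule subsetI)
        fix p assume "p \<in> X"
        then obtain u v c where p: "p = (u \<oplus>[A] c \<odot>[A] x, v \<oplus>[B] c \<odot>[B] y)" "(u, v) \<in> G" "c \<in> carrier K"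
          unfolding X_def by blast
        have "R (u \<oplus>[A] c \<odot>[A] x) (v \<oplus>[B] c \<odot>[B] y)"
          by (rule RD(1)[OF _ _ _ _ gD(3)[OF p(2)] RD(2)[OF p(3) x y]]) (use gD[OF p(2)] x y p(3) in simp_all)
        then show "p \<in> {(x, y). x \<in> carrier A \<and> y \<in> carrier B \<and> R x y}" using p gD[OF p(2)] x y by simp
      qed
      show "(\<zero>[A], \<zero>[B]) \<in> X" using GX g0 by blast
    next
      fix p q p' q' assume "(p, q) \<in> X" "(p', q') \<in> X"
      then obtain u v c u' v' c' where e: "p = u \<oplus>[A] c \<odot>[A] x" "q = v \<oplus>[B] c \<odot>[B] y" "(u, v) \<in> G" "c \<in> carrier K"
        "p' = u' \<oplus>[A] c' \<odot>[A] x" "q' = v' \<oplus>[B] c' \<odot>[B] y" "(u', v') \<in> G" "c' \<in> carrier K"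
        using XE by metis
      have "p \<oplus>[A] p' = (u \<oplus>[A] u') \<oplus>[A] (c \<oplus>[K] c') \<odot>[A] x" "q \<oplus>[B] q' = (v \<oplus>[B] v') \<oplus>[B] (c \<oplus>[K] c') \<odot>[B] y"
        using e gD[OF e(3)] gD[OF e(7)] x y(1)
        by (simp_all add: A.smult_l_distr B.smult_l_distr A.a_ac B.a_ac)
      then show "(p \<oplus>[A] p', q \<oplus>[B] q') \<in> X" using XI[OF gadd[OF e(3,7)] A.R.a_closed[OF e(4,8)]] by simp
    next
      fix k p q assume k: "k \<in> carrier K" and "(p, q) \<in> X"
      then obtain u v c where e: "p = u \<oplus>[A] c \<odot>[A] x" "q = v \<oplus>[B] c \<odot>[B] y" "(u, v) \<in> G" "c \<in> carrier K"
        using XE by metis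
      have "k \<odot>[A] p = k \<odot>[A] u \<oplus>[A] (k \<otimes>[K] c) \<odot>[A] x" "k \<odot>[B] q = k \<odot>[B] v \<oplus>[B] (k \<otimes>[K] c) \<odot>[B] y"
        using e gD[OF e(3)] x y(1) k by (simp_all add: A.smult_r_distr B.smult_r_distr A.smult_assoc1 B.smult_assoc1)
      then show "(k \<odot>[A] p, k \<odot>[B] q) \<in> X" using XI[OF gsm[OF k e(3)] A.R.m_closed[OF k e(4)]] by simp
    next
      fix q assume "(\<zero>[A], q) \<in> X"
      then obtain u v c where e: "\<zero>[A] = u \<oplus>[A] c \<odot>[A] x" "q = v \<oplus>[B] c \<odot>[B] y" "(u, v) \<in> G" "c \<in> carrier K"
        using XE by metis
      show "q = \<zero>[B]"
      proof (cases "c = \<zero>[K]")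
        case True
        then show ?thesis using e gD[OF e(3)] x y gz by simp
      next
        \<comment> \<open>Invertibility of nonzero scalars enters here: dividing by \<open>c\<close>
          would put \<open>x\<close> into the domain of \<open>G\<close>.\<close>
        case False
        then have cU: "c \<in> Units K" using e(4) K.field_Units by simp
        let ?d = "\<ominus>[K] (inv\<^bsub>K\<^esub> c)"
        have dK: "?d \<in> carrier K" using cU by simp
        have "u = \<ominus>[A] (c \<odot>[A] x)"
          using e(1,4) gD(1)[OF e(3)] x by (metis A.minus_equality A.smult_closed)
        then have "?d \<odot>[A] u = inv\<^bsub>K\<^esub> c \<odot>[A] (c \<odot>[A] x)"
          using cU e(4) x by (simp add: A.smult_l_minus A.smult_r_minus A.R.Units_closed)
        also have "\<dots> = x" using cU e(4) x by (simp flip: A.smult_assoc1)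
        finally show ?thesis using gsm[OF dK e(3)] nx by auto
      qed
    qed
    from max[OF this GX] have "(\<zero>[A] \<oplus>[A] \<one>[K] \<odot>[A] x, \<zero>[B] \<oplus>[B] \<one>[K] \<odot>[B] y) \<in> G" using XI[OF g0, of "\<one>[K]"] by simp
    then show False using nx x by auto
  qed
  have unique: "y = y'" if "(x, y) \<in> G" "(x, y') \<in> G" for x y y'
  proof -
    have "((\<ominus>[K] \<one>[K]) \<odot>[A] x, (\<ominus>[K] \<one>[K]) \<odot>[B] y') \<in> G" by (rule gsm[OF _ that(2)]) simp
    from gadd[OF that(1) this] have "(\<zero>[A], y \<oplus>[B] \<ominus>[B] y') \<in> G"
      using gD[OF that(1)] gD[OF that(2)] by (simp add: A.smult_l_minus B.smult_l_minus A.r_neg)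
    from gz[OF this] show ?thesis
      using gD(2)[OF that(1)] gD(2)[OF that(2)] by (metis B.a_inv_closed B.minus_equality B.minus_minus)
  qed
  define l where "l x = (THE y. (x, y) \<in> G)" for x
  have l: "(x, l x) \<in> G" if "x \<in> carrier A" for x
    unfolding l_def using total[OF that] unique by (metis theI)
  show "\<exists>l. lin_map K A B l \<and> (\<forall>x\<in>carrier A. R x (l x))"
  proof (intro exI[of _ l] conjI ballI lin_mapI)
    show "l x \<in> carrier B" "R x (l x)" if "x \<in> carrier A" for x using gD[OF l[OF that]] by simp_all
    show "l (x \<oplus>[A] y) = l x \<oplus>[B] l y" if "x \<in> carrier A" "y \<in> carrier A" for x y
      by (rule unique[OF l gadd[OF l l]]) (use that in simp_all)
    show "l (c \<odot>[A] x) = c \<odot>[B] l x" if "c \<in> carrier K" "x \<in> carrier A" for c x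
      by (rule unique[OF l gsm[OF _ l]]) (use that in simp_all)
  qed
qed

section \<open>Homotopy inverses of quasi-isomorphisms\<close>

definition prod_module :: "('k, 'a) module \<Rightarrow> ('k, 'b) module \<Rightarrow> ('k, 'a \<times> 'b) module" where
  "prod_module A B =
     \<lparr>carrier = carrier A \<times> carrier B, monoid.mult = undefined, one = undefined,
      zero = (\<zero>[A], \<zero>[B]), add = (\<lambda>p q. (fst p \<oplus>[A] fst q, snd p \<oplus>[B] snd q)),
      smult = (\<lambda>c p. (c \<odot>[A] fst p, c \<odot>[B] snd p))\<rparr>"

lemma prod_module_simps [simp]:
  "carrier (prod_module A B) = carrier A \<times> carrier B" "\<zero>[prod_module A B] = (\<zero>[A], \<zero>[B])"
  "p \<oplus>[prod_module A B] q = (fst p \<oplus>[A] fst q, snd p \<oplus>[B] snd q)"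
  "c \<odot>[prod_module A B] p = (c \<odot>[A] fst p, c \<odot>[B] snd p)"
  by (simp_all add: prod_module_def)

lemma prod_module_module:
  assumes "module K A" "module K B" shows "module K (prod_module A B)"
proof -
  interpret A: module K A by fact
  interpret B: module K B by fact
  show ?thesis
  proof (rule moduleI)
    show "abelian_group (prod_module A B)"
    proof (rule abelian_groupI)
      fix p assume "p \<in> carrier (prod_module A B)"
      then show "\<exists>q\<in>carrier (prod_module A B). q \<oplus>[prod_module A B] p = \<zero>[prod_module A B]"
        by (intro bexI[of _ "(\<ominus>[A] fst p, \<ominus>[B] snd p)"]) (simp_all add: mem_Times_iff A.l_neg B.l_neg)
    qed (simp_all add: mem_Times_iff A.a_ac B.a_ac)
  qed (simp_all add: mem_Times_iff A.is_cring A.smult_l_distr B.smult_l_distr A.smult_r_distr B.smult_r_distr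
    A.smult_assoc1 B.smult_assoc1)
qed

lemma lin_fst: "lin_map K (prod_module A B) A fst" and lin_snd: "lin_map K (prod_module A B) B snd"
  by (rule lin_mapI; simp add: mem_Times_iff)+

lemma lin_pair: "lin_map K A B f \<Longrightarrow> lin_map K A B' g \<Longrightarrow> lin_map K A (prod_module B B') (\<lambda>x. (f x, g x))"
  by (rule lin_mapI) (simp_all add: lin_closed lin_add lin_smult)

text \<open>Restrict the relation to the two axes \<open>(x, 0)\<close> and \<open>(0, x)\<close>
  and add the two lifts.\<close>

lemma liftable_prod:
  assumes "module K A" "module K A'" "module K B" "liftable K A B" "liftable K A' B"
  shows "liftable K (prod_module A A') B"
  unfolding liftable_def
proof (intro allI impI)
  fix R assume R: "linear_relation K (prod_module A A') B R"
  interpret A: module K A by fact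
  interpret A': module K A' by fact
  interpret B: module K B by fact
  note RD = linear_relationD[OF R]
  have "linear_relation K A B (\<lambda>x. R (x, \<zero>[A']))"
    unfolding linear_relation_def
  proof (intro conjI ballI impI)
    show "R (x \<oplus>[A] x', \<zero>[A']) (y \<oplus>[B] y')" if "x \<in> carrier A" "x' \<in> carrier A" "y \<in> carrier B" "y' \<in> carrier B"
      "R (x, \<zero>[A']) y" "R (x', \<zero>[A']) y'" for x x' y y'
      using RD(1)[OF _ _ that(3,4,5,6)] that by simp
    show "R (c \<odot>[A] x, \<zero>[A']) (c \<odot>[B] y)" if "c \<in> carrier K" "x \<in> carrier A" "y \<in> carrier B" "R (x, \<zero>[A']) y" for c x y
      using RD(2)[OF that(1) _ that(3,4)] that by simp
    show "\<exists>y\<in>carrier B. R (x, \<zero>[A']) y" if "x \<in> carrier A" for x using RD(3) that by simp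
  qed
  then obtain l where l: "lin_map K A B l" "\<And>x. x \<in> carrier A \<Longrightarrow> R (x, \<zero>[A']) (l x)"
    using assms(4) unfolding liftable_def by blast
  have "linear_relation K A' B (\<lambda>x. R (\<zero>[A], x))"
    unfolding linear_relation_def
  proof (intro conjI ballI impI)
    show "R (\<zero>[A], x \<oplus>[A'] x') (y \<oplus>[B] y')" if "x \<in> carrier A'" "x' \<in> carrier A'" "y \<in> carrier B" "y' \<in> carrier B"
      "R (\<zero>[A], x) y" "R (\<zero>[A], x') y'" for x x' y y'
      using RD(1)[OF _ _ that(3,4,5,6)] that by simp
    show "R (\<zero>[A], c \<odot>[A'] x) (c \<odot>[B] y)" if "c \<in> carrier K" "x \<in> carrier A'" "y \<in> carrier B" "R (\<zero>[A], x) y" for c x y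
      using RD(2)[OF that(1) _ that(3,4)] that by simp
    show "\<exists>y\<in>carrier B. R (\<zero>[A], x) y" if "x \<in> carrier A'" for x using RD(3) that by simp
  qed
  then obtain l' where l': "lin_map K A' B l'" "\<And>x. x \<in> carrier A' \<Longrightarrow> R (\<zero>[A], x) (l' x)"
    using assms(5) unfolding liftable_def by blast
  show "\<exists>l. lin_map K (prod_module A A') B l \<and> (\<forall>x\<in>carrier (prod_module A A'). R x (l x))"
  proof (intro exI conjI ballI)
    show "lin_map K (prod_module A A') B (\<lambda>p. l (fst p) \<oplus>[B] l' (snd p))"
      by (rule lin_plus[OF prod_module_module[OF assms(1,2)] assms(3)
        lin_comp[OF lin_fst l(1)] lin_comp[OF lin_snd l'(1)]])
    fix p assume p: "p \<in> carrier (prod_module A A')"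
    then have c: "fst p \<in> carrier A" "snd p \<in> carrier A'" by (auto simp: mem_Times_iff)
    show "R p (l (fst p) \<oplus>[B] l' (snd p))"
      using RD(1)[OF _ _ _ _ l(2)[OF c(1)] l'(2)[OF c(2)]] c lin_closed[OF l(1) c(1)] lin_closed[OF l'(1) c(2)]
      by simp
  qed
qed

text \<open>The contraction of a bounded below exact complex is built upwards in the degree. If
  \<open>t\<close> is already chosen in the degree below, \<open>x - t (b x)\<close> is a cycle,
  hence a boundary, and the lifting property selects preimages linearly.\<close>

lemma contraction_exists:
  fixes E :: "int \<Rightarrow> ('k, 'e) module"
  assumes E: "\<And>d. module K (E d)"
    and b: "\<And>d. lin_map K (E d) (E (d - 1)) (b d)"
    and bb: "\<And>d x. x \<in> carrier (E d) \<Longrightarrow> b (d - 1) (b d x) = \<zero>[E (d - 2)]"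
    and neg: "\<And>d. d < 0 \<Longrightarrow> zero_module (E d)"
    and exact: "\<And>d x. x \<in> carrier (E d) \<Longrightarrow> b d x = \<zero>[E (d - 1)] \<Longrightarrow> \<exists>u\<in>carrier (E (d + 1)). b (d + 1) u = x"
    and lift: "\<And>d. liftable K (E d) (E (d + 1))"
  shows "\<exists>s. (\<forall>d. lin_map K (E d) (E (d + 1)) (s d)) \<and>
     (\<forall>d. \<forall>x\<in>carrier (E d). b (d + 1) (s d x) \<oplus>[E d] s (d - 1) (b d x) = x)"
proof -
  interpret E: module K "E d" for d by (rule E)
  \<comment> \<open>\<open>t k\<close> leaves degree \<open>k - 1\<close>, so the recursion can
    start with the zero map out of the zero module in degree \<open>-1\<close>.\<close>
  define P where "P = (\<lambda>k t. lin_map K (E (int k - 1)) (E (int k)) t \<and>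
     (\<forall>x\<in>carrier (E (int k)). b (int k) (x \<ominus>[E (int k)] t (b (int k) x)) = \<zero>[E (int k - 1)]))"
  define Q where "Q = (\<lambda>k t t'. \<forall>x\<in>carrier (E (int k)). b (int k + 1) (t' x) = x \<ominus>[E (int k)] t (b (int k) x))"
  have "\<exists>t. \<forall>k. P k (t k) \<and> Q k (t k) (t (Suc k))"
  proof (rule dependent_nat_choice)
    have "b 0 (x \<ominus>[E 0] \<zero>[E 0]) = \<zero>[E (- 1)]" if "x \<in> carrier (E 0)" for x
      using zero_module_D[OF neg, of "- 1"] lin_closed[OF b, of _ 0] that by (simp add: a_minus_def)
    then show "\<exists>t. P 0 t" unfolding P_def by (intro exI[of _ "\<lambda>_. \<zero>[E 0]"]) (simp add: lin_const_zero[OF E])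
  next
    fix t k assume t: "P k t"
    let ?k = "int k"
    have tl: "lin_map K (E (?k - 1)) (E ?k) t" using t by (simp add: P_def)
    let ?w = "\<lambda>x. x \<ominus>[E ?k] t (b ?k x)"
    have wl: "lin_map K (E ?k) (E ?k) ?w" by (rule lin_diff[OF E E lin_id lin_comp[OF b tl]])
    have "linear_relation K (E ?k) (E (?k + 1)) (\<lambda>x u. b (?k + 1) u = ?w x)"
      unfolding linear_relation_def
    proof (intro conjI ballI impI)
      fix x assume x: "x \<in> carrier (E ?k)"
      show "\<exists>u\<in>carrier (E (?k + 1)). b (?k + 1) u = ?w x"
        by (rule exact[OF lin_closed[OF wl x]]) (use t x in \<open>simp add: P_def\<close>)
    next
      fix x x' u u' assume *: "x \<in> carrier (E ?k)" "x' \<in> carrier (E ?k)" "u \<in> carrier (E (?k + 1))"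
        "u' \<in> carrier (E (?k + 1))" "b (?k + 1) u = ?w x" "b (?k + 1) u' = ?w x'"
      show "b (?k + 1) (u \<oplus>[E (?k + 1)] u') = ?w (x \<oplus>[E ?k] x')"
        using lin_add[OF b *(3,4)] lin_add[OF wl *(1,2)] *(5,6) by simp
    next
      fix c x u assume *: "c \<in> carrier K" "x \<in> carrier (E ?k)" "u \<in> carrier (E (?k + 1))" "b (?k + 1) u = ?w x"
      show "b (?k + 1) (c \<odot>[E (?k + 1)] u) = ?w (c \<odot>[E ?k] x)"
        using lin_smult[OF b *(1,3)] lin_smult[OF wl *(1,2)] *(4) by simp
    qed
    then obtain t' where t': "lin_map K (E ?k) (E (?k + 1)) t'" "\<And>x. x \<in> carrier (E ?k) \<Longrightarrow> b (?k + 1) (t' x) = ?w x"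
      using lift[of ?k] unfolding liftable_def by blast
    have "P (Suc k) t'" unfolding P_def
    proof (intro conjI ballI)
      show "lin_map K (E (int (Suc k) - 1)) (E (int (Suc k))) t'" using t'(1) by (simp add: add.commute)
      fix z assume z': "z \<in> carrier (E (int (Suc k)))"
      then have z: "z \<in> carrier (E (?k + 1))" by (simp add: add.commute)
      have bz: "b (?k + 1) z \<in> carrier (E ?k)" using lin_closed[OF b z] by simp
      have bbz: "b ?k (b (?k + 1) z) = \<zero>[E (?k - 1)]" using bb[OF z] by simp
      have t0: "t \<zero>[E (?k - 1)] = \<zero>[E ?k]" by (rule lin_zero[OF E E tl])
      have "b (?k + 1) (z \<ominus>[E (?k + 1)] t' (b (?k + 1) z)) = b (?k + 1) z \<ominus>[E ?k] ?w (b (?k + 1) z)"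
        using lin_minus[OF E E b z lin_closed[OF t'(1) bz]] t'(2)[OF bz] by simp
      also have "\<dots> = \<zero>[E ?k]" using bz by (simp add: bbz t0 a_minus_def E.r_neg)
      finally show "b (int (Suc k)) (z \<ominus>[E (int (Suc k))] t' (b (int (Suc k)) z)) = \<zero>[E (int (Suc k) - 1)]"
        by (simp add: add.commute)
    qed
    then show "\<exists>t'. P (Suc k) t' \<and> Q k t t'" using t'(2) by (auto simp: Q_def)
  qed
  then obtain t where t: "\<And>k. P k (t k)" "\<And>k. Q k (t k) (t (Suc k))" by blast
  \<comment> \<open>The index is shifted by one to undo the numbering of \<open>t\<close>; below
    degree \<open>-1\<close> everything is zero.\<close>
  define s where "s = (\<lambda>d. if d < - 1 then (\<lambda>_. \<zero>[E (d + 1)]) else t (nat (d + 1)))"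
  have sl: "lin_map K (E d) (E (d + 1)) (s d)" for d
  proof (cases "d < - 1")
    case True then show ?thesis by (simp add: s_def lin_const_zero[OF E])
  next
    case False
    then have "int (nat (d + 1)) = d + 1" by simp
    then show ?thesis using t(1)[of "nat (d + 1)"] False by (simp add: s_def P_def)
  qed
  have "b (d + 1) (s d x) \<oplus>[E d] s (d - 1) (b d x) = x" if x: "x \<in> carrier (E d)" for d x
  proof (cases "d < 0")
    case True
    have "b (d + 1) (s d x) \<oplus>[E d] s (d - 1) (b d x) \<in> carrier (E d)"
      using lin_closed[OF b lin_closed[OF sl x]] lin_closed[OF sl lin_closed[OF b x]] by simp
    then show ?thesis using zero_module_D[OF neg[OF True]] x by metis
  next
    case False
    define k where "k = nat d"
    have d: "d = int k" using False by (simp add: k_def)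
    have s1: "s d = t (Suc k)" "s (d - 1) = t k" by (simp_all add: s_def d nat_add_distrib)
    have c: "t k (b d x) \<in> carrier (E d)" using lin_closed[OF sl lin_closed[OF b x]] s1 by simp
    have "b (d + 1) (s d x) = x \<ominus>[E d] t k (b d x)" unfolding s1 using t(2)[of k] x by (simp add: Q_def d)
    then show ?thesis using c x by (simp add: s1 a_minus_def E.a_assoc E.l_neg)
  qed
  then show ?thesis using sl by blast
qed

text \<open>Acyclicity of the mapping cone, spelled out on elements.\<close>

definition cone_acyclic where
  "cone_acyclic C b C' b' f \<longleftrightarrow> (\<forall>d. \<forall>x\<in>carrier (C (d - 1)). \<forall>y\<in>carrier (C' d).
     b (d - 1) x = \<zero>[C (d - 2)] \<longrightarrow> f (d - 1) x = b' d y \<longrightarrow>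
     (\<exists>u\<in>carrier (C d). \<exists>v\<in>carrier (C' (d + 1)). b d u = x \<and> f d u \<oplus>[C' d] b' (d + 1) v = y))"

locale chain_map =
  fixes K :: "('k, 'c) ring_scheme" and C :: "int \<Rightarrow> ('k, 'a) module" and b :: "int \<Rightarrow> 'a \<Rightarrow> 'a"
    and C' :: "int \<Rightarrow> ('k, 'e) module" and b' :: "int \<Rightarrow> 'e \<Rightarrow> 'e" and f :: "int \<Rightarrow> 'a \<Rightarrow> 'e"
  assumes modC: "\<And>d. module K (C d)" and modC': "\<And>d. module K (C' d)"
    and b: "\<And>d. lin_map K (C d) (C (d - 1)) (b d)" and b': "\<And>d. lin_map K (C' d) (C' (d - 1)) (b' d)"
    and bb: "\<And>d x. x \<in> carrier (C d) \<Longrightarrow> b (d - 1) (b d x) = \<zero>[C (d - 2)]"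
    and bb': "\<And>d x. x \<in> carrier (C' d) \<Longrightarrow> b' (d - 1) (b' d x) = \<zero>[C' (d - 2)]"
    and f: "\<And>d. lin_map K (C d) (C' d) (f d)"
    and chain: "\<And>d x. x \<in> carrier (C d) \<Longrightarrow> f (d - 1) (b d x) = b' d (f d x)"
begin

sublocale C: module K "C d" for d by (rule modC)
sublocale C': module K "C' d" for d by (rule modC')

lemma b_up: "x \<in> carrier (C (d + 1)) \<Longrightarrow> b (d + 1) x \<in> carrier (C d)"
  using lin_closed[OF b, of x "d + 1"] by simp

lemma b'_up: "x \<in> carrier (C' (d + 1)) \<Longrightarrow> b' (d + 1) x \<in> carrier (C' d)"
  using lin_closed[OF b', of x "d + 1"] by simp

lemma chain_up: "x \<in> carrier (C (d + 1)) \<Longrightarrow> f d (b (d + 1) x) = b' (d + 1) (f (d + 1) x)"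
  using chain[of x "d + 1"] by simp

text \<open>The two conditions are injectivity and surjectivity in homology. They follow from cone
  acyclicity by inserting \<open>(x, y)\<close> one degree higher and \<open>(0, y)\<close>.
  Conversely, injectivity writes \<open>x\<close> as a boundary of some \<open>u0\<close>, and
  surjectivity is applied to the cycle \<open>y - f u0\<close> that is left.\<close>

lemma cone_acyclic_iff:
  "cone_acyclic C b C' b' f \<longleftrightarrow>
     (\<forall>d. \<forall>x\<in>carrier (C d). b d x = \<zero>[C (d - 1)] \<longrightarrow> (\<exists>y\<in>carrier (C' (d + 1)). f d x = b' (d + 1) y) \<longrightarrow>
        (\<exists>u\<in>carrier (C (d + 1)). x = b (d + 1) u)) \<and>
     (\<forall>d. \<forall>y\<in>carrier (C' d). b' d y = \<zero>[C' (d - 1)] \<longrightarrow>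
        (\<exists>x\<in>carrier (C d). b d x = \<zero>[C (d - 1)] \<and> (\<exists>v\<in>carrier (C' (d + 1)). y \<ominus>[C' d] f d x = b' (d + 1) v)))"
  (is "?L \<longleftrightarrow> ?I \<and> ?S")
proof (intro iffI conjI)
  assume L: ?L
  show ?I
  proof (intro allI ballI impI)
    fix d x assume x: "x \<in> carrier (C d)" "b d x = \<zero>[C (d - 1)]" and "\<exists>y\<in>carrier (C' (d + 1)). f d x = b' (d + 1) y"
    then obtain y where "y \<in> carrier (C' (d + 1))" "f d x = b' (d + 1) y" by blast
    then have "\<exists>u\<in>carrier (C (d + 1)). \<exists>v\<in>carrier (C' (d + 1 + 1)). b (d + 1) u = x \<and> f (d + 1) u \<oplus>[C' (d + 1)] b' (d + 1 + 1) v = y"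
      using L[unfolded cone_acyclic_def, rule_format, of x "d + 1" y] x by simp
    then show "\<exists>u\<in>carrier (C (d + 1)). x = b (d + 1) u" by metis
  qed
  show ?S
  proof (intro allI ballI impI)
    fix d y assume y: "y \<in> carrier (C' d)" "b' d y = \<zero>[C' (d - 1)]"
    have "b (d - 1) \<zero>[C (d - 1)] = \<zero>[C (d - 2)]" using lin_zero[OF modC modC b[of "d - 1"]] by simp
    moreover have "f (d - 1) \<zero>[C (d - 1)] = b' d y" using lin_zero[OF modC modC' f] y by simp
    ultimately obtain u v where u: "u \<in> carrier (C d)" "v \<in> carrier (C' (d + 1))" "b d u = \<zero>[C (d - 1)]"
      "f d u \<oplus>[C' d] b' (d + 1) v = y"
      using L[unfolded cone_acyclic_def, rule_format, OF C.zero_closed y(1)] by blast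
    have "y \<ominus>[C' d] f d u = b' (d + 1) v"
      using u(4)[symmetric] lin_closed[OF f u(1)] b'_up[OF u(2)] by (simp add: a_minus_def C'.a_ac C'.cancels)
    then show "\<exists>x\<in>carrier (C d). b d x = \<zero>[C (d - 1)] \<and> (\<exists>v\<in>carrier (C' (d + 1)). y \<ominus>[C' d] f d x = b' (d + 1) v)"
      using u by blast
  qed
next
  assume "?I \<and> ?S"
  then have I: ?I and S: ?S by blast+
  show ?L unfolding cone_acyclic_def
  proof (intro allI ballI impI)
    fix d x y assume x: "x \<in> carrier (C (d - 1))" "b (d - 1) x = \<zero>[C (d - 2)]" and y: "y \<in> carrier (C' d)" "f (d - 1) x = b' d y"
    have "\<exists>u\<in>carrier (C d). x = b d u"
      using I[rule_format, of x "d - 1"] x y by auto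
    then obtain u0 where u0: "u0 \<in> carrier (C d)" "x = b d u0" by blast
    let ?z = "y \<ominus>[C' d] f d u0"
    have fu0: "f d u0 \<in> carrier (C' d)" by (rule lin_closed[OF f u0(1)])
    have z: "?z \<in> carrier (C' d)" using y(1) fu0 by simp
    have "b' d ?z = \<zero>[C' (d - 1)]"
      using lin_minus[OF modC' modC' b' y(1) fu0] chain[OF u0(1)] y(2) u0(2) lin_closed[OF b' fu0]
      by (simp add: a_minus_def C'.r_neg)
    then obtain u1 v where u1: "u1 \<in> carrier (C d)" "b d u1 = \<zero>[C (d - 1)]" "v \<in> carrier (C' (d + 1))"
      "?z \<ominus>[C' d] f d u1 = b' (d + 1) v" using S z by blast
    have fu1: "f d u1 \<in> carrier (C' d)" by (rule lin_closed[OF f u1(1)])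
    show "\<exists>u\<in>carrier (C d). \<exists>v\<in>carrier (C' (d + 1)). b d u = x \<and> f d u \<oplus>[C' d] b' (d + 1) v = y"
    proof (intro bexI[of _ "u0 \<oplus>[C d] u1"] bexI[of _ v] conjI)
      show "b d (u0 \<oplus>[C d] u1) = x" using lin_add[OF b u0(1) u1(1)] u1(2) u0(2) lin_closed[OF b u0(1)] by simp
      show "f d (u0 \<oplus>[C d] u1) \<oplus>[C' d] b' (d + 1) v = y"
        unfolding u1(4)[symmetric] lin_add[OF f u0(1) u1(1)] using fu0 fu1 y(1)
        by (simp add: a_minus_def C'.a_ac C'.cancels C'.minus_add)
    qed (use u0 u1 in simp_all)
  qed
qed

text \<open>A contraction of the cone consists of the inverse and the two homotopies.\<close>

lemma homotopy_inverse:
  assumes neg: "\<And>d. d < 0 \<Longrightarrow> zero_module (C d)" "\<And>d. d < 0 \<Longrightarrow> zero_module (C' d)"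
    and lift: "\<And>d d'. liftable K (C d) (prod_module (C d') (C' (d' + 1)))"
      "\<And>d d'. liftable K (C' d) (prod_module (C d') (C' (d' + 1)))"
    and ac: "cone_acyclic C b C' b' f"
  shows "\<exists>g h h'. (\<forall>d. lin_map K (C' d) (C d) (g d)) \<and> (\<forall>d. \<forall>y\<in>carrier (C' d). g (d - 1) (b' d y) = b d (g d y)) \<and>
    (\<forall>d. lin_map K (C d) (C (d + 1)) (h d)) \<and> (\<forall>d. lin_map K (C' d) (C' (d + 1)) (h' d)) \<and>
    (\<forall>d. \<forall>x\<in>carrier (C d). g d (f d x) = x \<oplus>[C d] (b (d + 1) (h d x) \<oplus>[C d] h (d - 1) (b d x))) \<and>
    (\<forall>d. \<forall>y\<in>carrier (C' d). f d (g d y) = y \<oplus>[C' d] (b' (d + 1) (h' d y) \<oplus>[C' d] h' (d - 1) (b' d y)))"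
proof -
  \<comment> \<open>The mapping cone: \<open>C\<close> is shifted by one and its differential
    changes sign, so that the mixed terms of the square cancel.\<close>
  let ?E = "\<lambda>d. prod_module (C (d - 1)) (C' d)"
  let ?b = "\<lambda>d p. (\<ominus>[C (d - 2)] b (d - 1) (fst p), f (d - 1) (fst p) \<oplus>[C' (d - 1)] b' d (snd p))"
  note E = prod_module_module[OF modC modC']
  have bl: "lin_map K (?E d) (?E (d - 1)) (?b d)" for d
  proof (rule lin_pair)
    show "lin_map K (?E d) (C (d - 1 - 1)) (\<lambda>p. \<ominus>[C (d - 2)] b (d - 1) (fst p))"
    proof -
      have "lin_map K (?E d) (C (d - 2)) (\<lambda>p. b (d - 1) (fst p))"
        using lin_comp[OF lin_fst[of K "C (d - 1)" "C' d"] b[of "d - 1"]] by simp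
      from lin_uminus[OF E modC this] show ?thesis by simp
    qed
    show "lin_map K (?E d) (C' (d - 1)) (\<lambda>p. f (d - 1) (fst p) \<oplus>[C' (d - 1)] b' d (snd p))"
      by (rule lin_plus[OF E modC' lin_comp[OF lin_fst f] lin_comp[OF lin_snd b']])
  qed
  have bb2: "?b (d - 1) (?b d p) = \<zero>[?E (d - 2)]" if p: "p \<in> carrier (?E d)" for d p
  proof -
    obtain x y where xy: "p = (x, y)" "x \<in> carrier (C (d - 1))" "y \<in> carrier (C' d)" using p by auto
    have bx: "b (d - 1) x \<in> carrier (C (d - 2))" using lin_closed[OF b xy(2)] by simp
    have fx: "f (d - 1) x \<in> carrier (C' (d - 1))" "b' d y \<in> carrier (C' (d - 1))"
      by (rule lin_closed[OF f xy(2)], rule lin_closed[OF b' xy(3)])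
    have fbx: "f (d - 2) (b (d - 1) x) \<in> carrier (C' (d - 2))" by (rule lin_closed[OF f bx])
    have 1: "b (d - 2) (\<ominus>[C (d - 2)] b (d - 1) x) = \<zero>[C (d - 3)]"
      using lin_neg[OF modC modC b bx] bb[OF xy(2)] by simp
    have 2: "f (d - 2) (\<ominus>[C (d - 2)] b (d - 1) x) = \<ominus>[C' (d - 2)] f (d - 2) (b (d - 1) x)"
      by (rule lin_neg[OF modC modC' f bx])
    have 3: "b' (d - 1) (f (d - 1) x \<oplus>[C' (d - 1)] b' d y) = f (d - 2) (b (d - 1) x)"
      using lin_add[OF b' fx] bb'[OF xy(3)] chain[OF xy(2)] fbx by simp
    show ?thesis using fbx by (simp add: xy(1) 1 2 3 C'.l_neg)
  qed
  have negE: "zero_module (?E d)" if "d < 0" for d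
    using neg(1)[of "d - 1"] neg(2)[of d] that by (simp add: zero_module_def)
  have exact: "\<exists>u\<in>carrier (?E (d + 1)). ?b (d + 1) u = p" if p: "p \<in> carrier (?E d)" "?b d p = \<zero>[?E (d - 1)]" for d p
  proof -
    obtain x y where xy: "p = (x, y)" "x \<in> carrier (C (d - 1))" "y \<in> carrier (C' d)" using p(1) by auto
    have fx: "f (d - 1) x \<in> carrier (C' (d - 1))" "b' d y \<in> carrier (C' (d - 1))"
      by (rule lin_closed[OF f xy(2)], rule lin_closed[OF b' xy(3)])
    have bx: "b (d - 1) x \<in> carrier (C (d - 2))" using lin_closed[OF b xy(2)] by simp
    have "\<ominus>[C (d - 2)] b (d - 1) x = \<zero>[C (d - 2)]" and 2: "f (d - 1) x \<oplus>[C' (d - 1)] b' d y = \<zero>[C' (d - 1)]"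
      using p(2) by (simp_all add: xy(1))
    then have 1: "b (d - 1) x = \<zero>[C (d - 2)]" using bx by (metis C.minus_minus C.neg_zero)
    have "f (d - 1) x = b' d (\<ominus>[C' d] y)"
      using C'.minus_equality[OF 2 fx(2) fx(1)] lin_neg[OF modC' modC' b' xy(3)] by simp
    then obtain u v where u: "u \<in> carrier (C d)" "v \<in> carrier (C' (d + 1))" "b d u = x" "f d u \<oplus>[C' d] b' (d + 1) v = \<ominus>[C' d] y"
      using ac[unfolded cone_acyclic_def, rule_format, OF xy(2) C'.a_inv_closed[OF xy(3)] 1] by blast
    have "?b (d + 1) (\<ominus>[C d] u, \<ominus>[C' (d + 1)] v) = p"
      using lin_neg[OF modC modC b u(1)] lin_neg[OF modC modC' f u(1)] lin_neg[OF modC' modC' b' u(2)]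
        u(3,4) xy C'.minus_add[OF lin_closed[OF f u(1)] b'_up[OF u(2)]] C'.minus_minus[OF xy(3)]
      by (simp add: C'.a_comm)
    moreover have "(\<ominus>[C d] u, \<ominus>[C' (d + 1)] v) \<in> carrier (?E (d + 1))" using u by simp
    ultimately show ?thesis by (intro bexI)
  qed
  have liftE: "liftable K (?E d) (?E (d + 1))" for d
    using liftable_prod[OF modC modC' E lift] by simp
  obtain s where s: "\<And>d. lin_map K (?E d) (?E (d + 1)) (s d)"
    and sb: "\<And>d p. p \<in> carrier (?E d) \<Longrightarrow> ?b (d + 1) (s d p) \<oplus>[?E d] s (d - 1) (?b d p) = p"
    using contraction_exists[of K ?E ?b, OF E bl bb2 negE exact liftE] by blast
  have inl: "lin_map K (C d) (?E (d + 1)) (\<lambda>x. (x, \<zero>[C' (d + 1)]))" for d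
    using lin_pair[OF lin_id lin_const_zero[OF modC']] by simp
  have inr: "lin_map K (C' d) (?E d) (\<lambda>y. (\<zero>[C (d - 1)], y))" for d
    by (rule lin_pair[OF lin_const_zero[OF modC] lin_id])
  \<comment> \<open>Entries of the contraction as a matrix: \<open>g\<close> goes from
    \<open>C'\<close> to \<open>C\<close> and will be the inverse, \<open>h\<close> from
    \<open>C\<close> to \<open>C\<close> and \<open>k\<close> from \<open>C'\<close> to
    \<open>C'\<close> will be the homotopies.\<close>
  define g where "g d y = fst (s d (\<zero>[C (d - 1)], y))" for d y
  define h where "h d x = fst (s (d + 1) (x, \<zero>[C' (d + 1)]))" for d x
  define k where "k d y = snd (s d (\<zero>[C (d - 1)], y))" for d y
  have fstE: "lin_map K (?E (d + 1)) (C d) fst" for d using lin_fst[of K "C d" "C' (d + 1)"] by simp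
  have sndE: "lin_map K (?E (d + 1)) (C' (d + 1)) snd" for d by (rule lin_snd)
  have gl: "lin_map K (C' d) (C d) (g d)" for d
    using lin_comp[OF lin_comp[OF inr s] fstE] by (simp add: g_def[abs_def])
  have kl: "lin_map K (C' d) (C' (d + 1)) (k d)" for d
    using lin_comp[OF lin_comp[OF inr s] sndE] by (simp add: k_def[abs_def])
  have hl: "lin_map K (C d) (C (d + 1)) (h d)" for d
    using lin_comp[OF lin_comp[OF inl s] fstE[of "d + 1"]] by (simp add: h_def[abs_def])
  \<comment> \<open>The contraction yields \<open>f g + b' k + k b' = id\<close> on
    \<open>C'\<close>, so the homotopy in the required orientation is \<open>-k\<close>. On
    \<open>C\<close> the minus sign of the cone differential already puts \<open>h\<close> on the
    right side.\<close>
  have A: "g (d - 1) (b' d y) = b d (g d y) \<and> f d (g d y) = y \<oplus>[C' d] (b' (d + 1) (\<ominus>[C' (d + 1)] k d y) \<oplus>[C' d] \<ominus>[C' d] k (d - 1) (b' d y))"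
    if y: "y \<in> carrier (C' d)" for d y
  proof -
    have 0: "b (d - 1) \<zero>[C (d - 1)] = \<zero>[C (d - 2)]" "f (d - 1) \<zero>[C (d - 1)] = \<zero>[C' (d - 1)]"
      using lin_zero[OF modC modC b[of "d - 1"]] lin_zero[OF modC modC' f] by simp_all
    have cby: "b' d y \<in> carrier (C' (d - 1))" by (rule lin_closed[OF b' y])
    have gy: "g d y \<in> carrier (C d)" "g (d - 1) (b' d y) \<in> carrier (C (d - 1))"
      using lin_closed[OF gl y] lin_closed[OF gl cby] by simp_all
    have ky: "k d y \<in> carrier (C' (d + 1))" "k (d - 1) (b' d y) \<in> carrier (C' d)"
      using lin_closed[OF kl y] lin_closed[OF kl cby] by simp_all
    have eq: "?b (d + 1) (s d (\<zero>[C (d - 1)], y)) \<oplus>[?E d] s (d - 1) (?b d (\<zero>[C (d - 1)], y)) = (\<zero>[C (d - 1)], y)"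
      by (rule sb) (use y in simp)
    have bz: "?b d (\<zero>[C (d - 1)], y) = (\<zero>[C (d - 1 - 1)], b' d y)" using cby by (simp add: 0)
    have e1: "\<ominus>[C (d - 1)] b d (g d y) \<oplus>[C (d - 1)] g (d - 1) (b' d y) = \<zero>[C (d - 1)]"
      and e2: "(f d (g d y) \<oplus>[C' d] b' (d + 1) (k d y)) \<oplus>[C' d] k (d - 1) (b' d y) = y"
      using eq unfolding bz by (simp_all add: g_def k_def)
    have bg: "b d (g d y) \<in> carrier (C (d - 1))" by (rule lin_closed[OF b gy(1)])
    have "g (d - 1) (b' d y) = b d (g d y)"
      using arg_cong[OF C.minus_equality[OF e1 gy(2) C.a_inv_closed[OF bg]], of "a_inv (C (d - 1))"] bg gy(2) by simp
    moreover have "f d (g d y) = y \<oplus>[C' d] (b' (d + 1) (\<ominus>[C' (d + 1)] k d y) \<oplus>[C' d] \<ominus>[C' d] k (d - 1) (b' d y))"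
    proof -
      have b1: "b' (d + 1) (\<ominus>[C' (d + 1)] k d y) = \<ominus>[C' d] b' (d + 1) (k d y)"
        using lin_neg[OF modC' modC' b' ky(1)] by simp
      show ?thesis unfolding b1 using arg_cong[OF e2, of "\<lambda>z. z \<oplus>[C' d] (\<ominus>[C' d] b' (d + 1) (k d y) \<oplus>[C' d] \<ominus>[C' d] k (d - 1) (b' d y))"]
          lin_closed[OF f gy(1)] b'_up[OF ky(1)] ky(2) y
        by (simp add: C'.a_ac C'.cancels)
    qed
    ultimately show ?thesis by blast
  qed
  have B: "g d (f d x) = x \<oplus>[C d] (b (d + 1) (h d x) \<oplus>[C d] h (d - 1) (b d x))" if x: "x \<in> carrier (C d)" for d x
  proof -
    have bx: "b d x \<in> carrier (C (d - 1))" and fx: "f d x \<in> carrier (C' d)"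
      by (rule lin_closed[OF b x], rule lin_closed[OF f x])
    have hx: "h d x \<in> carrier (C (d + 1))" "h (d - 1) (b d x) \<in> carrier (C d)" "g d (f d x) \<in> carrier (C d)"
      using lin_closed[OF hl x] lin_closed[OF hl bx] lin_closed[OF gl fx] by simp_all
    have z: "b' (d + 1) \<zero>[C' (d + 1)] = \<zero>[C' d]" using lin_zero[OF modC' modC' b', of "d + 1"] by simp
    have xE: "(x, \<zero>[C' (d + 1)]) \<in> carrier (?E (d + 1))" using x by simp
    have bz: "?b (d + 1) (x, \<zero>[C' (d + 1)]) = (\<ominus>[C (d - 1)] b d x, \<zero>[C' d]) \<oplus>[?E d] (\<zero>[C (d - 1)], f d x)"
      using bx fx by (simp add: z)
    have "fst (s d (\<ominus>[C (d - 1)] b d x, \<zero>[C' d])) = h (d - 1) (\<ominus>[C (d - 1)] b d x)" by (simp add: h_def)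
    also have "\<dots> = \<ominus>[C d] h (d - 1) (b d x)" using lin_neg[OF modC modC hl bx] by simp
    finally have s1: "fst (s d (\<ominus>[C (d - 1)] b d x, \<zero>[C' d])) = \<ominus>[C d] h (d - 1) (b d x)" .
    have "s d ((\<ominus>[C (d - 1)] b d x, \<zero>[C' d]) \<oplus>[?E d] (\<zero>[C (d - 1)], f d x)) =
        s d (\<ominus>[C (d - 1)] b d x, \<zero>[C' d]) \<oplus>[?E (d + 1)] s d (\<zero>[C (d - 1)], f d x)"
      by (rule lin_add[OF s]) (use bx fx in simp_all)
    then have s2: "fst (s d (?b (d + 1) (x, \<zero>[C' (d + 1)]))) = \<ominus>[C d] h (d - 1) (b d x) \<oplus>[C d] g d (f d x)"
      unfolding bz by (simp add: s1 g_def)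
    have "fst (?b (d + 1 + 1) (s (d + 1) (x, \<zero>[C' (d + 1)])) \<oplus>[?E (d + 1)] s (d + 1 - 1) (?b (d + 1) (x, \<zero>[C' (d + 1)]))) = x"
      unfolding sb[OF xE] by simp
    then have "\<ominus>[C d] b (d + 1) (h d x) \<oplus>[C d] (\<ominus>[C d] h (d - 1) (b d x) \<oplus>[C d] g d (f d x)) = x"
      using s2 by (simp add: h_def add.commute)
    from arg_cong[OF this, of "\<lambda>z. z \<oplus>[C d] (b (d + 1) (h d x) \<oplus>[C d] h (d - 1) (b d x))"]
    show ?thesis using hx b_up[OF hx(1)] x by (simp add: C.a_ac C.cancels)
  qed
  show ?thesis
  proof (intro exI conjI allI ballI)
    show "lin_map K (C' d) (C d) (g d)" for d by (rule gl)
    show "lin_map K (C d) (C (d + 1)) (h d)" for d by (rule hl)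
    show "lin_map K (C' d) (C' (d + 1)) (\<lambda>y. \<ominus>[C' (d + 1)] k d y)" for d by (rule lin_uminus[OF modC' modC' kl])
    show "g (d - 1) (b' d y) = b d (g d y)" if "y \<in> carrier (C' d)" for d y using A[OF that] by blast
    show "g d (f d x) = x \<oplus>[C d] (b (d + 1) (h d x) \<oplus>[C d] h (d - 1) (b d x))" if "x \<in> carrier (C d)" for d x
      by (rule B[OF that])
    show "f d (g d y) = y \<oplus>[C' d] (b' (d + 1) (\<ominus>[C' (d + 1)] k d y) \<oplus>[C' d] \<ominus>[C' (d - 1 + 1)] k (d - 1) (b' d y))"
      if "y \<in> carrier (C' d)" for d y using A[OF that] by simp
  qed
qed

end

section \<open>Quasi-isomorphisms as acyclic cones\<close>

lemma dg_sigma_moduleD: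
  assumes "dg_sigma_module K M"
  shows "module K (dg_mod M r d)" "d < 0 \<Longrightarrow> zero_module (dg_mod M r d)"
    and "lin_map K (dg_mod M r d) (dg_mod M r (d - 1)) (dg_diff M r d)"
    and "x \<in> elts M r d \<Longrightarrow> dg_diff M r (d - 1) (dg_diff M r d x) = \<zero>[dg_mod M r (d - 2)]"
  using assms by (simp_all add: dg_sigma_module_def)

lemma dg_morphismD:
  assumes "dg_morphism K M N f"
  shows "lin_map K (dg_mod M r d) (dg_mod N r d) (f r d)"
    and "x \<in> elts M r d \<Longrightarrow> f r (d - 1) (dg_diff M r d x) = dg_diff N r d (f r d x)"
    and "s permutes {..<r} \<Longrightarrow> x \<in> elts M r d \<Longrightarrow> f r d (dg_act M r d s x) = dg_act N r d s (f r d x)"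
  using assms by (simp_all add: dg_morphism_def)

lemma chain_map_arity:
  assumes "dg_sigma_module K M" "dg_sigma_module K N" "dg_morphism K M N f"
  shows "chain_map K (dg_mod M r) (dg_diff M r) (dg_mod N r) (dg_diff N r) (f r)"
  by (rule chain_map.intro; (rule dg_sigma_moduleD[OF assms(1)] dg_sigma_moduleD[OF assms(2)] dg_morphismD[OF assms(3)])?)

lemma submodule_boundaries:
  assumes "dg_sigma_module K M" shows "submodule (boundaries M r d) K (dg_mod M r d)"
  unfolding boundaries_def
  using submodule_image[OF dg_sigma_moduleD(1,1,3)[OF assms], of r "d + 1"] by simp

lemma image_eq_iff_if_subset:
  assumes "p ` Z \<subseteq> q ` Z'" shows "p ` Z = q ` Z' \<longleftrightarrow> (\<forall>y\<in>Z'. \<exists>x\<in>Z. q y = p x)"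
proof -
  have "p ` Z = q ` Z' \<longleftrightarrow> q ` Z' \<subseteq> p ` Z" using assms by (simp add: set_eq_subset)
  also have "\<dots> \<longleftrightarrow> (\<forall>y\<in>Z'. q y \<in> p ` Z)" by (rule image_subset_iff)
  finally show ?thesis by (simp add: image_iff)
qed

lemma homology_carrier:
  "carrier (homology M r d) = (\<lambda>x. boundaries M r d +>[dg_mod M r d] x) ` cycles M r d"
  by (auto simp: homology_def quot_module_simps A_RCOSETS_def' a_r_coset_def')

text \<open>Bijectivity on cosets of cycles translates into conditions on elements: injectivity says
  that a cycle with bounding image bounds, surjectivity that every cycle is an image up to a
  boundary. These are the two conditions of \<open>cone_acyclic_iff\<close>.\<close>

lemma quasi_iso_iff:
  assumes M: "dg_sigma_module K M" and N: "dg_sigma_module K N"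
  shows "quasi_iso K M N f \<longleftrightarrow> dg_morphism K M N f \<and>
     (\<forall>r. cone_acyclic (dg_mod M r) (dg_diff M r) (dg_mod N r) (dg_diff N r) (f r))"
proof (cases "dg_morphism K M N f")
  case False
  then show ?thesis by (simp add: quasi_iso_def)
next
  case True
  note MD = dg_sigma_moduleD[OF M] and ND = dg_sigma_moduleD[OF N] and fD = dg_morphismD[OF True]
  have main: "(\<forall>d. bij_betw (quot_map (dg_mod N r d) (boundaries N r d) (f r d)) (carrier (homology M r d)) (carrier (homology N r d))) \<longleftrightarrow>
     cone_acyclic (dg_mod M r) (dg_diff M r) (dg_mod N r) (dg_diff N r) (f r)" for r
  proof -
    interpret chain_map K "dg_mod M r" "dg_diff M r" "dg_mod N r" "dg_diff N r" "f r"
      by (rule chain_map_arity[OF M N True])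
    have "bij_betw (quot_map (dg_mod N r d) (boundaries N r d) (f r d)) (carrier (homology M r d)) (carrier (homology N r d)) \<longleftrightarrow>
      (\<forall>x\<in>cycles M r d. f r d x \<in> boundaries N r d \<longrightarrow> x \<in> boundaries M r d) \<and>
      (\<forall>y\<in>cycles N r d. \<exists>x\<in>cycles M r d. y \<ominus>[dg_mod N r d] f r d x \<in> boundaries N r d)" for d
    proof -
      let ?A = "dg_mod M r d" and ?B = "dg_mod N r d" and ?G = "boundaries M r d" and ?H = "boundaries N r d"
      note G = submodule_boundaries[OF M, of r d] and H = submodule_boundaries[OF N, of r d]
      have cyc: "x \<in> carrier ?A" if "x \<in> cycles M r d" for x using that by (simp add: cycles_def)
      have cyc': "x \<in> carrier ?B" if "x \<in> cycles N r d" for x using that by (simp add: cycles_def)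
      have fGH: "f r d x \<in> ?H" if "x \<in> ?G" for x
        using that chain_up lin_closed[OF f] unfolding boundaries_def by auto
      have q: "quot_map ?B ?H (f r d) (?G +>[?A] x) = ?H +>[?B] f r d x" if "x \<in> cycles M r d" for x
        by (rule quot_map_coset[OF modC G modC' H f fGH cyc[OF that]])
      have fz: "f r d x \<in> cycles N r d" if "x \<in> cycles M r d" for x
        using that chain[of x d] lin_closed[OF f] lin_zero[OF modC modC' f] by (simp add: cycles_def)
      have diff_cyc: "x \<ominus>[?A] x' \<in> cycles M r d" if "x \<in> cycles M r d" "x' \<in> cycles M r d" for x x'
        using that lin_minus[OF modC modC b, of x d x'] by (simp add: cycles_def a_minus_def C.r_neg)
      have zc: "\<zero>[?A] \<in> cycles M r d" using lin_zero[OF modC modC b] by (simp add: cycles_def)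
      have fc: "f r d x \<in> carrier ?B" if "x \<in> cycles M r d" for x by (rule lin_closed[OF f cyc[OF that]])
      have inj: "inj_on (quot_map ?B ?H (f r d)) (carrier (homology M r d)) \<longleftrightarrow>
          (\<forall>x\<in>cycles M r d. f r d x \<in> ?H \<longrightarrow> x \<in> ?G)"
      proof
        assume i: "inj_on (quot_map ?B ?H (f r d)) (carrier (homology M r d))"
        show "\<forall>x\<in>cycles M r d. f r d x \<in> ?H \<longrightarrow> x \<in> ?G"
        proof (intro ballI impI)
          fix x assume x: "x \<in> cycles M r d" "f r d x \<in> ?H"
          have "?H +>[?B] f r d x = ?H +>[?B] f r d \<zero>[?A]"
            using coset_eq_iff[OF modC' H fc[OF x(1)] fc[OF zc]] lin_zero[OF modC modC' f] x(2) fc[OF x(1)]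
            by (simp add: a_minus_def)
          then have "?G +>[?A] x = ?G +>[?A] \<zero>[?A]"
            using inj_onD[OF i] x(1) zc by (simp add: homology_carrier q)
          then show "x \<in> ?G" using coset_eq_iff[OF modC G cyc[OF x(1)] C.zero_closed] cyc[OF x(1)] by (simp add: a_minus_def)
        qed
      next
        assume i: "\<forall>x\<in>cycles M r d. f r d x \<in> ?H \<longrightarrow> x \<in> ?G"
        show "inj_on (quot_map ?B ?H (f r d)) (carrier (homology M r d))"
        proof (rule inj_onI)
          fix X Y assume "X \<in> carrier (homology M r d)" "Y \<in> carrier (homology M r d)"
            and eq: "quot_map ?B ?H (f r d) X = quot_map ?B ?H (f r d) Y"
          then obtain x y where x: "x \<in> cycles M r d" "X = ?G +>[?A] x" and y: "y \<in> cycles M r d" "Y = ?G +>[?A] y"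
            by (auto simp: homology_carrier)
          have "f r d x \<ominus>[?B] f r d y \<in> ?H"
            using eq coset_eq_iff[OF modC' H fc[OF x(1)] fc[OF y(1)]] by (simp add: x(2) y(2) q x(1) y(1))
          then have "x \<ominus>[?A] y \<in> ?G"
            using i diff_cyc[OF x(1) y(1)] lin_minus[OF modC modC' f cyc[OF x(1)] cyc[OF y(1)]] by simp
          then show "X = Y" using coset_eq_iff[OF modC G cyc[OF x(1)] cyc[OF y(1)]] x y by simp
        qed
      qed
      have surj: "quot_map ?B ?H (f r d) ` carrier (homology M r d) = carrier (homology N r d) \<longleftrightarrow>
          (\<forall>y\<in>cycles N r d. \<exists>x\<in>cycles M r d. y \<ominus>[?B] f r d x \<in> ?H)"
      proof -
        have im: "quot_map ?B ?H (f r d) ` carrier (homology M r d) = (\<lambda>x. ?H +>[?B] f r d x) ` cycles M r d"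
          unfolding homology_carrier image_image by (rule image_cong[OF refl q])
        have "(\<lambda>x. ?H +>[?B] f r d x) ` cycles M r d \<subseteq> carrier (homology N r d)"
          using fz by (auto simp: homology_carrier)
        then have "quot_map ?B ?H (f r d) ` carrier (homology M r d) = carrier (homology N r d) \<longleftrightarrow>
           (\<forall>y\<in>cycles N r d. \<exists>x\<in>cycles M r d. ?H +>[?B] y = ?H +>[?B] f r d x)"
          unfolding im unfolding homology_carrier by (rule image_eq_iff_if_subset)
        also have "\<dots> \<longleftrightarrow> (\<forall>y\<in>cycles N r d. \<exists>x\<in>cycles M r d. y \<ominus>[?B] f r d x \<in> ?H)"
          using coset_eq_iff[OF modC' H cyc' fc] by simp
        finally show ?thesis .
      qed
      show ?thesis unfolding bij_betw_def inj surj ..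
    qed
    then show ?thesis unfolding cone_acyclic_iff
      by (simp add: cycles_def boundaries_def image_iff Ball_def Bex_def all_conj_distrib conj_assoc imp_conjL)
  qed
  show ?thesis unfolding quasi_iso_def using True by (simp add: main[symmetric])
qed

section \<open>The associated graded map\<close>

text \<open>Agreement of the entries on the carriers suffices. It serves to identify composites with
  the idempotents, such as \<open>F \<circ> E\<close> with \<open>F\<close>.\<close>

lemma entrywise_unique:
  assumes "reduced_product K M N" "comp_product K M' N'" "entrywise K M N M' N' n r f g T" "entrywise K M N M' N' n r f' g' T'"
    and f: "\<And>a. lin_map K (dg_mod M r a) (dg_mod M' r a) (f a)" and g: "\<And>i j b. lin_map K (dg_mod N j b) (dg_mod N' j b) (g i j b)"
    and "\<And>a x. x \<in> elts M r a \<Longrightarrow> f' a x = f a x" "\<And>i j b y. y \<in> elts N j b \<Longrightarrow> g' i j b y = g i j b y"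
    and "X \<in> elts (comp_prod K M N) n d"
  shows "T d X = T' d X"
proof -
  interpret S: reduced_product K M N by fact
  interpret T: comp_product K M' N' by fact
  have f': "lin_map K (dg_mod M r a) (dg_mod M' r a) (f' a)" for a by (rule lin_cong[OF S.module_M f]) (rule assms(7))
  have g': "lin_map K (dg_mod N j b) (dg_mod N' j b) (g' i j b)" for i j b by (rule lin_cong[OF S.module_N g]) (rule assms(8))
  show ?thesis
  proof (rule S.lin_eq_on_sorted[OF T.module_A entrywise_lin[OF assms(3)] entrywise_lin[OF assms(4)] _ assms(9)])
    fix a x ys assume s: "(a, x, ys) \<in> sgens M N n d"
    note gD = S.gensD[OF sgensD(1)[OF s]]
    have "slot0 g' ys = slot0 g ys" by (rule inputs_eqI) (simp_all add: in_slot assms(8) gD(4))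
    moreover have "f' a x = f a x" if "length ys = r" using assms(7)[of x a] gD(1) that by simp
    ultimately show "T d (cls K M N n d (a, x, ys)) = T' d (cls K M N n d (a, x, ys))"
      using entrywise_cls[OF S.comp_product_axioms T.comp_product_axioms assms(3) f g s]
        entrywise_cls[OF S.comp_product_axioms T.comp_product_axioms assms(4) f' g' s] by simp
  qed
qed

text \<open>The idempotents \<open>E\<close> and \<open>E'\<close> cut out the part with exactly
  \<open>r\<close> inputs. Homotopy inverses of the root map and of the input maps assemble to
  \<open>G\<close>, with \<open>GF\<close> homotopic to \<open>E\<close> via \<open>H\<close> and
  \<open>FG\<close> to \<open>E'\<close> via \<open>H'\<close>. A solution can then be written down:
  \<open>U1 = G Y - H X\<close> has boundary \<open>X\<close>, the rest \<open>Z = Y - F U1\<close>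
  is a cycle, and \<open>U = U1 + G Z\<close>, \<open>V = - H' Z\<close> solve both
  equations.\<close>

lemma graded_acyclic:
  assumes S: "dg_product K M N" and T: "dg_product K M' N'"
    and f: "\<And>a. lin_map K (dg_mod M r a) (dg_mod M' r a) (f a)"
    and fc: "\<And>a x. x \<in> elts M r a \<Longrightarrow> f (a - 1) (dg_diff M r a x) = dg_diff M' r a (f a x)"
    and p: "\<And>j b. lin_map K (dg_mod N j b) (dg_mod N' j b) (p j b)"
    and pc: "\<And>j b y. y \<in> elts N j b \<Longrightarrow> p j (b - 1) (dg_diff N j b y) = dg_diff N' j b (p j b y)"
    and lM: "\<And>d d'. liftable K (dg_mod M r d) (prod_module (dg_mod M r d') (dg_mod M' r (d' + 1)))"
      "\<And>d d'. liftable K (dg_mod M' r d) (prod_module (dg_mod M r d') (dg_mod M' r (d' + 1)))"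
    and lN: "\<And>j d d'. liftable K (dg_mod N j d) (prod_module (dg_mod N j d') (dg_mod N' j (d' + 1)))"
      "\<And>j d d'. liftable K (dg_mod N' j d) (prod_module (dg_mod N j d') (dg_mod N' j (d' + 1)))"
    and acM: "cone_acyclic (dg_mod M r) (dg_diff M r) (dg_mod M' r) (dg_diff M' r) f"
    and acN: "\<And>j. j + r \<le> n + 1 \<Longrightarrow> cone_acyclic (dg_mod N j) (dg_diff N j) (dg_mod N' j) (dg_diff N' j) (p j)"
    and F: "entrywise K M N M' N' n r f (\<lambda>_. p) F"
    and E: "entrywise K M N M N n r (\<lambda>_ x. x) (\<lambda>_ _ _ y. y) E"
    and E': "entrywise K M' N' M' N' n r (\<lambda>_ x. x) (\<lambda>_ _ _ y. y) E'"
    and X: "X \<in> elts (comp_prod K M N) n (d - 1)" "E (d - 1) X = X"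
    and Y: "Y \<in> elts (comp_prod K M' N') n d" "E' d Y = Y"
    and dX: "dg_diff (comp_prod K M N) n (d - 1) X = \<zero>[dg_mod (comp_prod K M N) n (d - 2)]"
    and XY: "F (d - 1) X = dg_diff (comp_prod K M' N') n d Y"
  shows "\<exists>U\<in>elts (comp_prod K M N) n d. \<exists>V\<in>elts (comp_prod K M' N') n (d + 1).
    E d U = U \<and> E' (d + 1) V = V \<and> dg_diff (comp_prod K M N) n d U = X \<and>
    F d U \<oplus>[dg_mod (comp_prod K M' N') n d] dg_diff (comp_prod K M' N') n (d + 1) V = Y"
proof -
  interpret S: dg_product K M N by fact
  interpret T: dg_product K M' N' by fact
  note Sc = S.comp_product_axioms and Tc = T.comp_product_axioms and Sr = S.reduced_product_axioms and Tr = T.reduced_product_axioms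
  note SM = dg_sigma_moduleD[OF S.M] and SN = dg_sigma_moduleD[OF S.N] and TM = dg_sigma_moduleD[OF T.M] and TN = dg_sigma_moduleD[OF T.N]
  note il = lin_id
  interpret cM: chain_map K "dg_mod M r" "dg_diff M r" "dg_mod M' r" "dg_diff M' r" f
    by (rule chain_map.intro) (rule SM TM f fc; assumption?)+
  obtain g h h' where g: "\<And>d. lin_map K (dg_mod M' r d) (dg_mod M r d) (g d)"
    and gc: "\<And>d y. y \<in> elts M' r d \<Longrightarrow> g (d - 1) (dg_diff M' r d y) = dg_diff M r d (g d y)"
    and h: "\<And>d. lin_map K (dg_mod M r d) (dg_mod M r (d + 1)) (h d)" "\<And>d. lin_map K (dg_mod M' r d) (dg_mod M' r (d + 1)) (h' d)"
    and hom: "\<And>d x. x \<in> elts M r d \<Longrightarrow>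
        g d (f d x) = x \<oplus>[dg_mod M r d] (dg_diff M r (d + 1) (h d x) \<oplus>[dg_mod M r d] h (d - 1) (dg_diff M r d x))"
      "\<And>d y. y \<in> elts M' r d \<Longrightarrow>
        f d (g d y) = y \<oplus>[dg_mod M' r d] (dg_diff M' r (d + 1) (h' d y) \<oplus>[dg_mod M' r d] h' (d - 1) (dg_diff M' r d y))"
    using cM.homotopy_inverse[OF SM(2) TM(2) lM acM] by metis
  \<comment> \<open>The identities are claimed only for arities within the bound. Beyond it zero
    maps are placeholders, so that the inverse and the homotopies can be chosen for all
    \<open>j\<close> at once.\<close>
  define I where "I j q k k' \<longleftrightarrow> (\<forall>d. lin_map K (dg_mod N' j d) (dg_mod N j d) (q d)) \<and>
     (\<forall>d. \<forall>y\<in>elts N' j d. q (d - 1) (dg_diff N' j d y) = dg_diff N j d (q d y)) \<and>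
     (\<forall>d. lin_map K (dg_mod N j d) (dg_mod N j (d + 1)) (k d)) \<and> (\<forall>d. lin_map K (dg_mod N' j d) (dg_mod N' j (d + 1)) (k' d)) \<and>
     (j + r \<le> n + 1 \<longrightarrow> (\<forall>d. \<forall>x\<in>elts N j d.
        q d (p j d x) = x \<oplus>[dg_mod N j d] (dg_diff N j (d + 1) (k d x) \<oplus>[dg_mod N j d] k (d - 1) (dg_diff N j d x)))) \<and>
     (j + r \<le> n + 1 \<longrightarrow> (\<forall>d. \<forall>y\<in>elts N' j d.
        p j d (q d y) = y \<oplus>[dg_mod N' j d] (dg_diff N' j (d + 1) (k' d y) \<oplus>[dg_mod N' j d] k' (d - 1) (dg_diff N' j d y))))"
    for j q k k'
  have "\<exists>q k k'. I j q k k'" for j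
  proof (cases "j + r \<le> n + 1")
    case True
    interpret cN: chain_map K "dg_mod N j" "dg_diff N j" "dg_mod N' j" "dg_diff N' j" "p j"
      by (rule chain_map.intro) (rule SN TN p pc; assumption?)+
    show ?thesis using cN.homotopy_inverse[OF SN(2) TN(2) lN acN[OF True]] unfolding I_def by blast
  next
    case False
    have "I j (\<lambda>d y. \<zero>[dg_mod N j d]) (\<lambda>d y. \<zero>[dg_mod N j (d + 1)]) (\<lambda>d y. \<zero>[dg_mod N' j (d + 1)])"
      unfolding I_def using False by (simp add: lin_const_zero[OF SN(1)] lin_const_zero[OF TN(1)] lin_zero[OF SN(1) SN(1) SN(3)])
    then show ?thesis by blast
  qed
  then obtain q k k' where "\<And>j. I j (q j) (k j) (k' j)" by metis
  note I = this[unfolded I_def]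
  have q: "lin_map K (dg_mod N' j d) (dg_mod N j d) (q j d)" for j d using I by blast
  have qc: "q j (d - 1) (dg_diff N' j d y) = dg_diff N j d (q j d y)" if "y \<in> elts N' j d" for j d y using I that by blast
  have k: "lin_map K (dg_mod N j d) (dg_mod N j (d + 1)) (k j d)" "lin_map K (dg_mod N' j d) (dg_mod N' j (d + 1)) (k' j d)" for j d
    using I by blast+
  have homN: "q j d (p j d x) = x \<oplus>[dg_mod N j d] (dg_diff N j (d + 1) (k j d x) \<oplus>[dg_mod N j d] k j (d - 1) (dg_diff N j d x))"
    if "j + r \<le> n + 1" "x \<in> elts N j d" for j d x using I that by blast
  have homN': "p j d (q j d y) = y \<oplus>[dg_mod N' j d] (dg_diff N' j (d + 1) (k' j d y) \<oplus>[dg_mod N' j d] k' j (d - 1) (dg_diff N' j d y))"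
    if "j + r \<le> n + 1" "y \<in> elts N' j d" for j d y using I that by blast
  obtain G where G: "entrywise K M' N' M N n r g (\<lambda>_. q) G" using entrywise_exists[where g = "\<lambda>_. q", OF Tc Sc g q] by blast
  note GF = entrywise_compose[OF Sr Tc Sc F G f p g q]
  note FG = entrywise_compose[OF Tr Sc Tc G F g q f p]
  have hGF: "S.homotopic n (\<lambda>d X. G d (F d X)) E"
    by (rule S.entrywise_homotopic[OF lin_comp[OF f g] _ h(1) hom(1) lin_comp[OF p q] _ k(1) homN GF E])
      (simp_all add: fc gc pc qc lin_closed[OF f] lin_closed[OF p])
  have hFG: "T.homotopic n (\<lambda>d X. F d (G d X)) E'"
    by (rule T.entrywise_homotopic[OF lin_comp[OF g f] _ h(2) hom(2) lin_comp[OF q p] _ k(2) homN' FG E'])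
      (simp_all add: fc gc pc qc lin_closed[OF g] lin_closed[OF q])
  obtain H where H: "\<And>d. lin_map K (S.A n d) (S.A n (d + 1)) (H d)" and HE: "\<And>d X. X \<in> S.cA n d \<Longrightarrow>
      G d (F d X) = E d X \<oplus>[S.A n d] (S.del n (d + 1) (H d X) \<oplus>[S.A n d] H (d - 1) (S.del n d X))"
    using hGF unfolding S.homotopic_def by blast
  obtain H' where H': "\<And>d. lin_map K (T.A n d) (T.A n (d + 1)) (H' d)" and HE': "\<And>d X. X \<in> T.cA n d \<Longrightarrow>
      F d (G d X) = E' d X \<oplus>[T.A n d] (T.del n (d + 1) (H' d X) \<oplus>[T.A n d] H' (d - 1) (T.del n d X))"
    using hFG unfolding T.homotopic_def by blast
  note Fl = entrywise_lin[OF F] and Gl = entrywise_lin[OF G] and El = entrywise_lin[OF E] and E'l = entrywise_lin[OF E']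
  have Fch: "F (d - 1) (S.del n d X) = T.del n d (F d X)" if "X \<in> S.cA n d" for d X
    by (rule entrywise_chain[OF S T F f fc p pc that])
  have Gch: "G (d - 1) (T.del n d X) = S.del n d (G d X)" if "X \<in> T.cA n d" for d X
    by (rule entrywise_chain[OF T S G g gc q qc that])
  have Ech: "E (d - 1) (S.del n d X) = S.del n d (E d X)" if "X \<in> S.cA n d" for d X
    by (rule entrywise_chain[OF S S E il refl il refl that])
  have E'ch: "E' (d - 1) (T.del n d X) = T.del n d (E' d X)" if "X \<in> T.cA n d" for d X
    by (rule entrywise_chain[OF T T E' il refl il refl that])
  have FE: "F d (E d X) = F d X" if "X \<in> S.cA n d" for d X
    by (rule entrywise_unique[OF Sr Tc entrywise_compose[OF Sr Sc Tc E F il il f p] F f p refl refl that])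
  have E'F: "E' d (F d X) = F d X" if "X \<in> S.cA n d" for d X
    by (rule entrywise_unique[OF Sr Tc entrywise_compose[OF Sr Tc Tc F E' f p il il] F f p refl refl that])
  have EE: "E d (E d X) = E d X" if "X \<in> S.cA n d" for d X
    by (rule entrywise_unique[OF Sr Sc entrywise_compose[OF Sr Sc Sc E E il il il il] E il il refl refl that])
  have E'E': "E' d (E' d X) = E' d X" if "X \<in> T.cA n d" for d X
    by (rule entrywise_unique[OF Tr Tc entrywise_compose[OF Tr Tc Tc E' E' il il il il] E' il il refl refl that])
  have dl: "lin_map K (S.A n (d + 1)) (S.A n d) (dg_diff (comp_prod K M N) n (d + 1))" for d using S.diff_lin[of n "d + 1"] by simp
  have dl': "lin_map K (T.A n (d + 1)) (T.A n d) (dg_diff (comp_prod K M' N') n (d + 1))" for d using T.diff_lin[of n "d + 1"] by simp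
  have HX: "H (d - 1) X \<in> S.cA n d" using lin_closed[OF H X(1)] by simp
  have GY: "G d Y \<in> S.cA n d" by (rule lin_closed[OF Gl Y(1)])
  define U1 where "U1 = G d Y \<ominus>[S.A n d] H (d - 1) X"
  have U1: "U1 \<in> S.cA n d" using GY HX by (simp add: U1_def)
  have dHX: "S.del n d (H (d - 1) X) \<in> S.cA n (d - 1)" by (rule lin_closed[OF S.diff_lin HX])
  have H0: "H (d - 2) \<zero>[S.A n (d - 2)] = \<zero>[S.A n (d - 1)]" using lin_zero[OF S.module_A S.module_A H[of "d - 2"]] by simp
  have "S.del n d (G d Y) = X \<oplus>[S.A n (d - 1)] S.del n d (H (d - 1) X)"
    using HE[OF X(1)] X(2) dX H0 Gch[OF Y(1)] XY dHX by simp
  then have dU1: "S.del n d U1 = X"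
    unfolding U1_def using lin_minus[OF S.module_A S.module_A S.diff_lin GY HX] X(1) dHX
    by (simp add: a_minus_def S.A.a_assoc S.A.r_neg)
  define Z where "Z = Y \<ominus>[T.A n d] F d U1"
  have FU1: "F d U1 \<in> T.cA n d" by (rule lin_closed[OF Fl U1])
  have Z: "Z \<in> T.cA n d" using Y(1) FU1 by (simp add: Z_def)
  have dZ: "T.del n d Z = \<zero>[T.A n (d - 1)]"
    unfolding Z_def using lin_minus[OF T.module_A T.module_A T.diff_lin Y(1) FU1] Fch[OF U1] dU1 XY
      lin_closed[OF T.diff_lin Y(1)] by (simp add: a_minus_def T.A.r_neg)
  have GZ: "G d Z \<in> S.cA n d" by (rule lin_closed[OF Gl Z])
  have dGZ: "S.del n d (G d Z) = \<zero>[S.A n (d - 1)]"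
    using Gch[OF Z] dZ lin_zero[OF T.module_A S.module_A Gl] by simp
  have H'Z: "H' d Z \<in> T.cA n (d + 1)" by (rule lin_closed[OF H' Z])
  have dH'Z: "T.del n (d + 1) (H' d Z) \<in> T.cA n d" by (rule lin_closed[OF dl' H'Z])
  have H'0: "H' (d - 1) \<zero>[T.A n (d - 1)] = \<zero>[T.A n d]" using lin_zero[OF T.module_A T.module_A H'[of "d - 1"]] by simp
  have "E' d Z = Z" unfolding Z_def using lin_minus[OF T.module_A T.module_A E'l Y(1) FU1] Y(2) E'F[OF U1] by simp
  then have FGZ: "F d (G d Z) = Z \<oplus>[T.A n d] T.del n (d + 1) (H' d Z)"
    using HE'[OF Z] dZ H'0 dH'Z by simp
  define U where "U = U1 \<oplus>[S.A n d] G d Z"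
  define V where "V = \<ominus>[T.A n (d + 1)] H' d Z"
  have UV: "U \<in> S.cA n d" "V \<in> T.cA n (d + 1)" using U1 GZ H'Z by (simp_all add: U_def V_def)
  have dU: "S.del n d U = X" unfolding U_def using lin_add[OF S.diff_lin U1 GZ] dU1 dGZ X(1) by simp
  have dV: "T.del n (d + 1) V = \<ominus>[T.A n d] T.del n (d + 1) (H' d Z)" unfolding V_def by (rule lin_neg[OF T.module_A T.module_A dl' H'Z])
  have FUV: "F d U \<oplus>[T.A n d] T.del n (d + 1) V = Y"
  proof -
    have "F d U = F d U1 \<oplus>[T.A n d] (Z \<oplus>[T.A n d] T.del n (d + 1) (H' d Z))"
      unfolding U_def lin_add[OF Fl U1 GZ] FGZ ..
    moreover have "F d U1 \<oplus>[T.A n d] Z = Y"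
      unfolding Z_def using Y(1) FU1 by (simp add: a_minus_def T.A.a_ac T.A.cancels)
    ultimately show ?thesis unfolding dV using FU1 Z dH'Z Y(1)
      by (metis T.A.a_assoc T.A.a_closed T.A.a_inv_closed T.A.r_neg T.A.r_zero)
  qed
  \<comment> \<open>\<open>U\<close> and \<open>V\<close> may leave the part with \<open>r\<close>
    inputs; applying \<open>E\<close> and \<open>E'\<close> brings them back without affecting the
    equations, as \<open>X\<close> and \<open>Y\<close> are fixed.\<close>
  show ?thesis
  proof (intro bexI conjI)
    show "E d U \<in> S.cA n d" by (rule lin_closed[OF El UV(1)])
    show "E' (d + 1) V \<in> T.cA n (d + 1)" by (rule lin_closed[OF E'l UV(2)])
    show "E d (E d U) = E d U" by (rule EE[OF UV(1)])
    show "E' (d + 1) (E' (d + 1) V) = E' (d + 1) V" by (rule E'E'[OF UV(2)])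
    show "S.del n d (E d U) = X" using Ech[OF UV(1)] dU X(2) by simp
    have "T.del n (d + 1) (E' (d + 1) V) = E' d (T.del n (d + 1) V)" using E'ch[OF UV(2)] by simp
    then have "F d (E d U) \<oplus>[T.A n d] T.del n (d + 1) (E' (d + 1) V) = E' d (F d U \<oplus>[T.A n d] T.del n (d + 1) V)"
      using lin_add[OF E'l lin_closed[OF Fl UV(1)] lin_closed[OF dl' UV(2)]] FE[OF UV(1)] E'F[OF UV(1)] by simp
    then show "F d (E d U) \<oplus>[T.A n d] T.del n (d + 1) (E' (d + 1) V) = Y" using FUV Y(2) by simp
  qed
qed

section \<open>The unit sequence and the right unitor\<close>

lemma unit_seq_simps:
  "elts (unit_seq K) r d = (if r = 1 \<and> d = 0 then carrier K else {\<zero>[K]})"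
  "\<zero>[dg_mod (unit_seq K) r d] = \<zero>[K]" "x \<oplus>[dg_mod (unit_seq K) r d] y = x \<oplus>[K] y"
  "c \<odot>[dg_mod (unit_seq K) r d] x = c \<otimes>[K] x" "dg_diff (unit_seq K) r d x = \<zero>[K]" "dg_act (unit_seq K) r d s x = x"
  by (simp_all add: unit_seq_def)

lemma dg_sigma_unit_seq:
  assumes "cring K" shows "dg_sigma_module K (unit_seq K)"
proof -
  interpret K: cring K by fact
  have m: "module K (dg_mod (unit_seq K) r d)" for r d
  proof (rule moduleI)
    show "abelian_group (dg_mod (unit_seq K) r d)"
    proof (rule abelian_groupI)
      fix x assume "x \<in> elts (unit_seq K) r d"
      then show "\<exists>y\<in>elts (unit_seq K) r d. y \<oplus>[dg_mod (unit_seq K) r d] x = \<zero>[dg_mod (unit_seq K) r d]"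
        by (intro bexI[of _ "\<ominus>[K] x"]) (simp_all add: unit_seq_simps K.l_neg split: if_splits)
    qed (simp_all add: unit_seq_simps K.a_ac split: if_splits)
  qed (simp_all add: unit_seq_simps assms K.l_distr K.r_distr K.m_assoc split: if_splits)
  show ?thesis unfolding dg_sigma_module_def
    by (intro conjI allI impI ballI m lin_mapI) (simp_all add: unit_seq_simps zero_module_def)
qed

text \<open>The inputs that the unit sequence and the augmentation do not annihilate: singleton
  blocks in degree zero.\<close>

definition unary :: "'n inputs \<Rightarrow> bool" where
  "unary ys \<longleftrightarrow> (\<forall>i<length ys. card (in_block ys i) = 1 \<and> in_deg ys i = 0)"

text \<open>For unary inputs this is the permutation that sends a position to the element of its
  block; beyond the list it is the identity, so that it is a permutation of the whole type.\<close>

definition label :: "'n inputs \<Rightarrow> nat \<Rightarrow> nat" where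
  "label ys i = (if i < length ys then the_elem (in_block ys i) else i)"

definition val_prod where
  "val_prod K ys = finprod K (in_val ys) {..<length ys}"

lemma unary_iff: "(\<forall>(J, b, k)\<in>set ys. card J = 1 \<and> b = 0) \<longleftrightarrow> unary ys"
  by (simp add: unary_def in_block_def in_deg_def case_prod_unfold all_set_conv_all_nth)

lemma unary_set_val [simp]: "unary (set_val ys i v) = unary ys"
  by (simp add: unary_def)

lemma label_set_val [simp]: "label (set_val ys i v) = label ys"
  by (rule ext) (simp add: label_def)

lemma unary_block: "unary ys \<Longrightarrow> i < length ys \<Longrightarrow> in_block ys i = {label ys i}"
proof -
  assume u: "unary ys" and i: "i < length ys"
  then have "card (in_block ys i) = 1" by (simp add: unary_def)
  then obtain a where "in_block ys i = {a}" by (rule card_1_singletonE)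
  then show ?thesis using i by (simp add: label_def)
qed

lemma
  assumes "valid_inputs N n ys" "unary ys"
  shows unary_length: "length ys = n" and label_permutes: "label ys permutes {..<length ys}"
    and unary_tot_deg: "tot_deg ys = 0"
proof -
  have b: "in_block ys i = {label ys i}" if "i < length ys" for i by (rule unary_block[OF assms(2) that])
  have inj: "inj_on (label ys) {..<length ys}"
  proof (rule inj_onI, rule ccontr)
    fix i j assume ij: "i \<in> {..<length ys}" "j \<in> {..<length ys}" "label ys i = label ys j" "i \<noteq> j"
    then have "in_block ys i \<inter> in_block ys j = {}" using assms(1) by (simp add: valid_inputs_iff)
    then show False using ij b by simp
  qed
  have "{..<n} = (\<Union>i<length ys. in_block ys i)" using assms(1) by (simp add: valid_inputs_iff)
  also have "\<dots> = label ys ` {..<length ys}" using b by auto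
  finally have im: "label ys ` {..<length ys} = {..<n}" ..
  show len: "length ys = n" using card_image[OF inj] im by simp
  show "label ys permutes {..<length ys}"
    by (rule bij_imp_permutes) (use inj im len in \<open>simp_all add: bij_betw_def label_def\<close>)
  show "tot_deg ys = 0" using assms(2) by (simp add: tot_deg_def unary_def)
qed

lemma unary_permute:
  assumes "s permutes {..<length ys}" shows "unary (permute_list s ys) = unary ys"
proof -
  have "(\<forall>i<length ys. card (in_block ys (s i)) = 1 \<and> in_deg ys (s i) = 0) \<longleftrightarrow>
      (\<forall>i<length ys. card (in_block ys i) = 1 \<and> in_deg ys i = 0)"
    by (metis permutes_lessThan[OF assms] permutes_lessThan[OF permutes_inv[OF assms]] permutes_inverses(1)[OF assms])
  then show ?thesis by (simp add: unary_def in_block_permute[OF assms] in_deg_permute[OF assms])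
qed

lemma label_permute:
  assumes "s permutes {..<length ys}" shows "label (permute_list s ys) = label ys \<circ> s"
proof
  fix i
  show "label (permute_list s ys) i = (label ys \<circ> s) i"
  proof (cases "i < length ys")
    case True
    then show ?thesis using permutes_lessThan[OF assms] by (simp add: label_def in_block_permute[OF assms])
  next
    case False
    then have "s i = i" using assms by (simp add: permutes_def)
    then show ?thesis using False by (simp add: label_def)
  qed
qed

lemma perm_sign_degree_zero: "(\<And>i. i < length ys \<Longrightarrow> in_deg ys i = 0) \<Longrightarrow> s permutes {..<length ys} \<Longrightarrow> perm_sign K s ys = \<one>[K]"
proof -
  assume d: "\<And>i. i < length ys \<Longrightarrow> in_deg ys i = 0" and s: "s permutes {..<length ys}"
  have "(\<Sum>(i, j)\<in>{(i, j). i < j \<and> j < length ys \<and> s j < s i}. in_deg ys (s i) * in_deg ys (s j)) = 0"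
    by (rule sum.neutral) (clarsimp simp: d permutes_lessThan[OF s])
  then show ?thesis by (simp add: perm_sign_def ksign_def)
qed

context cring
begin

text \<open>Trades the ordered product in the right unitor for a product over a set of positions,
  which can be reindexed by a permutation.\<close>

lemma foldr_val_prod:
  assumes "\<And>i. i < length ys \<Longrightarrow> in_val ys i \<in> carrier R" "c \<in> carrier R"
  shows "foldr (\<lambda>(J, b, k) c. k \<otimes> c) ys c = val_prod R ys \<otimes> c"
  using assms(1)
proof (induction ys)
  case Nil
  then show ?case using assms(2) by (simp add: val_prod_def)
next
  case (Cons p ys)
  obtain J b k where p: "p = (J, b, k)" by (cases p)
  have v: "in_val (p # ys) 0 = k" "\<And>i. in_val (p # ys) (Suc i) = in_val ys i" by (simp_all add: in_val_def p)
  have k: "k \<in> carrier R" using Cons.prems[of 0] v by simp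
  have ys: "in_val ys i \<in> carrier R" if "i < length ys" for i using Cons.prems[of "Suc i"] v that by simp
  have "val_prod R (p # ys) = finprod R (in_val (p # ys)) (insert 0 (Suc ` {..<length ys}))"
    by (simp add: val_prod_def lessThan_Suc_eq_insert_0)
  also have "\<dots> = k \<otimes> finprod R (in_val (p # ys)) (Suc ` {..<length ys})"
    by (subst finprod_insert) (use k ys v in auto)
  also have "finprod R (in_val (p # ys)) (Suc ` {..<length ys}) = finprod R (\<lambda>i. in_val (p # ys) (Suc i)) {..<length ys}"
    by (rule finprod_reindex) (use ys v in auto)
  also have "\<dots> = val_prod R ys" by (simp add: v val_prod_def)
  finally have "val_prod R (p # ys) = k \<otimes> val_prod R ys" .
  moreover have "val_prod R ys \<in> carrier R" unfolding val_prod_def by (rule finprod_closed) (use ys in auto)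
  moreover have "foldr (\<lambda>(J, b, k) c. k \<otimes> c) (p # ys) c = k \<otimes> (val_prod R ys \<otimes> c)"
    using Cons.IH[OF ys] by (simp add: p)
  ultimately show ?case using k assms(2) by (simp add: m_assoc)
qed

lemma val_prod_closed: "(\<And>i. i < length ys \<Longrightarrow> in_val ys i \<in> carrier R) \<Longrightarrow> val_prod R ys \<in> carrier R"
  unfolding val_prod_def by (rule finprod_closed) auto

lemma val_prod_set_val:
  assumes "\<And>i. i < length ys \<Longrightarrow> in_val ys i \<in> carrier R" "i < length ys" "v \<in> carrier R"
  shows "val_prod R (set_val ys i v) = v \<otimes> finprod R (in_val ys) ({..<length ys} - {i})"
    and "finprod R (in_val ys) ({..<length ys} - {i}) \<in> carrier R"
proof -
  have I: "{..<length ys} = insert i ({..<length ys} - {i})" using assms(2) by auto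
  show "finprod R (in_val ys) ({..<length ys} - {i}) \<in> carrier R" by (rule finprod_closed) (use assms in auto)
  have c: "in_val (set_val ys i v) j \<in> carrier R" if "j < length ys" for j
    using assms that by (simp add: in_val_set_val)
  have "val_prod R (set_val ys i v) = finprod R (in_val (set_val ys i v)) (insert i ({..<length ys} - {i}))"
    using I by (simp add: val_prod_def)
  also have "\<dots> = in_val (set_val ys i v) i \<otimes> finprod R (in_val (set_val ys i v)) ({..<length ys} - {i})"
    by (rule finprod_insert) (use c assms(2) in auto)
  also have "finprod R (in_val (set_val ys i v)) ({..<length ys} - {i}) = finprod R (in_val ys) ({..<length ys} - {i})"
    by (rule finprod_cong') (use assms in \<open>auto simp: in_val_set_val\<close>)
  finally show "val_prod R (set_val ys i v) = v \<otimes> finprod R (in_val ys) ({..<length ys} - {i})"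
    using assms(2) by (simp add: in_val_set_val)
qed

lemma finprod_permute:
  assumes "s permutes {..<n}" "\<And>i. i < n \<Longrightarrow> w i \<in> carrier R"
  shows "finprod R (\<lambda>i. w (s i)) {..<n} = finprod R w {..<n}"
proof -
  have "finprod R w (s ` {..<n}) = finprod R (\<lambda>i. w (s i)) {..<n}"
    by (rule finprod_reindex) (use assms permutes_inj_on[OF assms(1)] permutes_image[OF assms(1)] in auto)
  then show ?thesis using permutes_image[OF assms(1)] by simp
qed

end

lemma unary_val_carrier:
  "valid_inputs (unit_seq K) n ys \<Longrightarrow> unary ys \<Longrightarrow> i < length ys \<Longrightarrow> in_val ys i \<in> carrier K"
  by (simp add: valid_inputs_iff unary_def unit_seq_simps)

text \<open>The right unitor is a \<open>comp_lift\<close>, so the point is that its values are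
  balanced. Non-unary inputs give zero throughout. For unary ones the Koszul sign is trivial because
  all input degrees vanish, and permuting the list by \<open>s\<close> composes the label with
  \<open>s\<close>.\<close>

lemma
  assumes "comp_product K M (unit_seq K)"
  shows right_unitor_lin: "lin_map K (dg_mod (comp_prod K M (unit_seq K)) n d) (dg_mod M n d) (right_unitor K M n d)"
    and right_unitor_cls: "(a, x, ys) \<in> gens M (unit_seq K) n d \<Longrightarrow>
      right_unitor K M n d (cls K M (unit_seq K) n d (a, x, ys)) =
      (if unary ys then val_prod K ys \<odot>[dg_mod M n d] dg_act M n d (label ys) x else \<zero>[dg_mod M n d])"
proof -
  interpret MI: comp_product K M "unit_seq K" by fact
  define F where "F = (\<lambda>(a :: int, x, ys). if \<forall>(J, b, k)\<in>set ys. card J = 1 \<and> b = 0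
     then foldr (\<lambda>(J, b, k) c. k \<otimes>[K] c) ys \<one>[K] \<odot>[dg_mod M n d]
       dg_act M n d (\<lambda>i. if i < length ys then the_elem (in_block ys i) else i) x
     else \<zero>[dg_mod M n d])"
  have ru: "right_unitor K M n d = comp_lift K (dg_mod M n d) F" by (simp add: right_unitor_def F_def)
  have F: "F (a, x, ys) = (if unary ys then val_prod K ys \<odot>[dg_mod M n d] dg_act M n d (label ys) x else \<zero>[dg_mod M n d])"
    if "valid_inputs (unit_seq K) n ys" for a x ys
  proof (cases "unary ys")
    case True
    have Fd: "F (a, x, ys) = foldr (\<lambda>(J, b, k) c. k \<otimes>[K] c) ys \<one>[K] \<odot>[dg_mod M n d] dg_act M n d (label ys) x"
      using True by (simp only: F_def prod.case unary_iff label_def[abs_def] if_True)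
    have "foldr (\<lambda>(J, b, k) c. k \<otimes>[K] c) ys \<one>[K] = val_prod K ys"
      using MI.K.foldr_val_prod[OF unary_val_carrier[OF that True] MI.K.one_closed]
        MI.K.val_prod_closed[OF unary_val_carrier[OF that True]] by simp
    then show ?thesis using True by (simp only: Fd if_True)
  next
    case False
    then show ?thesis by (simp only: F_def prod.case unary_iff if_False)
  qed
  have bal: "balanced K M (unit_seq K) n d (dg_mod M n d) F"
    unfolding balanced_def
  proof (intro allI impI)
    fix a x ys assume g: "(a, x, ys) \<in> gens M (unit_seq K) n d"
    note gD = MI.gensD[OF g]
    note Fs = F[OF gD(2)]
    have Fsv: "F (a, x, set_val ys i v) = (if unary ys then val_prod K (set_val ys i v) \<odot>[dg_mod M n d] dg_act M n d (label ys) x else \<zero>[dg_mod M n d])"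
      if "i < length ys" "v \<in> elts (unit_seq K) (card (in_block ys i)) (in_deg ys i)" for i v x
      using F[OF valid_inputs_set_val[OF gD(2) that]] by simp
    show "multilinear_at K M (unit_seq K) (dg_mod M n d) F a x ys \<and> (\<forall>s. s permutes {..<length ys} \<longrightarrow>
        F (a, dg_act M (length ys) a s x, ys) = perm_sign K s ys \<odot>[dg_mod M n d] F (a, x, permute_list s ys))"
    proof (cases "unary ys")
      case False
      have z: "F (a, x, zs) = \<zero>[dg_mod M n d]" if "valid_inputs (unit_seq K) n zs" "\<not> unary zs" for x zs
        using F[OF that(1)] that(2) by simp
      have "F (a, x, set_val ys i v) = \<zero>[dg_mod M n d]"
        if "i < length ys" "v \<in> elts (unit_seq K) (card (in_block ys i)) (in_deg ys i)" for i v
        using Fsv[OF that] False by simp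
      then show ?thesis
        using z[OF gD(2) False] z[OF valid_inputs_permute[OF gD(2)]] unary_permute[of _ ys] False gD(4)
        by (simp add: multilinear_at_def MI.perm_sign_closed)
    next
      case True
      have n: "length ys = n" by (rule unary_length[OF gD(2) True])
      have ad: "a = d" using gD(3) unary_tot_deg[OF gD(2) True] by simp
      have l: "label ys permutes {..<n}" using label_permutes[OF gD(2) True] n by simp
      let ?M = "dg_mod M n d"
      have x: "x \<in> carrier ?M" using gD(1) n ad by simp
      note al = MI.act_M[OF l, of d]
      have v: "in_val ys i \<in> carrier K" if "i < length ys" for i by (rule unary_val_carrier[OF gD(2) True that])
      have p: "val_prod K ys \<in> carrier K" by (rule MI.K.val_prod_closed[OF v])
      have F1: "F (a, z, ys) = val_prod K ys \<odot>[?M] dg_act M n d (label ys) z" for z using Fs True by simp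
      note F1d = F1[unfolded ad]
      have ax: "dg_act M n d (label ys) z \<in> carrier ?M" if "z \<in> carrier ?M" for z by (rule lin_closed[OF al that])
      show ?thesis unfolding multilinear_at_def
      proof (intro conjI ballI allI impI)
        show "F (a, x, ys) \<in> carrier ?M" using p ax[OF x] by (simp add: F1)
        show "F (a, x \<oplus>[dg_mod M (length ys) a] x', ys) = F (a, x, ys) \<oplus>[?M] F (a, x', ys)"
          if "x' \<in> elts M (length ys) a" for x'
          using that x p ax by (simp add: F1d n ad lin_add[OF al] MI.M.smult_r_distr)
        show "F (a, k \<odot>[dg_mod M (length ys) a] x, ys) = k \<odot>[?M] F (a, x, ys)" if "k \<in> carrier K" for k
          using that x p ax by (simp add: F1d n ad lin_smult[OF al] MI.K.m_comm flip: MI.M.smult_assoc1)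
        show "F (a, dg_act M (length ys) a s x, ys) = perm_sign K s ys \<odot>[?M] F (a, x, permute_list s ys)"
          if s: "s permutes {..<length ys}" for s
        proof -
          have 1: "perm_sign K s ys = \<one>[K]" by (rule perm_sign_degree_zero[OF _ s]) (use True in \<open>simp add: unary_def\<close>)
          have "val_prod K (permute_list s ys) = finprod K (\<lambda>i. in_val ys (s i)) {..<length ys}"
            unfolding val_prod_def length_permute_list
            by (rule MI.K.finprod_cong') (use v permutes_lessThan[OF s] in \<open>simp_all add: in_val_permute[OF s]\<close>)
          also have "\<dots> = val_prod K ys" unfolding val_prod_def by (rule MI.K.finprod_permute[OF s v])
          finally have 2: "val_prod K (permute_list s ys) = val_prod K ys" .
          have "F (a, x, permute_list s ys) = val_prod K ys \<odot>[?M] dg_act M n d (label ys \<circ> s) x"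
            using F[OF valid_inputs_permute[OF gD(2) s]] True by (simp add: unary_permute[OF s] 2 label_permute[OF s])
          also have "\<dots> = F (a, dg_act M (length ys) a s x, ys)"
            using MI.act_M_comp[OF l _ x, of s] s by (simp add: F1d n ad)
          finally show ?thesis using 1 p ax[of "dg_act M n d s x"] lin_closed[OF MI.act_M x, of s] s by (simp add: F1d n ad)
        qed
        fix i assume i: "i < length ys"
        have N: "elts (unit_seq K) (card (in_block ys i)) (in_deg ys i) = carrier K"
          using True i by (simp add: unary_def unit_seq_simps)
        have vp: "val_prod K (set_val ys i w) = w \<otimes>[K] finprod K (in_val ys) ({..<length ys} - {i})"
          if "w \<in> carrier K" for w by (rule MI.K.val_prod_set_val(1)[OF v i that])
        have vy: "val_prod K ys = in_val ys i \<otimes>[K] finprod K (in_val ys) ({..<length ys} - {i})"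
          using vp[OF v[OF i]] by (simp add: set_val_same)
        have pc: "finprod K (in_val ys) ({..<length ys} - {i}) \<in> carrier K"
          by (rule MI.K.val_prod_set_val(2)[OF v i v[OF i]])
        have Fi: "F (a, x, set_val ys i v) = val_prod K (set_val ys i v) \<odot>[?M] dg_act M n d (label ys) x"
          if "v \<in> carrier K" for v using Fsv[OF i, of v x] that True by (simp add: N)
        show "F (a, x, set_val ys i (in_val ys i \<oplus>[dg_mod (unit_seq K) (card (in_block ys i)) (in_deg ys i)] y)) =
          F (a, x, ys) \<oplus>[?M] F (a, x, set_val ys i y)"
          if "y \<in> elts (unit_seq K) (card (in_block ys i)) (in_deg ys i)" for y
          using that v[OF i] ax[OF x] pc
          by (simp add: N Fi F1 unit_seq_simps(3) vp vy MI.K.l_distr MI.M.smult_l_distr)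
        show "F (a, x, set_val ys i (k \<odot>[dg_mod (unit_seq K) (card (in_block ys i)) (in_deg ys i)] in_val ys i)) =
          k \<odot>[?M] F (a, x, ys)" if "k \<in> carrier K" for k
          using that v[OF i] ax[OF x] pc
          by (simp add: Fi F1 unit_seq_simps(4) vp vy MI.K.m_assoc flip: MI.M.smult_assoc1)
      qed
    qed
  qed
  show "lin_map K (MI.A n d) (dg_mod M n d) (right_unitor K M n d)"
    unfolding ru by (rule MI.comp_lift_lin_map[OF MI.module_M bal])
  show "right_unitor K M n d (cls K M (unit_seq K) n d (a, x, ys)) =
      (if unary ys then val_prod K ys \<odot>[dg_mod M n d] dg_act M n d (label ys) x else \<zero>[dg_mod M n d])"
    if "(a, x, ys) \<in> gens M (unit_seq K) n d"
    unfolding ru using MI.comp_lift_cls[OF MI.module_M bal that] F[OF MI.gensD(2)[OF that]] by simp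
qed

section \<open>Regrouping\<close>

lemma rank_bij:
  assumes "finite T" shows "bij_betw (rank T) T {..<card T}"
proof -
  have lt: "rank T i < rank T j" if "i \<in> T" "j \<in> T" "i < j" for i j
    unfolding rank_def by (rule psubset_card_mono) (use assms that in auto)
  have inj: "inj_on (rank T) T"
    by (rule inj_onI) (metis lt nat_neq_iff)
  have "rank T ` T \<subseteq> {..<card T}"
  proof (rule image_subsetI)
    fix j assume j: "j \<in> T"
    have "card {i \<in> T. i < j} < card T" by (rule psubset_card_mono) (use assms j in auto)
    then show "rank T j \<in> {..<card T}" by (simp add: rank_def)
  qed
  moreover have "card (rank T ` T) = card {..<card T}" using card_image[OF inj] by simp
  ultimately have "rank T ` T = {..<card T}" by (intro card_subset_eq) simp_all
  then show ?thesis using inj by (simp add: bij_betw_def)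
qed

text \<open>The list \<open>ws\<close> of inner inputs inside \<open>regroup\<close>, rewritten with
  the accessor functions.\<close>

definition subinputs :: "'z inputs \<Rightarrow> nat set \<Rightarrow> 'z inputs" where
  "subinputs zs J = map (\<lambda>k. (rank (\<Union>k\<in>J. in_block zs k) ` in_block zs k, in_deg zs k, in_val zs k)) (sorted_list_of_set J)"

lemma length_subinputs [simp]: "length (subinputs zs J) = card J"
  by (simp add: subinputs_def)

lemma
  assumes "t < card J"
  shows in_block_subinputs: "in_block (subinputs zs J) t = rank (\<Union>k\<in>J. in_block zs k) ` in_block zs (sorted_list_of_set J ! t)"
    and in_deg_subinputs: "in_deg (subinputs zs J) t = in_deg zs (sorted_list_of_set J ! t)"
    and in_val_subinputs: "in_val (subinputs zs J) t = in_val zs (sorted_list_of_set J ! t)"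
  using assms by (simp_all add: subinputs_def in_block_def in_deg_def in_val_def)

lemma sorted_nth_bij: "finite J \<Longrightarrow> bij_betw (\<lambda>t. sorted_list_of_set J ! t) {..<card J} J"
  using bij_betw_nth[of "sorted_list_of_set J" "{..<card J}" J] by simp

lemma tot_deg_subinputs: "finite J \<Longrightarrow> tot_deg (subinputs zs J) = (\<Sum>k\<in>J. in_deg zs k)"
  using sum.reindex_bij_betw[OF sorted_nth_bij, of J "in_deg zs"] by (simp add: tot_deg_def in_deg_subinputs)

lemma length_regroup [simp]: "length (regroup K P R lam ys zs) = length ys"
  by (simp add: regroup_def)

lemma
  assumes "i < length ys"
  shows in_block_regroup: "in_block (regroup K P R lam ys zs) i = (\<Union>k\<in>in_block ys i. in_block zs k)"
    and in_deg_regroup: "in_deg (regroup K P R lam ys zs) i = in_deg ys i + tot_deg (subinputs zs (in_block ys i))"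
    and in_val_regroup: "in_val (regroup K P R lam ys zs) i =
      lam (card (\<Union>k\<in>in_block ys i. in_block zs k)) (in_deg ys i + tot_deg (subinputs zs (in_block ys i)))
       (cls K P R (card (\<Union>k\<in>in_block ys i. in_block zs k)) (in_deg ys i + tot_deg (subinputs zs (in_block ys i)))
         (in_deg ys i, in_val ys i, subinputs zs (in_block ys i)))"
proof -
  have e: "regroup K P R lam ys zs ! i = (let T = (\<Union>k\<in>in_block ys i. in_block zs k); ws = subinputs zs (in_block ys i);
      e = in_deg ys i + tot_deg ws in (T, e, lam (card T) e (cls K P R (card T) e (in_deg ys i, in_val ys i, ws))))"
    using assms by (simp add: regroup_def subinputs_def in_block_def in_deg_def in_val_def case_prod_unfold)
  show "in_block (regroup K P R lam ys zs) i = (\<Union>k\<in>in_block ys i. in_block zs k)"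
    "in_deg (regroup K P R lam ys zs) i = in_deg ys i + tot_deg (subinputs zs (in_block ys i))"
    "in_val (regroup K P R lam ys zs) i =
      lam (card (\<Union>k\<in>in_block ys i. in_block zs k)) (in_deg ys i + tot_deg (subinputs zs (in_block ys i)))
       (cls K P R (card (\<Union>k\<in>in_block ys i. in_block zs k)) (in_deg ys i + tot_deg (subinputs zs (in_block ys i)))
         (in_deg ys i, in_val ys i, subinputs zs (in_block ys i)))"
    unfolding in_block_def[of "regroup K P R lam ys zs"] in_deg_def[of "regroup K P R lam ys zs"]
      in_val_def[of "regroup K P R lam ys zs"] e by (simp_all add: Let_def)
qed

lemma block_subset: "valid_inputs N n ys \<Longrightarrow> i < length ys \<Longrightarrow> in_block ys i \<subseteq> {..<n}"
  by (auto simp: valid_inputs_iff)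

lemma subinputs_gens:
  assumes ys: "valid_inputs P n ys" and zs: "valid_inputs R m zs" "length zs = n" and i: "i < length ys"
  shows "(in_deg ys i, in_val ys i, subinputs zs (in_block ys i))
    \<in> gens P R (card (\<Union>k\<in>in_block ys i. in_block zs k)) (in_deg ys i + tot_deg (subinputs zs (in_block ys i)))"
proof -
  let ?J = "in_block ys i" let ?T = "\<Union>k\<in>?J. in_block zs k" let ?s = "sorted_list_of_set ?J"
  have J: "?J \<subseteq> {..<n}" by (rule block_subset[OF ys i])
  have fJ: "finite ?J" by (rule finite_subset[OF J]) simp
  have fT: "finite ?T" using fJ valid_inputs_finite_block[OF zs(1)] J zs(2) by auto
  note rb = rank_bij[OF fT]
  have sJ: "?s ! t \<in> ?J" if "t < card ?J" for t using bij_betwE[OF sorted_nth_bij[OF fJ]] that by simp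
  have sub: "in_block zs (?s ! t) \<subseteq> ?T" if "t < card ?J" for t using sJ[OF that] by blast
  have inj: "inj_on (rank ?T) ?T" using rb by (simp add: bij_betw_def)
  have "valid_inputs R (card ?T) (subinputs zs ?J)"
    unfolding valid_inputs_iff length_subinputs
  proof (intro conjI allI impI)
    fix t t' assume t: "t < card ?J" "t' < card ?J" "t \<noteq> t'"
    then have "?s ! t \<noteq> ?s ! t'" using sorted_nth_bij[OF fJ] by (auto simp: bij_betw_def inj_on_def)
    then have "in_block zs (?s ! t) \<inter> in_block zs (?s ! t') = {}"
      using zs J sJ[OF t(1)] sJ[OF t(2)] by (simp add: valid_inputs_iff subset_iff)
    then show "in_block (subinputs zs ?J) t \<inter> in_block (subinputs zs ?J) t' = {}"
      using inj_on_image_Int[OF inj sub[OF t(1)] sub[OF t(2)]] t by (simp add: in_block_subinputs)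
  next
    have "(\<Union>t<card ?J. in_block (subinputs zs ?J) t) = (\<Union>t<card ?J. rank ?T ` in_block zs (?s ! t))"
      by (simp add: in_block_subinputs)
    also have "\<dots> = rank ?T ` (\<Union>k\<in>(\<lambda>t. ?s ! t) ` {..<card ?J}. in_block zs k)" by auto
    also have "(\<lambda>t. ?s ! t) ` {..<card ?J} = ?J" using sorted_nth_bij[OF fJ] by (simp add: bij_betw_def)
    also have "rank ?T ` ?T = {..<card ?T}" using rb by (simp add: bij_betw_def)
    finally show "(\<Union>t<card ?J. in_block (subinputs zs ?J) t) = {..<card ?T}" .
  next
    fix t assume t: "t < card ?J"
    have "card (rank ?T ` in_block zs (?s ! t)) = card (in_block zs (?s ! t))"
      by (rule card_image[OF inj_on_subset[OF inj sub[OF t]]])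
    moreover have "?s ! t < n" using sJ[OF t] J by auto
    ultimately show "in_val (subinputs zs ?J) t \<in> elts R (card (in_block (subinputs zs ?J) t)) (in_deg (subinputs zs ?J) t)"
      using zs t by (simp add: in_block_subinputs in_deg_subinputs in_val_subinputs valid_inputs_iff)
  qed
  then show ?thesis using ys i by (simp add: gens_def valid_inputs_iff)
qed

lemma
  assumes "comp_product K P R" and ys: "valid_inputs P n ys" and zs: "valid_inputs R m zs" "length zs = n"
    and lam: "\<And>k e X. X \<in> elts (comp_prod K P R) k e \<Longrightarrow> lam k e X \<in> elts R k e"
  shows valid_regroup: "valid_inputs R m (regroup K P R lam ys zs)"
    and tot_deg_regroup: "tot_deg (regroup K P R lam ys zs) = tot_deg ys + tot_deg zs"
proof -
  interpret PR: comp_product K P R by fact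
  have dis: "in_block ys i \<inter> in_block ys j = {}" if "i < length ys" "j < length ys" "i \<noteq> j" for i j
    using ys that by (simp add: valid_inputs_iff)
  have disz: "in_block zs i \<inter> in_block zs j = {}" if "i < n" "j < n" "i \<noteq> j" for i j
    using zs that by (simp add: valid_inputs_iff)
  have J: "in_block ys i \<subseteq> {..<n}" if "i < length ys" for i by (rule block_subset[OF ys that])
  have fJ: "finite (in_block ys i)" if "i < length ys" for i by (rule finite_subset[OF J[OF that]]) simp
  have cov: "(\<Union>i<length ys. in_block ys i) = {..<n}" using ys by (simp add: valid_inputs_iff)
  show "valid_inputs R m (regroup K P R lam ys zs)"
    unfolding valid_inputs_iff length_regroup
  proof (intro conjI allI impI)
    fix i j assume ij: "i < length ys" "j < length ys" "i \<noteq> j"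
    have "in_block zs k \<inter> in_block zs l = {}" if "k \<in> in_block ys i" "l \<in> in_block ys j" for k l
      by (rule disz) (use that J[OF ij(1)] J[OF ij(2)] dis[OF ij] in auto)
    then show "in_block (regroup K P R lam ys zs) i \<inter> in_block (regroup K P R lam ys zs) j = {}"
      using ij by (simp add: in_block_regroup) blast
  next
    have "(\<Union>i<length ys. in_block (regroup K P R lam ys zs) i) = (\<Union>k\<in>(\<Union>i<length ys. in_block ys i). in_block zs k)"
      by (simp add: in_block_regroup)
    also have "\<dots> = {..<m}" unfolding cov using zs by (simp add: valid_inputs_iff)
    finally show "(\<Union>i<length ys. in_block (regroup K P R lam ys zs) i) = {..<m}" .
  next
    fix i assume i: "i < length ys"
    show "in_val (regroup K P R lam ys zs) i \<in> elts R (card (in_block (regroup K P R lam ys zs) i)) (in_deg (regroup K P R lam ys zs) i)"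
      unfolding in_block_regroup[OF i] in_deg_regroup[OF i] in_val_regroup[OF i]
      by (rule lam[OF PR.cls_closed[OF subinputs_gens[OF ys zs i]]])
  qed
  have "(\<Sum>k<n. in_deg zs k) = (\<Sum>k\<in>(\<Union>i<length ys. in_block ys i). in_deg zs k)" by (simp add: cov)
  also have "\<dots> = (\<Sum>i<length ys. \<Sum>k\<in>in_block ys i. in_deg zs k)"
    by (rule sum.UNION_disjoint) (use fJ dis in auto)
  finally show "tot_deg (regroup K P R lam ys zs) = tot_deg ys + tot_deg zs"
    using fJ zs(2) by (simp add: tot_deg_def[of "regroup K P R lam ys zs"] in_deg_regroup sum.distrib
      tot_deg_subinputs tot_deg_def[of ys] tot_deg_def[of zs])
qed

section \<open>Quasi-free modules\<close>

lemma submodule_finsum: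
  assumes "module K A" "submodule H K A" "finite I" "\<And>i. i \<in> I \<Longrightarrow> f i \<in> H"
  shows "(\<Oplus>\<^bsub>A\<^esub>i\<in>I. f i) \<in> H"
proof -
  interpret A: module K A by fact
  note E = A.submoduleE[OF assms(2)]
  show ?thesis using assms(3,4)
  proof (induction I)
    case empty
    then show ?case using submodule_zero[OF assms(2)] by simp
  next
    case (insert i I)
    have c: "f \<in> I \<rightarrow> carrier A" "f i \<in> carrier A" using insert.prems E(1) by auto
    show ?case using insert c E(5) by simp
  qed
qed

lemma
  assumes "i < n"
  shows in_block_unit_inputs: "in_block (unit_inputs n u) i = {i}" and in_deg_unit_inputs: "in_deg (unit_inputs n u) i = 0"
    and in_val_unit_inputs: "in_val (unit_inputs n u) i = u"
  using assms by (simp_all add: unit_inputs_def in_block_def in_deg_def in_val_def)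

lemma length_unit_inputs [simp]: "length (unit_inputs n u) = n"
  by (simp add: unit_inputs_def)

lemmas in_unit_inputs = in_block_unit_inputs in_deg_unit_inputs in_val_unit_inputs

lemma tot_deg_unit_inputs [simp]: "tot_deg (unit_inputs n u) = 0"
  by (simp add: tot_deg_def in_unit_inputs)

lemma unary_unit_inputs [simp]: "unary (unit_inputs n u)"
  by (simp add: unary_def in_unit_inputs)

lemma label_unit_inputs [simp]: "label (unit_inputs n u) = id"
  by (rule ext) (simp add: label_def in_unit_inputs)

lemma valid_unit_inputs: "u \<in> elts N 1 0 \<Longrightarrow> valid_inputs N n (unit_inputs n u)"
  by (simp add: valid_inputs_iff in_unit_inputs)

lemma permute_unit_inputs:
  assumes "unary ys" "\<And>i. i < length ys \<Longrightarrow> in_val ys i = u" "label ys permutes {..<length ys}"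
  shows "ys = permute_list (label ys) (unit_inputs (length ys) u)"
proof (rule inputs_eqI)
  fix i assume "i < length (permute_list (label ys) (unit_inputs (length ys) u))"
  then have i: "i < length ys" by simp
  then have li: "label ys i < length ys" using permutes_lessThan[OF assms(3)] by simp
  have p: "label ys permutes {..<length (unit_inputs (length ys) u)}" using assms(3) by simp
  show "in_block ys i = in_block (permute_list (label ys) (unit_inputs (length ys) u)) i"
    "in_deg ys i = in_deg (permute_list (label ys) (unit_inputs (length ys) u)) i"
    "in_val ys i = in_val (permute_list (label ys) (unit_inputs (length ys) u)) i"
    using i li assms(1,2) unary_block[OF assms(1) i]
    by (simp_all add: in_block_permute[OF p] in_deg_permute[OF p] in_val_permute[OF p] in_unit_inputs unary_def)
qed simp

section \<open>Connected operads and their augmentation\<close>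

lemma
  assumes "connected_operad K P"
  shows operad_sigma: "dg_sigma_module K P" and operad_zero: "zero_in_arity_zero P"
    and operad_unit: "op_unit P \<in> elts P 1 0"
    and operad_comp_lin: "lin_map K (dg_mod (comp_prod K P P) n d) (dg_mod P n d) (op_comp P n d)"
    and operad_left_unit: "p \<in> elts P n d \<Longrightarrow> op_comp P n d (cls K P P n d (0, op_unit P, [({..<n}, d, p)])) = p"
    and operad_unary_bij: "bij_betw (\<lambda>k. k \<odot>[dg_mod P 1 0] op_unit P) (carrier K) (elts P 1 0)"
    and operad_unary_zero: "d \<noteq> 0 \<Longrightarrow> zero_module (dg_mod P 1 d)"
  using assms by (simp_all add: connected_operad_def operad_def ground_ring_in_arity_one_def right_action_def dg_morphism_def)

lemma operad_comp_closed:
  "connected_operad K P \<Longrightarrow> X \<in> elts (comp_prod K P P) n d \<Longrightarrow> op_comp P n d X \<in> elts P n d"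
  by (rule lin_closed[OF operad_comp_lin])

lemma
  assumes "cring K" "connected_operad K P"
  shows augmentation_lin: "lin_map K (dg_mod P r d) (dg_mod (unit_seq K) r d) (augmentation K P r d)"
    and augmentation_expand: "p \<in> elts P 1 0 \<Longrightarrow> p = augmentation K P 1 0 p \<odot>[dg_mod P 1 0] op_unit P"
    and augmentation_unique: "k \<in> carrier K \<Longrightarrow> augmentation K P 1 0 (k \<odot>[dg_mod P 1 0] op_unit P) = k"
    and augmentation_closed: "p \<in> elts P 1 0 \<Longrightarrow> augmentation K P 1 0 p \<in> carrier K"
proof -
  interpret K: cring K by fact
  interpret P: module K "dg_mod P 1 0" by (rule dg_sigma_moduleD(1)[OF operad_sigma[OF assms(2)]])
  note bij = operad_unary_bij[OF assms(2)]
  note u = operad_unit[OF assms(2)]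
  have uniq: "augmentation K P 1 0 (k \<odot>[dg_mod P 1 0] op_unit P) = k" if "k \<in> carrier K" for k
    unfolding augmentation_def using that bij by (auto simp: bij_betw_def inj_on_def intro!: the_equality)
  show "augmentation K P 1 0 (k \<odot>[dg_mod P 1 0] op_unit P) = k" if "k \<in> carrier K" by (rule uniq[OF that])
  have ex: "\<exists>k\<in>carrier K. p = k \<odot>[dg_mod P 1 0] op_unit P" if "p \<in> elts P 1 0" for p
    using bij that by (auto simp: bij_betw_def)
  then show "p \<in> elts P 1 0 \<Longrightarrow> p = augmentation K P 1 0 p \<odot>[dg_mod P 1 0] op_unit P"
    and "p \<in> elts P 1 0 \<Longrightarrow> augmentation K P 1 0 p \<in> carrier K"
    using uniq by (metis, metis)
  have l: "lin_map K (dg_mod P 1 0) (dg_mod (unit_seq K) 1 0) (augmentation K P 1 0)"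
  proof (rule lin_mapI)
    fix p assume p: "p \<in> elts P 1 0"
    obtain k where k: "k \<in> carrier K" "p = k \<odot>[dg_mod P 1 0] op_unit P" using ex[OF p] by blast
    show "augmentation K P 1 0 p \<in> elts (unit_seq K) 1 0" using k by (simp add: uniq unit_seq_simps del: One_nat_def)
    show "augmentation K P 1 0 (c \<odot>[dg_mod P 1 0] p) = c \<odot>[dg_mod (unit_seq K) 1 0] augmentation K P 1 0 p" if "c \<in> carrier K" for c
      using uniq[of "c \<otimes>[K] k"] k that u by (simp add: uniq unit_seq_simps P.smult_assoc1 del: One_nat_def)
    fix q assume q: "q \<in> elts P 1 0"
    obtain l where l: "l \<in> carrier K" "q = l \<odot>[dg_mod P 1 0] op_unit P" using ex[OF q] by blast
    show "augmentation K P 1 0 (p \<oplus>[dg_mod P 1 0] q) = augmentation K P 1 0 p \<oplus>[dg_mod (unit_seq K) 1 0] augmentation K P 1 0 q"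
      using uniq[of "k \<oplus>[K] l"] k l u by (simp add: uniq unit_seq_simps P.smult_l_distr del: One_nat_def)
  qed
  show "lin_map K (dg_mod P r d) (dg_mod (unit_seq K) r d) (augmentation K P r d)"
  proof (cases "r = 1 \<and> d = 0")
    case True
    then show ?thesis using l by simp
  next
    case False
    then have "augmentation K P r d = (\<lambda>p. \<zero>[K])" unfolding augmentation_def[abs_def] by (rule_tac ext) (simp only: if_False)
    then show ?thesis by (simp add: lin_map_def unit_seq_simps)
  qed
qed

context comp_product
begin

text \<open>The scalars are pulled out one input after the other: \<open>?z k\<close> is
  \<open>ys\<close> with its first \<open>k\<close> values replaced by those of
  \<open>zs\<close>.\<close>

lemma cls_scale_inputs:
  assumes g: "(a, x, ys) \<in> gens M N n d" and z: "(a, x, zs) \<in> gens M N n d" and l: "length zs = length ys"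
    and b: "\<And>i. i < length ys \<Longrightarrow> in_block zs i = in_block ys i" "\<And>i. i < length ys \<Longrightarrow> in_deg zs i = in_deg ys i"
    and c: "\<And>i. i < length ys \<Longrightarrow> c i \<in> carrier K"
    and v: "\<And>i. i < length ys \<Longrightarrow> in_val ys i = c i \<odot>[dg_mod N (card (in_block ys i)) (in_deg ys i)] in_val zs i"
  shows "C n d (a, x, ys) = finprod K c {..<length ys} \<odot>[A n d] C n d (a, x, zs)"
proof -
  let ?z = "\<lambda>k. slot0 (\<lambda>i j b y. if i < k then in_val zs i else y) ys"
  have zg: "(a, x, ?z k) \<in> gens M N n d" for k
  proof -
    have "valid_inputs N n (?z k)"
      by (rule valid_slot[OF gensD(2)[OF g]]) (use gensD(4)[OF g] gensD(4)[OF z] l b in simp)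
    then show ?thesis using gensD(1,3)[OF g] by (simp add: gens_def tot_deg_slot)
  qed
  have "finprod K c {..<k} \<in> carrier K \<and> C n d (a, x, ys) = finprod K c {..<k} \<odot>[A n d] C n d (a, x, ?z k)"
    if "k \<le> length ys" for k
    using that
  proof (induction k)
    case 0
    have "?z 0 = ys" by (rule inputs_eqI) (simp_all add: in_slot)
    then show ?case using cls_closed[OF g] by simp
  next
    case (Suc k)
    then have IH: "finprod K c {..<k} \<in> carrier K" "C n d (a, x, ys) = finprod K c {..<k} \<odot>[A n d] C n d (a, x, ?z k)" by simp_all
    have k: "k < length ys" using Suc.prems by simp
    have ck: "c k \<in> carrier K" by (rule c[OF k])
    have "finprod K c (insert k {..<k}) = c k \<otimes>[K] finprod K c {..<k}"
      by (rule K.finprod_insert) (use c k in auto)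
    then have fs: "finprod K c {..<Suc k} = finprod K c {..<k} \<otimes>[K] c k"
      using IH(1) ck by (simp add: lessThan_Suc K.m_comm)
    have "?z k = set_val (?z (Suc k)) k (in_val ys k)"
      by (rule inputs_eqI) (use k in \<open>simp_all add: in_slot in_val_set_val\<close>)
    then have "C n d (a, x, ?z k) = c k \<odot>[A n d] C n d (a, x, ?z (Suc k))"
      using cls_smult_input[OF zg[of "Suc k"], of k "c k"] k ck v[OF k] by (simp add: in_slot)
    then have "C n d (a, x, ys) = finprod K c {..<Suc k} \<odot>[A n d] C n d (a, x, ?z (Suc k))"
      using IH ck cls_closed[OF zg] by (simp add: fs A.smult_assoc1)
    then show ?case using fs IH(1) ck by simp
  qed
  note this[of "length ys"]
  moreover have "?z (length ys) = zs" by (rule inputs_eqI) (simp_all add: in_slot l b)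
  ultimately show ?thesis by simp
qed

text \<open>Pull the scalars out of the inputs, then move the label permutation to the root by
  coinvariance, with trivial sign in degree zero. It is applied both to the operad unit and to the
  unit of the ground ring.\<close>

lemma cls_unary:
  assumes g: "(a, x, ys) \<in> gens M N n d" and un: "unary ys" and u: "u \<in> elts N 1 0"
    and c: "\<And>i. i < n \<Longrightarrow> c i \<in> carrier K" "\<And>i. i < n \<Longrightarrow> in_val ys i = c i \<odot>[dg_mod N 1 0] u"
  shows "C n d (a, x, ys) = finprod K c {..<n} \<odot>[A n d] C n d (d, dg_act M n d (label ys) x, unit_inputs n u)"
proof -
  note gD = gensD[OF g]
  have n: "length ys = n" by (rule unary_length[OF gD(2) un])
  have ad: "a = d" using gD(3) unary_tot_deg[OF gD(2) un] by simp
  let ?z = "slot0 (\<lambda>i j b y. u) ys"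
  have vz: "valid_inputs N n ?z"
    by (rule valid_slot[OF gD(2)]) (use u un in \<open>simp add: unary_def\<close>)
  then have zg: "(a, x, ?z) \<in> gens M N n d" using gD(1,3) by (simp add: gens_def tot_deg_slot)
  have uz: "unary ?z" using un by (simp add: unary_def in_slot)
  have lz: "label ?z = label ys" by (rule ext) (simp add: label_def in_slot)
  note lp = label_permutes[OF vz uz]
  have lp': "label ys permutes {..<length (unit_inputs n u)}" using lp n lz by simp
  have ze: "?z = permute_list (label ys) (unit_inputs n u)"
    using permute_unit_inputs[OF uz _ lp, of u] n lz by (simp add: in_slot)
  have x: "x \<in> elts M n d" using gD(1) n ad by simp
  have ug: "(d, x, unit_inputs n u) \<in> gens M N n d"
    using x valid_unit_inputs[OF u] by (simp add: gens_def)
  have "C n d (d, dg_act M n d (label ys) x, unit_inputs n u) = perm_sign K (label ys) (unit_inputs n u) \<odot>[A n d] C n d (d, x, ?z)"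
    using cls_coinvariant[OF ug lp'] ze by simp
  also have "perm_sign K (label ys) (unit_inputs n u) = \<one>[K]"
    by (rule perm_sign_degree_zero[OF _ lp']) (simp add: in_unit_inputs)
  finally have "C n d (d, dg_act M n d (label ys) x, unit_inputs n u) = C n d (d, x, ?z)" using cls_closed[OF zg] ad by simp
  moreover have "C n d (a, x, ys) = finprod K c {..<length ys} \<odot>[A n d] C n d (a, x, ?z)"
    by (rule cls_scale_inputs[OF g zg]) (use un n c in \<open>simp_all add: in_slot unary_def\<close>)
  ultimately show ?thesis using n ad by simp
qed

end

lemma permutes_one: "s permutes {..<1::nat} \<Longrightarrow> s = id"
proof -
  assume "s permutes {..<1::nat}"
  moreover have "{..<1::nat} = {0}" by auto
  ultimately show ?thesis by simp
qed

lemma augmentation_equivariant: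
  assumes "connected_operad K P" "s permutes {..<r}" "p \<in> elts P r d"
  shows "augmentation K P r d (dg_act P r d s p) = augmentation K P r d p"
proof (cases "r = 1 \<and> d = 0")
  case True
  then have "dg_act P r d s p = p"
    using assms permutes_one[of s] operad_sigma[OF assms(1)] by (simp add: dg_sigma_module_def)
  then show ?thesis by simp
next
  case False
  then show ?thesis unfolding augmentation_def by (simp only: if_False)
qed

definition augs where
  "augs K P ys = map (\<lambda>(J, b, y). (J, b, augmentation K P (card J) b y)) ys"

lemma length_augs [simp]: "length (augs K P ys) = length ys"
  by (simp add: augs_def)

lemma in_augs:
  assumes "i < length ys"
  shows "in_block (augs K P ys) i = in_block ys i" "in_deg (augs K P ys) i = in_deg ys i"
    "in_val (augs K P ys) i = augmentation K P (card (in_block ys i)) (in_deg ys i) (in_val ys i)"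
  using assms by (simp_all add: augs_def in_block_map in_deg_map in_val_map)

lemma unary_augs [simp]: "unary (augs K P ys) = unary ys"
  by (simp add: unary_def in_augs)

lemma label_augs [simp]: "label (augs K P ys) = label ys"
  by (rule ext) (simp add: label_def in_augs)

text \<open>The content of \<open>quasi_free\<close> with the twisting map \<open>dth\<close> fixed
  once and for all.\<close>

locale quasi_free_module =
  fixes K :: "('k, 'c) ring_scheme" and P :: "('k, 'p, 'x) dg_operad_scheme" and M :: "('k, 'm, 'y) dg_seq_scheme"
    and L :: "('k, 'p, ('k, 'm, 'p) comp_el, 'z) dg_rmod_scheme"
    and dth :: "nat \<Rightarrow> int \<Rightarrow> ('k, 'm, 'p) comp_el \<Rightarrow> ('k, 'm, 'p) comp_el"
  assumes KK: "cring K" and P: "connected_operad K P" and MM: "dg_sigma_module K M" and L: "right_module K P L"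
    and L_mod: "dg_mod L = dg_mod (comp_prod K M P)"
    and L_act: "\<And>n d s X. s permutes {..<n} \<Longrightarrow> X \<in> elts L n d \<Longrightarrow>
      dg_act L n d s X = dg_act (comp_prod K M P) n d s X"
    and L_rm: "\<And>n d a x ys m zs. (a, x, ys) \<in> gens M P n d \<Longrightarrow> valid_inputs P m zs \<Longrightarrow> length zs = n \<Longrightarrow>
        rm_act L m (d + tot_deg zs) (cls K L P m (d + tot_deg zs) (d, cls K M P n d (a, x, ys), zs)) =
        assoc_sign K ys zs \<odot>[dg_mod L m (d + tot_deg zs)]
          cls K M P m (d + tot_deg zs) (a, x, regroup K P P (op_comp P) ys zs)"
    and dth_lin: "\<And>n d. lin_map K (dg_mod L n d) (dg_mod L n (d - 1)) (dth n d)"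
    and L_diff: "\<And>n d X. X \<in> elts L n d \<Longrightarrow>
        dg_diff L n d X = dg_diff (comp_prod K M P) n d X \<oplus>[dg_mod L n (d - 1)] dth n d X"
    and dth_cls: "\<And>n d a x ys. (a, x, ys) \<in> gens M P n d \<Longrightarrow> dth n d (cls K M P n d (a, x, ys)) =
           rm_act L n (d - 1) (cls K L P n (d - 1) (a - 1, dth (length ys) a (free_incl K P M (length ys) a x), ys))"
    and dth_proj: "\<And>n d X. X \<in> elts L n d \<Longrightarrow> free_proj K P M n (d - 1) (dth n d X) = \<zero>[dg_mod M n (d - 1)]"

lemma quasi_free_moduleI:
  assumes "cring K" "connected_operad K P" "quasi_free K P M L"
  shows "\<exists>dth. quasi_free_module K P M L dth"
proof -
  from assms(3) obtain dth where *:
        "(\<forall>n d. lin_map K (dg_mod L n d) (dg_mod L n (d - 1)) (dth n d)) \<and>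
        (\<forall>n d. \<forall>X\<in>elts L n d.
           dg_diff L n d X = dg_diff (comp_prod K M P) n d X \<oplus>[dg_mod L n (d - 1)] dth n d X) \<and>
        (\<forall>n d a x ys. (a, x, ys) \<in> gens M P n d \<longrightarrow>
           dth n d (cls K M P n d (a, x, ys)) =
           rm_act L n (d - 1) (cls K L P n (d - 1)
             (a - 1, dth (length ys) a (free_incl K P M (length ys) a x), ys))) \<and>
        (\<forall>n d. \<forall>X\<in>elts L n d.
           free_proj K P M n (d - 1) (dth n d X) = \<zero>[dg_mod M n (d - 1)])"
    using assms(3)[unfolded quasi_free_def, THEN conjunct2, THEN conjunct2, THEN conjunct2, THEN conjunct2, THEN conjunct2]
    by (elim exE) (rule that)
  have "quasi_free_module K P M L dth"
    by (rule quasi_free_module.intro) (use assms * in \<open>simp_all add: quasi_free_def\<close>)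
  then show ?thesis by (rule exI[where x = dth])
qed

context quasi_free_module
begin

sublocale reduced_product K M P
  by (rule reduced_product.intro, rule comp_product.intro)
    (simp_all add: KK MM operad_sigma[OF P] reduced_product_axioms_def operad_zero[OF P])

lemma L_sigma: "dg_sigma_module K L"
  using L by (simp add: right_module_def)

abbreviation (input) "D n \<equiv> dg_diff L n"

lemma D_lin: "lin_map K (A n d) (A n (d - 1)) (D n d)"
  using dg_sigma_moduleD(3)[OF L_sigma] by (simp add: L_mod)

lemma th_lin: "lin_map K (A n d) (A n (d - 1)) (dth n d)"
  using dth_lin by (simp add: L_mod)

lemma D_D: "X \<in> cA n d \<Longrightarrow> D n (d - 1) (D n d X) = \<zero>[A n (d - 2)]"
  using dg_sigma_moduleD(4)[OF L_sigma] by (simp add: L_mod)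

text \<open>The differential of \<open>L\<close> is the sum of the canonical one and
  \<open>dth\<close>. Since \<open>D\<close> and \<open>dth\<close> take cosets as values, the union
  that defines the canonical differential is a single coset, and it equals \<open>D - dth\<close>;
  linearity is inherited.\<close>

sublocale dg_product K M P
proof (unfold_locales)
  fix n d
  let ?F = "Fr n (d - 1)" and ?H = "comp_rels K M P n (d - 1)"
  let ?l = "lin_ext K ?F (gen_diff K M P n d)"
  have G: "gen_diff K M P n d \<in> gens M P n d \<rightarrow> carrier ?F" by (rule Pi_I) (rule gen_diff_closed)
  note T = lin_ext_lin_map[OF F.module_axioms G]
  have c: "dg_diff (comp_prod K M P) n d X \<in> cA n (d - 1)" if X: "X \<in> cA n d" for X
  proof -
    obtain x where x: "x \<in> carrier (Fr n d)" "X = comp_rels K M P n d +>[Fr n d] x"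
      using X unfolding A_def by (auto simp: quot_module_simps elim: rcosetsE)
    have xX: "x \<in> X" unfolding x(2) by (rule coset_self[OF F.module_axioms submodule_rels x(1)])
    have sub: "?l y \<in> carrier ?F" if "y \<in> X" for y
      using that x(2) mem_coset_iff[OF F.module_axioms submodule_rels x(1)] lin_closed[OF T] by simp
    have dd: "dg_diff (comp_prod K M P) n d X = quot_map ?F ?H ?l X" by (simp add: comp_prod_def)
    have th: "dth n d X \<in> a_rcosets\<^bsub>?F\<^esub> ?H"
      using lin_closed[OF th_lin X] by (simp add: A_def quot_module_simps)
    have "D n d X \<in> a_rcosets\<^bsub>?F\<^esub> ?H"
      using lin_closed[OF D_lin X] by (simp add: A_def quot_module_simps)
    moreover have "D n d X = quot_map ?F ?H ?l X <+>\<^bsub>?F\<^esub> dth n d X"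
      using L_diff[of X n d] X unfolding L_mod dd by (simp add: A_def quot_module_simps(3))
    ultimately have "quot_map ?F ?H ?l X = ?H +>[?F] ?l x"
      by (intro quot_map_rep_add[OF F.module_axioms submodule_rels xX sub th]) simp_all
    then show ?thesis unfolding dd using coset_closed[OF sub[OF xX]] by (simp add: A_def quot_module_simps(1))
  qed
  have eq: "dg_diff (comp_prod K M P) n d X = D n d X \<ominus>[A n (d - 1)] dth n d X" if X: "X \<in> cA n d" for X
    using L_diff[of X n d] X c[OF X] lin_closed[OF th_lin X] unfolding L_mod by (simp add: a_minus_def A.a_assoc A.r_neg)
  show "lin_map K (A n d) (A n (d - 1)) (dg_diff (comp_prod K M P) n d)"
    by (rule lin_cong[OF module_A lin_diff[OF module_A module_A D_lin th_lin] eq])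
qed

lemma D_eq: "X \<in> cA n d \<Longrightarrow> D n d X = del n d X \<oplus>[A n (d - 1)] dth n d X"
  using L_diff by (simp add: L_mod)

lemma LP: "comp_product K L P"
  by (rule comp_product.intro) (simp_all add: KK L_sigma operad_sigma[OF P])

lemma PP: "comp_product K P P"
  by (rule comp_product.intro) (simp_all add: KK operad_sigma[OF P])

lemma rm_lin: "lin_map K (dg_mod (comp_prod K L P) n d) (A n d) (rm_act L n d)"
  using L by (simp add: right_module_def right_action_def dg_morphism_def L_mod)

lemma gens_L: "X \<in> cA n d \<Longrightarrow> valid_inputs P m zs \<Longrightarrow> length zs = n \<Longrightarrow> e = d + tot_deg zs \<Longrightarrow>
    (d, X, zs) \<in> gens L P m e"
  by (simp add: gens_def L_mod)

lemma rm_root_lin: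
  assumes "valid_inputs P m zs" "length zs = n" "e = d + tot_deg zs"
  shows "lin_map K (A n d) (A m e) (\<lambda>X. rm_act L m e (cls K L P m e (d, X, zs)))"
proof -
  interpret LP: comp_product K L P by (rule LP)
  note g = gens_L[OF _ assms]
  have "lin_map K (A n d) (LP.A m e) (\<lambda>X. cls K L P m e (d, X, zs))"
  proof (rule lin_mapI)
    fix X assume X: "X \<in> cA n d"
    show "LP.C m e (d, X, zs) \<in> LP.cA m e" by (rule LP.cls_closed[OF g[OF X]])
    show "LP.C m e (d, X \<oplus>[A n d] Y, zs) = LP.C m e (d, X, zs) \<oplus>[LP.A m e] LP.C m e (d, Y, zs)" if "Y \<in> cA n d" for Y
      using LP.cls_add_root[OF g[OF X], of Y] that assms(2) by (simp add: L_mod)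
    show "LP.C m e (d, c \<odot>[A n d] X, zs) = c \<odot>[LP.A m e] LP.C m e (d, X, zs)" if "c \<in> carrier K" for c
      using LP.cls_smult_root[OF g[OF X] that] assms(2) by (simp add: L_mod)
  qed
  from lin_comp[OF this rm_lin] show ?thesis .
qed

lemma unit_valid: "valid_inputs P n (unit_inputs n (op_unit P))"
  by (rule valid_unit_inputs[OF operad_unit[OF P]])

lemma incl_gens: "x \<in> elts M n d \<Longrightarrow> (d, x, unit_inputs n (op_unit P)) \<in> gens M P n d"
  by (simp add: gens_def unit_valid)

abbreviation "incl n d x \<equiv> free_incl K P M n d x"

lemma incl_lin: "lin_map K (dg_mod M n d) (A n d) (free_incl K P M n d)"
proof (rule lin_mapI)
  fix x assume x: "x \<in> elts M n d"
  show "incl n d x \<in> cA n d" unfolding free_incl_def by (rule cls_closed[OF incl_gens[OF x]])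
  show "incl n d (x \<oplus>[dg_mod M n d] y) = incl n d x \<oplus>[A n d] incl n d y" if "y \<in> elts M n d" for y
    using cls_add_root[OF incl_gens[OF x]] that by (simp add: free_incl_def)
  show "incl n d (c \<odot>[dg_mod M n d] x) = c \<odot>[A n d] incl n d x" if "c \<in> carrier K" for c
    using cls_smult_root[OF incl_gens[OF x] that] by (simp add: free_incl_def)
qed

text \<open>Block \<open>i\<close> of the unit list is \<open>{i}\<close>, so entry \<open>i\<close>
  becomes the operad unit composed with input \<open>i\<close>, and the left unit law
  applies.\<close>

lemma regroup_unit_inputs:
  assumes "valid_inputs P n ys"
  shows "regroup K P P (op_comp P) (unit_inputs (length ys) (op_unit P)) ys = ys"
proof (rule inputs_eqI)
  let ?u = "unit_inputs (length ys) (op_unit P)"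
  fix i assume i: "i < length ys"
  then have iu: "i < length ?u" by simp
  let ?T = "in_block ys i"
  have fT: "finite ?T" by (rule valid_inputs_finite_block[OF assms i])
  have "rank ?T ` ?T = {..<card ?T}" using rank_bij[OF fT] by (simp add: bij_betw_def)
  then have s: "subinputs ys {i} = [({..<card ?T}, in_deg ys i, in_val ys i)]" by (simp add: subinputs_def)
  have t: "tot_deg (subinputs ys {i}) = in_deg ys i" by (simp add: tot_deg_subinputs)
  show "in_block (regroup K P P (op_comp P) ?u ys) i = in_block ys i"
    "in_deg (regroup K P P (op_comp P) ?u ys) i = in_deg ys i"
    using i by (simp_all add: in_block_regroup[OF iu] in_deg_regroup[OF iu] in_unit_inputs t)
  have td: "tot_deg [(J, b, y)] = b" for J b and y :: 'p by (simp add: tot_deg_def in_deg_def)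
  have v: "in_val ys i \<in> elts P (card ?T) (in_deg ys i)" using assms i by (simp add: valid_inputs_iff)
  have "in_val (regroup K P P (op_comp P) ?u ys) i = op_comp P (card ?T) (in_deg ys i)
     (cls K P P (card ?T) (in_deg ys i) (0, op_unit P, [({..<card ?T}, in_deg ys i, in_val ys i)]))"
    using i by (simp add: in_val_regroup[OF iu] in_unit_inputs t s td)
  then show "in_val (regroup K P P (op_comp P) ?u ys) i = in_val ys i" using operad_left_unit[OF P v] by simp
qed simp

lemma assoc_sign_unit_inputs: "assoc_sign K (unit_inputs n u) zs = \<one>[K]"
proof -
  have "(\<Sum>(i, j)\<in>{(i, j). i < j \<and> j < n}.
        (\<Sum>k\<in>in_block (unit_inputs n u) i. in_deg (unit_inputs n u) j * in_deg zs k) +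
        (\<Sum>(k, l)\<in>{(k, l). k \<in> in_block (unit_inputs n u) i \<and> l \<in> in_block (unit_inputs n u) j \<and> l < k}. in_deg zs k * in_deg zs l)) = 0"
  proof (rule sum.neutral, clarify)
    fix i j :: nat assume ij: "i < j" "j < n"
    then have "{(k, l). k \<in> in_block (unit_inputs n u) i \<and> l \<in> in_block (unit_inputs n u) j \<and> l < k} = {}"
      by (auto simp: in_unit_inputs)
    then show "(\<Sum>k\<in>in_block (unit_inputs n u) i. in_deg (unit_inputs n u) j * in_deg zs k) +
        (\<Sum>(k, l)\<in>{(k, l). k \<in> in_block (unit_inputs n u) i \<and> l \<in> in_block (unit_inputs n u) j \<and> l < k}. in_deg zs k * in_deg zs l) = 0"
      using ij by (simp only: sum.empty) (simp add: in_unit_inputs)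
  qed
  then show ?thesis by (simp only: assoc_sign_def length_unit_inputs) (simp add: ksign_def)
qed

text \<open>Freeness in concrete form: every generator class is the action of its inputs on a root
  \<open>x(1, \<dots>, 1)\<close>. Statements about \<open>L\<close> thereby reduce to the image of
  \<open>incl\<close>.\<close>

lemma rm_incl:
  assumes "(a, x, ys) \<in> gens M P n d"
  shows "rm_act L n d (cls K L P n d (a, incl (length ys) a x, ys)) = C n d (a, x, ys)"
proof -
  note gD = gensD[OF assms]
  have "rm_act L n d (cls K L P n d (a, incl (length ys) a x, ys)) =
      assoc_sign K (unit_inputs (length ys) (op_unit P)) ys \<odot>[A n d]
      C n d (a, x, regroup K P P (op_comp P) (unit_inputs (length ys) (op_unit P)) ys)"
    using L_rm[OF incl_gens[OF gD(1)] gD(2) refl] gD(3) by (simp add: free_incl_def L_mod)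
  also have "\<dots> = C n d (a, x, ys)"
    using cls_closed[OF assms] by (simp add: assoc_sign_unit_inputs regroup_unit_inputs[OF gD(2)])
  finally show ?thesis .
qed

text \<open>Acting by \<open>zs\<close> composes them into the existing inputs, whose number does
  not change.\<close>

lemma rm_filt:
  assumes "X \<in> filt s n d" "valid_inputs P m zs" "length zs = n" "e = d + tot_deg zs"
  shows "rm_act L m e (cls K L P m e (d, X, zs)) \<in> filt s m e"
proof (rule filt_lin[OF module_A rm_root_lin[OF assms(2-4)] submodule_filt assms(1)])
  fix a x ys assume base: "(a, x, ys) \<in> sgens M P n d" "length ys < s"
  note g = sgensD(1)[OF base(1)]
  note gD = gensD[OF g]
  let ?r = "regroup K P P (op_comp P) ys zs"
  have r: "(a, x, ?r) \<in> gens M P m e"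
    using gD valid_regroup[OF PP gD(2) assms(2,3) operad_comp_closed[OF P]] tot_deg_regroup[OF PP gD(2) assms(2,3) operad_comp_closed[OF P]]
    by (simp add: gens_def assms(4))
  have "rm_act L m e (cls K L P m e (d, C n d (a, x, ys), zs)) = assoc_sign K ys zs \<odot>[A m e] C m e (a, x, ?r)"
    using L_rm[OF g assms(2,3)] by (simp add: assms(4) L_mod)
  also have "\<dots> \<in> filt s m e" by (rule filt_smult[OF _ cls_filt[OF r]]) (simp_all add: assoc_sign_def ksign_closed[OF KK] base(2))
  finally show "rm_act L m e (cls K L P m e (d, C n d (a, x, ys), zs)) \<in> filt s m e" .
qed

lemma MI: "comp_product K M (unit_seq K)"
  by (rule comp_product.intro) (simp_all add: KK MM dg_sigma_unit_seq)

abbreviation "prj n d X \<equiv> free_proj K P M n d X"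

lemma prj_lin: "lin_map K (A n d) (dg_mod M n d) (free_proj K P M n d)"
proof -
  have "lin_map K (A n d) (dg_mod (comp_prod K M (unit_seq K)) n d) (comp_map K M (unit_seq K) (\<lambda>_ _ x. x) (augmentation K P) n d)"
    by (rule comp_map_props(1)[OF comp_product_axioms MI]) (simp_all add: lin_id augmentation_lin[OF KK P])
  from lin_comp[OF this right_unitor_lin[OF MI]] show ?thesis by (simp add: free_proj_def[abs_def])
qed

lemma prj_cls:
  assumes "(a, x, ys) \<in> gens M P n d"
  shows "prj n d (C n d (a, x, ys)) = (if unary ys then val_prod K (augs K P ys) \<odot>[dg_mod M n d] dg_act M n d (label ys) x else \<zero>[dg_mod M n d])"
proof -
  have "comp_map K M (unit_seq K) (\<lambda>_ _ x. x) (augmentation K P) n d (C n d (a, x, ys)) =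
      cls K M (unit_seq K) n d (a, x, augs K P ys)"
    unfolding augs_def
    by (rule comp_map_props(2)[OF comp_product_axioms MI _ _ _ assms]) (simp_all add: lin_id augmentation_lin[OF KK P])
  moreover have "(a, x, augs K P ys) \<in> gens M (unit_seq K) n d"
    unfolding augs_def
    by (rule comp_map_props(3)[where f = "\<lambda>_ _ x. x", OF comp_product_axioms MI _ _ _ assms])
      (simp_all add: lin_id augmentation_lin[OF KK P])
  ultimately show ?thesis using right_unitor_cls[OF MI] by (simp add: free_proj_def)
qed

lemma prj_incl: "x \<in> elts M n d \<Longrightarrow> prj n d (incl n d x) = x"
proof -
  assume x: "x \<in> elts M n d"
  have u: "augmentation K P 1 0 (op_unit P) = \<one>[K]"
    using augmentation_unique[OF KK P K.one_closed] operad_unit[OF P] dg_sigma_moduleD(1)[OF operad_sigma[OF P]]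
    by (simp add: module.smult_one)
  have "val_prod K (augs K P (unit_inputs n (op_unit P))) = \<one>[K]"
    unfolding val_prod_def by (rule K.finprod_one_eqI) (use u in \<open>simp add: in_augs in_unit_inputs\<close>)
  then show ?thesis unfolding free_incl_def using prj_cls[OF incl_gens[OF x]] x by (simp add: act_M_id)
qed

text \<open>The projection sees only unary inputs, and a unary list in arity \<open>n\<close> has
  exactly \<open>n\<close> entries.\<close>

lemma prj_filt: "X \<in> filt n n d \<Longrightarrow> prj n d X = \<zero>[dg_mod M n d]"
proof (induction rule: filt_induct)
  case (base a x ys)
  note g = sgensD(1)[OF base(1)]
  have "\<not> unary ys" using unary_length[OF gensD(2)[OF g]] base(2) by auto
  then show ?case using prj_cls[OF g] by simp
qed (simp_all add: lin_zero[OF module_A module_M prj_lin] lin_add[OF prj_lin] lin_smult[OF prj_lin])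

text \<open>With as many nonempty blocks as points every input is a multiple of the operad unit.\<close>

lemma top_cls_incl:
  assumes g: "(a, x, ys) \<in> gens M P n d" and n: "length ys = n"
  shows "\<exists>x'\<in>elts M n d. C n d (a, x, ys) = incl n d x'"
proof (cases "blocks_nonempty ys \<and> (\<forall>i<n. in_deg ys i = 0)")
  case False
  have "C n d (a, x, ys) = \<zero>[A n d]"
  proof (cases "blocks_nonempty ys")
    case True
    then obtain i where i: "i < length ys" "in_deg ys i \<noteq> 0" using False n by auto
    have "card (in_block ys i) = 1"
      using block_card_bound[OF gensD(2)[OF g] True i(1)] block_card_pos[OF gensD(2)[OF g] True i(1)] n by simp
    then have "in_val ys i = \<zero>[dg_mod P (card (in_block ys i)) (in_deg ys i)]"
      using zero_module_D[OF operad_unary_zero[OF P i(2)]] gensD(4)[OF g i(1)] by simp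
    then show ?thesis by (rule cls_zero_input[OF g i(1)])
  qed (rule cls_empty_block[OF g])
  then show ?thesis using lin_zero[OF module_M module_A incl_lin] by (metis M.zero_closed)
next
  case True
  let ?u = "op_unit P"
  have b1: "card (in_block ys i) = 1" if "i < length ys" for i
    using block_card_bound[OF gensD(2)[OF g] _ that] block_card_pos[OF gensD(2)[OF g] _ that] n True by simp
  have un: "unary ys" using b1 True n by (simp add: unary_def)
  let ?c = "\<lambda>i. augmentation K P 1 0 (in_val ys i)" and ?x = "dg_act M n d (label ys) x"
  have yc: "in_val ys i \<in> elts P 1 0" if "i < n" for i
    using gensD(4)[OF g, of i] un n that by (simp add: unary_def)
  have ad: "a = d" using gensD(3)[OF g] unary_tot_deg[OF gensD(2)[OF g] un] by simp
  have xc: "?x \<in> elts M n d"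
    using lin_closed[OF act_M] label_permutes[OF gensD(2)[OF g] un] gensD(1)[OF g] n ad by simp
  have fc: "finprod K ?c {..<n} \<in> carrier K"
    by (rule K.finprod_closed) (use augmentation_closed[OF KK P yc] in simp)
  have "C n d (a, x, ys) = finprod K ?c {..<n} \<odot>[A n d] C n d (d, ?x, unit_inputs n ?u)"
    by (rule cls_unary[OF g un operad_unit[OF P]])
      (use augmentation_closed[OF KK P yc] augmentation_expand[OF KK P yc] in simp_all)
  then have "C n d (a, x, ys) = incl n d (finprod K ?c {..<n} \<odot>[dg_mod M n d] ?x)"
    using lin_smult[OF incl_lin fc xc] by (simp add: free_incl_def)
  then show ?thesis using fc xc by (intro bexI[of _ "finprod K ?c {..<n} \<odot>[dg_mod M n d] ?x"]) simp_all
qed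

text \<open>The splitting of \<open>L(n)\<close> into its top piece and the rest. By
  \<open>top_cls_incl\<close> a class with \<open>n\<close> inputs is in the image of
  \<open>incl\<close>, where \<open>incl\<close> and \<open>prj\<close> are inverse to each other;
  classes with fewer inputs are killed by \<open>prj\<close>.\<close>

lemma decompose:
  assumes X: "X \<in> cA n d"
  shows "X \<ominus>[A n d] incl n d (prj n d X) \<in> filt n n d"
proof -
  let ?f = "\<lambda>X. X \<ominus>[A n d] incl n d (prj n d X)"
  have fl: "lin_map K (A n d) (A n d) ?f"
    by (rule lin_diff[OF module_A module_A lin_id lin_comp[OF prj_lin incl_lin]])
  have i0: "incl n d \<zero>[dg_mod M n d] = \<zero>[A n d]" by (rule lin_zero[OF module_M module_A incl_lin])
  show ?thesis
  proof (rule filt_lin[OF module_A fl submodule_filt filt_all[OF X lessI]])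
    fix a x ys assume base: "(a, x, ys) \<in> sgens M P n d" "length ys < Suc n"
    note g = sgensD(1)[OF base(1)]
    show "?f (C n d (a, x, ys)) \<in> filt n n d"
    proof (cases "length ys = n")
      case True
      then obtain x' where x': "x' \<in> elts M n d" "C n d (a, x, ys) = incl n d x'"
        using top_cls_incl[OF g] by blast
      then show ?thesis using filt_zero lin_closed[OF incl_lin x'(1)] by (simp add: prj_incl a_minus_def A.r_neg)
    next
      case False
      then have "C n d (a, x, ys) \<in> filt n n d" using base(2) by (intro cls_filt[OF g]) simp
      then show ?thesis using prj_filt i0 filt_carrier by (simp add: a_minus_def)
    qed
  qed
qed

lemma prj_zero_filt: "X \<in> cA n d \<Longrightarrow> prj n d X = \<zero>[dg_mod M n d] \<Longrightarrow> X \<in> filt n n d"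
  using decompose[of X n d] lin_zero[OF module_M module_A incl_lin] by (simp add: a_minus_def)

text \<open>On a root of arity \<open>r\<close> the twisting part lies in the kernel of the
  projection, that is, it has fewer than \<open>r\<close> inputs; the right action of the inputs
  keeps this bound. The assumption on the composite of the twisting part with the projection enters
  here.\<close>

lemma th_filt:
  assumes "X \<in> filt (Suc s) n d" shows "dth n d X \<in> filt s n (d - 1)"
proof (rule filt_lin[OF module_A th_lin submodule_filt assms])
  fix a x ys assume base: "(a, x, ys) \<in> sgens M P n d" "length ys < Suc s"
  note g = sgensD(1)[OF base(1)]
  let ?r = "length ys"
  have i: "incl ?r a x \<in> cA ?r a" by (rule lin_closed[OF incl_lin gensD(1)[OF g]])
  have "dth ?r a (incl ?r a x) \<in> filt ?r ?r (a - 1)"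
    by (rule prj_zero_filt[OF lin_closed[OF th_lin i] dth_proj]) (simp add: L_mod i)
  then have "rm_act L n (d - 1) (cls K L P n (d - 1) (a - 1, dth ?r a (incl ?r a x), ys)) \<in> filt ?r n (d - 1)"
    by (rule rm_filt[OF _ gensD(2)[OF g] refl]) (use gensD(3)[OF g] in simp)
  then show "dth n d (C n d (a, x, ys)) \<in> filt s n (d - 1)" unfolding dth_cls[OF g] by (rule filt_mono) (use base(2) in simp)
qed

lemma del_filt:
  assumes "X \<in> filt s n d" shows "del n d X \<in> filt s n (d - 1)"
proof (rule filt_lin[OF module_A diff_lin submodule_filt assms])
  fix a x ys assume base: "(a, x, ys) \<in> sgens M P n d" "length ys < s"
  note g = sgensD(1)[OF base(1)]
  show "del n d (C n d (a, x, ys)) \<in> filt s n (d - 1)" unfolding del_cls[OF g]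
    by (intro filt_add cls_filt[OF gens_diff_root[OF g]] submodule_finsum[OF module_A submodule_filt] filt_smult ksign_closed[OF KK]
      cls_filt gens_dslot[OF g]) (use base(2) in simp_all)
qed

lemma D_del:
  assumes "X \<in> filt (Suc s) n d" shows "D n d X \<ominus>[A n (d - 1)] del n d X \<in> filt s n (d - 1)"
proof -
  have X: "X \<in> cA n d" by (rule filt_carrier[OF assms])
  have "D n d X \<ominus>[A n (d - 1)] del n d X = dth n d X"
    using lin_closed[OF diff_lin X] lin_closed[OF th_lin X] by (simp add: D_eq[OF X] a_minus_def A.a_ac A.cancels)
  then show ?thesis using th_filt[OF assms] by simp
qed

text \<open>The Leibniz terms at the inputs vanish because the differential of the operad unit lies
  in \<open>P(1)\<close> in degree \<open>-1\<close>, which is zero.\<close>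

lemma del_incl:
  assumes x: "x \<in> elts M n d"
  shows "del n d (incl n d x) = incl n (d - 1) (dg_diff M n d x)"
proof -
  let ?u = "unit_inputs n (op_unit P)"
  note g = incl_gens[OF x]
  have z: "C n (d - 1) (d, x, dslot P k ?u) = \<zero>[A n (d - 1)]" if k: "k < n" for k
  proof (rule cls_zero_input[OF gens_dslot[OF g]])
    have "dg_diff P 1 0 (op_unit P) \<in> elts P 1 (- 1)"
      using lin_closed[OF diff_N operad_unit[OF P]] by simp
    then show "in_val (dslot P k ?u) k = \<zero>[dg_mod P (card (in_block (dslot P k ?u) k)) (in_deg (dslot P k ?u) k)]"
      using zero_module_D[OF operad_unary_zero[OF P, of "- 1"]] k by (simp add: in_dslot in_unit_inputs)
  qed (use k in simp_all)
  have "(\<Oplus>\<^bsub>A n (d - 1)\<^esub>k\<in>{..<n}. ksign K (leib d (in_deg ?u) k) \<odot>[A n (d - 1)] C n (d - 1) (d, x, dslot P k ?u)) =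
      (\<Oplus>\<^bsub>A n (d - 1)\<^esub>k\<in>{..<n}. \<zero>[A n (d - 1)])"
    by (rule A.finsum_cong'[OF refl]) (simp_all add: z ksign_closed[OF KK])
  then show ?thesis using del_cls[OF g] cls_closed[OF gens_diff_root[OF g]] by (simp add: free_incl_def)
qed

text \<open>The projection is a chain map to \<open>M\<close>: the canonical differential preserves
  both summands of \<open>decompose\<close>, and the twisting part projects to zero.\<close>

lemma prj_D:
  assumes X: "X \<in> cA n d"
  shows "prj n (d - 1) (D n d X) = dg_diff M n d (prj n d X)"
proof -
  let ?x = "prj n d X" let ?i = "incl n d ?x" let ?Y = "X \<ominus>[A n d] ?i"
  have x: "?x \<in> elts M n d" by (rule lin_closed[OF prj_lin X])
  have i: "?i \<in> cA n d" by (rule lin_closed[OF incl_lin x])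
  have Y: "?Y \<in> filt n n d" by (rule decompose[OF X])
  have dx: "dg_diff M n d ?x \<in> elts M n (d - 1)" by (rule lin_closed[OF diff_M x])
  have "prj n (d - 1) (del n d ?Y) = \<zero>[dg_mod M n (d - 1)]" by (rule prj_filt[OF del_filt[OF Y]])
  moreover have "X = ?Y \<oplus>[A n d] ?i" using X i by (simp add: a_minus_def A.a_assoc A.l_neg)
  then have "del n d X = del n d ?Y \<oplus>[A n (d - 1)] del n d ?i"
    using lin_add[OF diff_lin filt_carrier[OF Y] i] by simp
  then have "prj n (d - 1) (del n d X) = prj n (d - 1) (del n d ?Y) \<oplus>[dg_mod M n (d - 1)] prj n (d - 1) (del n d ?i)"
    using lin_add[OF prj_lin lin_closed[OF diff_lin filt_carrier[OF Y]] lin_closed[OF diff_lin i]] by simp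
  ultimately have "prj n (d - 1) (del n d X) = dg_diff M n d ?x"
    using dx by (simp add: del_incl[OF x] prj_incl)
  moreover have "prj n (d - 1) (dth n d X) = \<zero>[dg_mod M n (d - 1)]" by (rule dth_proj) (simp add: L_mod X)
  ultimately show ?thesis
    using lin_add[OF prj_lin lin_closed[OF diff_lin X] lin_closed[OF th_lin X]] dx by (simp add: D_eq[OF X])
qed

end

section \<open>Indecomposables of a quasi-free module\<close>

lemma transport_permutes:
  assumes "finite J" "inj_on f J"
  shows "(\<lambda>i. if i < card J then rank (f ` J) (f (sorted_list_of_set J ! i)) else i) permutes {..<card J}"
proof (rule bij_imp_permutes)
  have "bij_betw (rank (f ` J) \<circ> (f \<circ> (\<lambda>i. sorted_list_of_set J ! i))) {..<card J} {..<card (f ` J)}"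
    by (intro bij_betw_trans[OF bij_betw_trans[OF sorted_nth_bij[OF assms(1)] inj_on_imp_bij_betw[OF assms(2)]]]
      rank_bij finite_imageI assms(1))
  moreover have "card (f ` J) = card J" by (rule card_image[OF assms(2)])
  moreover have "bij_betw (rank (f ` J) \<circ> (f \<circ> (\<lambda>i. sorted_list_of_set J ! i))) {..<card J} {..<card J} \<longleftrightarrow>
      bij_betw (\<lambda>i. if i < card J then rank (f ` J) (f (sorted_list_of_set J ! i)) else i) {..<card J} {..<card J}"
    by (rule bij_betw_cong) simp
  ultimately show "bij_betw (\<lambda>i. if i < card J then rank (f ` J) (f (sorted_list_of_set J ! i)) else i) {..<card J} {..<card J}"
    by simp
qed simp

definition relabel where
  "relabel N s ys = map (\<lambda>(J, b, y). (s ` J, b, transport N J b s y)) ys"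

lemma length_relabel [simp]: "length (relabel N s ys) = length ys"
  by (simp add: relabel_def)

lemma in_relabel:
  assumes "i < length ys"
  shows "in_block (relabel N s ys) i = s ` in_block ys i" "in_deg (relabel N s ys) i = in_deg ys i"
    "in_val (relabel N s ys) i = transport N (in_block ys i) (in_deg ys i) s (in_val ys i)"
  using assms by (simp_all add: relabel_def in_block_def in_deg_def in_val_def case_prod_beta)

context comp_product
begin

lemma relabel_gens:
  assumes g: "(a, x, ys) \<in> gens M N n d" and s: "s permutes {..<n}"
  shows "(a, x, relabel N s ys) \<in> gens M N n d"
proof -
  note gD = gensD[OF g]
  have i: "inj_on s A" for A using permutes_inj[OF s] by (rule inj_on_subset) simp
  have fin: "finite (in_block ys i)" if "i < length ys" for i using gD(2) that by (rule valid_inputs_finite_block)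
  have "in_val (relabel N s ys) i \<in> elts N (card (in_block ys i)) (in_deg ys i)" if "i < length ys" for i
  proof -
    have "lin_map K (dg_mod N r e) (dg_mod N r e) (dg_act N r e t)" if "t permutes {..<r}" for r e t
      using N that by (simp add: dg_sigma_module_def)
    from lin_closed[OF this[OF transport_permutes[OF fin[OF that] i]] gD(4)[OF that]] show ?thesis
      by (simp add: in_relabel[OF that] transport_def)
  qed
  moreover have "s ` in_block ys i \<inter> s ` in_block ys j = {}" if "i < length ys" "j < length ys" "i \<noteq> j" for i j
    using gD(2) that by (simp add: valid_inputs_iff image_Int[OF permutes_inj[OF s], symmetric])
  moreover have "(\<Union>i<length ys. s ` in_block ys i) = {..<n}"
    using gD(2) permutes_image[OF s] by (simp add: valid_inputs_iff flip: image_UN)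
  ultimately have "valid_inputs N n (relabel N s ys)"
    by (simp add: valid_inputs_iff in_relabel card_image[OF i])
  moreover have "tot_deg (relabel N s ys) = tot_deg ys" by (simp add: tot_deg_def in_relabel)
  ultimately show ?thesis using gD(1,3) by (simp add: gens_def)
qed

text \<open>As with the differential, the action is a union over a coset and is read off at the
  basis vector once its value is known to be a class.\<close>

lemma act_cls:
  assumes g: "(a, x, ys) \<in> gens M N n d" and s: "s permutes {..<n}"
    and c: "dg_act (comp_prod K M N) n d s (C n d (a, x, ys)) \<in> cA n d"
  shows "dg_act (comp_prod K M N) n d s (C n d (a, x, ys)) = C n d (a, x, relabel N s ys)"
proof -
  let ?f = "lin_ext K (Fr n d) (\<lambda>g. basis_vec K (gen_act N s g))"
  have G: "(\<lambda>g. basis_vec K (gen_act N s g)) \<in> gens M N n d \<rightarrow> carrier (Fr n d)"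
  proof (rule Pi_I)
    fix g assume "g \<in> gens M N n d"
    then show "basis_vec K (gen_act N s g) \<in> carrier (Fr n d)"
      by (cases g) (simp add: gen_act_def basis_in[OF relabel_gens[OF _ s]] flip: relabel_def)
  qed
  have v: "?f (basis_vec K (a, x, ys)) = basis_vec K (a, x, relabel N s ys)"
    using lin_ext_basis_vec[OF F.module_axioms G g] by (simp add: gen_act_def relabel_def)
  have "quot_map (Fr n d) (comp_rels K M N n d) ?f (C n d (a, x, ys)) =
      comp_rels K M N n d +>[Fr n d] ?f (basis_vec K (a, x, ys))"
    by (rule quot_map_rep[OF F.module_axioms submodule_rels basis_vec_in_cls[OF g]])
      (use c basis_in[OF relabel_gens[OF g s]] in \<open>simp_all add: v A_def quot_module_simps comp_prod_def\<close>)
  then show ?thesis unfolding v by (simp add: comp_prod_def cls_def)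
qed

end

section \<open>Compatibility of the projection with permutations and with the right action\<close>

lemma map_case_prod_id: "map (\<lambda>(J, b, y). (J, b, y)) ys = ys"
  by (induction ys) auto

context quasi_free_module
begin

lemma act_L: "s permutes {..<n} \<Longrightarrow> lin_map K (A n d) (A n d) (dg_act L n d s)"
  using L_sigma by (simp add: dg_sigma_module_def L_mod)

lemma act_L_cls:
  assumes g: "(a, x, ys) \<in> gens M P n d" and s: "s permutes {..<n}"
  shows "dg_act L n d s (C n d (a, x, ys)) = C n d (a, x, relabel P s ys)"
proof -
  have e: "dg_act L n d s (C n d (a, x, ys)) = dg_act (comp_prod K M P) n d s (C n d (a, x, ys))"
    by (rule L_act[OF s]) (simp add: L_mod g)
  show ?thesis unfolding e
    by (rule act_cls[OF g s]) (use lin_closed[OF act_L[OF s] cls_closed[OF g]] in \<open>simp add: e\<close>)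
qed

lemma act_filt:
  assumes s: "s permutes {..<n}" and X: "X \<in> filt k n d"
  shows "dg_act L n d s X \<in> filt k n d"
proof (rule filt_lin[OF module_A act_L[OF s] submodule_filt X])
  fix a x ys assume base: "(a, x, ys) \<in> sgens M P n d" "length ys < k"
  note g = sgensD(1)[OF base(1)]
  show "dg_act L n d s (C n d (a, x, ys)) \<in> filt k n d"
    unfolding act_L_cls[OF g s] by (rule cls_filt[OF relabel_gens[OF g s]]) (simp add: base(2))
qed

text \<open>Relabelling by \<open>s\<close> turns the unit list into a list of units on the blocks
  \<open>{s i}\<close>; it is unary with label \<open>s\<close>, and coinvariance hands
  \<open>s\<close> over to the root.\<close>

lemma act_incl:
  assumes s: "s permutes {..<n}" and x: "x \<in> elts M n d"
  shows "dg_act L n d s (incl n d x) = incl n d (dg_act M n d s x)"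
proof -
  let ?u = "op_unit P" let ?y = "relabel P s (unit_inputs n (op_unit P))"
  note g = relabel_gens[OF incl_gens[OF x] s]
  have v: "in_val ?y i = ?u" if "i < n" for i
  proof -
    have "(\<lambda>j. if j < card {i} then rank (s ` {i}) (s (sorted_list_of_set {i} ! j)) else j) = id"
      by (rule permutes_one) (use transport_permutes[of "{i}" s] in simp)
    then have "transport P {i} 0 s ?u = dg_act P 1 0 id ?u" by (simp add: transport_def)
    then show ?thesis using that operad_sigma[OF P] operad_unit[OF P] by (simp add: in_relabel in_unit_inputs dg_sigma_module_def)
  qed
  have un: "unary ?y" by (simp add: unary_def in_relabel in_unit_inputs)
  have l: "label ?y = s"
  proof (rule ext)
    fix i show "label ?y i = s i"
      using s by (cases "i < n") (simp_all add: label_def in_relabel in_unit_inputs permutes_def)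
  qed
  have u1: "\<one>[K] \<odot>[dg_mod P 1 0] ?u = ?u" using operad_unit[OF P] by (rule N.smult_one)
  have "C n d (d, x, ?y) = finprod K (\<lambda>_. \<one>[K]) {..<n} \<odot>[A n d] C n d (d, dg_act M n d (label ?y) x, unit_inputs n ?u)"
    by (rule cls_unary[OF g un operad_unit[OF P]]) (simp_all only: v u1 K.one_closed)
  also have "\<dots> = incl n d (dg_act M n d s x)"
    using lin_closed[OF incl_lin lin_closed[OF act_M[OF s] x]] by (simp add: l free_incl_def)
  finally show ?thesis using act_L_cls[OF incl_gens[OF x] s] by (simp add: free_incl_def)
qed

lemma split_incl: "X \<in> cA n d \<Longrightarrow> X = (X \<ominus>[A n d] incl n d (prj n d X)) \<oplus>[A n d] incl n d (prj n d X)"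
  using lin_closed[OF incl_lin lin_closed[OF prj_lin]] by (simp add: a_minus_def A.a_assoc A.l_neg)

lemma prj_act:
  assumes s: "s permutes {..<n}" and X: "X \<in> cA n d"
  shows "prj n d (dg_act L n d s X) = dg_act M n d s (prj n d X)"
proof -
  let ?x = "prj n d X" let ?Y = "X \<ominus>[A n d] incl n d ?x"
  have x: "?x \<in> elts M n d" by (rule lin_closed[OF prj_lin X])
  note Y = decompose[OF X] and ax = lin_closed[OF act_M[OF s] x]
  have "dg_act L n d s X = dg_act L n d s ?Y \<oplus>[A n d] incl n d (dg_act M n d s ?x)"
    using lin_add[OF act_L[OF s] filt_carrier[OF Y] lin_closed[OF incl_lin x]] split_incl[OF X]
    by (simp add: act_incl[OF s x])
  then show ?thesis
    using lin_add[OF prj_lin filt_carrier[OF act_filt[OF s Y]] lin_closed[OF incl_lin ax]]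
      prj_filt[OF act_filt[OF s Y]] ax by (simp add: prj_incl)
qed

sublocale LP: reduced_product K L P
  by (rule reduced_product.intro[OF LP]) (simp add: reduced_product_axioms_def operad_zero[OF P])

text \<open>Split \<open>X\<close> by \<open>decompose\<close>. The part with fewer than
  \<open>n\<close> inputs keeps this property under the action and is killed by the projection in
  arity \<open>m\<close>, because \<open>n \<le> m\<close>; the other part becomes the generator
  with root \<open>prj X\<close> and inputs \<open>zs\<close>. If some block is empty,
  \<open>n\<close> may exceed \<open>m\<close>, but then the class vanishes.\<close>

lemma prj_rm:
  assumes X: "X \<in> cA n d" and zs: "valid_inputs P m zs" "length zs = n" and e: "e = d + tot_deg zs"
  shows "prj m e (rm_act L m e (cls K L P m e (d, X, zs))) =
    (if unary zs then val_prod K (augs K P zs) \<odot>[dg_mod M m e] dg_act M m e (label zs) (prj n d X) else \<zero>[dg_mod M m e])"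
proof (cases "blocks_nonempty zs")
  case False
  then have "\<not> unary zs" by (auto simp: blocks_nonempty_def unary_def)
  moreover have "cls K L P m e (d, X, zs) = \<zero>[dg_mod (comp_prod K L P) m e]"
    by (rule LP.cls_empty_block[OF gens_L[OF X zs e] False])
  ultimately show ?thesis
    using lin_zero[OF LP.module_A module_A rm_lin] lin_zero[OF module_A module_M prj_lin] by simp
next
  case True
  let ?x = "prj n d X" let ?Y = "X \<ominus>[A n d] incl n d ?x" let ?r = "\<lambda>X. rm_act L m e (cls K L P m e (d, X, zs))"
  have x: "?x \<in> elts M n d" by (rule lin_closed[OF prj_lin X])
  note Y = decompose[OF X] and rl = rm_root_lin[OF zs e]
  have nm: "n \<le> m" using length_le_arity[OF zs(1) True] zs(2) by simp
  have rY: "?r ?Y \<in> filt m m e" by (rule filt_mono[OF rm_filt[OF Y zs e] nm])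
  have g: "(d, ?x, zs) \<in> gens M P m e" using x zs e by (simp add: gens_def)
  have rx: "?r (incl n d ?x) = C m e (d, ?x, zs)" using rm_incl[OF g] zs(2) by simp
  have "?r X = ?r ?Y \<oplus>[A m e] C m e (d, ?x, zs)"
    using lin_add[OF rl filt_carrier[OF Y] lin_closed[OF incl_lin x]] split_incl[OF X] by (simp add: rx)
  then have "prj m e (?r X) = prj m e (C m e (d, ?x, zs))"
    using lin_add[OF prj_lin filt_carrier[OF rY] cls_closed[OF g]] prj_filt[OF rY] lin_closed[OF prj_lin cls_closed[OF g]] by simp
  then show ?thesis using prj_cls[OF g] by simp
qed

section \<open>The coequalizer that presents the indecomposable quotient\<close>

lemma LI: "comp_product K L (unit_seq K)"
  by (rule comp_product.intro) (simp_all add: KK L_sigma dg_sigma_unit_seq)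

sublocale LI: comp_product K L "unit_seq K" by (rule LI)

lemma PI: "comp_product K P (unit_seq K)"
  by (rule comp_product.intro) (simp_all add: KK operad_sigma[OF P] dg_sigma_unit_seq)

lemma II: "comp_product K (unit_seq K) (unit_seq K)"
  by (rule comp_product.intro) (simp_all add: KK dg_sigma_unit_seq)

text \<open>The composite of \<open>L \<circ> I \<rightarrow> M \<circ> I\<close> with the unitor.
  Its kernel will turn out to be the submodule of relations, which gives the identification of
  \<open>L \<circ>\<^sub>P I\<close> with \<open>M\<close>.\<close>

definition indec_prj where
  "indec_prj n d Z = right_unitor K M n d (comp_map K M (unit_seq K) (free_proj K P M) (\<lambda>_ _ k. k) n d Z)"

lemma
  shows indec_prj_lin: "lin_map K (LI.A n d) (dg_mod M n d) (indec_prj n d)"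
    and indec_prj_cls: "(e, X, zs) \<in> gens L (unit_seq K) n d \<Longrightarrow> indec_prj n d (cls K L (unit_seq K) n d (e, X, zs)) =
      (if unary zs then val_prod K zs \<odot>[dg_mod M n d] dg_act M n d (label zs) (prj (length zs) e X) else \<zero>[dg_mod M n d])"
proof -
  have 1: "lin_map K (dg_mod L r d) (dg_mod M r d) (free_proj K P M r d)" for r d using prj_lin by (simp add: L_mod)
  have 2: "free_proj K P M r d (dg_act L r d s x) = dg_act M r d s (free_proj K P M r d x)"
    if "s permutes {..<r}" "x \<in> elts L r d" for r d s x
    using prj_act that by (simp add: L_mod)
  note cm = comp_map_props[OF LI MI 1 2, of "\<lambda>_ _ k. k", OF _ _ lin_id]
  show "lin_map K (LI.A n d) (dg_mod M n d) (indec_prj n d)"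
    using lin_comp[OF cm(1) right_unitor_lin[OF MI]] by (simp add: indec_prj_def[abs_def])
  show "indec_prj n d (cls K L (unit_seq K) n d (e, X, zs)) =
      (if unary zs then val_prod K zs \<odot>[dg_mod M n d] dg_act M n d (label zs) (prj (length zs) e X) else \<zero>[dg_mod M n d])"
    if "(e, X, zs) \<in> gens L (unit_seq K) n d"
    using right_unitor_cls[OF MI cm(3)[OF _ _ that]] cm(2)[OF _ _ that] by (simp add: indec_prj_def map_case_prod_id)
qed

lemma
  shows unit_action_lin: "lin_map K (dg_mod (comp_prod K P (unit_seq K)) n d) (dg_mod (unit_seq K) n d) (unit_left_action K P n d)"
    and unit_action_cls: "(b, y, ws) \<in> gens P (unit_seq K) n d \<Longrightarrow>
      unit_left_action K P n d (cls K P (unit_seq K) n d (b, y, ws)) =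
      (if unary ws then val_prod K ws \<otimes>[K] augmentation K P (length ws) b y else \<zero>[K])"
proof -
  have 2: "augmentation K P r d (dg_act P r d s x) = dg_act (unit_seq K) r d s (augmentation K P r d x)"
    if "s permutes {..<r}" "x \<in> elts P r d" for r d s x
    using augmentation_equivariant[OF P that] by (simp add: unit_seq_simps)
  note cm = comp_map_props[OF PI II augmentation_lin[OF KK P] 2, of "\<lambda>_ _ k. k", OF _ _ lin_id]
  show "lin_map K (dg_mod (comp_prod K P (unit_seq K)) n d) (dg_mod (unit_seq K) n d) (unit_left_action K P n d)"
    using lin_comp[OF cm(1) right_unitor_lin[OF II]] by (simp add: unit_left_action_def[abs_def])
  show "unit_left_action K P n d (cls K P (unit_seq K) n d (b, y, ws)) =
      (if unary ws then val_prod K ws \<otimes>[K] augmentation K P (length ws) b y else \<zero>[K])"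
    if "(b, y, ws) \<in> gens P (unit_seq K) n d"
    using right_unitor_cls[OF II cm(3)[OF _ _ that]] cm(2)[OF _ _ that]
    by (simp add: unit_left_action_def map_case_prod_id unit_seq_simps)
qed

abbreviation "unit_regroup \<equiv> regroup K P (unit_seq K) (unit_left_action K P)"
abbreviation "indec_rels n d \<equiv> rel_comp_rels K P L (unit_seq K) (unit_left_action K P) n d"

lemma unit_regroup_val:
  assumes "valid_inputs P n ys" "valid_inputs (unit_seq K) m zs" "length zs = n" "i < length ys"
  shows "in_val (unit_regroup ys zs) i = (if unary (subinputs zs (in_block ys i))
    then val_prod K (subinputs zs (in_block ys i)) \<otimes>[K] augmentation K P (card (in_block ys i)) (in_deg ys i) (in_val ys i) else \<zero>[K])"
  unfolding in_val_regroup[OF assms(4)] unit_action_cls[OF subinputs_gens[OF assms]] by simp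

lemma subinputs_singleton:
  assumes "in_block ys i = {j}" "in_block zs j = {k}"
  shows "subinputs zs (in_block ys i) = [({0}, in_deg zs j, in_val zs j)]"
proof -
  have "rank {k} k = 0" by (simp add: rank_def)
  then show ?thesis using assms by (simp add: subinputs_def)
qed

text \<open>For unary lists regrouping amounts to composing the label permutations and multiplying
  the scalars; all Koszul signs are trivial since all input degrees vanish.\<close>

lemma
  assumes ys: "valid_inputs P n ys" "unary ys" and zs: "valid_inputs (unit_seq K) m zs" "length zs = n" "unary zs"
  shows unary_unit_regroup: "unary (unit_regroup ys zs)"
    and label_unit_regroup: "label (unit_regroup ys zs) = label zs \<circ> label ys"
    and val_prod_unit_regroup: "val_prod K (unit_regroup ys zs) = val_prod K zs \<otimes>[K] val_prod K (augs K P ys)"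
    and assoc_sign_unary: "assoc_sign K ys zs = \<one>[K]"
proof -
  let ?r = "unit_regroup ys zs"
  have n: "length ys = n" by (rule unary_length[OF ys])
  have lp: "label ys permutes {..<n}" using label_permutes[OF ys] n by simp
  have yb: "in_block ys i = {label ys i}" and yd: "in_deg ys i = 0" if "i < n" for i
    using unary_block[OF ys(2)] ys(2) that n by (simp_all add: unary_def)
  have zb: "in_block zs i = {label zs i}" and zd: "in_deg zs i = 0" if "i < n" for i
    using unary_block[OF zs(3)] zs(2,3) that by (simp_all add: unary_def)
  have ln: "label ys i < n" if "i < n" for i using permutes_lessThan[OF lp] that by simp
  have rb: "in_block ?r i = {label zs (label ys i)}" if "i < n" for i
    using that n by (simp add: in_block_regroup yb zb ln)
  have sub: "subinputs zs (in_block ys i) = [({0}, 0, in_val zs (label ys i))]" if "i < n" for i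
    using subinputs_singleton[OF yb[OF that] zb[OF ln[OF that]]] zd[OF ln[OF that]] by simp
  have rd: "in_deg ?r i = 0" if "i < n" for i
    using that n by (simp add: in_deg_regroup yd sub) (simp add: tot_deg_def in_deg_def)
  show "unary ?r" using n by (simp add: unary_def rb rd)
  show "label ?r = label zs \<circ> label ys"
  proof (rule ext)
    fix i show "label ?r i = (label zs \<circ> label ys) i"
    proof (cases "i < n")
      case True
      then have "label ?r i = the_elem (in_block ?r i)" using n by (simp add: label_def)
      then show ?thesis using True by (simp add: rb)
    next
      case False
      then have "label ?r i = i" "label ys i = i" "label zs i = i" using n zs(2) by (simp_all add: label_def)
      then show ?thesis by simp
    qed
  qed
  have zv: "in_val zs i \<in> carrier K" if "i < n" for i
    using unary_val_carrier[OF zs(1,3)] zs(2) that by simp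
  have yv: "in_val (augs K P ys) i \<in> carrier K" if "i < n" for i
  proof -
    have "in_val ys i \<in> elts P 1 0" using ys that n by (simp add: valid_inputs_iff unary_def)
    then show ?thesis using augmentation_closed[OF KK P] that n yb yd by (simp add: in_augs)
  qed
  have u1: "unary [({0::nat}, 0::int, v :: 'k)]" for v by (simp add: unary_def in_block_def in_deg_def)
  have vp: "val_prod K [({0::nat}, 0::int, v)] = v" if "v \<in> carrier K" for v
    using that by (simp add: val_prod_def lessThan_Suc in_val_def)
  have rv: "in_val ?r i = in_val zs (label ys i) \<otimes>[K] in_val (augs K P ys) i" if "i < n" for i
    using unit_regroup_val[OF ys(1) zs(1,2), of i] that n by (simp add: sub u1 vp zv ln in_augs)
  have "val_prod K ?r = finprod K (\<lambda>i. in_val zs (label ys i) \<otimes>[K] in_val (augs K P ys) i) {..<n}"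
    unfolding val_prod_def by (rule K.finprod_cong') (use n in \<open>simp_all add: rv zv yv ln\<close>)
  also have "\<dots> = finprod K (\<lambda>i. in_val zs (label ys i)) {..<n} \<otimes>[K] finprod K (in_val (augs K P ys)) {..<n}"
    by (rule K.finprod_multf) (use zv yv ln in auto)
  also have "finprod K (\<lambda>i. in_val zs (label ys i)) {..<n} = finprod K (in_val zs) {..<n}"
    by (rule K.finprod_permute[OF lp zv])
  finally show "val_prod K ?r = val_prod K zs \<otimes>[K] val_prod K (augs K P ys)"
    using n zs(2) by (simp add: val_prod_def)
  have "(\<Sum>(i, j)\<in>{(i, j). i < j \<and> j < length ys}.
        (\<Sum>k\<in>in_block ys i. in_deg ys j * in_deg zs k) +
        (\<Sum>(k, l)\<in>{(k, l). k \<in> in_block ys i \<and> l \<in> in_block ys j \<and> l < k}. in_deg zs k * in_deg zs l)) = 0"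
  proof (rule sum.neutral, clarify)
    fix i j :: nat assume ij: "i < j" "j < length ys"
    have "(\<Sum>(k, l)\<in>{(k, l). k \<in> in_block ys i \<and> l \<in> in_block ys j \<and> l < k}. in_deg zs k * in_deg zs l) = 0"
      by (rule sum.neutral) (use ij n in \<open>auto simp: yb zd ln\<close>)
    then show "(\<Sum>k\<in>in_block ys i. in_deg ys j * in_deg zs k) +
        (\<Sum>(k, l)\<in>{(k, l). k \<in> in_block ys i \<and> l \<in> in_block ys j \<and> l < k}. in_deg zs k * in_deg zs l) = 0"
      using ij n by (simp add: yd)
  qed
  then show "assoc_sign K ys zs = \<one>[K]" unfolding assoc_sign_def by (simp only:) (simp add: ksign_def)
qed

text \<open>If \<open>ys\<close> is not unary, the augmentation kills the entry where this fails. If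
  \<open>ys\<close> is unary and \<open>zs\<close> is not, the offending input \<open>z\<close> of
  \<open>zs\<close> is the only inner input of some entry, and the unit action vanishes on
  it.\<close>

lemma unit_regroup_zero:
  assumes ys: "valid_inputs P n ys" and zs: "valid_inputs (unit_seq K) m zs" "length zs = n"
    and nu: "\<not> (unary ys \<and> unary zs)"
  shows "\<exists>i<length ys. in_val (unit_regroup ys zs) i = \<zero>[K]"
proof (cases "unary ys")
  case False
  then obtain i where i: "i < length ys" "\<not> (card (in_block ys i) = 1 \<and> in_deg ys i = 0)" by (auto simp: unary_def)
  have a0: "augmentation K P (card (in_block ys i)) (in_deg ys i) (in_val ys i) = \<zero>[K]"
    unfolding augmentation_def using i(2) by (simp only: if_False)
  have "in_val (unit_regroup ys zs) i = \<zero>[K]"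
  proof (cases "unary (subinputs zs (in_block ys i))")
    case True
    have "val_prod K (subinputs zs (in_block ys i)) \<in> carrier K"
      by (rule K.val_prod_closed)
        (rule unary_val_carrier[OF comp_product.gensD(2)[OF PI subinputs_gens[OF ys zs i(1)]] True])
    then show ?thesis using unit_regroup_val[OF ys zs i(1)] a0 by simp
  qed (use unit_regroup_val[OF ys zs i(1)] in simp)
  then show ?thesis using i(1) by blast
next
  case True
  then obtain k where k: "k < n" "\<not> (card (in_block zs k) = 1 \<and> in_deg zs k = 0)" using nu zs(2) by (auto simp: unary_def)
  have "(\<Union>i<length ys. in_block ys i) = {..<n}" using ys by (simp add: valid_inputs_iff)
  then obtain i where i: "i < length ys" "k \<in> in_block ys i" using k(1) by auto
  then have b: "in_block ys i = {k}" using unary_block[OF True i(1)] by simp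
  have f: "finite (in_block zs k)" using valid_inputs_finite_block[OF zs(1)] k(1) zs(2) by simp
  have "bij_betw (rank (in_block zs k)) (in_block zs k) {..<card (in_block zs k)}" by (rule rank_bij[OF f])
  then have "rank (in_block zs k) ` in_block zs k = {..<card (in_block zs k)}" by (simp add: bij_betw_def)
  then have "subinputs zs (in_block ys i) = [({..<card (in_block zs k)}, in_deg zs k, in_val zs k)]"
    using b by (simp add: subinputs_def)
  then have "\<not> unary (subinputs zs (in_block ys i))" using k(2) by (simp add: unary_def in_block_def in_deg_def)
  then show ?thesis using unit_regroup_val[OF ys zs i(1)] i(1) by auto
qed

lemma
  assumes g: "(a, x, ys) \<in> gens L P n e" and zs: "valid_inputs (unit_seq K) m zs" "length zs = n" and d: "e + tot_deg zs = d"
  shows rel_gens_act: "(e, rm_act L n e (cls K L P n e (a, x, ys)), zs) \<in> gens L (unit_seq K) m d"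
    and rel_gens_regroup: "(a, x, unit_regroup ys zs) \<in> gens L (unit_seq K) m d"
proof -
  note gD = LP.gensD[OF g]
  show "(e, rm_act L n e (cls K L P n e (a, x, ys)), zs) \<in> gens L (unit_seq K) m d"
    using lin_closed[OF rm_lin LP.cls_closed[OF g]] zs d by (simp add: gens_def L_mod)
  note c = lin_closed[OF unit_action_lin]
  show "(a, x, unit_regroup ys zs) \<in> gens L (unit_seq K) m d"
    using gD valid_regroup[OF PI gD(2) zs c] tot_deg_regroup[OF PI gD(2) zs c] d by (simp add: gens_def)
qed

lemma assoc_sign_closed: "assoc_sign K ys zs \<in> carrier K"
  by (simp add: assoc_sign_def ksign_closed[OF KK])

lemma unit_regroup_cls_zero:
  assumes g: "(a, x, ys) \<in> gens L P n e" and zs: "valid_inputs (unit_seq K) m zs" "length zs = n" and d: "e + tot_deg zs = d"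
    and nu: "\<not> (unary ys \<and> unary zs)"
  shows "cls K L (unit_seq K) m d (a, x, unit_regroup ys zs) = \<zero>[LI.A m d]"
proof -
  obtain i where i: "i < length ys" "in_val (unit_regroup ys zs) i = \<zero>[K]"
    using unit_regroup_zero[OF LP.gensD(2)[OF g] zs nu] by blast
  show ?thesis
    by (rule LI.cls_zero_input[OF rel_gens_regroup[OF g zs d], of i]) (use i in \<open>simp_all add: unit_seq_simps\<close>)
qed

text \<open>Unless both lists are unary, both sides are zero. If they are, the claim is that the
  permutations \<open>label zs\<close> and \<open>label ys\<close> act on \<open>M\<close> through
  their composite.\<close>

lemma indec_prj_rel:
  assumes g: "(a, x, ys) \<in> gens L P n e" and zs: "valid_inputs (unit_seq K) m zs" "length zs = n" and d: "e + tot_deg zs = d"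
  shows "indec_prj m d (cls K L (unit_seq K) m d (e, rm_act L n e (cls K L P n e (a, x, ys)), zs)) =
    indec_prj m d (assoc_sign K ys zs \<odot>[LI.A m d] cls K L (unit_seq K) m d (a, x, unit_regroup ys zs))"
proof -
  note gD = LP.gensD[OF g]
  note ga = rel_gens_act[OF g zs d] and gr = rel_gens_regroup[OF g zs d]
  have x: "x \<in> cA (length ys) a" using gD(1) by (simp add: L_mod)
  let ?x = "prj (length ys) a x"
  have px: "?x \<in> elts M (length ys) a" by (rule lin_closed[OF prj_lin x])
  have pr: "prj n e (rm_act L n e (cls K L P n e (a, x, ys))) =
    (if unary ys then val_prod K (augs K P ys) \<odot>[dg_mod M n e] dg_act M n e (label ys) ?x else \<zero>[dg_mod M n e])"
    by (rule prj_rm[OF x gD(2) refl]) (use gD(3) in simp)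
  show ?thesis
  proof (cases "unary ys \<and> unary zs")
    case False
    have "indec_prj m d (cls K L (unit_seq K) m d (e, rm_act L n e (cls K L P n e (a, x, ys)), zs)) = \<zero>[dg_mod M m d]"
    proof (cases "unary zs")
      case True
      then have "\<not> unary ys" using False by simp
      then have "prj n e (rm_act L n e (cls K L P n e (a, x, ys))) = \<zero>[dg_mod M n e]" using pr by simp
      moreover have n: "m = n" using unary_length[OF zs(1) True] zs(2) by simp
      moreover have l: "label zs permutes {..<n}" using label_permutes[OF zs(1) True] zs(2) by simp
      moreover have "d = e" using d unary_tot_deg[OF zs(1) True] by simp
      moreover have "val_prod K zs \<in> carrier K" by (rule K.val_prod_closed) (rule unary_val_carrier[OF zs(1) True])
      ultimately show ?thesis
        using indec_prj_cls[OF ga] True zs(2) lin_zero[OF module_M module_M act_M[OF l]] by simp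
    qed (use indec_prj_cls[OF ga] in simp)
    then show ?thesis using lin_zero[OF LI.module_A module_M indec_prj_lin]
      by (simp add: assoc_sign_closed unit_regroup_cls_zero[OF g zs d False])
  next
    case True
    then have uy: "unary ys" and uz: "unary zs" by simp_all
    have n: "length ys = n" and m: "m = n" using unary_length[OF gD(2) uy] unary_length[OF zs(1) uz] zs(2) by simp_all
    have ae: "a = e" and de: "d = e" using gD(3) unary_tot_deg[OF gD(2) uy] d unary_tot_deg[OF zs(1) uz] by simp_all
    have ly: "label ys permutes {..<n}" and lz: "label zs permutes {..<n}"
      using label_permutes[OF gD(2) uy] label_permutes[OF zs(1) uz] n zs(2) by simp_all
    have vz: "val_prod K zs \<in> carrier K" by (rule K.val_prod_closed) (rule unary_val_carrier[OF zs(1) uz])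
    have vy: "val_prod K (augs K P ys) \<in> carrier K"
    proof (rule K.val_prod_closed)
      fix i assume "i < length (augs K P ys)"
      then have i: "i < length ys" by simp
      have "in_val ys i \<in> elts P 1 0" using gD(4)[OF i] uy i by (simp add: unary_def)
      then show "in_val (augs K P ys) i \<in> carrier K" using augmentation_closed[OF KK P] uy i by (simp add: in_augs unary_def)
    qed
    have px': "?x \<in> elts M n e" using px n ae by simp
    have ax: "dg_act M n e (label ys) ?x \<in> elts M n e" by (rule lin_closed[OF act_M[OF ly] px'])
    have azx: "dg_act M n e (label zs) (dg_act M n e (label ys) ?x) \<in> elts M n e" by (rule lin_closed[OF act_M[OF lz] ax])
    have "indec_prj m d (cls K L (unit_seq K) m d (e, rm_act L n e (cls K L P n e (a, x, ys)), zs)) =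
      val_prod K zs \<odot>[dg_mod M n e] dg_act M n e (label zs) (val_prod K (augs K P ys) \<odot>[dg_mod M n e] dg_act M n e (label ys) ?x)"
      using indec_prj_cls[OF ga] uz pr uy m de zs(2) by simp
    also have "\<dots> = (val_prod K zs \<otimes>[K] val_prod K (augs K P ys)) \<odot>[dg_mod M n e] dg_act M n e (label zs \<circ> label ys) ?x"
      using vz vy azx act_M_comp[OF lz ly px'] by (simp add: lin_smult[OF act_M[OF lz] vy ax] M.smult_assoc1)
    also have "\<dots> = indec_prj m d (cls K L (unit_seq K) m d (a, x, unit_regroup ys zs))"
      using indec_prj_cls[OF gr] unary_unit_regroup[OF gD(2) uy zs uz] label_unit_regroup[OF gD(2) uy zs uz]
        val_prod_unit_regroup[OF gD(2) uy zs uz] m de by simp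
    finally show ?thesis using assoc_sign_unary[OF gD(2) uy zs uz] LI.cls_closed[OF gr] by simp
  qed
qed

definition rel_set where
  "rel_set m d = {cls K L (unit_seq K) m d (e, rm_act L n e (cls K L P n e (a, x, ys)), zs) \<ominus>[LI.A m d]
     assoc_sign K ys zs \<odot>[LI.A m d] cls K L (unit_seq K) m d (a, x, unit_regroup ys zs)
     |n e a x ys zs. (a, x, ys) \<in> gens L P n e \<and> valid_inputs (unit_seq K) m zs \<and> length zs = n \<and> e + tot_deg zs = d}"

lemma indec_rels_eq: "indec_rels m d = mspan K (LI.A m d) (rel_set m d)"
  by (simp add: rel_comp_rels_def rel_set_def Let_def)

lemma rel_set_kernel: "rel_set m d \<subseteq> {Z \<in> LI.cA m d. indec_prj m d Z = \<zero>[dg_mod M m d]}"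
proof
  fix Z assume "Z \<in> rel_set m d"
  then obtain n e a x ys zs where Z: "Z = cls K L (unit_seq K) m d (e, rm_act L n e (cls K L P n e (a, x, ys)), zs) \<ominus>[LI.A m d]
     assoc_sign K ys zs \<odot>[LI.A m d] cls K L (unit_seq K) m d (a, x, unit_regroup ys zs)"
    and g: "(a, x, ys) \<in> gens L P n e" and zs: "valid_inputs (unit_seq K) m zs" "length zs = n" and d: "e + tot_deg zs = d"
    unfolding rel_set_def mem_Collect_eq by (elim exE conjE) (rule that)
  let ?u = "cls K L (unit_seq K) m d (e, rm_act L n e (cls K L P n e (a, x, ys)), zs)"
  let ?v = "assoc_sign K ys zs \<odot>[LI.A m d] cls K L (unit_seq K) m d (a, x, unit_regroup ys zs)"
  have u: "?u \<in> LI.cA m d" by (rule LI.cls_closed[OF rel_gens_act[OF g zs d]])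
  have v: "?v \<in> LI.cA m d" by (rule LI.A.smult_closed[OF assoc_sign_closed LI.cls_closed[OF rel_gens_regroup[OF g zs d]]])
  have "indec_prj m d (?u \<ominus>[LI.A m d] ?v) = indec_prj m d ?u \<ominus>[dg_mod M m d] indec_prj m d ?v"
    by (rule lin_minus[OF LI.module_A module_M indec_prj_lin u v])
  then show "Z \<in> {Z \<in> LI.cA m d. indec_prj m d Z = \<zero>[dg_mod M m d]}"
    using indec_prj_rel[OF g zs d] u v lin_closed[OF indec_prj_lin v] by (simp add: Z a_minus_def M.r_neg)
qed

lemma rel_set_carrier: "rel_set m d \<subseteq> LI.cA m d"
  using rel_set_kernel by blast

lemma submodule_indec_rels: "submodule (indec_rels m d) K (LI.A m d)"
  unfolding indec_rels_eq by (rule submodule_mspan[OF LI.module_A rel_set_carrier])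

lemma indec_prj_rels: "Z \<in> indec_rels m d \<Longrightarrow> Z \<in> LI.cA m d \<and> indec_prj m d Z = \<zero>[dg_mod M m d]"
  using mspan_least[OF submodule_kernel[OF LI.module_A module_M indec_prj_lin] rel_set_kernel] unfolding indec_rels_eq by blast

abbreviation "unit_cls n d X \<equiv> cls K L (unit_seq K) n d (d, X, unit_inputs n \<one>[K])"

lemma valid_one: "valid_inputs (unit_seq K) n (unit_inputs n \<one>[K])"
  by (rule valid_unit_inputs) (simp add: unit_seq_simps)

lemma unit_cls_gens: "X \<in> cA n d \<Longrightarrow> (d, X, unit_inputs n \<one>[K]) \<in> gens L (unit_seq K) n d"
  by (simp add: gens_def L_mod valid_one)

lemma unit_cls_lin: "lin_map K (A n d) (LI.A n d) (\<lambda>X. unit_cls n d X)"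
proof (rule lin_mapI)
  fix X assume X: "X \<in> cA n d"
  show "unit_cls n d X \<in> LI.cA n d" by (rule LI.cls_closed[OF unit_cls_gens[OF X]])
  show "unit_cls n d (X \<oplus>[A n d] Y) = unit_cls n d X \<oplus>[LI.A n d] unit_cls n d Y" if "Y \<in> cA n d" for Y
    using LI.cls_add_root[OF unit_cls_gens[OF X]] that by (simp add: L_mod)
  show "unit_cls n d (c \<odot>[A n d] X) = c \<odot>[LI.A n d] unit_cls n d X" if "c \<in> carrier K" for c
    using LI.cls_smult_root[OF unit_cls_gens[OF X] that] by (simp add: L_mod)
qed

lemma val_prod_one: "val_prod K (unit_inputs n \<one>[K]) = \<one>[K]"
  unfolding val_prod_def by (rule K.finprod_one_eqI) (simp add: in_unit_inputs)

lemma indec_prj_unit_cls: "X \<in> cA n d \<Longrightarrow> indec_prj n d (unit_cls n d X) = prj n d X"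
  using indec_prj_cls[OF unit_cls_gens] lin_closed[OF prj_lin] by (simp add: val_prod_one act_M_id)

text \<open>A class with fewer than \<open>n\<close> inputs is the action of its inputs
  \<open>ys\<close> on a root. The relation with \<open>zs = (1, \<dots>, 1)\<close> identifies it
  with a regrouped class, which is zero because \<open>ys\<close>, having fewer than
  \<open>n\<close> entries, is not unary.\<close>

lemma filt_indec_rels:
  assumes "X \<in> filt n n d" shows "unit_cls n d X \<in> indec_rels n d"
proof (rule filt_lin[OF LI.module_A unit_cls_lin submodule_indec_rels assms])
  fix a x ys assume base: "(a, x, ys) \<in> sgens M P n d" "length ys < n"
  note g = sgensD(1)[OF base(1)]
  note gD = gensD[OF g]
  let ?i = "incl (length ys) a x"
  have i: "?i \<in> cA (length ys) a" by (rule lin_closed[OF incl_lin gD(1)])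
  have gi: "(a, ?i, ys) \<in> gens L P n d" by (rule gens_L[OF i gD(2) refl]) (use gD(3) in simp)
  note z = valid_one[of n]
  have d: "d + tot_deg (unit_inputs n \<one>[K]) = d" by simp
  have l: "length (unit_inputs n \<one>[K]) = n" by simp
  have "\<not> unary ys" using unary_length[OF gD(2)] base(2) by auto
  then have z0: "cls K L (unit_seq K) n d (a, ?i, unit_regroup ys (unit_inputs n \<one>[K])) = \<zero>[LI.A n d]"
    by (intro unit_regroup_cls_zero[OF gi z l d]) simp
  have "unit_cls n d (rm_act L n d (cls K L P n d (a, ?i, ys))) \<ominus>[LI.A n d]
     assoc_sign K ys (unit_inputs n \<one>[K]) \<odot>[LI.A n d] cls K L (unit_seq K) n d (a, ?i, unit_regroup ys (unit_inputs n \<one>[K])) \<in> rel_set n d"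
    unfolding rel_set_def mem_Collect_eq by (intro exI conjI) (rule refl gi z l d)+
  then have "unit_cls n d (C n d (a, x, ys)) \<in> rel_set n d"
    unfolding rm_incl[OF g] z0 using lin_closed[OF unit_cls_lin cls_closed[OF g]] by (simp add: assoc_sign_closed a_minus_def)
  then show "unit_cls n d (C n d (a, x, ys)) \<in> indec_rels n d" unfolding indec_rels_eq using mspan_superset[OF LI.module_A rel_set_carrier] by blast
qed

text \<open>The unit sequence lives in arity one and degree zero, so a generator with non-unary
  inputs has a zero entry. For unary inputs, \<open>cls_unary\<close> collects the scalars and moves
  the permutation to the root.\<close>

lemma indec_normal_form:
  assumes Z: "Z \<in> LI.cA n d"
  shows "\<exists>X\<in>cA n d. Z = unit_cls n d X"
proof -
  note s = submodule_image[OF module_A LI.module_A unit_cls_lin, of n d]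
  have "cls K L (unit_seq K) n d h \<in> (\<lambda>X. unit_cls n d X) ` cA n d" if h: "h \<in> gens L (unit_seq K) n d" for h
  proof -
    obtain e X zs where hh: "h = (e, X, zs)" by (cases h)
    note g = h[unfolded hh]
    note gD = LI.gensD[OF g]
    show ?thesis
    proof (cases "unary zs")
      case False
      then obtain i where i: "i < length zs" "\<not> (card (in_block zs i) = 1 \<and> in_deg zs i = 0)" by (auto simp: unary_def)
      have "in_val zs i \<in> {\<zero>[K]}"
        using gD(4)[OF i(1)] i(2) unfolding unit_seq_simps by (simp only: if_False)
      then have "cls K L (unit_seq K) n d h = \<zero>[LI.A n d]" unfolding hh
        by (intro LI.cls_zero_input[OF g i(1)]) (simp add: unit_seq_simps)
      then show ?thesis using submodule_zero[OF s] by simp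
    next
      case True
      have n: "length zs = n" by (rule unary_length[OF gD(2) True])
      have ed: "e = d" using gD(3) unary_tot_deg[OF gD(2) True] by simp
      have v: "in_val zs i \<in> carrier K" if "i < n" for i using unary_val_carrier[OF gD(2) True] n that by simp
      have l: "label zs permutes {..<n}" using label_permutes[OF gD(2) True] n by simp
      have X: "X \<in> cA n d" using gD(1) n ed by (simp add: L_mod)
      let ?X = "dg_act L n d (label zs) X" and ?c = "finprod K (in_val zs) {..<n}"
      have aX: "?X \<in> cA n d" by (rule lin_closed[OF act_L[OF l] X])
      have c: "?c \<in> carrier K" by (rule K.finprod_closed) (use v in simp)
      have "cls K L (unit_seq K) n d h = ?c \<odot>[LI.A n d] unit_cls n d ?X" unfolding hh
        by (rule LI.cls_unary[OF g True]) (use v in \<open>simp_all add: unit_seq_simps\<close>)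
      also have "\<dots> = unit_cls n d (?c \<odot>[A n d] ?X)" using lin_smult[OF unit_cls_lin c aX] by simp
      finally show ?thesis using c aX by (intro image_eqI[of _ _ "?c \<odot>[A n d] ?X"]) simp_all
    qed
  qed
  then have "Z \<in> (\<lambda>X. unit_cls n d X) ` cA n d"
    using mspan_least[OF s, of "cls K L (unit_seq K) n d ` gens L (unit_seq K) n d"] LI.A_spanned[OF Z] by (meson image_subsetI subsetD)
  then show ?thesis by (elim imageE) (rule bexI)
qed

text \<open>On the normal form \<open>X(1, \<dots>, 1)\<close> the value of \<open>indec_prj\<close>
  is the projection of \<open>X\<close>; its kernel consists of elements with fewer than
  \<open>n\<close> inputs, and those are relations.\<close>

lemma indec_rels_iff:
  assumes Z: "Z \<in> LI.cA n d"
  shows "Z \<in> indec_rels n d \<longleftrightarrow> indec_prj n d Z = \<zero>[dg_mod M n d]"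
proof
  show "indec_prj n d Z = \<zero>[dg_mod M n d]" if "Z \<in> indec_rels n d" using indec_prj_rels[OF that] by simp
  assume z: "indec_prj n d Z = \<zero>[dg_mod M n d]"
  obtain X where X: "X \<in> cA n d" "Z = unit_cls n d X" using indec_normal_form[OF Z] by (elim bexE) (rule that)
  have "X \<in> filt n n d" using z X indec_prj_unit_cls[OF X(1)] by (intro prj_zero_filt) simp_all
  then show "Z \<in> indec_rels n d" unfolding X(2) by (rule filt_indec_rels)
qed

end

section \<open>Morphisms of quasi-free modules\<close>

locale quasi_free_morphism = S: quasi_free_module K P M L dth + T: quasi_free_module K P' M' L' dth'
  for K :: "('k, 'c) ring_scheme" and P :: "('k, 'p) dg_operad" and M :: "('k, 'm) dg_seq"
    and L :: "('k, 'p, ('k, 'm, 'p) comp_el) dg_rmod" and dth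
    and P' :: "('k, 'p1) dg_operad" and M' :: "('k, 'm1) dg_seq"
    and L' :: "('k, 'p1, ('k, 'm1, 'p1) comp_el) dg_rmod" and dth' +
  fixes psi :: "nat \<Rightarrow> int \<Rightarrow> 'p \<Rightarrow> 'p1"
    and phi :: "nat \<Rightarrow> int \<Rightarrow> ('k, 'm, 'p) comp_el \<Rightarrow> ('k, 'm1, 'p1) comp_el"
  assumes psi: "operad_morphism K P P' psi"
    and phi: "right_module_morphism K P L (restrict_rmod K P' psi L') phi"
begin

lemma psi_dg: "dg_morphism K P P' psi"
  using psi by (simp add: operad_morphism_def)

lemmas psi_lin = dg_morphismD(1)[OF psi_dg] and psi_D = dg_morphismD(2)[OF psi_dg]

lemma restrict_simps: "dg_mod (restrict_rmod K P' psi L') = dg_mod L'" "dg_diff (restrict_rmod K P' psi L') = dg_diff L'"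
  "dg_act (restrict_rmod K P' psi L') = dg_act L'"
  "rm_act (restrict_rmod K P' psi L') n d X = rm_act L' n d (comp_map K L' P' (\<lambda>_ _ x. x) psi n d X)"
  by (simp_all add: restrict_rmod_def)

lemma phi_dg: "dg_morphism K L L' phi"
  using phi unfolding right_module_morphism_def dg_morphism_def restrict_simps by (elim conjE) (intro conjI)

lemma phi_lin: "lin_map K (S.A n d) (T.A n d) (phi n d)"
  using dg_morphismD(1)[OF phi_dg] by (simp add: S.L_mod T.L_mod)

lemma phi_D: "X \<in> S.cA n d \<Longrightarrow> phi n (d - 1) (S.D n d X) = T.D n d (phi n d X)"
  using dg_morphismD(2)[OF phi_dg] by (simp add: S.L_mod)

lemma phi_act: "s permutes {..<n} \<Longrightarrow> X \<in> S.cA n d \<Longrightarrow> phi n d (dg_act L n d s X) = dg_act L' n d s (phi n d X)"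
  using dg_morphismD(3)[OF phi_dg] by (simp add: S.L_mod)

abbreviation "psis ys \<equiv> map (\<lambda>(J, b, y). (J, b, psi (card J) b y)) ys"

lemma psis_slot0: "psis ys = slot0 (\<lambda>_. psi) ys"
  by (rule inputs_eqI) (simp_all add: in_slot in_block_map in_deg_map in_val_map)

lemma RP: "comp_product K (restrict_rmod K P' psi L') P"
proof (rule comp_product.intro)
  show "dg_sigma_module K (restrict_rmod K P' psi L')"
    using T.L_sigma by (simp add: dg_sigma_module_def restrict_simps)
qed (simp_all add: S.KK operad_sigma[OF S.P])

text \<open>The target of \<open>phi\<close> is a restricted module, so the action passes through
  two functorial maps: first \<open>phi\<close> on the root, then \<open>psi\<close> on the
  inputs.\<close>

lemma
  assumes g: "(a, X, ys) \<in> gens L P n d"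
  shows psis_gens: "(a, phi (length ys) a X, psis ys) \<in> gens L' P' n d"
    and phi_rm: "phi n d (rm_act L n d (cls K L P n d (a, X, ys))) =
      rm_act L' n d (cls K L' P' n d (a, phi (length ys) a X, psis ys))"
proof -
  let ?R = "restrict_rmod K P' psi L'"
  have 1: "lin_map K (dg_mod L r e) (dg_mod ?R r e) (phi r e)" for r e
    using dg_morphismD(1)[OF phi_dg] by (simp add: restrict_simps)
  have 2: "phi r e (dg_act L r e s x) = dg_act ?R r e s (phi r e x)" if "s permutes {..<r}" "x \<in> elts L r e" for r e s x
    using dg_morphismD(3)[OF phi_dg] that by (simp add: restrict_simps)
  note c1 = comp_map_props[OF S.LP RP 1 2, of "\<lambda>_ _ p. p", OF _ _ lin_id]
  have g1: "(a, phi (length ys) a X, ys) \<in> gens ?R P n d" using c1(3)[OF _ _ g] by (simp add: map_case_prod_id)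
  have v1: "comp_map K ?R P phi (\<lambda>_ _ p. p) n d (cls K L P n d (a, X, ys)) = cls K ?R P n d (a, phi (length ys) a X, ys)"
    using c1(2)[OF _ _ g] by (simp add: map_case_prod_id)
  have 3: "lin_map K (dg_mod ?R r e) (dg_mod L' r e) ((\<lambda>_ _ x. x) r e)" for r e by (simp add: restrict_simps lin_id)
  have 4: "(\<lambda>_ _ x. x) r e (dg_act ?R r e s x) = dg_act L' r e s ((\<lambda>_ _ x. x) r e x)" for r e s x by (simp add: restrict_simps)
  note c2 = comp_map_props[where f = "\<lambda>_ _ x. x" and g = psi, OF RP T.LP 3 4 psi_lin]
  show "(a, phi (length ys) a X, psis ys) \<in> gens L' P' n d" using c2(3)[OF g1] by simp
  have v2: "comp_map K L' P' (\<lambda>_ _ x. x) psi n d (cls K ?R P n d (a, phi (length ys) a X, ys)) =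
      cls K L' P' n d (a, phi (length ys) a X, psis ys)"
    using c2(2)[OF g1] by simp
  have "phi n d (rm_act L n d (cls K L P n d (a, X, ys))) =
      rm_act ?R n d (comp_map K ?R P phi (\<lambda>_ _ p. p) n d (cls K L P n d (a, X, ys)))"
    using phi S.LP.cls_closed[OF g] by (simp add: right_module_morphism_def)
  then show "phi n d (rm_act L n d (cls K L P n d (a, X, ys))) =
      rm_act L' n d (cls K L' P' n d (a, phi (length ys) a X, psis ys))"
    unfolding v1 restrict_simps(4) v2 .
qed

lemma root_gens: "(a, x, ys) \<in> gens M P n d \<Longrightarrow> (a, S.incl (length ys) a x, ys) \<in> gens L P n d"
proof -
  assume g: "(a, x, ys) \<in> gens M P n d"
  note gD = S.gensD[OF g]
  show ?thesis by (rule S.gens_L[OF lin_closed[OF S.incl_lin gD(1)] gD(2) refl]) (use gD(3) in simp)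
qed

lemma phi_cls:
  assumes g: "(a, x, ys) \<in> gens M P n d"
  shows "phi n d (S.C n d (a, x, ys)) = rm_act L' n d (cls K L' P' n d (a, phi (length ys) a (S.incl (length ys) a x), psis ys))"
  using phi_rm[OF root_gens[OF g]] by (simp add: S.rm_incl[OF g])

lemma psis_valid: "(a, x, ys) \<in> gens M P n d \<Longrightarrow> valid_inputs P' n (psis ys)"
  using T.LP.gensD(2)[OF psis_gens[OF root_gens]] by simp

lemma psis_deg: "(a, x, ys) \<in> gens M P n d \<Longrightarrow> d = a + tot_deg (psis ys)"
  using T.LP.gensD(3)[OF psis_gens[OF root_gens]] by simp

lemma phi_incl_closed: "x \<in> elts M n d \<Longrightarrow> phi n d (S.incl n d x) \<in> T.cA n d"
  by (rule lin_closed[OF phi_lin lin_closed[OF S.incl_lin]])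

text \<open>\<open>phi\<close> of a generator is the action of \<open>psi\<close> of its inputs on
  \<open>phi\<close> of its root. For \<open>r\<close> inputs the latter lives in arity
  \<open>r\<close>, hence has at most \<open>r\<close> inputs, and the action does not raise their
  number.\<close>

lemma phi_filt:
  assumes "X \<in> S.filt s n d" shows "phi n d X \<in> T.filt s n d"
proof (rule S.filt_lin[OF T.module_A phi_lin T.submodule_filt assms])
  fix a x ys assume base: "(a, x, ys) \<in> sgens M P n d" "length ys < s"
  note g = sgensD(1)[OF base(1)]
  let ?X = "phi (length ys) a (S.incl (length ys) a x)"
  have "?X \<in> T.filt (Suc (length ys)) (length ys) a"
    by (rule T.filt_all[OF phi_incl_closed[OF S.gensD(1)[OF g]]]) simp
  from T.rm_filt[OF this psis_valid[OF g] _ psis_deg[OF g]]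
  have "phi n d (S.C n d (a, x, ys)) \<in> T.filt (Suc (length ys)) n d" by (simp add: phi_cls[OF g])
  then show "phi n d (S.C n d (a, x, ys)) \<in> T.filt s n d" by (rule T.filt_mono) (use base(2) in simp)
qed

text \<open>The concrete form of the map on generators: include, apply \<open>phi\<close>, project.
  Its agreement with the official \<open>gen_map\<close> is \<open>gen_map_gmap\<close>.\<close>

definition gmap where "gmap n d x = T.prj n d (phi n d (S.incl n d x))"

lemma gmap_lin: "lin_map K (dg_mod M n d) (dg_mod M' n d) (gmap n d)"
  unfolding gmap_def[abs_def] by (rule lin_comp[OF lin_comp[OF S.incl_lin phi_lin] T.prj_lin])

text \<open>\<open>phi\<close> preserves the kernel \<open>filt n n\<close> of the projection, so
  only the top piece of \<open>X\<close> matters.\<close>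

lemma prj_phi:
  assumes X: "X \<in> S.cA n d"
  shows "T.prj n d (phi n d X) = gmap n d (S.prj n d X)"
proof -
  let ?Y = "X \<ominus>[S.A n d] S.incl n d (S.prj n d X)"
  have x: "S.prj n d X \<in> elts M n d" by (rule lin_closed[OF S.prj_lin X])
  note Y = S.decompose[OF X]
  have "phi n d X = phi n d ?Y \<oplus>[T.A n d] phi n d (S.incl n d (S.prj n d X))"
    using lin_add[OF phi_lin S.filt_carrier[OF Y] lin_closed[OF S.incl_lin x]] S.split_incl[OF X] by simp
  then show ?thesis
    using lin_add[OF T.prj_lin T.filt_carrier[OF phi_filt[OF Y]] phi_incl_closed[OF x]] T.prj_filt[OF phi_filt[OF Y]]
      lin_closed[OF gmap_lin x] by (simp add: gmap_def)
qed

lemma gmap_D: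
  assumes x: "x \<in> elts M n d"
  shows "gmap n (d - 1) (dg_diff M n d x) = dg_diff M' n d (gmap n d x)"
proof -
  let ?X = "S.incl n d x"
  have X: "?X \<in> S.cA n d" by (rule lin_closed[OF S.incl_lin x])
  have "dg_diff M n d x = S.prj n (d - 1) (S.D n d ?X)" using S.prj_D[OF X] S.prj_incl[OF x] by simp
  then have "gmap n (d - 1) (dg_diff M n d x) = T.prj n (d - 1) (phi n (d - 1) (S.D n d ?X))"
    using prj_phi[OF lin_closed[OF S.D_lin X]] by simp
  then show ?thesis using T.prj_D[OF lin_closed[OF phi_lin X]] by (simp add: phi_D[OF X] gmap_def)
qed

lemma gmap_act:
  assumes s: "s permutes {..<n}" and x: "x \<in> elts M n d"
  shows "gmap n d (dg_act M n d s x) = dg_act M' n d s (gmap n d x)"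
proof -
  let ?X = "S.incl n d x"
  have X: "?X \<in> S.cA n d" by (rule lin_closed[OF S.incl_lin x])
  show ?thesis
    using T.prj_act[OF s lin_closed[OF phi_lin X]] phi_act[OF s X] by (simp add: gmap_def flip: S.act_incl[OF s x])
qed

lemma
  shows indec_phi_lin: "lin_map K (S.LI.A n d) (T.LI.A n d) (comp_map K L' (unit_seq K) phi (\<lambda>_ _ k. k) n d)"
    and indec_phi_cls: "(e, X, zs) \<in> gens L (unit_seq K) n d \<Longrightarrow>
      comp_map K L' (unit_seq K) phi (\<lambda>_ _ k. k) n d (cls K L (unit_seq K) n d (e, X, zs)) =
      cls K L' (unit_seq K) n d (e, phi (length zs) e X, zs)"
proof -
  note cm = comp_map_props[OF S.LI T.LI dg_morphismD(1)[OF phi_dg] dg_morphismD(3)[OF phi_dg], of "\<lambda>_ _ k. k", OF _ _ lin_id]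
  show "lin_map K (S.LI.A n d) (T.LI.A n d) (comp_map K L' (unit_seq K) phi (\<lambda>_ _ k. k) n d)" by (rule cm(1))
  show "comp_map K L' (unit_seq K) phi (\<lambda>_ _ k. k) n d (cls K L (unit_seq K) n d (e, X, zs)) =
      cls K L' (unit_seq K) n d (e, phi (length zs) e X, zs)" if "(e, X, zs) \<in> gens L (unit_seq K) n d"
    using cm(2)[OF _ _ that] by (simp add: map_case_prod_id)
qed

lemma indec_prj_phi:
  assumes Z: "Z \<in> S.LI.cA n d"
  shows "T.indec_prj n d (comp_map K L' (unit_seq K) phi (\<lambda>_ _ k. k) n d Z) = gmap n d (S.indec_prj n d Z)"
proof -
  obtain X where X: "X \<in> S.cA n d" "Z = S.unit_cls n d X" using S.indec_normal_form[OF Z] by (elim bexE) (rule that)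
  show ?thesis
    using T.indec_prj_unit_cls[OF lin_closed[OF phi_lin X(1)]] S.indec_prj_unit_cls[OF X(1)] prj_phi[OF X(1)]
      indec_phi_cls[OF S.unit_cls_gens[OF X(1)]] by (simp add: X(2))
qed

text \<open>The definite description is resolved by \<open>indec_rels_iff\<close>: two classes of
  the form \<open>X(1, \<dots>, 1)\<close> agree modulo relations iff their projections to
  \<open>M'\<close> agree, which for the class of \<open>y\<close> and the image of the class of
  \<open>x\<close> reads \<open>y = gmap n d x\<close>.\<close>

lemma gen_map_gmap:
  assumes x: "x \<in> elts M n d"
  shows "gen_map K P M L P' M' L' phi n d x = gmap n d x"
proof -
  let ?c = "comp_map K L' (unit_seq K) phi (\<lambda>_ _ k. k) n d" and ?X = "S.incl n d x"
  have X: "?X \<in> S.cA n d" by (rule lin_closed[OF S.incl_lin x])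
  have uX: "S.unit_cls n d ?X \<in> S.LI.cA n d" by (rule lin_closed[OF S.unit_cls_lin X])
  have pX: "phi n d ?X \<in> T.cA n d" by (rule lin_closed[OF phi_lin X])
  have "?c Z \<in> T.indec_rels n d" if "Z \<in> S.indec_rels n d" for Z
  proof -
    have Z: "Z \<in> S.LI.cA n d" "S.indec_prj n d Z = \<zero>[dg_mod M n d]" using S.indec_prj_rels[OF that] by simp_all
    show ?thesis unfolding T.indec_rels_iff[OF lin_closed[OF indec_phi_lin Z(1)]] indec_prj_phi[OF Z(1)] Z(2)
      by (rule lin_zero[OF S.module_M T.module_M gmap_lin])
  qed
  from quot_map_coset[OF S.LI.module_A S.submodule_indec_rels T.LI.module_A T.submodule_indec_rels indec_phi_lin this uX]
  have im: "indec_map K P' L' phi n d (gen_class K P M L n d x) = T.indec_rels n d +>[T.LI.A n d] T.unit_cls n d (phi n d ?X)"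
    by (simp add: indec_map_def gen_class_def indec_class_def indec_phi_cls[OF S.unit_cls_gens[OF X]])
  have iff: "gen_class K P' M' L' n d y = indec_map K P' L' phi n d (gen_class K P M L n d x) \<longleftrightarrow> y = gmap n d x"
    if y: "y \<in> elts M' n d" for y
  proof -
    have Y: "T.incl n d y \<in> T.cA n d" by (rule lin_closed[OF T.incl_lin y])
    note uY = lin_closed[OF T.unit_cls_lin Y] and up = lin_closed[OF T.unit_cls_lin pX]
    have "T.indec_prj n d (T.unit_cls n d (T.incl n d y) \<ominus>[T.LI.A n d] T.unit_cls n d (phi n d ?X)) = y \<ominus>[dg_mod M' n d] gmap n d x"
      using lin_minus[OF T.LI.module_A T.module_M T.indec_prj_lin uY up]
      by (simp add: T.indec_prj_unit_cls[OF Y] T.indec_prj_unit_cls[OF pX] T.prj_incl[OF y] gmap_def)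
    moreover have gc: "gen_class K P' M' L' n d y = T.indec_rels n d +>[T.LI.A n d] T.unit_cls n d (T.incl n d y)"
      by (simp add: gen_class_def indec_class_def)
    ultimately have "gen_class K P' M' L' n d y = indec_map K P' L' phi n d (gen_class K P M L n d x) \<longleftrightarrow>
        y \<ominus>[dg_mod M' n d] gmap n d x = \<zero>[dg_mod M' n d]"
      unfolding im gc coset_eq_iff[OF T.LI.module_A T.submodule_indec_rels uY up]
      by (simp add: T.indec_rels_iff[OF T.LI.A.minus_closed[OF uY up]])
    moreover have "y \<ominus>[dg_mod M' n d] gmap n d x = \<zero>[dg_mod M' n d] \<longleftrightarrow> y = gmap n d x"
    proof
      assume z: "y \<ominus>[dg_mod M' n d] gmap n d x = \<zero>[dg_mod M' n d]"
      have "y = (y \<ominus>[dg_mod M' n d] gmap n d x) \<oplus>[dg_mod M' n d] gmap n d x"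
        using y lin_closed[OF gmap_lin x] by (simp add: a_minus_def T.M.a_assoc T.M.l_neg)
      then show "y = gmap n d x" unfolding z using lin_closed[OF gmap_lin x] by simp
    qed (use lin_closed[OF gmap_lin x] in \<open>simp add: a_minus_def T.M.r_neg\<close>)
    ultimately show ?thesis by simp
  qed
  show ?thesis unfolding gen_map_def
  proof (rule the_equality)
    show "gmap n d x \<in> elts M' n d \<and>
        gen_class K P' M' L' n d (gmap n d x) = indec_map K P' L' phi n d (gen_class K P M L n d x)"
      using iff[OF lin_closed[OF gmap_lin x]] lin_closed[OF gmap_lin x] by simp
    fix y assume "y \<in> elts M' n d \<and>
        gen_class K P' M' L' n d y = indec_map K P' L' phi n d (gen_class K P M L n d x)"
    then show "y = gmap n d x" using iff[of y] by (elim conjE) simp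
  qed
qed

text \<open>The images of the root \<open>x\<close> under \<open>phi\<close> and under
  \<open>incl \<circ> gmap\<close> differ by an element with fewer than \<open>r\<close> inputs, by
  \<open>decompose\<close>. Acting by \<open>psi\<close> of the inputs preserves that bound and
  turns the second image into the entrywise map.\<close>

lemma phi_entry:
  assumes F: "entrywise K M P M' P' n r (gmap r) (\<lambda>_. psi) F" and X: "X \<in> S.filt (Suc r) n d"
  shows "phi n d X \<ominus>[T.A n d] F d X \<in> T.filt r n d"
proof -
  have fl: "lin_map K (S.A n d) (T.A n d) (\<lambda>X. phi n d X \<ominus>[T.A n d] F d X)"
    by (rule lin_diff[OF S.module_A T.module_A phi_lin entrywise_lin[OF F]])
  show ?thesis
  proof (rule S.filt_lin[OF T.module_A fl T.submodule_filt X])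
    fix a x ys assume base: "(a, x, ys) \<in> sgens M P n d" "length ys < Suc r"
    note g = sgensD(1)[OF base(1)]
    note gD = S.gensD[OF g]
    note Fc = entrywise_cls[OF S.comp_product_axioms T.comp_product_axioms F gmap_lin psi_lin base(1)]
    show "phi n d (S.C n d (a, x, ys)) \<ominus>[T.A n d] F d (S.C n d (a, x, ys)) \<in> T.filt r n d"
    proof (cases "length ys = r")
      case True
      let ?X = "phi r a (S.incl r a x)" let ?l = "?X \<ominus>[T.A r a] T.incl r a (gmap r a x)"
      let ?rm = "\<lambda>X. rm_act L' n d (cls K L' P' n d (a, X, psis ys))"
      have x: "x \<in> elts M r a" using gD(1) True by simp
      have l: "?l \<in> T.filt r r a" using T.decompose[OF phi_incl_closed[OF x]] by (simp add: gmap_def)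
      have i: "T.incl r a (gmap r a x) \<in> T.cA r a"
        by (rule lin_closed[OF T.incl_lin lin_closed[OF gmap_lin x]])
      have lp: "length (psis ys) = r" using True by simp
      note rl = T.rm_root_lin[OF psis_valid[OF g] lp psis_deg[OF g]]
      have g': "(a, gmap r a x, psis ys) \<in> gens M' P' n d"
        using lin_closed[OF gmap_lin x] psis_valid[OF g] psis_deg[OF g] True by (simp add: gens_def)
      have ri: "?rm (T.incl r a (gmap r a x)) = F d (S.C n d (a, x, ys))"
        using T.rm_incl[OF g'] Fc True by (simp add: psis_slot0)
      have ph: "phi n d (S.C n d (a, x, ys)) = ?rm ?X" using phi_cls[OF g] True by simp
      have "?rm ?l = ?rm ?X \<ominus>[T.A n d] ?rm (T.incl r a (gmap r a x))"
        by (rule lin_minus[OF T.module_A T.module_A rl phi_incl_closed[OF x] i])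
      then show ?thesis using T.rm_filt[OF l psis_valid[OF g] lp psis_deg[OF g]] by (simp only: ph ri)
    next
      case False
      then have "S.C n d (a, x, ys) \<in> S.filt r n d" using base(2) by (intro S.cls_filt[OF g]) simp
      then show ?thesis using phi_filt T.filt_carrier[OF phi_filt] Fc False by (simp add: a_minus_def)
    qed
  qed
qed

end

section \<open>Comparison along the filtration\<close>

context reduced_product
begin

text \<open>Congruence modulo \<open>filt s\<close>, which takes the place of equality in the
  associated graded module.\<close>

definition eqv where
  "eqv s n d X Y \<longleftrightarrow> X \<in> cA n d \<and> Y \<in> cA n d \<and> X \<ominus>[A n d] Y \<in> filt s n d"

lemma eqvI: "X \<ominus>[A n d] Y \<in> filt s n d \<Longrightarrow> X \<in> cA n d \<Longrightarrow> Y \<in> cA n d \<Longrightarrow> eqv s n d X Y"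
  by (simp add: eqv_def)

lemma eqvD: "eqv s n d X Y \<Longrightarrow> X \<ominus>[A n d] Y \<in> filt s n d"
  "eqv s n d X Y \<Longrightarrow> X \<in> cA n d" "eqv s n d X Y \<Longrightarrow> Y \<in> cA n d"
  by (simp_all add: eqv_def)

lemma eqv_sym:
  assumes "eqv s n d X Y" shows "eqv s n d Y X"
proof -
  note e = eqvD[OF assms]
  have "\<ominus>[A n d] (X \<ominus>[A n d] Y) = Y \<ominus>[A n d] X" using e(2,3) by (simp add: a_minus_def A.minus_add A.a_comm)
  then show ?thesis using filt_neg[OF e(1)] e(2,3) by (simp add: eqv_def)
qed

lemma eqv_trans:
  assumes "eqv s n d X Y" "eqv s n d Y Z" shows "eqv s n d X Z"
proof -
  note e = eqvD[OF assms(1)] and e' = eqvD[OF assms(2)]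
  have "(X \<ominus>[A n d] Y) \<oplus>[A n d] (Y \<ominus>[A n d] Z) = X \<ominus>[A n d] Z"
    using e(2,3) e'(3) by (simp add: a_minus_def A.a_ac A.cancels)
  then show ?thesis using filt_add[OF e(1) e'(1)] e(2) e'(3) by (simp add: eqv_def)
qed

lemma eqv_add:
  assumes "eqv s n d X Y" "eqv s n d X' Y'" shows "eqv s n d (X \<oplus>[A n d] X') (Y \<oplus>[A n d] Y')"
proof -
  note e = eqvD[OF assms(1)] and e' = eqvD[OF assms(2)]
  have "(X \<ominus>[A n d] Y) \<oplus>[A n d] (X' \<ominus>[A n d] Y') = (X \<oplus>[A n d] X') \<ominus>[A n d] (Y \<oplus>[A n d] Y')"
    using e(2,3) e'(2,3) by (simp add: a_minus_def A.minus_add A.a_ac)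
  then show ?thesis using filt_add[OF e(1) e'(1)] e(2,3) e'(2,3) by (simp add: eqv_def)
qed

lemma eqv_zero: "eqv s n d X \<zero>[A n d] \<longleftrightarrow> X \<in> filt s n d"
proof
  assume "eqv s n d X \<zero>[A n d]"
  from eqvD[OF this] show "X \<in> filt s n d" by (simp add: a_minus_def)
qed (simp add: eqv_def a_minus_def filt_carrier)

lemma eqv_bot: "eqv 0 n d X Y \<Longrightarrow> X = Y"
proof -
  assume e: "eqv 0 n d X Y"
  note c = eqvD[OF e]
  have "X \<ominus>[A n d] Y = \<zero>[A n d]" by (rule filt_0[OF c(1)])
  moreover have "X = (X \<ominus>[A n d] Y) \<oplus>[A n d] Y" using c(2,3) by (simp add: a_minus_def A.a_assoc A.l_neg)
  ultimately show "X = Y" using c(3) by simp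
qed

lemma slot0_id: "slot0 (\<lambda>i j b y. y) ys = ys"
  by (rule inputs_eqI) (simp_all add: in_slot)

text \<open>\<open>E\<close> realises the graded piece with \<open>r\<close> inputs inside
  \<open>M \<circ> N\<close>: it kills everything below and represents every element of
  \<open>filt (Suc r)\<close> modulo \<open>filt r\<close>.\<close>

lemma
  assumes E: "entrywise K M N M N n r (\<lambda>_ x. x) (\<lambda>_ _ _ y. y) E"
  shows level_filt: "X \<in> cA n d \<Longrightarrow> E d X \<in> filt (Suc r) n d"
    and level_zero: "X \<in> filt r n d \<Longrightarrow> E d X = \<zero>[A n d]"
    and level_eqv: "X \<in> filt (Suc r) n d \<Longrightarrow> eqv r n d X (E d X)"
proof -
  note El = entrywise_lin[OF E]
  note Ec = entrywise_cls[OF comp_product_axioms comp_product_axioms E lin_id lin_id, unfolded slot0_id]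
  note z = lin_zero[OF module_A module_A El]
  show "E d X \<in> filt (Suc r) n d" if X: "X \<in> cA n d"
  proof (rule filt_lin[OF module_A El submodule_filt filt_all[OF X lessI]])
    fix a x ys assume base: "(a, x, ys) \<in> sgens M N n d"
    show "E d (C n d (a, x, ys)) \<in> filt (Suc r) n d"
      using Ec[OF base] cls_sorted_filt[OF base, of "Suc r"] filt_zero by simp
  qed
  show "E d X = \<zero>[A n d]" if "X \<in> filt r n d"
    using that
  proof (induction rule: filt_induct)
    case (base a x ys)
    then show ?case using Ec[OF base(1)] by simp
  qed (simp_all add: z lin_add[OF El] lin_smult[OF El])
  show "eqv r n d X (E d X)" if X: "X \<in> filt (Suc r) n d"
  proof -
    have fl: "lin_map K (A n d) (A n d) (\<lambda>X. X \<ominus>[A n d] E d X)" by (rule lin_diff[OF module_A module_A lin_id El])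
    have "X \<ominus>[A n d] E d X \<in> filt r n d"
    proof (rule filt_lin[OF module_A fl submodule_filt X])
      fix a x ys assume base: "(a, x, ys) \<in> sgens M N n d" "length ys < Suc r"
      note g = sgensD(1)[OF base(1)]
      show "C n d (a, x, ys) \<ominus>[A n d] E d (C n d (a, x, ys)) \<in> filt r n d"
      proof (cases "length ys = r")
        case True
        then show ?thesis using Ec[OF base(1)] cls_closed[OF g] filt_zero by (simp add: a_minus_def A.r_neg)
      next
        case False
        then show ?thesis using Ec[OF base(1)] cls_sorted_filt[OF base(1), of r] base(2) cls_closed[OF g] by (simp add: a_minus_def)
      qed
    qed
    then show ?thesis using filt_carrier[OF X] lin_closed[OF El filt_carrier[OF X]] by (rule eqvI)
  qed
qed

end

section \<open>Correction of pairs along the filtration\<close>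

locale liftable_morphism = quasi_free_morphism K P M L dth P' M' L' dth' psi phi
  for K :: "('k, 'c) ring_scheme" and P :: "('k, 'p) dg_operad" and M :: "('k, 'm) dg_seq"
    and L :: "('k, 'p, ('k, 'm, 'p) comp_el) dg_rmod" and dth
    and P' :: "('k, 'p1) dg_operad" and M' :: "('k, 'm1) dg_seq"
    and L' :: "('k, 'p1, ('k, 'm1, 'p1) comp_el) dg_rmod" and dth' psi phi +
  assumes projective: "\<not> field K \<Longrightarrow> projective_seq K P \<and> projective_seq K P' \<and> projective_seq K M \<and> projective_seq K M'"
begin

lemma liftable_components:
  assumes B: "module K B"
  shows "liftable K (dg_mod M r d) B" "liftable K (dg_mod M' r d) B" "liftable K (dg_mod P r d) B" "liftable K (dg_mod P' r d) B"
proof -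
  have "liftable K (dg_mod M r d) B \<and> liftable K (dg_mod M' r d) B \<and> liftable K (dg_mod P r d) B \<and> liftable K (dg_mod P' r d) B"
  proof (cases "field K")
    case True
    show ?thesis by (intro conjI liftable_field S.module_M T.module_M S.module_N T.module_N B True)
  next
    case False
    show ?thesis
      by (intro conjI liftable_projective S.module_M T.module_M S.module_N T.module_N B)
        (use projective[OF False] in \<open>simp_all add: projective_seq_def\<close>)
  qed
  then show "liftable K (dg_mod M r d) B" "liftable K (dg_mod M' r d) B" "liftable K (dg_mod P r d) B" "liftable K (dg_mod P' r d) B"
    by simp_all
qed

abbreviation "gen_acyclic r \<equiv> cone_acyclic (dg_mod M r) (dg_diff M r) (dg_mod M' r) (dg_diff M' r) (gmap r)"
abbreviation "op_acyclic r \<equiv> cone_acyclic (dg_mod P r) (dg_diff P r) (dg_mod P' r) (dg_diff P' r) (psi r)"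
abbreviation "rm_acyclic n \<equiv> cone_acyclic (S.A n) (S.D n) (T.A n) (T.D n) (phi n)"

text \<open>Modulo \<open>filt r\<close>, the differential is the canonical one and
  \<open>phi\<close> is the entrywise map \<open>F\<close>. Applying the idempotents
  \<open>E\<close> and \<open>E'\<close> turns the congruences for \<open>X\<close> and
  \<open>Y\<close> into equations; \<open>graded_acyclic\<close> solves them exactly, and the
  solution is read as a congruence again.\<close>

lemma level_step:
  assumes acM: "gen_acyclic r" and acP: "\<And>j. j + r \<le> n + 1 \<Longrightarrow> op_acyclic j"
    and X: "X \<in> S.filt (Suc r) n (d - 1)" and Y: "Y \<in> T.filt (Suc r) n d"
    and DX: "S.D n (d - 1) X \<in> S.filt r n (d - 2)" and XY: "T.eqv r n (d - 1) (phi n (d - 1) X) (T.D n d Y)"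
  shows "\<exists>U\<in>S.filt (Suc r) n d. \<exists>V\<in>T.filt (Suc r) n (d + 1). S.eqv r n (d - 1) X (S.D n d U) \<and>
    T.eqv r n d Y (phi n d U \<oplus>[T.A n d] T.D n (d + 1) V)"
proof -
  note Sc = S.comp_product_axioms and Tc = T.comp_product_axioms
  note il = lin_id
  obtain F where F: "entrywise K M P M' P' n r (gmap r) (\<lambda>_. psi) F"
    using entrywise_exists[where n = n and r = r and f = "gmap r" and g = "\<lambda>_. psi", OF Sc Tc gmap_lin psi_lin] by (elim exE) (rule that)
  obtain E where E: "entrywise K M P M P n r (\<lambda>_ x. x) (\<lambda>_ _ _ y. y) E"
    using entrywise_exists[where n = n and r = r and f = "\<lambda>_ x. x" and g = "\<lambda>_ _ _ y. y", OF Sc Sc il il] by (elim exE) (rule that)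
  obtain E' where E': "entrywise K M' P' M' P' n r (\<lambda>_ x. x) (\<lambda>_ _ _ y. y) E'"
    using entrywise_exists[where n = n and r = r and f = "\<lambda>_ x. x" and g = "\<lambda>_ _ _ y. y", OF Tc Tc il il] by (elim exE) (rule that)
  note Fl = entrywise_lin[OF F] and El = entrywise_lin[OF E] and El' = entrywise_lin[OF E']
  have Echain: "E (e - 1) (S.del n e Z) = S.del n e (E e Z)" if "Z \<in> S.cA n e" for Z e
    by (rule entrywise_chain[OF S.dg_product_axioms S.dg_product_axioms E il _ il _ that]) simp_all
  have Echain': "E' (e - 1) (T.del n e Z) = T.del n e (E' e Z)" if "Z \<in> T.cA n e" for Z e
    by (rule entrywise_chain[OF T.dg_product_axioms T.dg_product_axioms E' il _ il _ that]) simp_all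
  have FE: "F e (E e Z) = F e Z" if Z: "Z \<in> S.cA n e" for Z e
    using entrywise_compose[where f = "\<lambda>_ x. x" and g = "\<lambda>_ _ _ y. y" and f' = "gmap r" and g' = "\<lambda>_. psi",
        OF S.reduced_product_axioms Sc Tc E F il il gmap_lin psi_lin]
    by (rule entrywise_unique[OF S.reduced_product_axioms Tc _ F gmap_lin psi_lin _ _ Z]) simp_all
  have EF: "E' e (F e Z) = F e Z" if Z: "Z \<in> S.cA n e" for Z e
    using entrywise_compose[where f' = "\<lambda>_ x. x" and g' = "\<lambda>_ _ _ y. y" and f = "gmap r" and g = "\<lambda>_. psi",
        OF S.reduced_product_axioms Tc Tc F E' gmap_lin psi_lin il il]
    by (rule entrywise_unique[OF S.reduced_product_axioms Tc _ F gmap_lin psi_lin _ _ Z]) simp_all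
  have EE: "E e (E e Z) = E e Z" if Z: "Z \<in> S.cA n e" for Z e
    using entrywise_compose[where f' = "\<lambda>_ x. x" and g' = "\<lambda>_ _ _ y. y" and f = "\<lambda>_ x. x" and g = "\<lambda>_ _ _ y. y",
        OF S.reduced_product_axioms Sc Sc E E il il il il]
    by (rule entrywise_unique[OF S.reduced_product_axioms Sc _ E il il _ _ Z]) simp_all
  have EE': "E' e (E' e Z) = E' e Z" if Z: "Z \<in> T.cA n e" for Z e
    using entrywise_compose[where f' = "\<lambda>_ x. x" and g' = "\<lambda>_ _ _ y. y" and f = "\<lambda>_ x. x" and g = "\<lambda>_ _ _ y. y",
        OF T.reduced_product_axioms Tc Tc E' E' il il il il]
    by (rule entrywise_unique[OF T.reduced_product_axioms Tc _ E' il il _ _ Z]) simp_all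
  have d2: "d - 1 - 1 = d - 2" by simp
  have Xc: "X \<in> S.cA n (d - 1)" and Yc: "Y \<in> T.cA n d" by (rule S.filt_carrier[OF X], rule T.filt_carrier[OF Y])
  have SD: "S.eqv r n (e - 1) (S.D n e Z) (S.del n e Z)" if "Z \<in> S.filt (Suc r) n e" for Z e
    by (rule S.eqvI[OF S.D_del[OF that] lin_closed[OF S.D_lin] lin_closed[OF S.diff_lin]]) (rule S.filt_carrier[OF that])+
  have TD: "T.eqv r n (e - 1) (T.D n e Z) (T.del n e Z)" if "Z \<in> T.filt (Suc r) n e" for Z e
    by (rule T.eqvI[OF T.D_del[OF that] lin_closed[OF T.D_lin] lin_closed[OF T.diff_lin]]) (rule T.filt_carrier[OF that])+
  have PF: "T.eqv r n e (phi n e Z) (F e Z)" if "Z \<in> S.filt (Suc r) n e" for Z e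
    by (rule T.eqvI[OF phi_entry[OF F that] lin_closed[OF phi_lin] lin_closed[OF Fl]]) (rule S.filt_carrier[OF that])+
  have "S.eqv r n (d - 2) (S.del n (d - 1) X) \<zero>[S.A n (d - 2)]"
    by (rule S.eqv_trans[OF S.eqv_sym[OF SD[OF X, unfolded d2]] iffD2[OF S.eqv_zero DX]])
  then have "S.del n (d - 1) X \<in> S.filt r n (d - 2)" by (simp add: S.eqv_zero)
  then have dX: "S.del n (d - 1) (E (d - 1) X) = \<zero>[S.A n (d - 2)]"
    using S.level_zero[OF E] Echain[OF Xc] by (simp add: d2)
  have "T.eqv r n (d - 1) (F (d - 1) X) (T.del n d Y)"
    by (rule T.eqv_trans[OF T.eqv_sym[OF PF[OF X]] T.eqv_trans[OF XY TD[OF Y]]])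
  note w = T.eqvD[OF this]
  \<comment> \<open>The difference lies in \<open>filt r\<close>, which the idempotent
    annihilates.\<close>
  have "E' (d - 1) (F (d - 1) X) \<ominus>[T.A n (d - 1)] E' (d - 1) (T.del n d Y) = \<zero>[T.A n (d - 1)]"
    using lin_minus[OF T.module_A T.module_A El' w(2,3)] T.level_zero[OF E' w(1)] by simp
  then have "T.eqv 0 n (d - 1) (E' (d - 1) (F (d - 1) X)) (E' (d - 1) (T.del n d Y))"
    using lin_closed[OF El' w(2)] lin_closed[OF El' w(3)] by (simp add: T.eqv_def T.filt_zero)
  then have FX: "F (d - 1) (E (d - 1) X) = T.del n d (E' d Y)"
    using T.eqv_bot EF[OF Xc] FE[OF Xc] Echain'[OF Yc] by simp
  note pm = prod_module_module[OF S.module_M T.module_M] and pn = prod_module_module[OF S.module_N T.module_N]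
  have "\<exists>U\<in>S.cA n d. \<exists>V\<in>T.cA n (d + 1). E d U = U \<and> E' (d + 1) V = V \<and>
      S.del n d U = E (d - 1) X \<and> F d U \<oplus>[T.A n d] T.del n (d + 1) V = E' d Y"
    by (rule graded_acyclic[OF S.dg_product_axioms T.dg_product_axioms gmap_lin gmap_D psi_lin psi_D
      liftable_components(1)[OF pm] liftable_components(2)[OF pm] liftable_components(3)[OF pn] liftable_components(4)[OF pn]
      acM _ F E E' lin_closed[OF El Xc] EE[OF Xc] lin_closed[OF El' Yc] EE'[OF Yc] dX FX]) (assumption | erule acP)+
  then obtain U V where U: "U \<in> S.cA n d" "E d U = U" "S.del n d U = E (d - 1) X"
    and V: "V \<in> T.cA n (d + 1)" "E' (d + 1) V = V"
    and UV: "F d U \<oplus>[T.A n d] T.del n (d + 1) V = E' d Y"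
    by (elim bexE conjE) (rule that)
  have Uf: "U \<in> S.filt (Suc r) n d" using S.level_filt[OF E U(1)] U(2) by simp
  have Vf: "V \<in> T.filt (Suc r) n (d + 1)" using T.level_filt[OF E' V(1)] V(2) by simp
  have 1: "S.eqv r n (d - 1) X (S.D n d U)"
    using S.eqv_trans[OF S.level_eqv[OF E X] S.eqv_sym[OF SD[OF Uf, unfolded U(3)]]] .
  have "T.eqv r n d (phi n d U \<oplus>[T.A n d] T.D n (d + 1) V) (F d U \<oplus>[T.A n d] T.del n (d + 1) V)"
    using T.eqv_add[OF PF[OF Uf]] TD[OF Vf] by simp
  then have 2: "T.eqv r n d Y (phi n d U \<oplus>[T.A n d] T.D n (d + 1) V)"
    unfolding UV by (rule T.eqv_trans[OF T.level_eqv[OF E' Y] T.eqv_sym])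
  show ?thesis using 1 2 by (intro bexI[OF _ Uf] bexI[OF _ Vf] conjI)
qed

lemma D_D': "V \<in> T.cA n (d + 1) \<Longrightarrow> T.D n d (T.D n (d + 1) V) = \<zero>[T.A n (d - 1)]"
  using T.D_D[of V n "d + 1"] by simp

lemma T_D_up: "V \<in> T.cA n (d + 1) \<Longrightarrow> T.D n (d + 1) V \<in> T.cA n d"
  using lin_closed[OF T.D_lin, of V n "d + 1"] by simp

text \<open>Subtracting a cone boundary does not change the cone differential, so the remainder of a
  corrected pair satisfies the same conditions and can be corrected further.\<close>

lemma cone_differential:
  assumes X: "X \<in> S.cA n (d - 1)" and Y: "Y \<in> T.cA n d" and U: "U \<in> S.cA n d" and V: "V \<in> T.cA n (d + 1)"
  shows "S.D n (d - 1) (X \<ominus>[S.A n (d - 1)] S.D n d U) = S.D n (d - 1) X"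
    and "phi n (d - 1) (X \<ominus>[S.A n (d - 1)] S.D n d U) \<ominus>[T.A n (d - 1)]
        T.D n d (Y \<ominus>[T.A n d] (phi n d U \<oplus>[T.A n d] T.D n (d + 1) V)) =
      phi n (d - 1) X \<ominus>[T.A n (d - 1)] T.D n d Y"
proof -
  have DU: "S.D n d U \<in> S.cA n (d - 1)" by (rule lin_closed[OF S.D_lin U])
  have d2: "d - 1 - 1 = d - 2" by simp
  have DX: "S.D n (d - 1) X \<in> S.cA n (d - 2)" using lin_closed[OF S.D_lin X] by (simp only: d2)
  show "S.D n (d - 1) (X \<ominus>[S.A n (d - 1)] S.D n d U) = S.D n (d - 1) X"
    using lin_minus[OF S.module_A S.module_A S.D_lin X DU] S.D_D[OF U] DX by (simp add: d2 a_minus_def)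
  have pU: "phi n d U \<in> T.cA n d" and pX: "phi n (d - 1) X \<in> T.cA n (d - 1)"
    by (rule lin_closed[OF phi_lin U], rule lin_closed[OF phi_lin X])
  have DpU: "T.D n d (phi n d U) \<in> T.cA n (d - 1)" and DY: "T.D n d Y \<in> T.cA n (d - 1)"
    by (rule lin_closed[OF T.D_lin pU], rule lin_closed[OF T.D_lin Y])
  note DV = T_D_up[OF V]
  have 1: "phi n (d - 1) (X \<ominus>[S.A n (d - 1)] S.D n d U) = phi n (d - 1) X \<ominus>[T.A n (d - 1)] T.D n d (phi n d U)"
    using lin_minus[OF S.module_A T.module_A phi_lin X DU] phi_D[OF U] by simp
  have 2: "T.D n d (phi n d U \<oplus>[T.A n d] T.D n (d + 1) V) = T.D n d (phi n d U)"
    using lin_add[OF T.D_lin pU DV] D_D'[OF V] DpU by simp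
  have 3: "T.D n d (Y \<ominus>[T.A n d] (phi n d U \<oplus>[T.A n d] T.D n (d + 1) V)) =
      T.D n d Y \<ominus>[T.A n (d - 1)] T.D n d (phi n d U)"
    using lin_minus[OF T.module_A T.module_A T.D_lin Y T.A.a_closed[OF pU DV]] 2 by simp
  show "phi n (d - 1) (X \<ominus>[S.A n (d - 1)] S.D n d U) \<ominus>[T.A n (d - 1)]
        T.D n d (Y \<ominus>[T.A n d] (phi n d U \<oplus>[T.A n d] T.D n (d + 1) V)) =
      phi n (d - 1) X \<ominus>[T.A n (d - 1)] T.D n d Y"
    unfolding 1 3 using pX DY DpU by (simp add: a_minus_def T.A.minus_add T.A.a_ac T.A.cancels)
qed

text \<open>Each application of \<open>level_step\<close> lowers the pair by one level, down to
  \<open>s0\<close>; the pair has to be a cone cycle only modulo \<open>filt s0\<close>. Only levels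
  from \<open>s0\<close> on are visited, whence the bound \<open>j + s0 \<le> n + 1\<close> on the
  arities of \<open>psi\<close>. The correction stays in \<open>filt s\<close>, which matters where
  it has to vanish under the projection to the generators.\<close>

lemma filtration_chase:
  assumes "s0 \<le> s" and acM: "\<And>r. s0 \<le> r \<Longrightarrow> r < s \<Longrightarrow> gen_acyclic r" and acP: "\<And>j. j + s0 \<le> n + 1 \<Longrightarrow> op_acyclic j"
    and "X \<in> S.filt s n (d - 1)" "Y \<in> T.filt s n d" "S.D n (d - 1) X \<in> S.filt s0 n (d - 2)"
    and "phi n (d - 1) X \<ominus>[T.A n (d - 1)] T.D n d Y \<in> T.filt s0 n (d - 1)"
  shows "\<exists>U\<in>S.cA n d. \<exists>V\<in>T.cA n (d + 1). X \<ominus>[S.A n (d - 1)] S.D n d U \<in> S.filt s0 n (d - 1) \<and>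
    Y \<ominus>[T.A n d] (phi n d U \<oplus>[T.A n d] T.D n (d + 1) V) \<in> T.filt s0 n d \<and> U \<in> S.filt s n d \<and> V \<in> T.filt s n (d + 1)"
  using assms(1,2,4-)
proof (induction s arbitrary: X Y rule: dec_induct)
  case base
  have z: "S.D n d \<zero>[S.A n d] = \<zero>[S.A n (d - 1)]" "phi n d \<zero>[S.A n d] = \<zero>[T.A n d]"
    "T.D n (d + 1) \<zero>[T.A n (d + 1)] = \<zero>[T.A n d]"
    using lin_zero[OF S.module_A S.module_A S.D_lin] lin_zero[OF S.module_A T.module_A phi_lin]
      lin_zero[OF T.module_A T.module_A T.D_lin, of n "d + 1"] by simp_all
  have "X \<ominus>[S.A n (d - 1)] \<zero>[S.A n (d - 1)] \<in> S.filt s0 n (d - 1)" "Y \<ominus>[T.A n d] (\<zero>[T.A n d] \<oplus>[T.A n d] \<zero>[T.A n d]) \<in> T.filt s0 n d"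
    using base S.filt_carrier[of X] T.filt_carrier[of Y] by (simp_all add: a_minus_def)
  then show ?case
    by (intro bexI[of _ "\<zero>[S.A n d]"] bexI[of _ "\<zero>[T.A n (d + 1)]"] conjI)
      (simp_all only: z S.filt_zero T.filt_zero S.A.zero_closed T.A.zero_closed)
next
  case (step s)
  have acM: "gen_acyclic s" using step.prems(1)[of s] step.hyps by simp
  have acP': "op_acyclic j" if "j + s \<le> n + 1" for j using acP[of j] that step.hyps by simp
  have Xc: "X \<in> S.cA n (d - 1)" and Yc: "Y \<in> T.cA n d"
    by (rule S.filt_carrier[OF step.prems(2)], rule T.filt_carrier[OF step.prems(3)])
  have DX: "S.D n (d - 1) X \<in> S.filt s n (d - 2)" by (rule S.filt_mono[OF step.prems(4) step.hyps(1)])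
  have XY: "T.eqv s n (d - 1) (phi n (d - 1) X) (T.D n d Y)"
    by (rule T.eqvI[OF T.filt_mono[OF step.prems(5) step.hyps(1)] lin_closed[OF phi_lin Xc] lin_closed[OF T.D_lin Yc]])
  obtain U V where U: "U \<in> S.filt (Suc s) n d" and V: "V \<in> T.filt (Suc s) n (d + 1)"
    and eX: "S.eqv s n (d - 1) X (S.D n d U)" and eY: "T.eqv s n d Y (phi n d U \<oplus>[T.A n d] T.D n (d + 1) V)"
  proof -
    have "\<exists>U\<in>S.filt (Suc s) n d. \<exists>V\<in>T.filt (Suc s) n (d + 1). S.eqv s n (d - 1) X (S.D n d U) \<and>
        T.eqv s n d Y (phi n d U \<oplus>[T.A n d] T.D n (d + 1) V)"
      by (rule level_step[OF acM _ step.prems(2,3) DX XY]) (rule acP')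
    then show ?thesis by (elim bexE conjE) (rule that)
  qed
  have Uc: "U \<in> S.cA n d" and Vc: "V \<in> T.cA n (d + 1)" by (rule S.filt_carrier[OF U], rule T.filt_carrier[OF V])
  let ?X = "X \<ominus>[S.A n (d - 1)] S.D n d U" and ?Y = "Y \<ominus>[T.A n d] (phi n d U \<oplus>[T.A n d] T.D n (d + 1) V)"
  note cd = cone_differential[OF Xc Yc Uc Vc]
  have acM': "gen_acyclic r" if "s0 \<le> r" "r < s" for r using step.prems(1)[of r] that by simp
  have "S.D n (d - 1) ?X \<in> S.filt s0 n (d - 2)"
    "phi n (d - 1) ?X \<ominus>[T.A n (d - 1)] T.D n d ?Y \<in> T.filt s0 n (d - 1)"
    unfolding cd by (rule step.prems(4), rule step.prems(5))
  note st = S.eqvD(1)[OF eX] T.eqvD(1)[OF eY] this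
  have "\<exists>U'\<in>S.cA n d. \<exists>V'\<in>T.cA n (d + 1). ?X \<ominus>[S.A n (d - 1)] S.D n d U' \<in> S.filt s0 n (d - 1) \<and>
    ?Y \<ominus>[T.A n d] (phi n d U' \<oplus>[T.A n d] T.D n (d + 1) V') \<in> T.filt s0 n d \<and> U' \<in> S.filt s n d \<and> V' \<in> T.filt s n (d + 1)"
    by (rule step.IH[OF _ st]) (rule acM')
  then obtain U' V' where U': "U' \<in> S.cA n d" "U' \<in> S.filt s n d" and V': "V' \<in> T.cA n (d + 1)" "V' \<in> T.filt s n (d + 1)"
    and rX: "?X \<ominus>[S.A n (d - 1)] S.D n d U' \<in> S.filt s0 n (d - 1)"
    and rY: "?Y \<ominus>[T.A n d] (phi n d U' \<oplus>[T.A n d] T.D n (d + 1) V') \<in> T.filt s0 n d"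
    by (elim bexE conjE) (rule that)
  have DV: "T.D n (d + 1) (V \<oplus>[T.A n (d + 1)] V') = T.D n (d + 1) V \<oplus>[T.A n d] T.D n (d + 1) V'"
    using lin_add[OF T.D_lin Vc V'(1)] by simp
  have "X \<ominus>[S.A n (d - 1)] S.D n d (U \<oplus>[S.A n d] U') = ?X \<ominus>[S.A n (d - 1)] S.D n d U'"
    unfolding lin_add[OF S.D_lin Uc U'(1)] using Xc lin_closed[OF S.D_lin Uc] lin_closed[OF S.D_lin U'(1)]
    by (simp add: a_minus_def S.A.minus_add S.A.a_ac)
  moreover have "Y \<ominus>[T.A n d] (phi n d (U \<oplus>[S.A n d] U') \<oplus>[T.A n d] T.D n (d + 1) (V \<oplus>[T.A n (d + 1)] V')) =
      ?Y \<ominus>[T.A n d] (phi n d U' \<oplus>[T.A n d] T.D n (d + 1) V')"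
    unfolding DV lin_add[OF phi_lin Uc U'(1)]
    using Yc lin_closed[OF phi_lin Uc] lin_closed[OF phi_lin U'(1)] T_D_up[OF Vc] T_D_up[OF V'(1)]
    by (simp add: a_minus_def T.A.minus_add T.A.a_ac)
  moreover have "U \<oplus>[S.A n d] U' \<in> S.filt (Suc s) n d" by (rule S.filt_add[OF U S.filt_mono[OF U'(2)]]) simp
  moreover have "V \<oplus>[T.A n (d + 1)] V' \<in> T.filt (Suc s) n (d + 1)" by (rule T.filt_add[OF V T.filt_mono[OF V'(2)]]) simp
  ultimately show ?case using rX rY
    by (intro bexI[of _ "U \<oplus>[S.A n d] U'"] bexI[of _ "V \<oplus>[T.A n (d + 1)] V'"] conjI)
      (simp_all only: S.A.a_closed[OF Uc U'(1)] T.A.a_closed[OF Vc V'(1)])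
qed

text \<open>The chase with the largest range: \<open>filt (n + 1)\<close> is everything and
  \<open>filt 0\<close> is zero, so the corrected pair is zero and the correction is a
  solution.\<close>

lemma rm_acyclicI:
  assumes acM: "\<And>r. gen_acyclic r" and acP: "\<And>j. op_acyclic j"
  shows "rm_acyclic n"
  unfolding cone_acyclic_def
proof (intro allI ballI impI)
  fix d X Y assume X: "X \<in> S.cA n (d - 1)" and Y: "Y \<in> T.cA n d"
    and DX: "S.D n (d - 1) X = \<zero>[S.A n (d - 2)]" and XY: "phi n (d - 1) X = T.D n d Y"
  have f: "X \<in> S.filt (n + 1) n (d - 1)" "Y \<in> T.filt (n + 1) n d" by (simp_all add: S.filt_all[OF X] T.filt_all[OF Y])
  have DX': "S.D n (d - 1) X \<in> S.filt 0 n (d - 2)" by (simp add: DX S.filt_zero)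
  have XY': "phi n (d - 1) X \<ominus>[T.A n (d - 1)] T.D n d Y \<in> T.filt 0 n (d - 1)"
    unfolding XY using lin_closed[OF T.D_lin Y] by (simp add: a_minus_def T.A.r_neg T.filt_zero)
  obtain U V where U: "U \<in> S.cA n d" and V: "V \<in> T.cA n (d + 1)"
    and r: "X \<ominus>[S.A n (d - 1)] S.D n d U \<in> S.filt 0 n (d - 1)"
      "Y \<ominus>[T.A n d] (phi n d U \<oplus>[T.A n d] T.D n (d + 1) V) \<in> T.filt 0 n d"
    using filtration_chase[OF le0 acM acP f DX' XY'] by (elim bexE conjE) (rule that)
  have "S.D n d U = X"
    using S.eqv_bot[OF S.eqvI[OF r(1) X lin_closed[OF S.D_lin U]]] by simp
  moreover have "phi n d U \<oplus>[T.A n d] T.D n (d + 1) V = Y"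
    using T.eqv_bot[OF T.eqvI[OF r(2) Y T.A.a_closed[OF lin_closed[OF phi_lin U] T_D_up[OF V]]]] by simp
  ultimately show "\<exists>U\<in>S.cA n d. \<exists>V\<in>T.cA n (d + 1). S.D n d U = X \<and>
      phi n d U \<oplus>[T.A n d] T.D n (d + 1) V = Y"
    by (intro bexI[OF _ U] bexI[OF _ V] conjI)
qed

text \<open>Include a cone cycle \<open>(x, y)\<close> of the generators into \<open>L\<close>. Its
  cone differential \<open>(?A, ?B)\<close> there has fewer than \<open>n\<close> inputs, where only
  \<open>gmap\<close> in arities below \<open>n\<close> occurs, so by induction it is the cone
  boundary of some \<open>(U, V)\<close> with fewer than \<open>n\<close> inputs. Correcting by
  \<open>(U, V)\<close> gives a cone cycle of \<open>L\<close>, which bounds; projecting the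
  bounding pair to the generators loses \<open>U\<close> and \<open>V\<close> and solves the problem
  for \<open>(x, y)\<close>.\<close>

lemma gen_acyclicI:
  assumes acL: "\<And>n. rm_acyclic n" and acP: "\<And>j. op_acyclic j"
  shows "gen_acyclic n"
proof (induction n rule: less_induct)
  case (less n)
  show ?case unfolding cone_acyclic_def
  proof (intro allI ballI impI)
    fix d x y assume x: "x \<in> elts M n (d - 1)" and y: "y \<in> elts M' n d"
      and dx: "dg_diff M n (d - 1) x = \<zero>[dg_mod M n (d - 2)]" and xy: "gmap n (d - 1) x = dg_diff M' n d y"
    let ?X = "S.incl n (d - 1) x" and ?Y = "T.incl n d y"
    let ?A = "S.D n (d - 1) ?X" and ?B = "phi n (d - 1) ?X \<ominus>[T.A n (d - 1)] T.D n d ?Y"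
    have d2: "d - 1 - 1 = d - 2" "d - 2 - 1 = d - 3" "d - 1 - 2 = d - 3" "d - 1 + 1 = d" by simp_all
    have X: "?X \<in> S.cA n (d - 1)" and Y: "?Y \<in> T.cA n d"
      by (rule lin_closed[OF S.incl_lin x], rule lin_closed[OF T.incl_lin y])
    have A: "?A \<in> S.cA n (d - 2)" using lin_closed[OF S.D_lin X] by (simp only: d2)
    have pX: "phi n (d - 1) ?X \<in> T.cA n (d - 1)" by (rule lin_closed[OF phi_lin X])
    have DY: "T.D n d ?Y \<in> T.cA n (d - 1)" by (rule lin_closed[OF T.D_lin Y])
    have B: "?B \<in> T.cA n (d - 1)" by (rule T.A.minus_closed[OF pX DY])
    have "S.prj n (d - 2) ?A = \<zero>[dg_mod M n (d - 2)]"
      using S.prj_D[OF X] by (simp only: d2 S.prj_incl[OF x] dx)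
    then have Af: "?A \<in> S.filt n n (d - 2)" by (rule S.prj_zero_filt[OF A])
    have "T.prj n (d - 1) ?B = \<zero>[dg_mod M' n (d - 1)]"
      using lin_minus[OF T.module_A T.module_M T.prj_lin pX DY] prj_phi[OF X] T.prj_D[OF Y] lin_closed[OF T.diff_M y]
      by (simp add: S.prj_incl[OF x] T.prj_incl[OF y] xy a_minus_def T.M.r_neg)
    then have Bf: "?B \<in> T.filt n n (d - 1)" by (rule T.prj_zero_filt[OF B])
    have DA: "S.D n (d - 2) ?A = \<zero>[S.A n (d - 3)]" using S.D_D[OF X] by (simp only: d2)
    have DDY: "T.D n (d - 1) (T.D n d ?Y) = \<zero>[T.A n (d - 2)]" by (rule T.D_D[OF Y])
    have DpX: "T.D n (d - 1) (phi n (d - 1) ?X) \<in> T.cA n (d - 2)" using lin_closed[OF T.D_lin pX] by (simp only: d2)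
    have "phi n (d - 2) ?A = T.D n (d - 1) ?B"
      using lin_minus[OF T.module_A T.module_A T.D_lin pX DY] phi_D[OF X] DpX by (simp add: d2 DDY a_minus_def)
    then have AB: "phi n (d - 2) ?A \<ominus>[T.A n (d - 2)] T.D n (d - 1) ?B \<in> T.filt 0 n (d - 2)"
      using lin_closed[OF phi_lin A] by (simp add: a_minus_def T.A.r_neg T.filt_zero)
    have ac: "gen_acyclic r" if "0 \<le> r" "r < n" for r by (rule less[OF that(2)])
    \<comment> \<open>The pair \<open>(?A, ?B)\<close> is a cone differential, so it sits one degree
      lower than \<open>(x, y)\<close>. The range from \<open>n\<close> to \<open>0\<close> leaves
      out the top piece, which is the one in question.\<close>
    have "\<exists>U\<in>S.cA n (d - 1). \<exists>V\<in>T.cA n (d - 1 + 1). ?A \<ominus>[S.A n (d - 1 - 1)] S.D n (d - 1) U \<in> S.filt 0 n (d - 1 - 1) \<and>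
        ?B \<ominus>[T.A n (d - 1)] (phi n (d - 1) U \<oplus>[T.A n (d - 1)] T.D n (d - 1 + 1) V) \<in> T.filt 0 n (d - 1) \<and>
        U \<in> S.filt n n (d - 1) \<and> V \<in> T.filt n n (d - 1 + 1)"
      by (rule filtration_chase[OF le0 _ acP]) (use ac Af Bf DA AB S.filt_zero in \<open>simp_all add: d2\<close>)
    then obtain U V where U: "U \<in> S.cA n (d - 1)" "U \<in> S.filt n n (d - 1)"
      and V: "V \<in> T.cA n d" "V \<in> T.filt n n d"
      and r: "?A \<ominus>[S.A n (d - 2)] S.D n (d - 1) U \<in> S.filt 0 n (d - 2)"
        "?B \<ominus>[T.A n (d - 1)] (phi n (d - 1) U \<oplus>[T.A n (d - 1)] T.D n d V) \<in> T.filt 0 n (d - 1)"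
      unfolding d2 by (elim bexE conjE) (rule that)
    have DU: "S.D n (d - 1) U \<in> S.cA n (d - 2)" using lin_closed[OF S.D_lin U(1)] by (simp only: d2)
    have pU: "phi n (d - 1) U \<in> T.cA n (d - 1)" by (rule lin_closed[OF phi_lin U(1)])
    have DV: "T.D n d V \<in> T.cA n (d - 1)" by (rule lin_closed[OF T.D_lin V(1)])
    have AU: "?A = S.D n (d - 1) U" by (rule S.eqv_bot[OF S.eqvI[OF r(1) A DU]])
    have BU: "?B = phi n (d - 1) U \<oplus>[T.A n (d - 1)] T.D n d V"
      by (rule T.eqv_bot[OF T.eqvI[OF r(2) B T.A.a_closed[OF pU DV]]])
    \<comment> \<open>The opposite signs follow the cone equation:
      \<open>phi ?X - T.D n d ?Y\<close> equals \<open>phi U + T.D n d V\<close>.\<close>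
    let ?X' = "?X \<ominus>[S.A n (d - 1)] U" and ?Y' = "?Y \<oplus>[T.A n d] V"
    have X': "?X' \<in> S.cA n (d - 1)" and Y': "?Y' \<in> T.cA n d" using X U V Y by simp_all
    have DX': "S.D n (d - 1) ?X' = \<zero>[S.A n (d - 2)]"
      using lin_minus[OF S.module_A S.module_A S.D_lin X U(1)] DU by (simp add: AU d2 a_minus_def S.A.r_neg)
    have "phi n (d - 1) ?X = ?B \<oplus>[T.A n (d - 1)] T.D n d ?Y"
      using pX DY by (simp add: a_minus_def T.A.a_assoc T.A.l_neg)
    then have "phi n (d - 1) ?X = (phi n (d - 1) U \<oplus>[T.A n (d - 1)] T.D n d V) \<oplus>[T.A n (d - 1)] T.D n d ?Y"
      by (simp only: BU)
    then have XY': "phi n (d - 1) ?X' = T.D n d ?Y'"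
      using lin_minus[OF S.module_A T.module_A phi_lin X U(1)] lin_add[OF T.D_lin Y V(1)] pU DV DY
      by (simp add: a_minus_def T.A.a_ac T.A.cancels)
    obtain U2 V2 where U2: "U2 \<in> S.cA n d" "S.D n d U2 = ?X'"
      and V2: "V2 \<in> T.cA n (d + 1)" "phi n d U2 \<oplus>[T.A n d] T.D n (d + 1) V2 = ?Y'"
      using acL[unfolded cone_acyclic_def, rule_format, OF X' Y' DX' XY'] by (elim bexE conjE) (rule that)
    have u: "S.prj n d U2 \<in> elts M n d" by (rule lin_closed[OF S.prj_lin U2(1)])
    have v: "T.prj n (d + 1) V2 \<in> elts M' n (d + 1)" by (rule lin_closed[OF T.prj_lin V2(1)])
    have "dg_diff M n d (S.prj n d U2) = S.prj n (d - 1) ?X'" using S.prj_D[OF U2(1)] U2(2) by simp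
    also have "\<dots> = x"
      using lin_minus[OF S.module_A S.module_M S.prj_lin X U(1)] S.prj_filt[OF U(2)] x by (simp add: S.prj_incl a_minus_def)
    finally have 1: "dg_diff M n d (S.prj n d U2) = x" .
    have "gmap n d (S.prj n d U2) \<oplus>[dg_mod M' n d] dg_diff M' n (d + 1) (T.prj n (d + 1) V2) = T.prj n d ?Y'"
      using lin_add[OF T.prj_lin lin_closed[OF phi_lin U2(1)] T_D_up[OF V2(1)]] prj_phi[OF U2(1)] T.prj_D[OF V2(1)] V2(2) by simp
    also have "\<dots> = y" using lin_add[OF T.prj_lin Y V(1)] T.prj_filt[OF V(2)] y by (simp add: T.prj_incl)
    finally have 2: "gmap n d (S.prj n d U2) \<oplus>[dg_mod M' n d] dg_diff M' n (d + 1) (T.prj n (d + 1) V2) = y" .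
    show "\<exists>u\<in>elts M n d. \<exists>v\<in>elts M' n (d + 1). dg_diff M n d u = x \<and>
        gmap n d u \<oplus>[dg_mod M' n d] dg_diff M' n (d + 1) v = y"
      using 1 2 by (intro bexI[OF _ u] bexI[OF _ v] conjI)
  qed
qed

end

section \<open>The submodule generated in arity one\<close>

context quasi_free_module
begin

text \<open>The class \<open>e(p)\<close>: the root is in arity one and all of \<open>{..<n}\<close>
  forms a single block. With \<open>e\<close> a generator of \<open>M(1)\<close>, it embeds
  \<open>P(n)\<close> as the part of \<open>L(n)\<close> with at most one input.\<close>

definition one_comp where
  "one_comp e n d p = C n d (0, e, [({..<n}, d, p)])"

lemma in_single [simp]: "in_block [(J, b, y)] 0 = J" "in_deg [(J, b, y)] 0 = b" "in_val [(J, b, y)] 0 = y"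
  by (simp_all add: in_block_def in_deg_def in_val_def)

lemma tot_deg_single [simp]: "tot_deg [(J, b, y)] = b"
  by (simp add: tot_deg_def)

lemma set_val_single [simp]: "set_val [(J, b, y)] 0 v = [(J, b, v)]"
  by (rule inputs_eqI) (simp_all add: in_val_set_val)

lemma one_gens:
  assumes "0 < n" "e \<in> elts M 1 0" "p \<in> elts P n d"
  shows "(0, e, [({..<n}, d, p)]) \<in> sgens M P n d"
proof (rule sgensI)
  have "valid_inputs P n [({..<n}, d, p)]" using assms(3) by (simp add: valid_inputs_iff lessThan_Suc)
  then show "(0, e, [({..<n}, d, p)]) \<in> gens M P n d" using assms(2) by (simp add: gens_def)
  have "0 \<in> {..<n}" using assms(1) by simp
  then have "{..<n} \<noteq> {}" by (intro notI) simp
  then show "sorted_inputs [({..<n}, d, p)]" by (simp add: sorted_inputs_def blocks_nonempty_def)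
qed

lemma one_lin:
  assumes "0 < n" "e \<in> elts M 1 0"
  shows "lin_map K (dg_mod P n d) (A n d) (one_comp e n d)"
proof (rule lin_mapI)
  fix p assume p: "p \<in> elts P n d"
  note g = sgensD(1)[OF one_gens[OF assms p]]
  show "one_comp e n d p \<in> cA n d" unfolding one_comp_def by (rule cls_closed[OF g])
  show "one_comp e n d (p \<oplus>[dg_mod P n d] q) = one_comp e n d p \<oplus>[A n d] one_comp e n d q" if "q \<in> elts P n d" for q
    using cls_add_input[OF g, of 0 q] that by (simp add: one_comp_def)
  show "one_comp e n d (c \<odot>[dg_mod P n d] p) = c \<odot>[A n d] one_comp e n d p" if "c \<in> carrier K" for c
    using cls_smult_input[OF g _ that, of 0] by (simp add: one_comp_def)
qed

lemma one_filt:
  assumes "0 < n" "e \<in> elts M 1 0" "p \<in> elts P n d"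
  shows "one_comp e n d p \<in> filt 2 n d"
  unfolding one_comp_def by (rule cls_sorted_filt[OF one_gens[OF assms]]) simp

text \<open>The twisting part would have no inputs, hence vanishes in positive arity, and the
  differential of \<open>e\<close> lies in degree \<open>-1\<close>, where \<open>M(1)\<close> is
  zero. What is left of the Leibniz rule is the differential of \<open>p\<close>, without sign
  because \<open>e\<close> has degree zero.\<close>

lemma one_D:
  assumes n: "0 < n" and e: "ground_ring_in_arity_one K M e" and p: "p \<in> elts P n d"
  shows "D n d (one_comp e n d p) = one_comp e n (d - 1) (dg_diff P n d p)"
proof -
  have ec: "e \<in> elts M 1 0" using e by (simp add: ground_ring_in_arity_one_def)
  note g = sgensD(1)[OF one_gens[OF n ec p]]
  have "dth n d (one_comp e n d p) \<in> filt 1 n (d - 1)"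
    by (rule th_filt) (use one_filt[OF n ec p] in \<open>simp add: numeral_2_eq_2\<close>)
  then have th: "dth n d (one_comp e n d p) = \<zero>[A n (d - 1)]" by (rule filt_1[OF n])
  have "dg_diff M 1 0 e \<in> elts M 1 (0 - 1)" by (rule lin_closed[OF diff_M ec])
  then have "dg_diff M 1 0 e = \<zero>[dg_mod M 1 (- 1)]"
    using e by (simp add: ground_ring_in_arity_one_def zero_module_def)
  then have z: "C n (d - 1) (0 - 1, dg_diff M (length [({..<n}, d, p)]) 0 e, [({..<n}, d, p)]) = \<zero>[A n (d - 1)]"
    using cls_zero_root[of "- 1" "[({..<n}, d, p)]" n "d - 1"] gens_diff_root[OF g] by simp
  have ds: "dslot P 0 [({..<n}, d, p)] = [({..<n}, d - 1, dg_diff P n d p)]"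
    by (rule inputs_eqI) (simp_all add: in_dslot)
  have dp: "dg_diff P n d p \<in> elts P n (d - 1)" by (rule lin_closed[OF diff_N p])
  have c: "C n (d - 1) (0, e, [({..<n}, d - 1, dg_diff P n d p)]) \<in> cA n (d - 1)"
    by (rule cls_closed[OF sgensD(1)[OF one_gens[OF n ec dp]]])
  have "del n d (one_comp e n d p) = one_comp e n (d - 1) (dg_diff P n d p)"
    using del_cls[OF g, unfolded z] c by (simp add: one_comp_def lessThan_Suc ds leib_def ksign_def)
  then show ?thesis
    using D_eq[OF lin_closed[OF one_lin[OF n ec] p]] th c by (simp add: one_comp_def)
qed

text \<open>In positive arity fewer than two inputs means exactly one, and its block is everything.
  The root is a multiple of \<open>e\<close>, and the scalar can be moved into the input.\<close>

lemma one_surj: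
  assumes n: "0 < n" and e: "ground_ring_in_arity_one K M e" and X: "X \<in> filt 2 n d"
  shows "\<exists>p\<in>elts P n d. X = one_comp e n d p"
proof -
  have ec: "e \<in> elts M 1 0" using e by (simp add: ground_ring_in_arity_one_def)
  note ol = one_lin[OF n ec]
  have "X \<in> one_comp e n d ` elts P n d"
  proof (rule filt_lin[OF module_A lin_id submodule_image[OF module_N module_A ol] X])
    fix a x ys assume base: "(a, x, ys) \<in> sgens M P n d" "length ys < 2"
    note g = sgensD(1)[OF base(1)]
    note gD = gensD[OF g]
    have cov: "(\<Union>i<length ys. in_block ys i) = {..<n}" using gD(2) by (simp add: valid_inputs_iff)
    have "0 \<in> (\<Union>i<length ys. in_block ys i)" unfolding cov using n by simp
    then obtain i where "i < length ys" by (elim UN_E) simp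
    then have "length ys = 1" using base(2) by linarith
    then obtain J b y where ys: "ys = [(J, b, y)]" by (cases ys) (auto simp: length_Suc_conv)
    have J: "J = {..<n}" using cov by (simp add: ys lessThan_Suc)
    have y: "y \<in> elts P n b" using gD(4)[of 0] by (simp add: ys J)
    have x: "x \<in> elts M 1 a" and ab: "a + b = d" using gD(1,3) by (simp_all add: ys)
    show "C n d (a, x, ys) \<in> one_comp e n d ` elts P n d"
    proof (cases "a = 0")
      case False
      then have "x = \<zero>[dg_mod M (length ys) a]" using e x by (simp add: ground_ring_in_arity_one_def zero_module_def ys)
      then have "C n d (a, x, ys) = \<zero>[A n d]" using cls_zero_root[of a ys n d] g by simp
      then show ?thesis using lin_zero[OF module_N module_A ol] by (intro image_eqI[of _ _ "\<zero>[dg_mod P n d]"]) simp_all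
    next
      case True
      have "x \<in> (\<lambda>k. k \<odot>[dg_mod M 1 0] e) ` carrier K"
        using e x True by (simp only: ground_ring_in_arity_one_def bij_betw_def)
      then obtain k where k: "k \<in> carrier K" "x = k \<odot>[dg_mod M 1 0] e" by (elim imageE) (rule that)
      have y': "y \<in> elts P n d" using y ab True by simp
      have "C n d (a, x, ys) = k \<odot>[A n d] one_comp e n d y"
        using cls_smult_root[OF sgensD(1)[OF one_gens[OF n ec y']] k(1)] ab True by (simp add: ys J k(2) one_comp_def)
      also have "\<dots> = one_comp e n d (k \<odot>[dg_mod P n d] y)" using lin_smult[OF ol k(1) y'] by simp
      finally show ?thesis using k(1) y' by (intro image_eqI[of _ _ "k \<odot>[dg_mod P n d] y"]) simp_all
    qed
  qed
  then show ?thesis by (elim imageE) (rule bexI)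
qed

text \<open>Sending the generator of \<open>M(1)\<close> to the unit of \<open>P\<close> gives a map from the arity-one part of
  \<open>M \<circ> P\<close> to \<open>P \<circ> P\<close>, which followed by the composition of \<open>P\<close> is a left inverse of \<open>one_comp\<close>.\<close>

lemma one_inj:
  assumes n: "0 < n" and e: "ground_ring_in_arity_one K M e"
    and p: "p \<in> elts P n d" "q \<in> elts P n d" and eq: "one_comp e n d p = one_comp e n d q"
  shows "p = q"
proof -
  let ?u = "op_unit P"
  have ec: "e \<in> elts M 1 0" and bij: "bij_betw (\<lambda>k. k \<odot>[dg_mod M 1 0] e) (carrier K) (elts M 1 0)"
    using e by (simp_all add: ground_ring_in_arity_one_def)
  define c where "c x = inv_into (carrier K) (\<lambda>k. k \<odot>[dg_mod M 1 0] e) x" for x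
  have c: "c (k \<odot>[dg_mod M 1 0] e) = k" if "k \<in> carrier K" for k
    unfolding c_def by (rule bij_betw_inv_into_left[OF bij that])
  have cx: "\<exists>k\<in>carrier K. x = k \<odot>[dg_mod M 1 0] e" if "x \<in> elts M 1 0" for x
  proof -
    have "x \<in> (\<lambda>k. k \<odot>[dg_mod M 1 0] e) ` carrier K" using bij that by (simp only: bij_betw_def)
    then show ?thesis by (elim imageE) (rule bexI)
  qed
  \<comment> \<open>The linear map \<open>M(1) \<rightarrow> P(1)\<close> that replaces
    \<open>e\<close> by the operad unit, zero outside degree zero.\<close>
  define f where "f a x = (if a = 0 then c x \<odot>[dg_mod P 1 0] ?u else \<zero>[dg_mod P 1 a])" for a :: int and x
  have fl: "lin_map K (dg_mod M 1 a) (dg_mod P 1 a) (f a)" for a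
  proof (cases "a = 0")
    case True
    have "lin_map K (dg_mod M 1 0) (dg_mod P 1 0) (\<lambda>x. c x \<odot>[dg_mod P 1 0] ?u)"
    proof (rule lin_mapI)
      fix x assume x: "x \<in> elts M 1 0"
      obtain k where k: "k \<in> carrier K" "x = k \<odot>[dg_mod M 1 0] e" using cx[OF x] by (elim bexE) (rule that)
      show "c x \<odot>[dg_mod P 1 0] ?u \<in> elts P 1 0" unfolding k(2) c[OF k(1)] by (rule N.smult_closed[OF k(1) operad_unit[OF P]])
      show "c (l \<odot>[dg_mod M 1 0] x) \<odot>[dg_mod P 1 0] ?u = l \<odot>[dg_mod P 1 0] (c x \<odot>[dg_mod P 1 0] ?u)" if l: "l \<in> carrier K" for l
        unfolding k(2) c[OF k(1)] M.smult_assoc1[OF l k(1) ec, symmetric] c[OF K.m_closed[OF l k(1)]]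
        by (rule N.smult_assoc1[OF l k(1) operad_unit[OF P]])
      fix y assume y: "y \<in> elts M 1 0"
      obtain m where m: "m \<in> carrier K" "y = m \<odot>[dg_mod M 1 0] e" using cx[OF y] by (elim bexE) (rule that)
      show "c (x \<oplus>[dg_mod M 1 0] y) \<odot>[dg_mod P 1 0] ?u = c x \<odot>[dg_mod P 1 0] ?u \<oplus>[dg_mod P 1 0] c y \<odot>[dg_mod P 1 0] ?u"
        unfolding k(2) m(2) c[OF k(1)] c[OF m(1)] M.smult_l_distr[OF k(1) m(1) ec, symmetric] c[OF K.a_closed[OF k(1) m(1)]]
        by (rule N.smult_l_distr[OF k(1) m(1) operad_unit[OF P]])
    qed
    then show ?thesis by (simp only: True f_def[abs_def] simp_thms if_True)
  next
    case False
    then show ?thesis by (simp add: f_def[abs_def] lin_const_zero[OF N.module_axioms])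
  qed
  have fe: "f 0 e = ?u" using c[OF K.one_closed] ec operad_unit[OF P] by (simp add: f_def)
  obtain T where T: "entrywise K M P P P n 1 f (\<lambda>_ _ _ y. y) T"
    using entrywise_exists[where n = n and r = 1 and f = f and g = "\<lambda>_ _ _ y. y", OF comp_product_axioms PP fl lin_id]
    by (elim exE) (rule that)
  have v: "op_comp P n d (T d (one_comp e n d z)) = z" if z: "z \<in> elts P n d" for z
  proof -
    have "T d (one_comp e n d z) = cls K P P n d (0, op_unit P, [({..<n}, d, z)])"
      using entrywise_cls[OF comp_product_axioms PP T fl lin_id one_gens[OF n ec z]]
      unfolding one_comp_def slot0_id fe by (simp only: list.size simp_thms if_True add_0 One_nat_def)
    then show ?thesis by (simp only: operad_left_unit[OF P z])
  qed
  show ?thesis by (rule trans[OF v[OF p(1), unfolded eq, symmetric] v[OF p(2)]])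
qed

end

context liftable_morphism
begin

text \<open>The description of \<open>phi\<close> by its entries holds modulo elements without
  inputs, and in positive arity these are zero, so here it is an equality.\<close>

lemma phi_one:
  assumes n: "0 < n" and e: "e \<in> elts M 1 0" and p: "p \<in> elts P n d"
  shows "phi n d (S.one_comp e n d p) = T.one_comp (gmap 1 0 e) n d (psi n d p)"
proof -
  obtain F where F: "entrywise K M P M' P' n 1 (gmap 1) (\<lambda>_. psi) F"
    using entrywise_exists[where n = n and r = 1 and f = "gmap 1" and g = "\<lambda>_. psi", OF S.comp_product_axioms T.comp_product_axioms gmap_lin psi_lin]
    by (elim exE) (rule that)
  let ?X = "S.one_comp e n d p"
  have X: "?X \<in> S.filt (Suc 1) n d" using S.one_filt[OF n e p] by (simp add: numeral_2_eq_2)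
  have "T.eqv 0 n d (phi n d ?X) (F d ?X)"
    by (rule T.eqvI[OF _ lin_closed[OF phi_lin S.filt_carrier[OF X]] lin_closed[OF entrywise_lin[OF F] S.filt_carrier[OF X]]])
      (use T.filt_1[OF n phi_entry[OF F X]] T.filt_zero in simp)
  moreover have "F d ?X = T.one_comp (gmap 1 0 e) n d (psi n d p)"
  proof -
    have "slot0 (\<lambda>_. psi) [({..<n}, d, p)] = [({..<n}, d, psi n d p)]"
      by (rule inputs_eqI) (simp_all add: in_slot)
    then show ?thesis
      using entrywise_cls[OF S.comp_product_axioms T.comp_product_axioms F gmap_lin psi_lin S.one_gens[OF n e p]]
      by (simp add: S.one_comp_def T.one_comp_def)
  qed
  ultimately show ?thesis using T.eqv_bot by simp
qed

text \<open>In arity one both complexes are the ground ring in degree zero, so surjectivity in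
  homology makes \<open>e'\<close> itself an image, of a multiple \<open>k\<close> of
  \<open>e\<close>; comparing coefficients gives the inverse of \<open>c\<close>.\<close>

lemma gmap_unit:
  assumes ac: "gen_acyclic 1" and e: "ground_ring_in_arity_one K M e" and e': "ground_ring_in_arity_one K M' e'"
  shows "\<exists>c\<in>carrier K. \<exists>k\<in>carrier K. gmap 1 0 e = c \<odot>[dg_mod M' 1 0] e' \<and> k \<otimes>[K] c = \<one>[K]"
proof -
  have ec: "e \<in> elts M 1 0" and ec': "e' \<in> elts M' 1 0"
    using e e' by (simp_all add: ground_ring_in_arity_one_def)
  have im: "(\<lambda>k. k \<odot>[dg_mod M 1 0] e) ` carrier K = elts M 1 0"
    and im': "(\<lambda>k. k \<odot>[dg_mod M' 1 0] e') ` carrier K = elts M' 1 0"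
    and inj': "inj_on (\<lambda>k. k \<odot>[dg_mod M' 1 0] e') (carrier K)"
    using e e' by (simp_all add: ground_ring_in_arity_one_def bij_betw_def)
  have "gmap 1 0 e \<in> (\<lambda>k. k \<odot>[dg_mod M' 1 0] e') ` carrier K" unfolding im' by (rule lin_closed[OF gmap_lin ec])
  then obtain c where c: "c \<in> carrier K" "gmap 1 0 e = c \<odot>[dg_mod M' 1 0] e'" by (elim imageE) (rule that)
  \<comment> \<open>Cone acyclicity will be applied to the pair \<open>(0, e')\<close>.\<close>
  have zc: "\<zero>[dg_mod M 1 (0 - 1)] \<in> elts M 1 (0 - 1)" by (rule S.M.zero_closed)
  have z1: "dg_diff M 1 (0 - 1) \<zero>[dg_mod M 1 (0 - 1)] = \<zero>[dg_mod M 1 (0 - 2)]"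
    using lin_zero[OF S.module_M S.module_M S.diff_M, of 1 "0 - 1"] by simp
  have dz: "dg_diff M' 1 0 e' \<in> elts M' 1 (0 - 1)" by (rule lin_closed[OF T.diff_M ec'])
  then have z2: "gmap 1 (0 - 1) \<zero>[dg_mod M 1 (0 - 1)] = dg_diff M' 1 0 e'"
    using lin_zero[OF S.module_M T.module_M gmap_lin, of 1 "0 - 1"] e'
    by (simp add: ground_ring_in_arity_one_def zero_module_def)
  obtain u v where u: "u \<in> elts M 1 0" and v: "v \<in> elts M' 1 (0 + 1)"
    and uv: "gmap 1 0 u \<oplus>[dg_mod M' 1 0] dg_diff M' 1 (0 + 1) v = e'"
    using ac[unfolded cone_acyclic_def, rule_format, OF zc ec' z1 z2] by (elim bexE conjE) (rule that)
  have "v = \<zero>[dg_mod M' 1 1]" using v e' by (simp add: ground_ring_in_arity_one_def zero_module_def)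
  then have "dg_diff M' 1 (0 + 1) v = \<zero>[dg_mod M' 1 0]"
    using lin_zero[OF T.module_M T.module_M T.diff_M, of 1 1] by simp
  then have gu: "gmap 1 0 u = e'" using uv lin_closed[OF gmap_lin u] by simp
  have "u \<in> (\<lambda>k. k \<odot>[dg_mod M 1 0] e) ` carrier K" unfolding im by (rule u)
  then obtain k where k: "k \<in> carrier K" "u = k \<odot>[dg_mod M 1 0] e" by (elim imageE) (rule that)
  have "(k \<otimes>[K] c) \<odot>[dg_mod M' 1 0] e' = \<one>[K] \<odot>[dg_mod M' 1 0] e'"
    using lin_smult[OF gmap_lin k(1) ec] gu ec' k(1) c(1)
    by (simp add: k(2) c(2) T.M.smult_assoc1 del: One_nat_def)
  then have kc: "k \<otimes>[K] c = \<one>[K]" using inj_onD[OF inj'] k(1) c(1) by simp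
  show ?thesis
    by (rule bexI[where x = c], rule bexI[where x = k], rule conjI, rule c(2), rule kc, rule k(1), rule c(1))
qed

text \<open>A cone cycle \<open>(p, q)\<close> is carried to \<open>L\<close> by
  \<open>one_comp\<close>, where it bounds by assumption. At least two inputs force all input
  arities below \<open>n\<close>, so by induction the bounding pair can be pushed into the part with
  at most one input, which is \<open>P(n)\<close> and \<open>P'(n)\<close>. As \<open>phi\<close>
  maps \<open>e\<close> to \<open>c\<close> times \<open>e'\<close>, the second component carries a
  factor \<open>c\<close>, removed at the end by its inverse \<open>k\<close>.\<close>

lemma op_acyclicI:
  assumes acL: "\<And>n. rm_acyclic n" and acM: "\<And>r. gen_acyclic r"
    and e: "ground_ring_in_arity_one K M e" and e': "ground_ring_in_arity_one K M' e'"
  shows "op_acyclic n"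
proof (induction n rule: less_induct)
  case (less n)
  have ec: "e \<in> elts M 1 0" and ec': "e' \<in> elts M' 1 0"
    using e e' by (simp_all add: ground_ring_in_arity_one_def)
  obtain c k where c: "c \<in> carrier K" and k: "k \<in> carrier K" and ge: "gmap 1 0 e = c \<odot>[dg_mod M' 1 0] e'" and kc: "k \<otimes>[K] c = \<one>[K]"
    using gmap_unit[OF acM e e'] by (elim bexE conjE) (rule that)
  show ?case unfolding cone_acyclic_def
  proof (intro allI ballI impI)
    fix d p q assume p: "p \<in> elts P n (d - 1)" and q: "q \<in> elts P' n d"
      and dp: "dg_diff P n (d - 1) p = \<zero>[dg_mod P n (d - 2)]" and pq: "psi n (d - 1) p = dg_diff P' n d q"
    show "\<exists>u\<in>elts P n d. \<exists>v\<in>elts P' n (d + 1). dg_diff P n d u = p \<and>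
        psi n d u \<oplus>[dg_mod P' n d] dg_diff P' n (d + 1) v = q"
    proof (cases "n = 0")
      case True
      have zp: "p = \<zero>[dg_mod P n (d - 1)]" and zq: "q = \<zero>[dg_mod P' n d]"
        using p q operad_zero[OF S.P] operad_zero[OF T.P] True by (simp_all add: zero_in_arity_zero_def zero_module_def)
      have "dg_diff P n d \<zero>[dg_mod P n d] = p" "psi n d \<zero>[dg_mod P n d] = \<zero>[dg_mod P' n d]"
        "dg_diff P' n (d + 1) \<zero>[dg_mod P' n (d + 1)] = \<zero>[dg_mod P' n d]"
        using lin_zero[OF S.module_N S.module_N S.diff_N] lin_zero[OF S.module_N T.module_N psi_lin]
          lin_zero[OF T.module_N T.module_N T.diff_N, of n "d + 1"] zp by simp_all
      then show ?thesis using zq by (intro bexI[of _ "\<zero>[dg_mod P n d]"] bexI[of _ "\<zero>[dg_mod P' n (d + 1)]"]) simp_all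
    next
      case False
      then have n: "0 < n" by simp
      let ?j = "S.one_comp e n" and ?j' = "T.one_comp e' n"
      note jl = S.one_lin[OF n ec] and jl' = T.one_lin[OF n ec']
      have phj: "phi n b (?j b z) = ?j' b (c \<odot>[dg_mod P' n b] psi n b z)" if z: "z \<in> elts P n b" for z b
      proof -
        note pz = lin_closed[OF psi_lin z]
        have "phi n b (?j b z) = c \<odot>[T.A n b] ?j' b (psi n b z)"
          using phi_one[OF n ec z] T.cls_smult_root[OF sgensD(1)[OF T.one_gens[OF n ec' pz]] c]
          by (simp add: T.one_comp_def ge[unfolded One_nat_def])
        then show ?thesis using lin_smult[OF jl' c pz] by simp
      qed
      have d1: "d + 1 - 1 = d" "d + 1 + 1 = d + 2" "d + 1 - 2 = d - 1" by simp_all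
      let ?X = "?j (d - 1) p" and ?Y = "?j' d (c \<odot>[dg_mod P' n d] q)"
      have cq: "c \<odot>[dg_mod P' n d] q \<in> elts P' n d" using c q by simp
      have X: "?X \<in> S.cA n (d - 1)" and Y: "?Y \<in> T.cA n d"
        by (rule lin_closed[OF jl p], rule lin_closed[OF jl' cq])
      have Xf: "?X \<in> S.filt 2 n (d - 1)" and Yf: "?Y \<in> T.filt 2 n d"
        by (rule S.one_filt[OF n ec p], rule T.one_filt[OF n ec' cq])
      have d2: "d - 1 - 1 = d - 2" by simp
      have DX: "S.D n (d - 1) ?X = \<zero>[S.A n (d - 2)]"
        using S.one_D[OF n e p] lin_zero[OF S.module_N S.module_A jl] by (simp add: d2 dp)
      have XY: "phi n (d - 1) ?X = T.D n d ?Y"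
        using phj[OF p] T.one_D[OF n e' cq] lin_smult[OF T.diff_N c q] by (simp add: pq)
      obtain U V where U: "U \<in> S.cA n d" "S.D n d U = ?X"
        and V: "V \<in> T.cA n (d + 1)" "phi n d U \<oplus>[T.A n d] T.D n (d + 1) V = ?Y"
        using acL[unfolded cone_acyclic_def, rule_format, OF X Y DX XY] by (elim bexE conjE) (rule that)
      \<comment> \<open>The chase asks for a difference where the cone equation has a sum; with the
        sign changed, the difference is \<open>?Y\<close>, which has at most one input.\<close>
      let ?V = "\<ominus>[T.A n (d + 1)] V"
      have nV: "?V \<in> T.cA n (d + 1)" using V(1) by simp
      have DV: "T.D n (d + 1) ?V = \<ominus>[T.A n d] T.D n (d + 1) V"
        using lin_neg[OF T.module_A T.module_A T.D_lin V(1)] by simp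
      have pU: "phi n d U \<in> T.cA n d" by (rule lin_closed[OF phi_lin U(1)])
      have UV: "phi n d U \<ominus>[T.A n d] T.D n (d + 1) ?V = ?Y"
        using V(2) T_D_up[OF V(1)] by (simp add: DV a_minus_def)
      have "\<exists>U1\<in>S.cA n (d + 1). \<exists>V1\<in>T.cA n (d + 1 + 1).
          U \<ominus>[S.A n (d + 1 - 1)] S.D n (d + 1) U1 \<in> S.filt 2 n (d + 1 - 1) \<and>
          ?V \<ominus>[T.A n (d + 1)] (phi n (d + 1) U1 \<oplus>[T.A n (d + 1)] T.D n (d + 1 + 1) V1) \<in> T.filt 2 n (d + 1) \<and>
          U1 \<in> S.filt (n + 1) n (d + 1) \<and> V1 \<in> T.filt (n + 1) n (d + 1 + 1)"
      proof (rule filtration_chase[where ?s0.0 = 2 and s = "n + 1" and d = "d + 1" and X = U and Y = ?V])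
        show "2 \<le> n + 1" using n by simp
        show "gen_acyclic r" for r by (rule acM)
        show "op_acyclic j" if "j + 2 \<le> n + 1" for j
        proof -
          \<comment> \<open>The lower bound \<open>2\<close> of the chase is what brings
            \<open>psi\<close> down to arities covered by the induction.\<close>
          have "j < n" using that by simp
          then show ?thesis by (rule less)
        qed
        show "U \<in> S.filt (n + 1) n (d + 1 - 1)" unfolding d1 by (rule S.filt_all[OF U(1)]) simp
        show "?V \<in> T.filt (n + 1) n (d + 1)" by (rule T.filt_all[OF nV]) simp
        show "S.D n (d + 1 - 1) U \<in> S.filt 2 n (d + 1 - 2)" unfolding d1 U(2) by (rule Xf)
        show "phi n (d + 1 - 1) U \<ominus>[T.A n (d + 1 - 1)] T.D n (d + 1) ?V \<in> T.filt 2 n (d + 1 - 1)"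
          unfolding d1 UV by (rule Yf)
      qed
      then obtain U1 V1 where U1: "U1 \<in> S.cA n (d + 1)" and V1: "V1 \<in> T.cA n (d + 1 + 1)"
        and r: "U \<ominus>[S.A n (d + 1 - 1)] S.D n (d + 1) U1 \<in> S.filt 2 n (d + 1 - 1)"
          "?V \<ominus>[T.A n (d + 1)] (phi n (d + 1) U1 \<oplus>[T.A n (d + 1)] T.D n (d + 1 + 1) V1) \<in> T.filt 2 n (d + 1)"
        by (elim bexE conjE) (rule that)
      have U': "U \<in> S.cA n (d + 1 - 1)" using U(1) by simp
      note cd = cone_differential[OF U' nV U1 V1, unfolded d1(1)]
      let ?U' = "U \<ominus>[S.A n d] S.D n (d + 1) U1"
        and ?V' = "?V \<ominus>[T.A n (d + 1)] (phi n (d + 1) U1 \<oplus>[T.A n (d + 1)] T.D n (d + 1 + 1) V1)"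
      obtain u where u: "u \<in> elts P n d" "?U' = ?j d u"
        using S.one_surj[OF n e r(1)[unfolded d1(1)]] by (elim bexE) (rule that)
      obtain v where v: "v \<in> elts P' n (d + 1)" "?V' = ?j' (d + 1) v"
        using T.one_surj[OF n e' r(2)] by (elim bexE) (rule that)
      have du: "dg_diff P n d u \<in> elts P n (d - 1)" by (rule lin_closed[OF S.diff_N u(1)])
      have "?j (d - 1) (dg_diff P n d u) = ?j (d - 1) p"
        using S.one_D[OF n e u(1)] cd(1) U(2) by (simp add: u(2))
      then have 1: "dg_diff P n d u = p" by (rule S.one_inj[OF n e du p])
      have dv: "dg_diff P' n (d + 1) v \<in> elts P' n d" using lin_closed[OF T.diff_N v(1)] by simp
      have pu: "psi n d u \<in> elts P' n d" by (rule lin_closed[OF psi_lin u(1)])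
      have cpu: "c \<odot>[dg_mod P' n d] psi n d u \<in> elts P' n d" using c pu by simp
      have "phi n d ?U' \<ominus>[T.A n d] T.D n (d + 1) ?V' = ?Y" using cd(2) by (simp only: UV)
      then have w: "phi n d (?j d u) \<ominus>[T.A n d] T.D n (d + 1) (?j' (d + 1) v) = ?Y" by (simp only: u(2) v(2))
      have "?j' d (c \<odot>[dg_mod P' n d] psi n d u \<ominus>[dg_mod P' n d] dg_diff P' n (d + 1) v) = ?Y"
        using lin_minus[OF T.module_N T.module_A jl' cpu dv] w phj[OF u(1)] T.one_D[OF n e' v(1)] by simp
      then have 2: "c \<odot>[dg_mod P' n d] psi n d u \<ominus>[dg_mod P' n d] dg_diff P' n (d + 1) v = c \<odot>[dg_mod P' n d] q"
        by (rule T.one_inj[OF n e' T.N.minus_closed[OF cpu dv] cq])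
      \<comment> \<open>The factor \<open>k\<close> cancels \<open>c\<close>, and the minus sign
        undoes the one introduced with \<open>?V\<close>.\<close>
      let ?v = "(\<ominus>[K] k) \<odot>[dg_mod P' n (d + 1)] v"
      have kn: "\<ominus>[K] k \<in> carrier K" using k by simp
      have vc: "?v \<in> elts P' n (d + 1)" using kn v(1) by simp
      have s1: "k \<odot>[dg_mod P' n d] (c \<odot>[dg_mod P' n d] z) = z" if "z \<in> elts P' n d" for z
        using T.N.smult_assoc1[OF k c that] that by (simp add: kc)
      have "psi n d u \<oplus>[dg_mod P' n d] dg_diff P' n (d + 1) ?v =
          k \<odot>[dg_mod P' n d] (c \<odot>[dg_mod P' n d] psi n d u \<ominus>[dg_mod P' n d] dg_diff P' n (d + 1) v)"
        using lin_smult[OF T.diff_N kn v(1)] k dv cpu s1[OF pu]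
        by (simp add: a_minus_def T.N.smult_r_distr T.N.smult_l_minus T.N.smult_r_minus)
      also have "\<dots> = q" unfolding 2 by (rule s1[OF q])
      finally show ?thesis using 1 by (intro bexI[OF _ u(1)] bexI[OF _ vc] conjI)
    qed
  qed
qed

end

theorem theorem2p1p15:
  fixes K :: "('k, 'c) ring_scheme"
    and P :: "('k, 'p) dg_operad" and P' :: "('k, 'p1) dg_operad"
    and Lbar :: "('k, 'm) dg_seq" and Lbar' :: "('k, 'm1) dg_seq"
    and L :: "('k, 'p, ('k, 'm, 'p) comp_el) dg_rmod"
    and L' :: "('k, 'p1, ('k, 'm1, 'p1) comp_el) dg_rmod"
    and psi :: "nat \<Rightarrow> int \<Rightarrow> 'p \<Rightarrow> 'p1"
    and phi :: "nat \<Rightarrow> int \<Rightarrow> ('k, 'm, 'p) comp_el \<Rightarrow> ('k, 'm1, 'p1) comp_el"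
    and phibar :: "nat \<Rightarrow> int \<Rightarrow> 'm \<Rightarrow> 'm1"
  assumes "cring K"
    and "connected_operad K P" and "connected_operad K P'"
    and "operad_morphism K P P' psi"
    and "quasi_free K P Lbar L" and "quasi_free K P' Lbar' L'"
    and "right_module_morphism K P L (restrict_rmod K P' psi L') phi"
    and "\<not> field K \<Longrightarrow> projective_seq K P \<and> projective_seq K P' \<and>
           projective_seq K Lbar \<and> projective_seq K Lbar'"
    and "phibar = gen_map K P Lbar L P' Lbar' L' phi"
  shows "(quasi_iso K P P' psi \<and> quasi_iso K Lbar Lbar' phibar \<longrightarrow> quasi_iso K L L' phi) \<and>
         (quasi_iso K P P' psi \<and> quasi_iso K L L' phi \<longrightarrow> quasi_iso K Lbar Lbar' phibar) \<and>
         (zero_in_arity_zero Lbar \<and> zero_in_arity_zero Lbar' \<and>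
          (\<exists>e. ground_ring_in_arity_one K Lbar e) \<and> (\<exists>e. ground_ring_in_arity_one K Lbar' e) \<and>
          quasi_iso K L L' phi \<and> quasi_iso K Lbar Lbar' phibar \<longrightarrow> quasi_iso K P P' psi)"
proof -
  obtain dth dth' where SM: "quasi_free_module K P Lbar L dth" and TM: "quasi_free_module K P' Lbar' L' dth'"
    using quasi_free_moduleI[OF assms(1,2,5)] quasi_free_moduleI[OF assms(1,3,6)] by (elim exE) (rule that)
  interpret liftable_morphism K P Lbar L dth P' Lbar' L' dth' psi phi
    by (rule liftable_morphism.intro[OF quasi_free_morphism.intro[OF SM TM quasi_free_morphism_axioms.intro[OF assms(4,7)]]
      liftable_morphism_axioms.intro]) (rule assms(8))
  \<comment> \<open>The two maps are compared on the carriers only, which is enough for the morphism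
    and the cone conditions.\<close>
  have pb: "phibar n d x = gmap n d x" if "x \<in> elts Lbar n d" for n d x
    unfolding assms(9) by (rule gen_map_gmap[OF that])
  have "cone_acyclic (dg_mod Lbar r) (dg_diff Lbar r) (dg_mod Lbar' r) (dg_diff Lbar' r) (phibar r) \<longleftrightarrow> gen_acyclic r" for r
    unfolding cone_acyclic_def using pb by (simp cong: ball_cong bex_cong)
  moreover have "dg_morphism K Lbar Lbar' phibar"
  proof -
    have "lin_map K (dg_mod Lbar r d) (dg_mod Lbar' r d) (phibar r d)" for r d
      by (rule lin_cong[OF S.module_M gmap_lin pb])
    moreover have "phibar r (d - 1) (dg_diff Lbar r d x) = dg_diff Lbar' r d (phibar r d x)" if "x \<in> elts Lbar r d" for r d x
      using gmap_D[OF that] by (simp add: pb[OF that] pb[OF lin_closed[OF S.diff_M that]])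
    moreover have "phibar r d (dg_act Lbar r d s x) = dg_act Lbar' r d s (phibar r d x)"
      if "s permutes {..<r}" "x \<in> elts Lbar r d" for r d s x
      using gmap_act[OF that] by (simp add: pb[OF that(2)] pb[OF lin_closed[OF S.act_M[OF that(1)] that(2)]])
    ultimately show ?thesis by (simp add: dg_morphism_def)
  qed
  ultimately have qM: "quasi_iso K Lbar Lbar' phibar \<longleftrightarrow> (\<forall>r. gen_acyclic r)"
    by (simp add: quasi_iso_iff[OF S.MM T.MM])
  have qP: "quasi_iso K P P' psi \<longleftrightarrow> (\<forall>r. op_acyclic r)"
    by (simp add: quasi_iso_iff[OF operad_sigma[OF S.P] operad_sigma[OF T.P]] psi_dg)
  have qL: "quasi_iso K L L' phi \<longleftrightarrow> (\<forall>r. rm_acyclic r)"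
    by (simp add: quasi_iso_iff[OF S.L_sigma T.L_sigma] phi_dg S.L_mod T.L_mod)
  show ?thesis unfolding qM qP qL
  proof (intro conjI impI)
    show "\<forall>r. rm_acyclic r" if "(\<forall>r. op_acyclic r) \<and> (\<forall>r. gen_acyclic r)"
      by (intro allI rm_acyclicI) (use that in simp_all)
    show "\<forall>r. gen_acyclic r" if "(\<forall>r. op_acyclic r) \<and> (\<forall>r. rm_acyclic r)"
      by (intro allI gen_acyclicI) (use that in simp_all)
    assume *: "zero_in_arity_zero Lbar \<and> zero_in_arity_zero Lbar' \<and> (\<exists>e. ground_ring_in_arity_one K Lbar e) \<and>
      (\<exists>e. ground_ring_in_arity_one K Lbar' e) \<and> (\<forall>r. rm_acyclic r) \<and> (\<forall>r. gen_acyclic r)"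
    then obtain e e' where e: "ground_ring_in_arity_one K Lbar e" "ground_ring_in_arity_one K Lbar' e'"
      by (elim conjE exE) (rule that)
    show "\<forall>r. op_acyclic r" by (rule allI, rule op_acyclicI[OF _ _ e]) (use * in simp_all)
  qed
qed

end
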